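(* Let $0<p,q\le\infty$ and $s>n/p$. Then the space $B^s_{p,q}(\mathbb R^n)$ is a multiplication algebra.
   Context: Let $n\in\mathbb N$ (with $n/p=0$ if $p=\infty$). $\widehat f$ and $f^\vee$ denote the Fourier transform and its inverse on $S'(\mathbb R^n)$ (normalized by $(2\pi)^{-n/2}$). Fix a function $\varphi_0\in S(\mathbb R^n)$ with $\varphi_0(x)=1$ if $|x|\le1$ and $\varphi_0(x)=0$ if $|x|\ge3/2$, and let $\varphi_k(x)=\varphi_0(2^{-k}x)-\varphi_0(2^{-k+1}x)$, $k\in\mathbb N$. $B^s_{p,q}(\mathbb R^n)$ is the collection of all $f\in S'(\mathbb R^n)$ with $$\|f|B^s_{p,q}(\mathbb R^n)\|=\Big(\sum_{j=0}^\infty2^{jsq}\|(\varphi_j\widehat f)^\vee|L_p(\mathbb R^n)\|^q\Big)^{1/q}<\infty$$ (usual modification if $q=\infty$). A quasi-Banach space $A(\mathbb R^n)$ with continuous embeddings $S(\mathbb R^n)\hookrightarrow A(\mathbb R^n)\hookrightarrow S'(\mathbb R^n)$ and $A(\mathbb R^n)\subset L_1^{\mathrm{loc}}(\mathbb R^n)$ (so that products make sense pointwise almost everywhere) is said to be a multiplication algebra if $f_1f_2\in A(\mathbb R^n)$ whenever $f_1,f_2\in A(\mathbb R^n)$, and if there is a constant $c>0$ such that $\|f_1f_2|A(\mathbb R^n)\|\le c\,\|f_1|A(\mathbb R^n)\|\cdot\|f_2|A(\mathbb R^n)\|$ for all $f_1,f_2\in A(\mathbb R^n)$. *)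

theory Defs
  imports "HOL-Analysis.Analysis" "HOL-Probability.Essential_Supremum"
begin

section \<open>Schwartz functions\<close>

type_synonym 'n cfun = "real ^ 'n \<Rightarrow> complex"

definition partial_deriv :: "'n::finite \<Rightarrow> 'n cfun \<Rightarrow> 'n cfun" where
  "partial_deriv i f = (\<lambda>x. frechet_derivative f (at x) (axis i 1))"

text \<open>A list of directions plays the role of a multi-index, its length being the order.\<close>

definition partial_derivs :: "'n::finite list \<Rightarrow> 'n cfun \<Rightarrow> 'n cfun" where
  "partial_derivs \<alpha> f = foldr partial_deriv \<alpha> f"

definition smooth :: "'n::finite cfun \<Rightarrow> bool" where
  "smooth f \<longleftrightarrow> (\<forall>\<alpha> x. partial_derivs \<alpha> f differentiable (at x))"

definition schwartz :: "'n::finite cfun set" where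
  "schwartz = {\<phi>. smooth \<phi> \<and>
     (\<forall>k \<alpha>. bounded (range (\<lambda>x. (1 + norm x) ^ k *\<^sub>R partial_derivs \<alpha> \<phi> x)))}"

definition schwartz_seminorm :: "nat \<Rightarrow> 'n::finite list \<Rightarrow> 'n cfun \<Rightarrow> real" where
  "schwartz_seminorm k \<alpha> \<phi> = (SUP x. (1 + norm x) ^ k * norm (partial_derivs \<alpha> \<phi> x))"

definition schwartz_nbhd :: "nat \<Rightarrow> real \<Rightarrow> 'n::finite cfun \<Rightarrow> 'n cfun set" where
  "schwartz_nbhd N \<epsilon> \<phi> = {\<psi> \<in> schwartz. \<forall>k \<alpha>. k \<le> N \<longrightarrow> length \<alpha> \<le> N \<longrightarrow>
     schwartz_seminorm k \<alpha> (\<lambda>x. \<psi> x - \<phi> x) < \<epsilon>}"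

definition schwartz_open :: "'n::finite cfun set \<Rightarrow> bool" where
  "schwartz_open U \<longleftrightarrow> U \<subseteq> schwartz \<and> (\<forall>\<phi>\<in>U. \<exists>N. \<exists>\<epsilon>>0. schwartz_nbhd N \<epsilon> \<phi> \<subseteq> U)"

definition schwartz_topology :: "'n::finite cfun topology" where
  "schwartz_topology = topology schwartz_open"

lemma schwartz_nbhd_mono: "N \<le> N' \<Longrightarrow> \<epsilon>' \<le> \<epsilon> \<Longrightarrow> schwartz_nbhd N' \<epsilon>' \<phi> \<subseteq> schwartz_nbhd N \<epsilon> \<phi>"
  unfolding schwartz_nbhd_def by (auto intro: less_le_trans le_trans)

lemma istopology_schwartz_open: "istopology (schwartz_open :: 'n::finite cfun set \<Rightarrow> bool)"
  unfolding istopology_def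
proof (intro conjI allI impI)
  fix U V :: "'n cfun set"
  assume U: "schwartz_open U" and V: "schwartz_open V"
  show "schwartz_open (U \<inter> V)"
    unfolding schwartz_open_def
  proof (intro conjI ballI)
    show "U \<inter> V \<subseteq> schwartz" using U by (auto simp: schwartz_open_def)
    fix \<phi> assume "\<phi> \<in> U \<inter> V"
    then obtain N \<epsilon> N' \<epsilon>' where 1: "\<epsilon> > 0" "schwartz_nbhd N \<epsilon> \<phi> \<subseteq> U"
      and 2: "\<epsilon>' > 0" "schwartz_nbhd N' \<epsilon>' \<phi> \<subseteq> V"
      using U V unfolding schwartz_open_def by (meson IntE)
    have "schwartz_nbhd (max N N') (min \<epsilon> \<epsilon>') \<phi> \<subseteq> U \<inter> V"
      using 1 2 schwartz_nbhd_mono[of N "max N N'" "min \<epsilon> \<epsilon>'" \<epsilon> \<phi>]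
        schwartz_nbhd_mono[of N' "max N N'" "min \<epsilon> \<epsilon>'" \<epsilon>' \<phi>] by auto
    moreover have "min \<epsilon> \<epsilon>' > 0" using 1 2 by simp
    ultimately show "\<exists>N. \<exists>\<epsilon>>0. schwartz_nbhd N \<epsilon> \<phi> \<subseteq> U \<inter> V" by blast
  qed
next
  fix \<K> :: "'n cfun set set" assume "\<forall>K\<in>\<K>. schwartz_open K"
  then show "schwartz_open (\<Union>\<K>)"
    unfolding schwartz_open_def by (meson Sup_least Union_upper UnionE order_trans)
qed

lemma openin_schwartz_topology: "openin schwartz_topology U \<longleftrightarrow> schwartz_open U"
  unfolding schwartz_topology_def by (simp add: topology_inverse'[OF istopology_schwartz_open])

lemma topspace_schwartz_topology: "topspace schwartz_topology = schwartz"
proof -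
  have "schwartz_open schwartz"
    unfolding schwartz_open_def schwartz_nbhd_def using zero_less_one by blast
  then show ?thesis
    unfolding topspace_def openin_schwartz_topology by (auto simp: schwartz_open_def)
qed


section \<open>Tempered distributions\<close>

type_synonym 'n distr = "'n cfun \<Rightarrow> complex"

text \<open>A tempered distribution only matters on \<^const>\<open>schwartz\<close>; it is set to \<open>0\<close> elsewhere so that
  equality of distributions is equality of functions.\<close>

definition tempered :: "'n::finite distr set" where
  "tempered = {T.
     (\<forall>\<phi>\<in>schwartz. \<forall>\<psi>\<in>schwartz. T (\<lambda>x. \<phi> x + \<psi> x) = T \<phi> + T \<psi>) \<and>
     (\<forall>\<phi>\<in>schwartz. \<forall>c. T (\<lambda>x. c * \<phi> x) = c * T \<phi>) \<and>
     continuous_map schwartz_topology euclidean T \<and>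
     (\<forall>\<phi>. \<phi> \<notin> schwartz \<longrightarrow> T \<phi> = 0)}"

definition schwartz_bounded :: "'n::finite cfun set \<Rightarrow> bool" where
  "schwartz_bounded K \<longleftrightarrow> K \<subseteq> schwartz \<and> (\<forall>k \<alpha>. bdd_above (schwartz_seminorm k \<alpha> ` K))"

text \<open>The strong topology: uniform convergence on bounded sets of Schwartz functions.\<close>

definition tempered_nbhd :: "'n::finite cfun set \<Rightarrow> real \<Rightarrow> 'n distr \<Rightarrow> 'n distr set" where
  "tempered_nbhd K \<epsilon> T = {T' \<in> tempered. \<forall>\<phi>\<in>K. norm (T' \<phi> - T \<phi>) < \<epsilon>}"

definition tempered_open :: "'n::finite distr set \<Rightarrow> bool" where
  "tempered_open U \<longleftrightarrow> U \<subseteq> tempered \<and>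
     (\<forall>T\<in>U. \<exists>K. schwartz_bounded K \<and> (\<exists>\<epsilon>>0. tempered_nbhd K \<epsilon> T \<subseteq> U))"

definition tempered_topology :: "'n::finite distr topology" where
  "tempered_topology = topology tempered_open"

lemma schwartz_bounded_Un:
  "schwartz_bounded K \<Longrightarrow> schwartz_bounded L \<Longrightarrow> schwartz_bounded (K \<union> L)"
  unfolding schwartz_bounded_def by (simp add: image_Un)

lemma istopology_tempered_open: "istopology (tempered_open :: 'n::finite distr set \<Rightarrow> bool)"
  unfolding istopology_def
proof (intro conjI allI impI)
  fix U V :: "'n distr set"
  assume U: "tempered_open U" and V: "tempered_open V"
  show "tempered_open (U \<inter> V)"
    unfolding tempered_open_def
  proof (intro conjI ballI)
    show "U \<inter> V \<subseteq> tempered" using U by (auto simp: tempered_open_def)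
    fix T assume "T \<in> U \<inter> V"
    then obtain K \<epsilon> K' \<epsilon>' where 1: "schwartz_bounded K" "\<epsilon> > 0" "tempered_nbhd K \<epsilon> T \<subseteq> U"
      and 2: "schwartz_bounded K'" "\<epsilon>' > 0" "tempered_nbhd K' \<epsilon>' T \<subseteq> V"
      using U V unfolding tempered_open_def by (meson IntE)
    have "tempered_nbhd (K \<union> K') (min \<epsilon> \<epsilon>') T \<subseteq> tempered_nbhd K \<epsilon> T \<inter> tempered_nbhd K' \<epsilon>' T"
      unfolding tempered_nbhd_def by auto
    then have "tempered_nbhd (K \<union> K') (min \<epsilon> \<epsilon>') T \<subseteq> U \<inter> V" using 1 2 by blast
    moreover have "min \<epsilon> \<epsilon>' > 0" using 1 2 by simp
    ultimately show "\<exists>K. schwartz_bounded K \<and> (\<exists>\<epsilon>>0. tempered_nbhd K \<epsilon> T \<subseteq> U \<inter> V)"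
      using schwartz_bounded_Un[OF 1(1) 2(1)] by blast
  qed
next
  fix \<K> :: "'n distr set set" assume "\<forall>K\<in>\<K>. tempered_open K"
  then show "tempered_open (\<Union>\<K>)"
    unfolding tempered_open_def by (meson Sup_least Union_upper UnionE order_trans)
qed

lemma openin_tempered_topology: "openin tempered_topology U \<longleftrightarrow> tempered_open U"
  unfolding tempered_topology_def by (simp add: topology_inverse'[OF istopology_tempered_open])

lemma topspace_tempered_topology: "topspace tempered_topology = tempered"
proof -
  have "schwartz_bounded {}" by (simp add: schwartz_bounded_def)
  then have "tempered_open tempered"
    unfolding tempered_open_def tempered_nbhd_def using zero_less_one by blast
  then show ?thesis
    unfolding topspace_def openin_tempered_topology by (auto simp: tempered_open_def)
qed

definition distr_mult :: "'n::finite cfun \<Rightarrow> 'n distr \<Rightarrow> 'n distr" where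
  "distr_mult \<psi> T = (\<lambda>\<phi>. if \<phi> \<in> schwartz then T (\<lambda>x. \<psi> x * \<phi> x) else 0)"

definition distr_of_schwartz :: "'n::finite cfun \<Rightarrow> 'n distr" where
  "distr_of_schwartz \<psi> = (\<lambda>\<phi>. if \<phi> \<in> schwartz then (LINT x|lebesgue. \<psi> x * \<phi> x) else 0)"


subsection \<open>Fourier transform\<close>

definition fourier :: "'n::finite cfun \<Rightarrow> 'n cfun" where
  "fourier \<phi> = (\<lambda>\<xi>. of_real ((2 * pi) powr (- real CARD('n) / 2)) *
     (LINT x|lebesgue. exp (- \<i> * of_real (x \<bullet> \<xi>)) * \<phi> x))"

definition inv_fourier :: "'n::finite cfun \<Rightarrow> 'n cfun" where
  "inv_fourier \<phi> = (\<lambda>x. of_real ((2 * pi) powr (- real CARD('n) / 2)) *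
     (LINT \<xi>|lebesgue. exp (\<i> * of_real (x \<bullet> \<xi>)) * \<phi> \<xi>))"

definition distr_fourier :: "'n::finite distr \<Rightarrow> 'n distr" where
  "distr_fourier T = (\<lambda>\<phi>. if \<phi> \<in> schwartz then T (fourier \<phi>) else 0)"

definition distr_inv_fourier :: "'n::finite distr \<Rightarrow> 'n distr" where
  "distr_inv_fourier T = (\<lambda>\<phi>. if \<phi> \<in> schwartz then T (inv_fourier \<phi>) else 0)"


subsection \<open>Regular distributions\<close>

definition L1_loc :: "'n::finite cfun set" where
  "L1_loc = {g. \<forall>K. compact K \<longrightarrow> g absolutely_integrable_on K}"

definition test_functions :: "'n::finite cfun set" where
  "test_functions = {\<phi>. smooth \<phi> \<and> compact (closure {x. \<phi> x \<noteq> 0})}"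

text \<open>Only compactly supported test functions are used: for a locally integrable \<open>g\<close> that defines
  a tempered distribution, \<open>g\<close> times a Schwartz function need not be integrable. Test functions are
  dense in the Schwartz space, so \<open>g\<close> determines \<open>T\<close>; conversely \<open>T\<close> determines \<open>g\<close> almost everywhere.\<close>

definition represents :: "'n::finite cfun \<Rightarrow> 'n distr \<Rightarrow> bool" where
  "represents g T \<longleftrightarrow> g \<in> L1_loc \<and> T \<in> tempered \<and>
     (\<forall>\<phi>\<in>test_functions. T \<phi> = (LINT x|lebesgue. g x * \<phi> x))"


section \<open>Multiplication algebras\<close>

definition quasi_normed_space :: "'n::finite distr set \<Rightarrow> ('n distr \<Rightarrow> real) \<Rightarrow> bool" where
  "quasi_normed_space A N \<longleftrightarrow>
     (\<lambda>\<phi>. 0) \<in> A \<and>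
     (\<forall>f\<in>A. \<forall>g\<in>A. (\<lambda>\<phi>. f \<phi> + g \<phi>) \<in> A) \<and>
     (\<forall>f\<in>A. \<forall>c. (\<lambda>\<phi>. c * f \<phi>) \<in> A) \<and>
     (\<forall>f\<in>A. N f \<ge> 0) \<and>
     (\<forall>f\<in>A. N f = 0 \<longleftrightarrow> f = (\<lambda>\<phi>. 0)) \<and>
     (\<forall>f\<in>A. \<forall>c. N (\<lambda>\<phi>. c * f \<phi>) = norm c * N f) \<and>
     (\<exists>C\<ge>1. \<forall>f\<in>A. \<forall>g\<in>A. N (\<lambda>\<phi>. f \<phi> + g \<phi>) \<le> C * (N f + N g))"

definition quasi_banach_space :: "'n::finite distr set \<Rightarrow> ('n distr \<Rightarrow> real) \<Rightarrow> bool" where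
  "quasi_banach_space A N \<longleftrightarrow> quasi_normed_space A N \<and>
     (\<forall>F :: nat \<Rightarrow> 'n distr. (\<forall>k. F k \<in> A) \<longrightarrow>
        (\<forall>\<epsilon>>0. \<exists>M. \<forall>k\<ge>M. \<forall>l\<ge>M. N (\<lambda>\<phi>. F k \<phi> - F l \<phi>) < \<epsilon>) \<longrightarrow>
        (\<exists>f\<in>A. (\<lambda>k. N (\<lambda>\<phi>. F k \<phi> - f \<phi>)) \<longlonglongrightarrow> 0))"

definition quasi_norm_open :: "'n::finite distr set \<Rightarrow> ('n distr \<Rightarrow> real) \<Rightarrow> 'n distr set \<Rightarrow> bool" where
  "quasi_norm_open A N U \<longleftrightarrow> U \<subseteq> A \<and>
     (\<forall>f\<in>U. \<exists>\<epsilon>>0. {g \<in> A. N (\<lambda>\<phi>. g \<phi> - f \<phi>) < \<epsilon>} \<subseteq> U)"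

definition quasi_norm_topology :: "'n::finite distr set \<Rightarrow> ('n distr \<Rightarrow> real) \<Rightarrow> 'n distr topology" where
  "quasi_norm_topology A N = topology (quasi_norm_open A N)"

lemma istopology_quasi_norm_open: "istopology (quasi_norm_open A N)"
  unfolding istopology_def
proof (intro conjI allI impI)
  fix U V
  assume U: "quasi_norm_open A N U" and V: "quasi_norm_open A N V"
  show "quasi_norm_open A N (U \<inter> V)"
    unfolding quasi_norm_open_def
  proof (intro conjI ballI)
    show "U \<inter> V \<subseteq> A" using U by (auto simp: quasi_norm_open_def)
    fix f assume "f \<in> U \<inter> V"
    then obtain \<epsilon> \<epsilon>' where 1: "\<epsilon> > 0" "{g \<in> A. N (\<lambda>\<phi>. g \<phi> - f \<phi>) < \<epsilon>} \<subseteq> U"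
      and 2: "\<epsilon>' > 0" "{g \<in> A. N (\<lambda>\<phi>. g \<phi> - f \<phi>) < \<epsilon>'} \<subseteq> V"
      using U V unfolding quasi_norm_open_def by (meson IntE)
    have "{g \<in> A. N (\<lambda>\<phi>. g \<phi> - f \<phi>) < min \<epsilon> \<epsilon>'} \<subseteq> U \<inter> V" using 1 2 by auto
    moreover have "min \<epsilon> \<epsilon>' > 0" using 1 2 by simp
    ultimately show "\<exists>\<epsilon>>0. {g \<in> A. N (\<lambda>\<phi>. g \<phi> - f \<phi>) < \<epsilon>} \<subseteq> U \<inter> V" by blast
  qed
next
  fix \<K> assume "\<forall>K\<in>\<K>. quasi_norm_open A N K"
  then show "quasi_norm_open A N (\<Union>\<K>)"
    unfolding quasi_norm_open_def by (meson Sup_least Union_upper UnionE order_trans)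
qed

lemma openin_quasi_norm_topology: "openin (quasi_norm_topology A N) U \<longleftrightarrow> quasi_norm_open A N U"
  unfolding quasi_norm_topology_def by (simp add: topology_inverse'[OF istopology_quasi_norm_open])

lemma topspace_quasi_norm_topology: "topspace (quasi_norm_topology A N) = A"
proof -
  have "quasi_norm_open A N A"
    unfolding quasi_norm_open_def using zero_less_one by blast
  then show ?thesis
    unfolding topspace_def openin_quasi_norm_topology by (auto simp: quasi_norm_open_def)
qed

text \<open>The product of two elements of \<open>A\<close> is the distribution represented by the pointwise product of
  the functions representing them; its membership in \<open>A\<close> includes that this pointwise product is
  locally integrable.\<close>

definition multiplication_algebra :: "'n::finite distr set \<Rightarrow> ('n distr \<Rightarrow> real) \<Rightarrow> bool" where
  "multiplication_algebra A N \<longleftrightarrow>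
     quasi_banach_space A N \<and>
     continuous_map schwartz_topology (quasi_norm_topology A N) distr_of_schwartz \<and>
     continuous_map (quasi_norm_topology A N) tempered_topology (\<lambda>f. f) \<and>
     (\<forall>f\<in>A. \<exists>g. represents g f) \<and>
     (\<exists>c>0. \<forall>f1\<in>A. \<forall>f2\<in>A. \<forall>g1 g2. represents g1 f1 \<longrightarrow> represents g2 f2 \<longrightarrow>
        (\<exists>f\<in>A. represents (\<lambda>x. g1 x * g2 x) f \<and> N f \<le> c * N f1 * N f2))"


section \<open>Besov spaces\<close>

definition ennreal_powr :: "ennreal \<Rightarrow> real \<Rightarrow> ennreal" where
  "ennreal_powr x r = (if x = \<infinity> then \<infinity> else ennreal (enn2real x powr r))"

definition Lp_norm :: "ereal \<Rightarrow> 'n::finite cfun \<Rightarrow> ennreal" where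
  "Lp_norm p g = (if p = \<infinity> then esssup lebesgue (\<lambda>x. ennreal (norm (g x)))
     else ennreal_powr (\<integral>\<^sup>+x. ennreal (norm (g x) powr real_of_ereal p) \<partial>lebesgue)
            (1 / real_of_ereal p))"

text \<open>All functions representing \<open>T\<close> agree almost everywhere, so the infimum is over at most one
  value; it is \<open>\<infinity>\<close> if \<open>T\<close> is not regular.\<close>

definition distr_Lp_norm :: "ereal \<Rightarrow> 'n::finite distr \<Rightarrow> ennreal" where
  "distr_Lp_norm p T = (INF g\<in>{g. represents g T}. Lp_norm p g)"

fun dyadic :: "'n::finite cfun \<Rightarrow> nat \<Rightarrow> 'n cfun" where
  "dyadic \<phi>0 0 = \<phi>0"
| "dyadic \<phi>0 (Suc k) = (\<lambda>x. \<phi>0 ((1 / 2 ^ Suc k) *\<^sub>R x) - \<phi>0 ((1 / 2 ^ k) *\<^sub>R x))"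

definition besov_norm ::
    "'n::finite cfun \<Rightarrow> real \<Rightarrow> ereal \<Rightarrow> ereal \<Rightarrow> 'n distr \<Rightarrow> ennreal" where
  "besov_norm \<phi>0 s p q f =
     (let L = (\<lambda>j. distr_Lp_norm p (distr_inv_fourier (distr_mult (dyadic \<phi>0 j) (distr_fourier f))))
      in if q = \<infinity> then (SUP j. ennreal (2 powr (real j * s)) * L j)
         else ennreal_powr
           (\<Sum>j. ennreal (2 powr (real j * s * real_of_ereal q)) * ennreal_powr (L j) (real_of_ereal q))
           (1 / real_of_ereal q))"

definition besov_space ::
    "'n::finite cfun \<Rightarrow> real \<Rightarrow> ereal \<Rightarrow> ereal \<Rightarrow> 'n distr set" where
  "besov_space \<phi>0 s p q = {f \<in> tempered. besov_norm \<phi>0 s p q f < \<infinity>}"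

end

theory Submission
  imports Defs "HOL-Probability.Characteristic_Functions"
begin

text \<open>Cutting \<open>f\<close> into its frequency bands \<open>f = a\<^sub>0 + a\<^sub>1 + \<dots>\<close>, Nikolskii's inequality bounds the supremum of
  \<open>a\<^sub>j\<close> by \<open>2 ^ (j n/p)\<close> times its \<open>L\<^sub>p\<close> quasi-norm; as \<open>s > n/p\<close> these suprema decay geometrically, so \<open>f\<close> is
  a bounded function. A product is rearranged into \<open>\<Sum>\<^sub>m h\<^sub>m\<close>, where \<open>h\<^sub>m\<close> pairs the \<open>m\<close>-th band of one factor with
  all lower bands of the other. The latter are uniformly bounded, so \<open>h\<^sub>m\<close> is as small in \<open>L\<^sub>p\<close> as the bands
  themselves. The \<open>l\<close>-th band of the product only sees \<open>h\<^sub>m\<close> with \<open>m \<ge> l - 7\<close>. For \<open>p < 1\<close> filtering \<open>h\<^sub>m\<close> to the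
  band \<open>l\<close> costs a factor \<open>2 ^ ((m - l) n (1/p - 1))\<close>, which the weights \<open>2 ^ (l s)\<close> absorb since \<open>s > n/p\<close>. The
  same estimates for rapidly converging series give the quasi-triangle inequality and completeness.\<close>

section \<open>Iterated partial derivatives\<close>

text \<open>The spectrum of a bounded function is never described by the support of a Fourier
  transform, which would only be a distribution. It is encoded by the reproducing identity
  \<open>multiplier (cutoff j) u = u\<close>: an absolutely convergent integral against a Schwartz
  kernel, to which Fubini applies. Facts about spectra thus become identities between cut-off
  symbols; the fixed shifts in the indices come from there, since \<open>cutoff j\<close> is 1 on
  the ball of radius \<open>2 ^ j\<close> but vanishes only outside radius
  \<open>3 / 2 * 2 ^ j\<close>. A second obstacle is that a finite \<open>distr_Lp_norm\<close>
  merely provides some locally integrable representative of a piece, with no control at infinity.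
  Its growth is read off from the continuity of the distribution, and only then can the kernel
  integral be formed and Nikolskii's inequality, which yields boundedness, be proved. Convexity
  fails for \<open>p < 1\<close>. There the power \<open>1 - p\<close> of a function is estimated by
  its supremum and the rest is integrated, so such estimates need a supremum known to be finite
  beforehand.\<close>

lemma partial_derivs_Nil [simp]: "partial_derivs [] f = f"
  by (simp add: partial_derivs_def)

lemma partial_derivs_Cons [simp]:
  "partial_derivs (i # \<alpha>) f = partial_deriv i (partial_derivs \<alpha> f)"
  by (simp add: partial_derivs_def)

lemma partial_derivs_append:
  "partial_derivs (\<alpha> @ \<beta>) f = partial_derivs \<alpha> (partial_derivs \<beta> f)"
  by (simp add: partial_derivs_def)

lemma partial_deriv_eqI:
  "(f has_derivative f') (at x) \<Longrightarrow> partial_deriv i f x = f' (axis i 1)"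
  unfolding partial_deriv_def by (simp add: frechet_derivative_at[symmetric])

lemma vec_as_axis_sum: "v = (\<Sum>i\<in>UNIV. (v $ i) *\<^sub>R axis i (1::real))"
  using basis_expansion[of v] by (simp add: scalar_mult_eq_scaleR)

text \<open>Total derivatives are always put into this coordinate form, so that one derivative
  computation yields all partial derivatives at once through
  \<open>partial_deriv_from_has_derivative\<close>.\<close>

lemma has_derivative_partial_deriv:
  assumes "f differentiable (at x)"
  shows "(f has_derivative (\<lambda>v. \<Sum>i\<in>UNIV. (v $ i) *\<^sub>R partial_deriv i f x)) (at x)"
proof -
  have d: "(f has_derivative frechet_derivative f (at x)) (at x)"
    using assms by (simp add: frechet_derivative_works)
  then have l: "linear (frechet_derivative f (at x))"
    by (rule has_derivative_linear)
  have "frechet_derivative f (at x) = (\<lambda>v. \<Sum>i\<in>UNIV. (v $ i) *\<^sub>R partial_deriv i f x)"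
  proof
    fix v :: "real ^ 'a"
    have "frechet_derivative f (at x) v = frechet_derivative f (at x) (\<Sum>i\<in>UNIV. (v $ i) *\<^sub>R axis i 1)"
      using vec_as_axis_sum[of v] by simp
    also have "\<dots> = (\<Sum>i\<in>UNIV. (v $ i) *\<^sub>R partial_deriv i f x)"
      by (simp add: linear_sum[OF l] linear_scale[OF l] partial_deriv_def)
    finally show "frechet_derivative f (at x) v = (\<Sum>i\<in>UNIV. (v $ i) *\<^sub>R partial_deriv i f x)" .
  qed
  with d show ?thesis by simp
qed

lemma partial_deriv_from_has_derivative:
  assumes "\<And>x. (f has_derivative (\<lambda>v. \<Sum>i\<in>UNIV. (v $ i) *\<^sub>R F i x)) (at x)"
  shows "partial_deriv i f = F i"
proof
  fix x
  have "partial_deriv i f x = (\<Sum>j\<in>UNIV. (axis i 1 $ j) *\<^sub>R F j x)"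
    by (rule partial_deriv_eqI[OF assms])
  also have "\<dots> = (\<Sum>j\<in>UNIV. if j = i then F j x else 0)"
    by (intro sum.cong) (auto simp: axis_def)
  finally show "partial_deriv i f x = F i x" by simp
qed

lemma smooth_differentiable: "smooth f \<Longrightarrow> f differentiable (at x)"
  unfolding smooth_def by (drule spec[of _ "[]"]) simp

lemma smooth_partial_derivs: "smooth f \<Longrightarrow> smooth (partial_derivs \<alpha> f)"
  unfolding smooth_def by (simp flip: partial_derivs_append)

lemma smooth_partial_deriv: "smooth f \<Longrightarrow> smooth (partial_deriv i f)"
  using smooth_partial_derivs[of f "[i]"] by simp

text \<open>\<open>smooth\<close> quantifies over all lists of directions, so a direct induction
  would need a formula for every iterated derivative. It is enough to exhibit a class of
  differentiable functions that contains \<open>f\<close> and is closed under partial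
  derivatives.\<close>

lemma smooth_coinduct [consumes 1, case_names diff step]:
  assumes "P f" and "\<And>g x. P g \<Longrightarrow> g differentiable (at x)"
    and "\<And>g i. P g \<Longrightarrow> P (partial_deriv i g)"
  shows "smooth f"
proof -
  have "P (partial_derivs \<alpha> f)" for \<alpha>
    by (induction \<alpha>) (auto intro: assms)
  then show ?thesis
    unfolding smooth_def using assms(2) by blast
qed

lemma smooth_isCont: "smooth f \<Longrightarrow> isCont f x"
  using smooth_differentiable differentiable_imp_continuous_within by blast

lemma smooth_continuous_on: "smooth f \<Longrightarrow> continuous_on S f"
  by (simp add: continuous_at_imp_continuous_on smooth_isCont)

lemma smooth_borel: "smooth f \<Longrightarrow> f \<in> borel_measurable borel"
  by (intro borel_measurable_continuous_onI smooth_continuous_on)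

lemma partial_deriv_add:
  assumes "\<And>x. f differentiable (at x)" "\<And>x. g differentiable (at x)"
  shows "partial_deriv i (\<lambda>x. f x + g x) = (\<lambda>x. partial_deriv i f x + partial_deriv i g x)"
  using has_derivative_add[OF has_derivative_partial_deriv[OF assms(1)]
      has_derivative_partial_deriv[OF assms(2)]]
  by (intro partial_deriv_from_has_derivative) (simp add: sum.distrib scaleR_add_right)

lemma partial_deriv_mult:
  assumes "\<And>x. f differentiable (at x)" "\<And>x. g differentiable (at x)"
  shows "partial_deriv i (\<lambda>x. f x * g x) = (\<lambda>x. partial_deriv i f x * g x + f x * partial_deriv i g x)"
  using has_derivative_mult[OF has_derivative_partial_deriv[OF assms(1)]
      has_derivative_partial_deriv[OF assms(2)]]
  by (intro partial_deriv_from_has_derivative)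
    (simp add: sum.distrib scaleR_add_right sum_distrib_left sum_distrib_right add.commute)

lemma has_derivative_dilate:
  assumes "f differentiable (at (c *\<^sub>R x))"
  shows "((\<lambda>x. f (c *\<^sub>R x)) has_derivative
     (\<lambda>v. \<Sum>i\<in>UNIV. (v $ i) *\<^sub>R (c *\<^sub>R partial_deriv i f (c *\<^sub>R x)))) (at x)"
proof -
  have "((f \<circ> (\<lambda>x. c *\<^sub>R x)) has_derivative
      ((\<lambda>v. \<Sum>i\<in>UNIV. (v $ i) *\<^sub>R partial_deriv i f (c *\<^sub>R x)) \<circ> (\<lambda>v. c *\<^sub>R v))) (at x)"
    by (intro diff_chain_at has_derivative_partial_deriv assms)
      (auto intro!: derivative_eq_intros)
  then show ?thesis
    by (simp add: o_def scaleR_left_commute mult.commute)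
qed

lemma partial_deriv_dilate:
  assumes "\<And>x. f differentiable (at x)"
  shows "partial_deriv i (\<lambda>x. f (c *\<^sub>R x)) = (\<lambda>x. of_real c * partial_deriv i f (c *\<^sub>R x))"
  using has_derivative_dilate[OF assms]
  by (intro partial_deriv_from_has_derivative) (simp add: scaleR_conv_of_real)

text \<open>The product rule turns one product into a sum of two, so products alone are not closed
  under \<open>partial_deriv\<close>; their sums are, which is what \<open>smooth_coinduct\<close>
  asks for.\<close>

inductive sum_of_products :: "'n::finite cfun \<Rightarrow> bool" where
  prod: "smooth f \<Longrightarrow> smooth g \<Longrightarrow> sum_of_products (\<lambda>x. f x * g x)"
| add: "sum_of_products f \<Longrightarrow> sum_of_products g \<Longrightarrow> sum_of_products (\<lambda>x. f x + g x)"

lemma smooth_sum_of_products: "sum_of_products f \<Longrightarrow> smooth f"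
proof (induction rule: smooth_coinduct)
  case (diff g x)
  then show ?case by induction (auto intro: smooth_differentiable differentiable_mult)
next
  case (step g i)
  have d: "g differentiable (at x)" if "sum_of_products g" for g :: "'a cfun" and x
    using that by induction (auto intro: smooth_differentiable differentiable_mult)
  from step show ?case
  proof induction
    case (prod f g)
    then have "sum_of_products (\<lambda>x. partial_deriv i f x * g x + f x * partial_deriv i g x)"
      by (intro sum_of_products.add[OF sum_of_products.prod[of "partial_deriv i f" g]
            sum_of_products.prod[of f "partial_deriv i g"]] smooth_partial_deriv)
    with prod show ?case
      by (subst partial_deriv_mult) (auto intro: smooth_differentiable)
  next
    case (add f g)
    then show ?case
      by (subst partial_deriv_add) (auto intro!: sum_of_products.intros d)
  qed
qed

lemma smooth_mult: "smooth f \<Longrightarrow> smooth g \<Longrightarrow> smooth (\<lambda>x. f x * g x)"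
  by (rule smooth_sum_of_products[OF sum_of_products.prod])

lemma partial_deriv_const: "partial_deriv i (\<lambda>x. c) = (\<lambda>x. 0)"
  by (intro ext) (simp add: partial_deriv_eqI[OF has_derivative_const])

lemma smooth_const: "smooth (\<lambda>x. c)"
proof -
  show ?thesis
    by (rule smooth_coinduct[of "\<lambda>f. \<exists>d. f = (\<lambda>x. d)"]) (auto simp: partial_deriv_const)
qed

lemma smooth_cmult: "smooth f \<Longrightarrow> smooth (\<lambda>x. c * f x)"
  by (rule smooth_mult[OF smooth_const])

lemma smooth_add: assumes "smooth f" "smooth g" shows "smooth (\<lambda>x. f x + g x)"
proof -
  have "sum_of_products (\<lambda>x. 1 * f x + 1 * g x)"
    by (rule sum_of_products.add[OF sum_of_products.prod sum_of_products.prod]) (use assms smooth_const in auto)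
  then show ?thesis using smooth_sum_of_products by fastforce
qed

lemma smooth_diff: assumes "smooth f" "smooth g" shows "smooth (\<lambda>x. f x - g x)"
  using smooth_add[OF assms(1) smooth_cmult[OF assms(2), of "-1"]] by simp

lemma partial_deriv_cmult:
  "smooth f \<Longrightarrow> partial_deriv i (\<lambda>x. c * f x) = (\<lambda>x. c * partial_deriv i f x)"
  by (subst partial_deriv_mult) (auto simp: smooth_differentiable partial_deriv_const)

lemma smooth_dilate: assumes "smooth f" shows "smooth (\<lambda>x. f (c *\<^sub>R x))"
proof -
  \<comment> \<open>The free factor \<open>d\<close> absorbs the powers of \<open>c\<close> that the
    chain rule produces, which makes this class closed under partial derivatives.\<close>
  have "\<exists>g d. (\<lambda>x. f (c *\<^sub>R x)) = (\<lambda>x. d * g (c *\<^sub>R x)) \<and> smooth g"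
    using assms by (intro exI[of _ f] exI[of _ 1]) auto
  then show ?thesis
  proof (induction rule: smooth_coinduct)
    case (diff h x)
    then obtain g d where h: "h = (\<lambda>x. d * g (c *\<^sub>R x))" "smooth g" by blast
    have "(\<lambda>x. g (c *\<^sub>R x)) differentiable (at x)"
      using has_derivative_dilate[OF smooth_differentiable[OF h(2)]] differentiableI by blast
    then show ?case unfolding h by auto
  next
    case (step h i)
    then obtain g d where h: "h = (\<lambda>x. d * g (c *\<^sub>R x))" "smooth g" by blast
    have "(\<lambda>x. g (c *\<^sub>R x)) differentiable (at x)" for x
      using has_derivative_dilate[OF smooth_differentiable[OF h(2)]] differentiableI by blast
    then have "partial_deriv i h = (\<lambda>x. (d * of_real c) * partial_deriv i g (c *\<^sub>R x))"
      unfolding h using h(2)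
      by (subst partial_deriv_mult)
        (auto simp: partial_deriv_const partial_deriv_dilate smooth_differentiable mult.assoc)
    then show ?case using smooth_partial_deriv[OF h(2)] by blast
  qed
qed

lemma partial_derivs_add:
  assumes "smooth f" "smooth g"
  shows "partial_derivs \<alpha> (\<lambda>x. f x + g x) = (\<lambda>x. partial_derivs \<alpha> f x + partial_derivs \<alpha> g x)"
  by (induction \<alpha>)
    (auto simp: partial_deriv_add smooth_differentiable smooth_partial_derivs assms)

lemma partial_derivs_cmult:
  assumes "smooth f"
  shows "partial_derivs \<alpha> (\<lambda>x. c * f x) = (\<lambda>x. c * partial_derivs \<alpha> f x)"
  by (induction \<alpha>) (auto simp: partial_deriv_cmult smooth_partial_derivs assms)

lemma partial_derivs_dilate:
  assumes "smooth f"
  shows "partial_derivs \<alpha> (\<lambda>x. f (c *\<^sub>R x)) = (\<lambda>x. of_real c ^ length \<alpha> * partial_derivs \<alpha> f (c *\<^sub>R x))"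
proof (induction \<alpha>)
  case (Cons i \<alpha>)
  have s: "smooth (\<lambda>x. partial_derivs \<alpha> f (c *\<^sub>R x))"
    by (intro smooth_dilate smooth_partial_derivs assms)
  show ?case
    by (simp add: Cons partial_deriv_cmult[OF s] partial_deriv_dilate
        smooth_differentiable smooth_partial_derivs assms mult_ac)
qed simp

lemma smooth_coord: "smooth (\<lambda>x. of_real (x $ i))"
  and partial_deriv_coord: "partial_deriv j (\<lambda>x. of_real (x $ i)) = (\<lambda>x. if i = j then 1 else 0)"
proof -
  have d: "((\<lambda>x::real^'a. complex_of_real (x $ i)) has_derivative (\<lambda>v. of_real (v $ i))) (at x)" for x
    by (rule bounded_linear_imp_has_derivative)
      (intro bounded_linear_compose[OF bounded_linear_of_real] bounded_linear_vec_nth)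
  show p: "partial_deriv j (\<lambda>x. of_real (x $ i)) = (\<lambda>x. if i = j then 1 else 0)" for j
    by (intro ext) (auto simp: partial_deriv_eqI[OF d] axis_def)
  have diff: "(\<lambda>x::real^'a. complex_of_real (x $ i)) differentiable (at x)" for x
    using d by (rule differentiableI)
  show "smooth (\<lambda>x::real^'a. complex_of_real (x $ i))"
    by (rule smooth_coinduct[of "\<lambda>g. g = (\<lambda>x. complex_of_real (x $ i)) \<or> (\<exists>d. g = (\<lambda>x. d))"])
      (auto simp: p partial_deriv_const intro: diff)
qed

text \<open>One number controls all derivatives up to order \<open>N\<close>. Lists that differ by a
  permutation are counted separately, which affects only constants; the sum is finite because there
  are finitely many directions.\<close>

definition deriv_sum :: "nat \<Rightarrow> 'n::finite cfun \<Rightarrow> real ^ 'n \<Rightarrow> real" where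
  "deriv_sum N f x = (\<Sum>\<alpha>\<in>{\<alpha>. length \<alpha> \<le> N}. norm (partial_derivs \<alpha> f x))"

lemma finite_multi: "finite {\<alpha> :: 'n::finite list. length \<alpha> \<le> N}"
  using finite_lists_length_le[of "UNIV :: 'n set" N] by simp

lemma deriv_sum_nonneg [simp]: "0 \<le> deriv_sum N f x"
  by (simp add: deriv_sum_def sum_nonneg)

lemma deriv_sum_mono: "M \<le> N \<Longrightarrow> deriv_sum M f x \<le> deriv_sum N f x"
  unfolding deriv_sum_def by (intro sum_mono2 finite_multi) auto

lemma norm_partial_derivs_le: "length \<alpha> \<le> N \<Longrightarrow> norm (partial_derivs \<alpha> f x) \<le> deriv_sum N f x"
  unfolding deriv_sum_def by (intro member_le_sum finite_multi) auto

lemma norm_le_deriv_sum: "norm (f x) \<le> deriv_sum N f x"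
  using norm_partial_derivs_le[of "[]"] by simp

lemma deriv_sum_0: "deriv_sum 0 f x = norm (f x)"
  by (simp add: deriv_sum_def)

lemma deriv_sum_Suc:
  "deriv_sum (Suc N) f x = norm (f x) + (\<Sum>i\<in>UNIV. deriv_sum N (partial_deriv i f) x)"
proof -
  \<comment> \<open>The last entry of a list is the derivative that acts first, so splitting it off
    leaves lists that act on \<open>partial_deriv i f\<close>.\<close>
  have eq: "{\<alpha> :: 'n list. length \<alpha> \<le> Suc N} = insert [] ((\<lambda>(i, \<alpha>). \<alpha> @ [i]) ` (UNIV \<times> {\<alpha>. length \<alpha> \<le> N}))"
    (is "?L = insert [] (?h ` ?A)")
  proof (intro set_eqI iffI)
    fix \<alpha> :: "'n list" assume "\<alpha> \<in> ?L"
    then show "\<alpha> \<in> insert [] (?h ` ?A)"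
      by (cases \<alpha> rule: rev_cases) (auto simp: image_iff)
  qed auto
  have inj: "inj_on ?h ?A" by (auto simp: inj_on_def)
  have "deriv_sum (Suc N) f x = norm (f x) + (\<Sum>\<alpha>\<in>?h ` ?A. norm (partial_derivs \<alpha> f x))"
    unfolding deriv_sum_def eq
    by (subst sum.insert) (auto simp: finite_multi intro!: finite_imageI finite_cartesian_product)
  also have "(\<Sum>\<alpha>\<in>?h ` ?A. norm (partial_derivs \<alpha> f x)) = (\<Sum>(i, \<alpha>)\<in>?A. norm (partial_derivs \<alpha> (partial_deriv i f) x))"
    by (subst sum.reindex[OF inj]) (auto simp: o_def partial_derivs_append intro!: sum.cong)
  also have "\<dots> = (\<Sum>i\<in>UNIV. deriv_sum N (partial_deriv i f) x)"
    unfolding deriv_sum_def by (simp add: sum.cartesian_product)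
  finally show ?thesis .
qed

lemma deriv_sum_partial_deriv: "deriv_sum N (partial_deriv i f) x \<le> deriv_sum (Suc N) f x"
  unfolding deriv_sum_Suc
  using member_le_sum[of i UNIV "\<lambda>i. deriv_sum N (partial_deriv i f) x"] by (simp add: add_increasing)

lemma deriv_sum_add_le:
  "smooth f \<Longrightarrow> smooth g \<Longrightarrow> deriv_sum N (\<lambda>x. f x + g x) x \<le> deriv_sum N f x + deriv_sum N g x"
  unfolding deriv_sum_def sum.distrib[symmetric]
  by (intro sum_mono) (simp add: partial_derivs_add norm_triangle_ineq)

lemma deriv_sum_cmult: "smooth f \<Longrightarrow> deriv_sum N (\<lambda>x. c * f x) x = norm c * deriv_sum N f x"
  unfolding deriv_sum_def by (simp add: partial_derivs_cmult norm_mult sum_distrib_left)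

lemma deriv_sum_diff_le:
  assumes "smooth f" "smooth g"
  shows "deriv_sum N (\<lambda>x. f x - g x) x \<le> deriv_sum N f x + deriv_sum N g x"
  using deriv_sum_add_le[OF assms(1) smooth_cmult[OF assms(2), of "-1"], of N x]
    deriv_sum_cmult[OF assms(2), of N "-1" x] by simp

text \<open>Each derivative contributes a factor \<open>c\<close> of modulus at most 1. Hence
  widening a fixed bump does not increase its derivatives, and the cut-offs at all scales share one
  bound.\<close>

lemma deriv_sum_dilate_le:
  assumes "smooth f" "\<bar>c\<bar> \<le> 1"
  shows "deriv_sum N (\<lambda>x. f (c *\<^sub>R x)) x \<le> deriv_sum N f (c *\<^sub>R x)"
  unfolding deriv_sum_def
  using assms by (intro sum_mono)
    (simp add: partial_derivs_dilate norm_mult norm_power mult_left_le_one_le power_le_one)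

text \<open>A Leibniz rule without binomial coefficients: the induction on the order differentiates
  the product once and applies the estimate of lower order to both terms. The constant depends on
  \<open>N\<close> and the dimension alone.\<close>

lemma deriv_sum_mult_le:
  "\<exists>C\<ge>0. \<forall>f g :: 'n::finite cfun. \<forall>x. smooth f \<longrightarrow> smooth g \<longrightarrow>
     deriv_sum N (\<lambda>x. f x * g x) x \<le> C * deriv_sum N f x * deriv_sum N g x"
proof (induction N)
  case 0
  show ?case by (intro exI[of _ 1]) (auto simp: deriv_sum_0 norm_mult)
next
  case (Suc N)
  then obtain C where C: "C \<ge> 0" "\<And>f g :: 'n cfun. \<And>x. smooth f \<Longrightarrow> smooth g \<Longrightarrow>
     deriv_sum N (\<lambda>x. f x * g x) x \<le> C * deriv_sum N f x * deriv_sum N g x" by metis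
  show ?case
  proof (intro exI[of _ "1 + real CARD('n) * (2 * C)"] conjI allI impI)
    fix f g :: "'n cfun" and x assume s: "smooth f" "smooth g"
    let ?A = "deriv_sum (Suc N) f x" and ?B = "deriv_sum (Suc N) g x"
    have "deriv_sum N (partial_deriv i (\<lambda>x. f x * g x)) x \<le> 2 * C * (?A * ?B)" for i
    proof -
      have "deriv_sum N (partial_deriv i (\<lambda>x. f x * g x)) x
        \<le> deriv_sum N (\<lambda>x. partial_deriv i f x * g x) x + deriv_sum N (\<lambda>x. f x * partial_deriv i g x) x"
        using s by (subst partial_deriv_mult)
          (auto intro!: deriv_sum_add_le smooth_mult smooth_partial_deriv smooth_differentiable)
      also have "\<dots> \<le> C * deriv_sum N (partial_deriv i f) x * deriv_sum N g x
          + C * deriv_sum N f x * deriv_sum N (partial_deriv i g) x"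
        using s by (intro add_mono C smooth_partial_deriv)
      also have "\<dots> \<le> C * ?A * ?B + C * ?A * ?B"
        using C(1) by (intro add_mono mult_mono deriv_sum_partial_deriv deriv_sum_mono) auto
      finally show ?thesis by simp
    qed
    then have "(\<Sum>i\<in>UNIV. deriv_sum N (partial_deriv i (\<lambda>x. f x * g x)) x) \<le> (\<Sum>i\<in>(UNIV::'n set). 2 * C * (?A * ?B))"
      by (intro sum_mono) auto
    moreover have "norm (f x * g x) \<le> ?A * ?B"
      by (simp add: norm_mult mult_mono norm_le_deriv_sum)
    ultimately show "deriv_sum (Suc N) (\<lambda>x. f x * g x) x \<le> (1 + real CARD('n) * (2 * C)) * ?A * ?B"
      by (simp add: deriv_sum_Suc[of N "\<lambda>x. f x * g x"] algebra_simps)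
  qed (use C(1) in auto)
qed

section \<open>The Schwartz space\<close>

text \<open>A single increasing scale of norms that is equivalent to the two-parameter family
  \<open>schwartz_seminorm\<close>: weight and order are both taken to be \<open>N\<close>.\<close>

definition schwartz_sup :: "nat \<Rightarrow> 'n::finite cfun \<Rightarrow> real" where
  "schwartz_sup N f = (SUP x. (1 + norm x) ^ N * deriv_sum N f x)"

lemma schwartzI:
  assumes "smooth f" "\<And>N. \<exists>B. \<forall>x. (1 + norm x) ^ N * deriv_sum N f x \<le> B"
  shows "f \<in> schwartz"
proof -
  have "bounded (range (\<lambda>x. (1 + norm x) ^ k *\<^sub>R partial_derivs \<alpha> f x))" for k \<alpha>
  proof -
    let ?N = "max k (length \<alpha>)"
    obtain B where B: "\<And>x. (1 + norm x) ^ ?N * deriv_sum ?N f x \<le> B" using assms(2) by blast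
    have "norm ((1 + norm x) ^ k *\<^sub>R partial_derivs \<alpha> f x) \<le> B" for x
    proof -
      have "norm ((1 + norm x) ^ k *\<^sub>R partial_derivs \<alpha> f x) = (1 + norm x) ^ k * norm (partial_derivs \<alpha> f x)"
        by simp
      also have "\<dots> \<le> (1 + norm x) ^ ?N * deriv_sum ?N f x"
        by (intro mult_mono power_increasing norm_partial_derivs_le) auto
      finally show ?thesis using B[of x] by simp
    qed
    then show ?thesis by (auto simp: bounded_iff)
  qed
  then show ?thesis using assms(1) by (simp add: schwartz_def)
qed

lemma schwartz_smooth: "f \<in> schwartz \<Longrightarrow> smooth f"
  by (simp add: schwartz_def)

lemma schwartz_deriv_bdd:
  assumes "f \<in> schwartz" shows "bdd_above (range (\<lambda>x. (1 + norm x) ^ k * norm (partial_derivs \<alpha> f x)))"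
proof -
  have "bounded (range (\<lambda>x. (1 + norm x) ^ k *\<^sub>R partial_derivs \<alpha> f x))"
    using assms by (simp add: schwartz_def)
  then obtain B where "\<forall>x. norm ((1 + norm x) ^ k *\<^sub>R partial_derivs \<alpha> f x) \<le> B"
    by (auto simp: bounded_iff)
  then show ?thesis by (intro bdd_aboveI[of _ B]) (auto simp: norm_mult)
qed

lemma schwartz_seminorm_upper:
  "f \<in> schwartz \<Longrightarrow> (1 + norm x) ^ k * norm (partial_derivs \<alpha> f x) \<le> schwartz_seminorm k \<alpha> f"
  unfolding schwartz_seminorm_def by (intro cSUP_upper schwartz_deriv_bdd) auto

lemma schwartz_weight_le:
  assumes "f \<in> schwartz"
  shows "(1 + norm x) ^ N * deriv_sum N f x \<le> (\<Sum>\<alpha>\<in>{\<alpha>. length \<alpha> \<le> N}. schwartz_seminorm N \<alpha> f)"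
  unfolding deriv_sum_def sum_distrib_left
  by (intro sum_mono schwartz_seminorm_upper assms)

lemma schwartz_sup_upper:
  "f \<in> schwartz \<Longrightarrow> (1 + norm x) ^ N * deriv_sum N f x \<le> schwartz_sup N f"
  unfolding schwartz_sup_def
  by (intro cSUP_upper bdd_aboveI2[of _ _ "\<Sum>\<alpha>\<in>{\<alpha>. length \<alpha> \<le> N}. schwartz_seminorm N \<alpha> f"])
    (auto intro: schwartz_weight_le)

lemma schwartz_sup_le:
  "(\<And>x. (1 + norm x) ^ N * deriv_sum N f x \<le> B) \<Longrightarrow> schwartz_sup N f \<le> B"
  unfolding schwartz_sup_def by (intro cSUP_least) auto

lemma schwartz_sup_le_seminorms:
  "f \<in> schwartz \<Longrightarrow> schwartz_sup N f \<le> (\<Sum>\<alpha>\<in>{\<alpha>. length \<alpha> \<le> N}. schwartz_seminorm N \<alpha> f)"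
  by (intro schwartz_sup_le schwartz_weight_le)

lemma schwartz_sup_nonneg: "f \<in> schwartz \<Longrightarrow> 0 \<le> schwartz_sup N f"
  using order_trans[OF deriv_sum_nonneg[of N f 0]] schwartz_sup_upper[of f 0 N] by simp

lemma schwartz_sup_mono:
  "f \<in> schwartz \<Longrightarrow> M \<le> N \<Longrightarrow> schwartz_sup M f \<le> schwartz_sup N f"
proof (rule schwartz_sup_le)
  fix x assume "f \<in> schwartz" "M \<le> N"
  then have "(1 + norm x) ^ M * deriv_sum M f x \<le> (1 + norm x) ^ N * deriv_sum N f x"
    by (intro mult_mono power_increasing deriv_sum_mono) auto
  then show "(1 + norm x) ^ M * deriv_sum M f x \<le> schwartz_sup N f"
    using schwartz_sup_upper[OF \<open>f \<in> schwartz\<close>] order_trans by blast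
qed

lemma schwartz_decay:
  assumes "f \<in> schwartz" "length \<alpha> \<le> N"
  shows "norm (partial_derivs \<alpha> f x) \<le> schwartz_sup N f / (1 + norm x) ^ N"
proof -
  have "(1 + norm x) ^ N * norm (partial_derivs \<alpha> f x) \<le> (1 + norm x) ^ N * deriv_sum N f x"
    by (intro mult_left_mono norm_partial_derivs_le assms) auto
  then have "(1 + norm x) ^ N * norm (partial_derivs \<alpha> f x) \<le> schwartz_sup N f"
    using schwartz_sup_upper[OF assms(1)] order_trans by blast
  moreover have "(1 + norm x) ^ N > 0" by (simp add: add_pos_nonneg)
  ultimately show ?thesis by (simp add: pos_le_divide_eq mult.commute)
qed

lemma schwartz_decay0:
  "f \<in> schwartz \<Longrightarrow> norm (f x) \<le> schwartz_sup N f / (1 + norm x) ^ N"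
  using schwartz_decay[of f "[]" N x] by simp

lemma schwartz_seminorm_le_sup:
  assumes "f \<in> schwartz" "k \<le> N" "length \<alpha> \<le> N"
  shows "schwartz_seminorm k \<alpha> f \<le> schwartz_sup N f"
  unfolding schwartz_seminorm_def
proof (intro cSUP_least)
  fix x
  have "(1 + norm x) ^ k * norm (partial_derivs \<alpha> f x) \<le> (1 + norm x) ^ N * deriv_sum N f x"
    by (intro mult_mono power_increasing norm_partial_derivs_le assms) auto
  then show "(1 + norm x) ^ k * norm (partial_derivs \<alpha> f x) \<le> schwartz_sup N f"
    using schwartz_sup_upper[OF assms(1)] order_trans by blast
qed auto

lemma schwartz_add:
  assumes "f \<in> schwartz" "g \<in> schwartz" shows "(\<lambda>x. f x + g x) \<in> schwartz"
proof (rule schwartzI)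
  fix N
  have "(1 + norm x) ^ N * deriv_sum N (\<lambda>x. f x + g x) x \<le> schwartz_sup N f + schwartz_sup N g" for x
  proof -
    have "(1 + norm x) ^ N * deriv_sum N (\<lambda>x. f x + g x) x
      \<le> (1 + norm x) ^ N * (deriv_sum N f x + deriv_sum N g x)"
      by (intro mult_left_mono deriv_sum_add_le schwartz_smooth assms) auto
    also have "\<dots> \<le> schwartz_sup N f + schwartz_sup N g"
      unfolding distrib_left by (intro add_mono schwartz_sup_upper assms)
    finally show ?thesis .
  qed
  then show "\<exists>B. \<forall>x. (1 + norm x) ^ N * deriv_sum N (\<lambda>x. f x + g x) x \<le> B" by blast
qed (intro smooth_add schwartz_smooth assms)

lemma schwartz_cmult:
  assumes "f \<in> schwartz" shows "(\<lambda>x. c * f x) \<in> schwartz"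
proof (rule schwartzI)
  fix N
  have "(1 + norm x) ^ N * deriv_sum N (\<lambda>x. c * f x) x \<le> norm c * schwartz_sup N f" for x
    using mult_left_mono[OF schwartz_sup_upper[OF assms, of x N], of "norm c"]
    by (simp add: deriv_sum_cmult schwartz_smooth[OF assms] mult_ac)
  then show "\<exists>B. \<forall>x. (1 + norm x) ^ N * deriv_sum N (\<lambda>x. c * f x) x \<le> B" by blast
qed (intro smooth_cmult schwartz_smooth assms)

lemma schwartz_sup_cmult_le:
  assumes "f \<in> schwartz" shows "schwartz_sup N (\<lambda>x. c * f x) \<le> norm c * schwartz_sup N f"
proof (rule schwartz_sup_le)
  fix x show "(1 + norm x) ^ N * deriv_sum N (\<lambda>x. c * f x) x \<le> norm c * schwartz_sup N f"
    using mult_left_mono[OF schwartz_sup_upper[OF assms, of x N], of "norm c"]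
    by (simp add: deriv_sum_cmult schwartz_smooth[OF assms] mult_ac)
qed

lemma schwartz_diff:
  assumes "f \<in> schwartz" "g \<in> schwartz" shows "(\<lambda>x. f x - g x) \<in> schwartz"
  using schwartz_add[OF assms(1) schwartz_cmult[OF assms(2), of "-1"]] by simp

lemma schwartz_zero: "(\<lambda>x. 0) \<in> schwartz"
proof -
  have "partial_derivs \<alpha> (\<lambda>x. 0) = (\<lambda>x. 0)" for \<alpha> :: "'a list"
    by (induction \<alpha>) (auto simp: partial_deriv_const)
  then show ?thesis
    by (intro schwartzI[OF smooth_const]) (auto simp: deriv_sum_def)
qed

lemma schwartz_partial_deriv:
  assumes "f \<in> schwartz" shows "partial_deriv i f \<in> schwartz"
    and "schwartz_sup N (partial_deriv i f) \<le> schwartz_sup (Suc N) f"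
proof -
  have *: "(1 + norm x) ^ N * deriv_sum N (partial_deriv i f) x \<le> schwartz_sup (Suc N) f" for x N
  proof -
    have "(1 + norm x) ^ N * deriv_sum N (partial_deriv i f) x \<le> (1 + norm x) ^ Suc N * deriv_sum (Suc N) f x"
      by (intro mult_mono power_increasing deriv_sum_partial_deriv) auto
    then show ?thesis using schwartz_sup_upper[OF assms] order_trans by blast
  qed
  show "partial_deriv i f \<in> schwartz"
    by (rule schwartzI[OF smooth_partial_deriv[OF schwartz_smooth[OF assms]]]) (use * in blast)
  show "schwartz_sup N (partial_deriv i f) \<le> schwartz_sup (Suc N) f"
    by (rule schwartz_sup_le) (rule *)
qed

lemma schwartz_partial_derivs: "f \<in> schwartz \<Longrightarrow> partial_derivs \<alpha> f \<in> schwartz"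
  by (induction \<alpha>) (auto intro: schwartz_partial_deriv)

text \<open>By the Leibniz estimate, growth of order \<open>m\<close> of the factor \<open>g\<close>
  is paid by \<open>m\<close> additional orders of \<open>f\<close>. The constant \<open>K\<close>
  does not depend on \<open>g\<close> or \<open>f\<close>, so the lemma gives continuity estimates
  as well as membership in \<open>schwartz\<close>.\<close>

lemma schwartz_mult_gen:
  "\<exists>K\<ge>0. \<forall>g f :: 'n::finite cfun. \<forall>C m. smooth g \<longrightarrow> (\<forall>x. deriv_sum N g x \<le> C * (1 + norm x) ^ m) \<longrightarrow> f \<in> schwartz \<longrightarrow>
     (\<forall>x. (1 + norm x) ^ N * deriv_sum N (\<lambda>x. g x * f x) x \<le> K * C * schwartz_sup (N + m) f)"
proof -
  obtain K where K: "K \<ge> 0" "\<And>f g :: 'n cfun. \<And>x. smooth f \<Longrightarrow> smooth g \<Longrightarrow>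
     deriv_sum N (\<lambda>x. f x * g x) x \<le> K * deriv_sum N f x * deriv_sum N g x"
    using deriv_sum_mult_le by metis
  have "(1 + norm x) ^ N * deriv_sum N (\<lambda>x. g x * f x) x \<le> K * C * schwartz_sup (N + m) f"
    if g: "smooth g" "\<And>x. deriv_sum N g x \<le> C * (1 + norm x) ^ m" and f: "f \<in> schwartz"
    for g f :: "'n cfun" and C m x
  proof -
    have C: "C \<ge> 0"
      using order_trans[OF deriv_sum_nonneg g(2)[of 0]] by simp
    have "(1 + norm x) ^ N * deriv_sum N (\<lambda>x. g x * f x) x
      \<le> (1 + norm x) ^ N * (K * deriv_sum N g x * deriv_sum N f x)"
      by (intro mult_left_mono K g schwartz_smooth f) auto
    also have "\<dots> \<le> (1 + norm x) ^ N * (K * (C * (1 + norm x) ^ m) * deriv_sum (N + m) f x)"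
      using K(1) C by (intro mult_left_mono mult_mono g deriv_sum_mono) (auto intro!: mult_nonneg_nonneg)
    also have "\<dots> = K * C * ((1 + norm x) ^ (N + m) * deriv_sum (N + m) f x)"
      by (simp add: power_add)
    also have "\<dots> \<le> K * C * schwartz_sup (N + m) f"
      using K(1) C by (intro mult_left_mono schwartz_sup_upper f) auto
    finally show ?thesis .
  qed
  then show ?thesis using K(1) by blast
qed

lemma schwartz_mult_moderate:
  fixes g f :: "'n::finite cfun"
  assumes "smooth g" "\<And>N. \<exists>C m. \<forall>x. deriv_sum N g x \<le> C * (1 + norm x) ^ m" "f \<in> schwartz"
  shows "(\<lambda>x. g x * f x) \<in> schwartz"
proof (rule schwartzI)
  fix N
  obtain C m where *: "\<forall>x. deriv_sum N g x \<le> C * (1 + norm x) ^ m" using assms(2) by blast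
  obtain K where K: "\<forall>g f :: 'n::finite cfun. \<forall>C m. smooth g \<longrightarrow> (\<forall>x. deriv_sum N g x \<le> C * (1 + norm x) ^ m) \<longrightarrow> f \<in> schwartz \<longrightarrow>
     (\<forall>x. (1 + norm x) ^ N * deriv_sum N (\<lambda>x. g x * f x) x \<le> K * C * schwartz_sup (N + m) f)"
    using schwartz_mult_gen[of N, where 'n = 'n] by blast
  have "\<forall>x. (1 + norm x) ^ N * deriv_sum N (\<lambda>x. g x * f x) x \<le> K * C * schwartz_sup (N + m) f"
    using K[rule_format, of g C m f] assms(1,3) * by blast
  then show "\<exists>B. \<forall>x. (1 + norm x) ^ N * deriv_sum N (\<lambda>x. g x * f x) x \<le> B"
    by blast
qed (intro smooth_mult assms schwartz_smooth)

lemma schwartz_mult: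
  assumes "f \<in> schwartz" "g \<in> schwartz" shows "(\<lambda>x. f x * g x) \<in> schwartz"
proof (rule schwartz_mult_moderate)
  fix N
  have "deriv_sum N f x \<le> schwartz_sup N f" for x
    using order_trans[OF mult_right_mono[OF one_le_power[of "1 + norm x" N] deriv_sum_nonneg]
        schwartz_sup_upper[OF assms(1), of x N]] by simp
  then show "\<exists>C m. \<forall>x. deriv_sum N f x \<le> C * (1 + norm x) ^ m"
    by (intro exI[of _ "schwartz_sup N f"] exI[of _ 0]) simp
qed (intro assms schwartz_smooth)+

lemma deriv_sum_coord_le: "deriv_sum N (\<lambda>x. of_real (x $ i)) x \<le> (1 + norm x) ^ 1"
proof (cases N)
  case 0
  then show ?thesis using component_le_norm_cart[of x i] by (simp add: deriv_sum_0)
next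
  case (Suc M)
  have c: "deriv_sum M (\<lambda>x::real^'a. c) x = norm c" for c M
  proof (cases M)
    case (Suc L)
    have "partial_derivs \<alpha> (\<lambda>x::real^'a. 0) = (\<lambda>x. 0)" for \<alpha>
      by (induction \<alpha>) (auto simp: partial_deriv_const)
    then show ?thesis unfolding Suc deriv_sum_Suc by (simp add: partial_deriv_const deriv_sum_def)
  qed (simp add: deriv_sum_0)
  have "deriv_sum N (\<lambda>x. of_real (x $ i)) x = \<bar>x $ i\<bar> + (\<Sum>j\<in>UNIV. if i = j then 1 else 0)"
    unfolding Suc deriv_sum_Suc by (auto simp: partial_deriv_coord c if_distrib[of cmod] cong: if_cong)
  then show ?thesis using component_le_norm_cart[of x i] by simp
qed

lemma schwartz_coord_mult:
  assumes "f \<in> schwartz" shows "(\<lambda>x. of_real (x $ i) * f x) \<in> schwartz"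
proof (rule schwartz_mult_moderate[OF smooth_coord _ assms])
  show "\<exists>C m. \<forall>x. deriv_sum N (\<lambda>x. of_real (x $ i)) x \<le> C * (1 + norm x) ^ m" for N
    using deriv_sum_coord_le[of N i] by (intro exI[of _ 1]) auto
qed

lemma schwartz_sup_coord_mult:
  "\<exists>K\<ge>0. \<forall>f :: 'n::finite cfun. \<forall>i. f \<in> schwartz \<longrightarrow>
    schwartz_sup N (\<lambda>x. of_real (x $ i) * f x) \<le> K * schwartz_sup (Suc N) f"
proof -
  obtain K where K: "K \<ge> 0" "\<forall>g f :: 'n::finite cfun. \<forall>C m. smooth g \<longrightarrow> (\<forall>x. deriv_sum N g x \<le> C * (1 + norm x) ^ m) \<longrightarrow> f \<in> schwartz \<longrightarrow>
     (\<forall>x. (1 + norm x) ^ N * deriv_sum N (\<lambda>x. g x * f x) x \<le> K * C * schwartz_sup (N + m) f)"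
    using schwartz_mult_gen[of N, where 'n='n] by blast
  show ?thesis
  proof (intro exI[of _ K] conjI allI impI schwartz_sup_le)
    fix f :: "'n cfun" and i x assume f: "f \<in> schwartz"
    show "(1 + norm x) ^ N * deriv_sum N (\<lambda>x. of_real (x $ i) * f x) x \<le> K * schwartz_sup (Suc N) f"
      using K(2)[rule_format, OF smooth_coord, of i 1 1 f x] f deriv_sum_coord_le[of N i] by simp
  qed (rule K(1))
qed

lemma schwartz_dilate:
  assumes "f \<in> schwartz" "c \<noteq> 0" shows "(\<lambda>x. f (c *\<^sub>R x)) \<in> schwartz"
proof -
  have "bounded (range (\<lambda>x. (1 + norm x) ^ k *\<^sub>R partial_derivs \<alpha> (\<lambda>x. f (c *\<^sub>R x)) x))" for k \<alpha>
  proof -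
    \<comment> \<open>\<open>?d\<close> compares the weights before and after the dilation:
      \<open>1 + norm x \<le> ?d * (1 + norm (c *\<^sub>R x))\<close>.\<close>
    let ?d = "max 1 (1 / \<bar>c\<bar>)"
    have "norm ((1 + norm x) ^ k *\<^sub>R partial_derivs \<alpha> (\<lambda>x. f (c *\<^sub>R x)) x)
       \<le> \<bar>c\<bar> ^ length \<alpha> * (?d ^ k * schwartz_seminorm k \<alpha> f)" for x
    proof -
      have "norm x \<le> ?d * norm (c *\<^sub>R x)"
        using assms(2) mult_right_mono[of "1 / \<bar>c\<bar>" ?d "\<bar>c\<bar> * norm x"] by simp
      then have "1 + norm x \<le> ?d * (1 + norm (c *\<^sub>R x))"
        unfolding distrib_left by linarith
      then have "(1 + norm x) ^ k \<le> ?d ^ k * (1 + norm (c *\<^sub>R x)) ^ k"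
        unfolding power_mult_distrib[symmetric] by (intro power_mono) auto
      then have "(1 + norm x) ^ k * norm (partial_derivs \<alpha> f (c *\<^sub>R x)) \<le> (?d ^ k * (1 + norm (c *\<^sub>R x)) ^ k) * norm (partial_derivs \<alpha> f (c *\<^sub>R x))"
        by (intro mult_right_mono) auto
      also have "\<dots> \<le> ?d ^ k * schwartz_seminorm k \<alpha> f"
        unfolding mult.assoc by (intro mult_left_mono schwartz_seminorm_upper assms) auto
      finally have "\<bar>c\<bar> ^ length \<alpha> * ((1 + norm x) ^ k * norm (partial_derivs \<alpha> f (c *\<^sub>R x)))
         \<le> \<bar>c\<bar> ^ length \<alpha> * (?d ^ k * schwartz_seminorm k \<alpha> f)"
        by (intro mult_left_mono) auto
      then show ?thesis
        by (simp add: partial_derivs_dilate schwartz_smooth[OF assms(1)] norm_mult norm_power mult_ac)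
    qed
    then show ?thesis by (auto simp: bounded_iff)
  qed
  then show ?thesis using smooth_dilate[OF schwartz_smooth[OF assms(1)]] by (simp add: schwartz_def)
qed

lemma schwartz_reflect: "f \<in> schwartz \<Longrightarrow> (\<lambda>x. f (- x)) \<in> schwartz"
  using schwartz_dilate[of f "-1"] by simp

lemma schwartz_sup_reflect_le: 
  assumes "f \<in> schwartz" shows "schwartz_sup N (\<lambda>x. f (- x)) \<le> schwartz_sup N f"
proof (rule schwartz_sup_le)
  fix x
  have "(1 + norm x) ^ N * deriv_sum N (\<lambda>x. f (- x)) x \<le> (1 + norm x) ^ N * deriv_sum N f (- x)"
    using deriv_sum_dilate_le[OF schwartz_smooth[OF assms], of "-1" N x]
    by (intro mult_left_mono) auto
  then show "(1 + norm x) ^ N * deriv_sum N (\<lambda>x. f (- x)) x \<le> schwartz_sup N f"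
    using schwartz_sup_upper[OF assms, of "-x" N] by simp
qed

section \<open>The Schwartz topology in terms of \<open>schwartz_sup\<close>, and tempered
  distributions as bounded functionals\<close>

lemma openin_schwartz_topologyD: "openin schwartz_topology U \<Longrightarrow> \<phi> \<in> U \<Longrightarrow>
    \<exists>N \<epsilon>. \<epsilon> > 0 \<and> (\<forall>\<psi>\<in>schwartz. schwartz_sup N (\<lambda>x. \<psi> x - \<phi> x) < \<epsilon> \<longrightarrow> \<psi> \<in> U)"
proof -
  assume U: "openin schwartz_topology U" "\<phi> \<in> U"
  then have "schwartz_open U" by (simp add: openin_schwartz_topology)
  then obtain N \<epsilon> where N: "\<epsilon> > 0" "schwartz_nbhd N \<epsilon> \<phi> \<subseteq> U" and \<phi>: "\<phi> \<in> schwartz"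
    using U(2) unfolding schwartz_open_def by blast
  have "\<psi> \<in> U" if "\<psi> \<in> schwartz" "schwartz_sup N (\<lambda>x. \<psi> x - \<phi> x) < \<epsilon>" for \<psi>
  proof -
    have "\<psi> \<in> schwartz_nbhd N \<epsilon> \<phi>"
      unfolding schwartz_nbhd_def using that schwartz_seminorm_le_sup[OF schwartz_diff[OF that(1) \<phi>], of _ N]
      by (auto intro: le_less_trans)
    then show ?thesis using N by blast
  qed
  then show ?thesis using N by blast
qed

lemma openin_schwartzI:
  assumes "U \<subseteq> schwartz"
    and "\<And>\<phi>. \<phi> \<in> U \<Longrightarrow> \<exists>N \<epsilon>. \<epsilon> > 0 \<and> (\<forall>\<psi>\<in>schwartz. schwartz_sup N (\<lambda>x. \<psi> x - \<phi> x) < \<epsilon> \<longrightarrow> \<psi> \<in> U)"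
  shows "openin schwartz_topology (U :: 'n::finite cfun set)"
  unfolding openin_schwartz_topology schwartz_open_def
proof (intro conjI ballI assms(1))
  fix \<phi> assume \<phi>: "\<phi> \<in> U"
  then obtain N \<epsilon> where N: "\<epsilon> > 0" "\<And>\<psi>. \<psi>\<in>schwartz \<Longrightarrow> schwartz_sup N (\<lambda>x. \<psi> x - \<phi> x) < \<epsilon> \<Longrightarrow> \<psi> \<in> U"
    using assms(2) by metis
  \<comment> \<open>\<open>K\<close> exceeds the number of multi-indices, so the sum of that many
    seminorms below \<open>\<epsilon> / K\<close> stays strictly below
    \<open>\<epsilon>\<close>.\<close>
  define K where "K = real (card {\<alpha> :: 'n list. length \<alpha> \<le> N}) + 1"
  have K: "K > 0" by (simp add: K_def)
  have "schwartz_nbhd N (\<epsilon> / K) \<phi> \<subseteq> U"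
  proof
    fix \<psi> assume "\<psi> \<in> schwartz_nbhd N (\<epsilon> / K) \<phi>"
    then have s: "\<psi> \<in> schwartz" "\<And>\<alpha>. length \<alpha> \<le> N \<Longrightarrow> schwartz_seminorm N \<alpha> (\<lambda>x. \<psi> x - \<phi> x) < \<epsilon> / K"
      by (auto simp: schwartz_nbhd_def)
    have d: "(\<lambda>x. \<psi> x - \<phi> x) \<in> schwartz"
      using s(1) \<phi> assms(1) by (intro schwartz_diff) auto
    have "schwartz_sup N (\<lambda>x. \<psi> x - \<phi> x) \<le> (\<Sum>\<alpha>\<in>{\<alpha>::'n list. length \<alpha> \<le> N}. \<epsilon> / K)"
      by (intro order_trans[OF schwartz_sup_le_seminorms[OF d]] sum_mono) (use s(2) in \<open>auto intro: less_imp_le\<close>)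
    also have "\<dots> = (K - 1) * (\<epsilon> / K)" by (simp add: K_def)
    also have "\<dots> < \<epsilon>" using K N(1) by (simp add: field_simps)
    finally show "\<psi> \<in> U" using N(2) s(1) by blast
  qed
  then show "\<exists>N. \<exists>\<epsilon>>0. schwartz_nbhd N \<epsilon> \<phi> \<subseteq> U"
    using N(1) K by (intro exI[of _ N] exI[of _ "\<epsilon> / K"]) auto
qed

lemma tempered_add: "T \<in> tempered \<Longrightarrow> \<phi> \<in> schwartz \<Longrightarrow> \<psi> \<in> schwartz \<Longrightarrow> T (\<lambda>x. \<phi> x + \<psi> x) = T \<phi> + T \<psi>"
  by (simp add: tempered_def)

lemma tempered_cmult: "T \<in> tempered \<Longrightarrow> \<phi> \<in> schwartz \<Longrightarrow> T (\<lambda>x. c * \<phi> x) = c * T \<phi>"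
  by (simp add: tempered_def)

lemma tempered_outside: "T \<in> tempered \<Longrightarrow> \<phi> \<notin> schwartz \<Longrightarrow> T \<phi> = 0"
  by (simp add: tempered_def)

lemma tempered_diff:
  "T \<in> tempered \<Longrightarrow> \<phi> \<in> schwartz \<Longrightarrow> \<psi> \<in> schwartz \<Longrightarrow> T (\<lambda>x. \<phi> x - \<psi> x) = T \<phi> - T \<psi>"
  using tempered_add[of T \<phi> "\<lambda>x. -1 * \<psi> x"] tempered_cmult[of T \<psi> "-1"] schwartz_cmult[of \<psi> "-1"] by simp

text \<open>Continuity at zero gives a neighbourhood
  \<open>schwartz_sup N \<phi> < \<epsilon>\<close> on which \<open>T\<close> is bounded by 1;
  homogeneity spreads this bound to all of \<open>schwartz\<close>.\<close>

lemma tempered_bound: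
  assumes "T \<in> tempered"
  shows "\<exists>N C. C \<ge> 0 \<and> (\<forall>\<phi>\<in>schwartz. norm (T \<phi>) \<le> C * schwartz_sup N \<phi>)"
proof -
  have z: "T (\<lambda>x. 0) = 0" using tempered_cmult[OF assms schwartz_zero, of 0] by simp
  have "openin schwartz_topology {\<phi> \<in> topspace schwartz_topology. T \<phi> \<in> ball 0 1}"
    using assms by (intro openin_continuous_map_preimage[of _ euclidean]) (auto simp: tempered_def)
  moreover have "(\<lambda>x. 0) \<in> {\<phi> \<in> topspace schwartz_topology. T \<phi> \<in> ball 0 1}"
    by (simp add: z topspace_schwartz_topology schwartz_zero)
  ultimately have "\<exists>N \<epsilon>. \<epsilon> > 0 \<and> (\<forall>\<psi>\<in>schwartz. schwartz_sup N (\<lambda>x. \<psi> x - 0) < \<epsilon> \<longrightarrow>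
      \<psi> \<in> {\<phi> \<in> topspace schwartz_topology. T \<phi> \<in> ball 0 1})"
    by (rule openin_schwartz_topologyD)
  then obtain N \<epsilon> where N: "\<epsilon> > 0"
      "\<And>\<psi>. \<psi>\<in>schwartz \<Longrightarrow> schwartz_sup N \<psi> < \<epsilon> \<Longrightarrow> T \<psi> \<in> ball 0 1"
    by auto
  have "norm (T \<phi>) \<le> 1 / \<epsilon> * schwartz_sup N \<phi>" if \<phi>: "\<phi> \<in> schwartz" for \<phi>
  \<comment> \<open>Working with any \<open>r\<close> strictly above the claimed bound makes
    \<open>r\<close> positive, so one can divide by it even when
    \<open>schwartz_sup N \<phi>\<close> vanishes.\<close>
  proof (rule dense_ge)
    fix r assume r: "1 / \<epsilon> * schwartz_sup N \<phi> < r"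
    have r0: "r > 0" using r schwartz_sup_nonneg[OF \<phi>, of N] N(1)
      by (smt (verit) divide_nonneg_pos mult_nonneg_nonneg)
    have "schwartz_sup N (\<lambda>x. of_real (1/r) * \<phi> x) \<le> 1/r * schwartz_sup N \<phi>"
      using schwartz_sup_cmult_le[OF \<phi>, of N "of_real (1/r)"] r0 by (simp del: of_real_divide)
    also have "\<dots> < \<epsilon>" using r r0 N(1) by (simp add: field_simps)
    finally have "T (\<lambda>x. of_real (1/r) * \<phi> x) \<in> ball 0 1"
      by (rule N(2)[OF schwartz_cmult[OF \<phi>]])
    then have "norm (of_real (1/r) * T \<phi>) < 1" unfolding tempered_cmult[OF assms \<phi>] by simp
    then show "norm (T \<phi>) \<le> r" using r0 by (simp add: norm_divide field_simps)
  qed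
  then show ?thesis using N(1) by (intro exI[of _ N] exI[of _ "1/\<epsilon>"]) auto
qed

lemma temperedI:
  assumes "\<And>\<phi> \<psi>. \<phi> \<in> schwartz \<Longrightarrow> \<psi> \<in> schwartz \<Longrightarrow> T (\<lambda>x. \<phi> x + \<psi> x) = T \<phi> + T \<psi>"
    and "\<And>\<phi> c. \<phi> \<in> schwartz \<Longrightarrow> T (\<lambda>x. c * \<phi> x) = c * T \<phi>"
    and "\<And>\<phi>. \<phi> \<notin> schwartz \<Longrightarrow> T \<phi> = 0"
    and bd: "\<And>\<phi>. \<phi> \<in> schwartz \<Longrightarrow> norm (T \<phi>) \<le> C * schwartz_sup N \<phi>"
  shows "T \<in> tempered"
proof -
  have "openin schwartz_topology {\<phi> \<in> schwartz. T \<phi> \<in> V}" if V: "open V" for V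
  proof (rule openin_schwartzI)
    fix \<phi> assume \<phi>: "\<phi> \<in> {\<phi> \<in> schwartz. T \<phi> \<in> V}"
    then obtain e where e: "e > 0" "\<And>z. dist z (T \<phi>) < e \<Longrightarrow> z \<in> V"
      using V unfolding open_dist by blast
    have "T \<psi> \<in> V" if \<psi>: "\<psi> \<in> schwartz" "schwartz_sup N (\<lambda>x. \<psi> x - \<phi> x) < e / (\<bar>C\<bar> + 1)" for \<psi>
    proof (rule e(2))
      have d: "(\<lambda>x. \<psi> x - \<phi> x) \<in> schwartz" using \<phi> \<psi> schwartz_diff by auto
      have "T (\<lambda>x. \<psi> x - \<phi> x) = T \<psi> - T \<phi>"
        using assms(1)[of \<psi> "\<lambda>x. -1 * \<phi> x"] assms(2)[of \<phi> "-1"] schwartz_cmult[of \<phi> "-1"] \<phi> \<psi> by simp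
      then have "dist (T \<psi>) (T \<phi>) \<le> C * schwartz_sup N (\<lambda>x. \<psi> x - \<phi> x)"
        using bd[OF d] by (simp add: dist_norm)
      also have "\<dots> \<le> (\<bar>C\<bar> + 1) * schwartz_sup N (\<lambda>x. \<psi> x - \<phi> x)"
        using schwartz_sup_nonneg[OF d] by (intro mult_right_mono) auto
      also have "\<dots> < e" using \<psi>(2) by (simp add: field_simps)
      finally show "dist (T \<psi>) (T \<phi>) < e" .
    qed
    then show "\<exists>N \<epsilon>. \<epsilon> > 0 \<and> (\<forall>\<psi>\<in>schwartz. schwartz_sup N (\<lambda>x. \<psi> x - \<phi> x) < \<epsilon> \<longrightarrow> \<psi> \<in> {\<phi> \<in> schwartz. T \<phi> \<in> V})"
      using e(1) by (intro exI[of _ N] exI[of _ "e / (\<bar>C\<bar> + 1)"]) auto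
  qed auto
  then have "continuous_map schwartz_topology euclidean T"
    by (simp add: continuous_map topspace_schwartz_topology)
  then show ?thesis unfolding tempered_def using assms by auto
qed

section \<open>Integration on Euclidean space\<close>

lemma lborel_translate: "distr lborel borel (\<lambda>x. a + x) = (lborel :: 'a::euclidean_space measure)"
  using lborel_affine[of 1 a] by (simp add: density_1)

lemma lborel_reflect: "distr lborel borel (\<lambda>x. a - x) = (lborel :: 'a::euclidean_space measure)"
  using lborel_affine[of "-1" a] by (simp add: density_1)

lemma integral_translate:
  fixes f :: "'a::euclidean_space \<Rightarrow> 'b::{banach, second_countable_topology}"
  assumes [measurable]: "f \<in> borel_measurable borel"
  shows "(LINT x|lborel. f (a + x)) = (LINT x|lborel. f x)"
  by (subst (2) lborel_translate[of a, symmetric]) (simp add: integral_distr)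

lemma integral_reflect:
  fixes f :: "'a::euclidean_space \<Rightarrow> 'b::{banach, second_countable_topology}"
  assumes [measurable]: "f \<in> borel_measurable borel"
  shows "(LINT x|lborel. f (a - x)) = (LINT x|lborel. f x)"
  by (subst (2) lborel_reflect[of a, symmetric]) (simp add: integral_distr)

lemma integrable_translate:
  fixes f :: "'a::euclidean_space \<Rightarrow> 'b::{banach, second_countable_topology}"
  assumes "integrable lborel f"
  shows "integrable lborel (\<lambda>x. f (a + x))"
  using assms borel_measurable_integrable[OF assms]
  by (subst (asm) lborel_translate[of a, symmetric]) (simp add: integrable_distr_eq)

lemma integrable_reflect:
  fixes f :: "'a::euclidean_space \<Rightarrow> 'b::{banach, second_countable_topology}"
  assumes "integrable lborel f"
  shows "integrable lborel (\<lambda>x. f (a - x))"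
  using assms borel_measurable_integrable[OF assms]
  by (subst (asm) lborel_reflect[of a, symmetric]) (simp add: integrable_distr_eq)

lemma nn_integral_reflect:
  fixes f :: "'a::euclidean_space \<Rightarrow> ennreal"
  assumes [measurable]: "f \<in> borel_measurable borel"
  shows "(\<integral>\<^sup>+x. f (a - x) \<partial>lborel) = (\<integral>\<^sup>+x. f x \<partial>lborel)"
  by (subst (2) lborel_reflect[of a, symmetric]) (simp add: nn_integral_distr)

lemma nn_integral_translate:
  fixes f :: "'a::euclidean_space \<Rightarrow> ennreal"
  assumes [measurable]: "f \<in> borel_measurable borel"
  shows "(\<integral>\<^sup>+x. f (a + x) \<partial>lborel) = (\<integral>\<^sup>+x. f x \<partial>lborel)"
  by (subst (2) lborel_translate[of a, symmetric]) (simp add: nn_integral_distr)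

lemma nn_integral_dilate:
  fixes f :: "'a::euclidean_space \<Rightarrow> ennreal"
  assumes [measurable]: "f \<in> borel_measurable borel" and c: "c \<noteq> 0"
  shows "(\<integral>\<^sup>+x. f x \<partial>lborel) = ennreal (\<bar>c\<bar> ^ DIM('a)) * (\<integral>\<^sup>+x. f (c *\<^sub>R x) \<partial>lborel)"
  by (subst lborel_affine[OF c, of 0])
     (simp add: nn_integral_density nn_integral_distr nn_integral_cmult)

lemma integrable_dilate:
  fixes f :: "'a::euclidean_space \<Rightarrow> 'b::{banach, second_countable_topology}"
  assumes "integrable lborel f" "c \<noteq> 0"
  shows "integrable lborel (\<lambda>x. f (c *\<^sub>R x))"
proof (rule integrableI_bounded)
  have [measurable]: "f \<in> borel_measurable borel" using borel_measurable_integrable[OF assms(1)] by simp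
  show "(\<lambda>x. f (c *\<^sub>R x)) \<in> borel_measurable lborel" by measurable
  have "ennreal (\<bar>c\<bar> ^ DIM('a)) * (\<integral>\<^sup>+x. ennreal (norm (f (c *\<^sub>R x))) \<partial>lborel) < \<infinity>"
    using assms by (subst nn_integral_dilate[symmetric]) (auto simp: integrable_iff_bounded)
  then show "(\<integral>\<^sup>+x. ennreal (norm (f (c *\<^sub>R x))) \<partial>lborel) < \<infinity>"
    using assms(2) by (auto simp: ennreal_mult_less_top)
qed

lemma integral_dilate:
  fixes f :: "'a::euclidean_space \<Rightarrow> 'b::{banach, second_countable_topology}"
  assumes "integrable lborel f" "c \<noteq> 0"
  shows "(LINT x|lborel. f x) = \<bar>c\<bar> ^ DIM('a) *\<^sub>R (LINT x|lborel. f (c *\<^sub>R x))"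
proof -
  have [measurable]: "f \<in> borel_measurable borel" using borel_measurable_integrable[OF assms(1)] by simp
  show ?thesis
    by (subst lborel_affine[OF assms(2), of 0])
      (use integrable_dilate[OF assms] in \<open>simp add: integral_density integral_distr\<close>)
qed

lemma lebesgue_integral_lborel:
  fixes f :: "'a::euclidean_space \<Rightarrow> 'b::{banach, second_countable_topology}"
  shows "f \<in> borel_measurable borel \<Longrightarrow> (LINT x|lebesgue. f x) = (LINT x|lborel. f x)"
  by (simp add: integral_completion)

section \<open>An integrable polynomial weight\<close>

definition decay :: "real ^ 'n::finite \<Rightarrow> real" where
  "decay x = 1 / (1 + norm x) ^ (CARD('n) + 1)"

lemma decay_pos: "0 < decay x"
  unfolding decay_def by (simp add: add_pos_nonneg del: power_Suc)

lemma decay_nonneg [simp]: "0 \<le> decay x"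
  using decay_pos[of x] by simp

lemma decay_borel [measurable]: "decay \<in> borel_measurable borel"
  unfolding decay_def by measurable

text \<open>The weight decays with exponent \<open>n + 1\<close> for \<open>n = CARD('n)\<close>. It
  is dominated by a sum of indicators of the balls of radius \<open>2 ^ k\<close> with heights of
  order \<open>2 ^ (- k (n + 1))\<close>; as these balls have volume of order
  \<open>2 ^ (k n)\<close>, a geometric series remains.\<close>

lemma decay_integrable_self: "integrable lborel (decay :: real ^ 'n::finite \<Rightarrow> real)"
  unfolding decay_def
proof (rule integrableI_bounded)
  let ?n = "CARD('n)"
  let ?V = "unit_ball_vol (real ?n)"
  let ?b = "\<lambda>k (x::real^'n). ennreal (2 ^ (?n + 1) / 2 ^ (k * (?n + 1))) * indicator (cball 0 (2 ^ k)) x"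
  have pt: "ennreal (1 / (1 + norm x) ^ (?n + 1)) \<le> (\<Sum>k. ?b k x)" for x :: "real ^ 'n"
  proof -
    \<comment> \<open>The least such exponent: minimality gives
      \<open>2 ^ k \<le> 2 * (1 + norm x)\<close>, so the term with index \<open>k\<close> alone
      dominates the weight at \<open>x\<close>.\<close>
    obtain k where k: "norm x \<le> 2 ^ k" "\<And>j. j < k \<Longrightarrow> \<not> norm x \<le> 2 ^ j"
    proof -
      obtain m where "norm x < 2 ^ m" using real_arch_pow[of 2 "norm x"] by auto
      then have "\<exists>m. norm x \<le> 2 ^ m" by (auto intro: less_imp_le)
      then show ?thesis using that exists_least_iff[of "\<lambda>m. norm x \<le> 2 ^ m"] by metis
    qed
    have "2 ^ k \<le> 2 * (1 + norm x)"
    proof (cases k)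
      case (Suc j)
      then show ?thesis using k(2)[of j] by simp
    qed simp
    then have "(2 ^ k) ^ (?n + 1) \<le> (2 * (1 + norm x)) ^ (?n + 1)" by (intro power_mono) auto
    then have "2 ^ (k * (?n + 1)) \<le> 2 ^ (?n + 1) * (1 + norm x) ^ (?n + 1)"
      by (simp only: power_mult power_mult_distrib)
    moreover have "(1 + norm x) ^ (?n + 1) > 0" by (simp add: add_pos_nonneg)
    ultimately have "1 / (1 + norm x) ^ (?n + 1) \<le> 2 ^ (?n + 1) / 2 ^ (k * (?n + 1))"
      by (simp add: divide_simps mult.commute del: power_Suc)
    then have "ennreal (1 / (1 + norm x) ^ (?n + 1)) \<le> ?b k x"
      using k(1) by (simp add: ennreal_leI del: power_Suc)
    also have "\<dots> \<le> (\<Sum>k. ?b k x)"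
    proof -
      have "(\<Sum>j\<in>{k}. ?b j x) \<le> (\<Sum>k. ?b k x)" by (rule sum_le_suminf) auto
      then show ?thesis
        by (simp only: sum.insert finite.emptyI empty_iff not_False_eq_True sum.empty add_0_right)
    qed
    finally show ?thesis .
  qed
  have "(\<integral>\<^sup>+x. ennreal (norm (1 / (1 + norm (x::real^'n)) ^ (?n + 1))) \<partial>lborel) \<le> (\<integral>\<^sup>+x. (\<Sum>k. ?b k x) \<partial>lborel)"
    using pt by (intro nn_integral_mono) (simp add: add_nonneg_nonneg)
  also have "\<dots> = (\<Sum>k. \<integral>\<^sup>+x. ?b k x \<partial>lborel)"
    by (intro nn_integral_suminf borel_measurable_times_ennreal borel_measurable_indicator
        borel_measurable_const) (simp add: borel_closed)
  also have "\<dots> = (\<Sum>k. ennreal (2 ^ (?n + 1) * ?V * (1/2) ^ k))"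
  proof (intro suminf_cong)
    fix k
    have "(\<integral>\<^sup>+x. ?b k x \<partial>lborel) = ennreal (2 ^ (?n + 1) / 2 ^ (k * (?n + 1))) * emeasure lborel (cball (0::real^'n) (2 ^ k))"
      by (subst nn_integral_cmult_indicator) auto
    also have "\<dots> = ennreal (2 ^ (?n + 1) / 2 ^ (k * (?n + 1)) * (?V * (2 ^ k) ^ ?n))"
    proof -
      have "emeasure lborel (cball (0::real^'n) (2 ^ k)) = ennreal (?V * (2 ^ k) ^ ?n)"
        by (subst emeasure_cball) auto
      then show ?thesis by (simp only: ennreal_mult' zero_le_divide_iff zero_le_power zero_le_numeral simp_thms)
    qed
    also have "2 ^ (?n + 1) / 2 ^ (k * (?n + 1)) * (?V * (2 ^ k) ^ ?n) = 2 ^ (?n + 1) * ?V * (1/2) ^ k"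
    proof -
      have e: "2 ^ (k * (?n + 1)) = (2 ^ k) ^ ?n * (2::real) ^ k"
        by (simp only: distrib_left power_add power_mult mult_1_right)
      show ?thesis unfolding e power_one_over by (simp add: divide_simps del: power_Suc)
    qed
    finally show "(\<integral>\<^sup>+x. ?b k x \<partial>lborel) = ennreal (2 ^ (?n + 1) * ?V * (1/2) ^ k)" .
  qed
  also have "\<dots> = ennreal (\<Sum>k. 2 ^ (?n + 1) * ?V * (1/2) ^ k)"
    by (rule suminf_ennreal2) (auto intro!: summable_mult summable_geometric)
  finally show "(\<integral>\<^sup>+x. ennreal (norm (1 / (1 + norm (x::real^'n)) ^ (?n + 1))) \<partial>lborel) < \<infinity>"
    by (rule le_less_trans) simp
qed measurable

lemma schwartz_borel [measurable]: "f \<in> schwartz \<Longrightarrow> f \<in> borel_measurable borel"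
  by (simp add: schwartz_smooth smooth_borel)

lemma decay_integrable:
  fixes f :: "real ^ 'n::finite \<Rightarrow> 'b::{banach, second_countable_topology}"
  assumes "f \<in> borel_measurable borel" "\<And>x. norm (f x) \<le> B * decay x"
  shows "integrable lborel f"
proof (rule Bochner_Integration.integrable_bound[OF integrable_mult_right[OF decay_integrable_self[where 'n='n], of B]])
  show "AE x in lborel. norm (f x) \<le> norm (B * decay x)"
    using assms(2) by (intro AE_I2) (metis abs_ge_self order_trans real_norm_def)
qed (use assms in auto)

lemma schwartz_decay_le:
  "f \<in> schwartz \<Longrightarrow> norm (f x) \<le> schwartz_sup (CARD('n) + 1) f * decay (x :: real ^ 'n::finite)"
  using schwartz_decay0[of f x "CARD('n) + 1"] unfolding decay_def by simp

lemma schwartz_integrable: "f \<in> schwartz \<Longrightarrow> integrable lborel f"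
  by (rule decay_integrable[OF schwartz_borel schwartz_decay_le])

definition decay_mass :: "'n::finite itself \<Rightarrow> real" where
  "decay_mass _ = (LINT x|lborel. decay (x::real^'n))"

lemma decay_mass_nonneg: "0 \<le> decay_mass TYPE('n::finite)"
  unfolding decay_mass_def by (intro integral_nonneg_AE AE_I2) simp

lemma decay_integral_le:
  fixes f :: "real ^ 'n::finite \<Rightarrow> 'b::{banach, second_countable_topology}"
  assumes "f \<in> borel_measurable borel" "\<And>x. norm (f x) \<le> B * decay x"
  shows "(LINT x|lborel. norm (f x)) \<le> B * decay_mass TYPE('n)"
proof -
  have "(LINT x|lborel. norm (f x)) \<le> (LINT x|lborel. B * decay (x::real^'n))"
    using assms by (intro integral_mono integrable_norm decay_integrable[of f B]
        integrable_mult_right decay_integrable_self) auto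
  then show ?thesis by (simp add: decay_mass_def)
qed

section \<open>Taylor estimate and differentiation under the integral\<close>

lemma norm_partial_sum_le:
  "norm (\<Sum>i\<in>UNIV. ((v::real^'n::finite) $ i) *\<^sub>R (w i :: complex)) \<le> norm v * (\<Sum>i\<in>UNIV. norm (w i))"
proof -
  have "norm (\<Sum>i\<in>UNIV. (v $ i) *\<^sub>R w i) \<le> (\<Sum>i\<in>UNIV. norm v * norm (w i))"
    by (intro order_trans[OF norm_sum] sum_mono) (simp add: mult_right_mono component_le_norm_cart)
  then show ?thesis by (simp add: sum_distrib_left)
qed

lemma smooth_lipschitz_segment:
  assumes "smooth f" "\<And>t. t \<in> {0..1} \<Longrightarrow> deriv_sum 1 f (x + t *\<^sub>R v) \<le> B"
  shows "norm (f (x + v) - f x) \<le> B * norm v"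
proof -
  have "norm (f (x + v) - f x) \<le> norm v * B"
  proof (rule differentiable_bound_segment[where G = UNIV and f = f])
    fix y
    show "(f has_derivative (\<lambda>v. \<Sum>i\<in>UNIV. (v $ i) *\<^sub>R partial_deriv i f y)) (at y within UNIV)"
      by (intro has_derivative_partial_deriv smooth_differentiable assms)
  next
    fix t :: real assume t: "t \<in> {0..1}"
    let ?y = "x + t *\<^sub>R v"
    show "onorm (\<lambda>v. \<Sum>i\<in>UNIV. (v $ i) *\<^sub>R partial_deriv i f ?y) \<le> B"
    proof (rule onorm_le)
      fix w :: "real ^ 'a"
      have "norm (f ?y) + (\<Sum>i\<in>UNIV. norm (partial_deriv i f ?y)) \<le> B"
        using assms(2)[OF t] deriv_sum_Suc[of 0 f ?y] by (simp add: deriv_sum_0)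
      then have "(\<Sum>i\<in>UNIV. norm (partial_deriv i f ?y)) \<le> B"
        using norm_ge_zero[of "f ?y"] by linarith
      then have "norm w * (\<Sum>i\<in>UNIV. norm (partial_deriv i f ?y)) \<le> norm w * B"
        by (intro mult_left_mono) auto
      then show "norm (\<Sum>i\<in>UNIV. (w $ i) *\<^sub>R partial_deriv i f ?y) \<le> B * norm w"
        using norm_partial_sum_le[of w "\<lambda>i. partial_deriv i f ?y"] by (simp add: mult.commute)
    qed
  qed auto
  then show ?thesis by (simp add: mult.commute)
qed

text \<open>The mean value theorem applied to \<open>f\<close> minus its linear part. The explicit
  quadratic remainder is the form of differentiability that survives integration over a
  parameter.\<close>

lemma smooth_taylor2:
  fixes f :: "'n::finite cfun"
  assumes "smooth f" "\<And>t. t \<in> {0..1} \<Longrightarrow> deriv_sum 2 f (x + t *\<^sub>R v) \<le> B"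
  shows "norm (f (x + v) - f x - (\<Sum>i\<in>UNIV. (v $ i) *\<^sub>R partial_deriv i f x)) \<le> real CARD('n) * B * (norm v)\<^sup>2"
proof -
  let ?S = "(\<lambda>t. x + t *\<^sub>R v) ` {0..1}"
  let ?f' = "\<lambda>y v. \<Sum>i\<in>UNIV. (v $ i) *\<^sub>R partial_deriv i f y"
  have "deriv_sum 2 f x \<le> B" using assms(2)[of 0] by simp
  then have B0: "B \<ge> 0" using deriv_sum_nonneg[of 2 f x] by linarith
  have "norm (f (x + v) - f x - ?f' x ((x + v) - x)) \<le> norm ((x + v) - x) * (real CARD('n) * B * norm v)"
  proof (rule differentiable_bound_linearization[where S = ?S])
    fix y assume "y \<in> ?S"
    then obtain t where t: "t \<in> {0..1}" "y = x + t *\<^sub>R v" by auto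
    show "(f has_derivative ?f' y) (at y within ?S)"
      by (intro has_derivative_at_withinI[OF has_derivative_partial_deriv[OF smooth_differentiable[OF assms(1)]]])
    have pd: "norm (partial_deriv i f y - partial_deriv i f x) \<le> B * norm v" for i
    proof -
      have sf: "smooth (partial_deriv i f)" by (intro smooth_partial_deriv assms)
      have "norm (partial_deriv i f (x + t *\<^sub>R v) - partial_deriv i f x) \<le> B * norm (t *\<^sub>R v)"
      proof (rule smooth_lipschitz_segment[OF sf])
        fix s :: real assume s: "s \<in> {0..1}"
        have "s * t \<in> {0..1}" using s t(1) by (auto intro: mult_le_one)
        then have "deriv_sum 2 f (x + s *\<^sub>R t *\<^sub>R v) \<le> B" using assms(2)[of "s * t"] by simp
        then show "deriv_sum 1 (partial_deriv i f) (x + s *\<^sub>R t *\<^sub>R v) \<le> B"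
          using deriv_sum_partial_deriv[of 1 i f "x + s *\<^sub>R t *\<^sub>R v"] by (simp add: numeral_2_eq_2)
      qed
      also have "\<dots> \<le> B * norm v"
        using t(1) B0 by (intro mult_left_mono) (auto simp: mult_left_le_one_le)
      finally show ?thesis by (simp add: t(2))
    qed
    show "onorm (?f' y - ?f' x) \<le> real CARD('n) * B * norm v"
      unfolding fun_diff_def
    proof (rule onorm_le)
      fix w :: "real ^ 'n"
      have "?f' y w - ?f' x w = (\<Sum>i\<in>UNIV. (w $ i) *\<^sub>R (partial_deriv i f y - partial_deriv i f x))"
        by (simp add: sum_subtractf scaleR_diff_right)
      also have "norm \<dots> \<le> norm w * (\<Sum>i\<in>(UNIV::'n set). B * norm v)"
        by (intro order_trans[OF norm_partial_sum_le] mult_left_mono sum_mono pd) auto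
      finally show "norm (?f' y w - ?f' x w) \<le> real CARD('n) * B * norm v * norm w"
        by (simp add: mult_ac)
    qed
  next
    show "x \<in> ?S" by (rule image_eqI[of _ _ 0]) auto
  next
    fix t :: real assume "t \<in> {0..1}"
    then show "x + t *\<^sub>R (x + v - x) \<in> ?S" by (intro image_eqI[of _ _ t]) auto
  qed
  then show ?thesis by (simp add: power2_eq_square mult_ac)
qed

text \<open>A quadratic remainder with an integrable coefficient \<open>h\<close> bounds the
  difference quotient of the integral directly. The remainder is only asked for
  \<open>norm v \<le> 1\<close>, which allows \<open>h\<close> to absorb shifted decaying
  functions.\<close>

lemma has_derivative_integral:
  fixes F :: "real ^ 'n::finite \<Rightarrow> 't \<Rightarrow> complex"
  assumes F: "\<And>y. integrable M (F y)" and F': "\<And>i. integrable M (F' i)" and h: "integrable M h"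
    and T: "\<And>v t. t \<in> space M \<Longrightarrow> norm v \<le> 1 \<Longrightarrow>
      norm (F (x + v) t - F x t - (\<Sum>i\<in>UNIV. (v $ i) *\<^sub>R F' i t)) \<le> h t * (norm v)\<^sup>2"
  shows "((\<lambda>y. LINT t|M. F y t) has_derivative (\<lambda>v. \<Sum>i\<in>UNIV. (v $ i) *\<^sub>R (LINT t|M. F' i t))) (at x)"
  unfolding has_derivative_at
proof (intro conjI)
  show "bounded_linear (\<lambda>v. \<Sum>i\<in>UNIV. (v $ i) *\<^sub>R (LINT t|M. F' i t))"
    by (intro bounded_linear_sum bounded_linear_scaleR_const bounded_linear_vec_nth)
  let ?R = "\<lambda>v. norm ((LINT t|M. F (x + v) t) - (LINT t|M. F x t) - (\<Sum>i\<in>UNIV. (v $ i) *\<^sub>R (LINT t|M. F' i t))) / norm v"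
  have bd: "norm (?R v) \<le> (LINT t|M. h t) * norm v" if v: "norm v \<le> 1" "v \<noteq> 0" for v
  proof -
    have i: "integrable M (\<lambda>t. F (x + v) t - F x t - (\<Sum>i\<in>UNIV. (v $ i) *\<^sub>R F' i t))"
      by (intro Bochner_Integration.integrable_diff Bochner_Integration.integrable_sum integrable_scaleR_right F F')
    have "(LINT t|M. F (x + v) t) - (LINT t|M. F x t) - (\<Sum>i\<in>UNIV. (v $ i) *\<^sub>R (LINT t|M. F' i t))
       = (LINT t|M. F (x + v) t - F x t - (\<Sum>i\<in>UNIV. (v $ i) *\<^sub>R F' i t))"
      by (simp add: Bochner_Integration.integral_diff Bochner_Integration.integral_sum F F'
          Bochner_Integration.integrable_diff Bochner_Integration.integrable_sum)
    also have "norm \<dots> \<le> (LINT t|M. h t * (norm v)\<^sup>2)"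
      by (intro order_trans[OF integral_norm_bound] integral_mono integrable_norm i integrable_mult_left h T v)
    also have "\<dots> = (LINT t|M. h t) * (norm v)\<^sup>2" by simp
    finally show ?thesis using v(2) by (simp add: power2_eq_square divide_le_eq mult.assoc)
  qed
  show "(?R \<longlongrightarrow> 0) (at 0)"
  proof (rule Lim_null_comparison)
    show "\<forall>\<^sub>F v in at 0. norm (?R v) \<le> (LINT t|M. h t) * norm v"
      unfolding eventually_at by (intro exI[of _ 1]) (use bd in auto)
    show "((\<lambda>v. (LINT t|M. h t) * norm v) \<longlongrightarrow> 0) (at 0)"
      by (auto intro!: tendsto_eq_intros)
  qed
qed

section \<open>The Fourier transform on the Schwartz space\<close>

definition fourier_const :: "'n::finite itself \<Rightarrow> real" where
  "fourier_const _ = (2 * pi) powr (- real CARD('n) / 2)"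

lemma fourier_const_pos: "0 < fourier_const TYPE('n::finite)"
  by (simp add: fourier_const_def)

lemma norm_exp_ii [simp]: "norm (exp (\<i> * complex_of_real r)) = 1" "norm (exp (- (\<i> * complex_of_real r))) = 1"
  by (simp_all add: norm_exp_eq_Re)

lemma exp_inner_borel [measurable]:
  "f \<in> borel_measurable M \<Longrightarrow> g \<in> borel_measurable M \<Longrightarrow>
    (\<lambda>x. exp (\<i> * complex_of_real ((f x :: real ^ 'n::finite) \<bullet> g x))) \<in> borel_measurable M"
  by (intro borel_measurable_exp[THEN measurable_compose[rotated]] borel_measurable_times
      borel_measurable_const borel_measurable_inner measurable_compose[OF _ borel_measurable_of_real]) auto

lemma fourier_eq:
  fixes f :: "'n::finite cfun"
  assumes [measurable]: "f \<in> borel_measurable borel"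
  shows "fourier f \<xi> = of_real (fourier_const TYPE('n)) * (LINT x|lborel. exp (\<i> * of_real (x \<bullet> - \<xi>)) * f x)"
  unfolding fourier_def fourier_const_def by (subst lebesgue_integral_lborel) simp_all

lemma inv_fourier_eq:
  fixes f :: "'n::finite cfun"
  assumes [measurable]: "f \<in> borel_measurable borel"
  shows "inv_fourier f x = of_real (fourier_const TYPE('n)) * (LINT \<xi>|lborel. exp (\<i> * of_real (\<xi> \<bullet> x)) * f \<xi>)"
  unfolding inv_fourier_def fourier_const_def
  by (subst lebesgue_integral_lborel) (simp_all add: inner_commute)

lemma inv_fourier_eq_fourier:
  "f \<in> borel_measurable borel \<Longrightarrow> inv_fourier f x = fourier f (- x)"
  by (simp add: fourier_eq inv_fourier_eq)

lemma exp_mult_integrable: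
  "integrable lborel f \<Longrightarrow> integrable lborel (\<lambda>x. exp (\<i> * of_real ((x::real^'n::finite) \<bullet> \<xi>)) * f x)"
  by (rule Bochner_Integration.integrable_bound) (auto simp: norm_mult)

lemma fourier_norm_le:
  fixes f :: "'n::finite cfun"
  assumes "f \<in> schwartz"
  shows "norm (fourier f \<xi>) \<le> fourier_const TYPE('n) * decay_mass TYPE('n) * schwartz_sup (CARD('n) + 1) f"
proof -
  have "norm (LINT x|lborel. exp (\<i> * of_real (x \<bullet> - \<xi>)) * f x) \<le> (LINT x|lborel. norm (f x))"
    using integral_norm_bound[of lborel "\<lambda>x. exp (\<i> * of_real (x \<bullet> - \<xi>)) * f x"] by (simp add: norm_mult)
  also have "\<dots> \<le> schwartz_sup (CARD('n) + 1) f * decay_mass TYPE('n)"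
    by (intro decay_integral_le schwartz_borel schwartz_decay_le assms)
  finally show ?thesis
    using fourier_const_pos[where 'n = 'n]
    by (simp add: fourier_eq[OF schwartz_borel[OF assms]] norm_mult mult.assoc mult.commute)
qed

lemma norm_exp_remainder: "norm (exp (\<i> * of_real u) - 1 - \<i> * of_real u) \<le> u\<^sup>2"
proof -
  have "norm (exp (\<i> * of_real u) - 1 - \<i> * of_real u) \<le> \<bar>u\<bar>\<^sup>2 / 2"
    using iexp_approx1[of u 1] by (simp add: numeral_2_eq_2 algebra_simps)
  also have "\<dots> \<le> u\<^sup>2" using zero_le_power2[of u] by (simp del: zero_le_power2)
  finally show ?thesis .
qed

lemma inner_as_sum: "(x::real^'n::finite) \<bullet> v = (\<Sum>i\<in>UNIV. v $ i * x $ i)"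
  by (simp add: inner_vec_def mult.commute)

text \<open>The remainder of \<open>exp (\<i> * u)\<close> after its linear term is at most
  \<open>u\<^sup>2\<close>; with \<open>u = x \<bullet> v\<close> the dominating coefficient is
  \<open>(norm x)\<^sup>2 * norm (f x)\<close>.\<close>

lemma exp_inner_integral_has_derivative:
  fixes f :: "'n::finite cfun"
  assumes f: "f \<in> schwartz"
  shows "((\<lambda>\<xi>. LINT x|lborel. exp (\<i> * of_real (x \<bullet> \<xi>)) * f x) has_derivative
     (\<lambda>v. \<Sum>i\<in>UNIV. (v $ i) *\<^sub>R (LINT x|lborel. exp (\<i> * of_real (x \<bullet> \<xi>)) * (\<i> * (of_real (x $ i) * f x))))) (at \<xi>)"
proof (rule has_derivative_integral)
  show "integrable lborel (\<lambda>x. exp (\<i> * of_real (x \<bullet> y)) * f x)" for y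
    by (intro exp_mult_integrable schwartz_integrable f)
  show "integrable lborel (\<lambda>x. exp (\<i> * of_real (x \<bullet> \<xi>)) * (\<i> * (of_real (x $ i) * f x)))" for i
    by (intro exp_mult_integrable integrable_mult_right schwartz_integrable schwartz_coord_mult f)
  \<comment> \<open>Two orders pay for the factor \<open>(norm x)\<^sup>2\<close>, the remaining
    \<open>CARD('n) + 1\<close> for the integrable weight \<open>decay\<close>.\<close>
  let ?N = "CARD('n) + 3"
  show "integrable lborel (\<lambda>x. (norm x)\<^sup>2 * norm (f x))"
  proof (rule decay_integrable)
    fix x
    have "(1 + norm x) ^ ?N * norm (f x) \<le> schwartz_sup ?N f"
      using schwartz_sup_upper[OF f, of x ?N] mult_left_mono[OF norm_le_deriv_sum[of f x ?N], of "(1 + norm x) ^ ?N"]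
      by simp
    moreover have "(norm x)\<^sup>2 * norm (f x) * (1 + norm x) ^ (CARD('n) + 1) \<le> (1 + norm x) ^ ?N * norm (f x)"
    proof -
      have "(norm x)\<^sup>2 * (1 + norm x) ^ (CARD('n) + 1) \<le> (1 + norm x)\<^sup>2 * (1 + norm x) ^ (CARD('n) + 1)"
        by (intro mult_right_mono power_mono) auto
      also have "\<dots> = (1 + norm x) ^ ?N"
        by (simp add: power_add power2_eq_square numeral_3_eq_3)
      finally have "norm (f x) * ((norm x)\<^sup>2 * (1 + norm x) ^ (CARD('n) + 1)) \<le> norm (f x) * (1 + norm x) ^ ?N"
        by (rule mult_left_mono) simp
      then show ?thesis by (simp only: mult_ac)
    qed
    ultimately have "(norm x)\<^sup>2 * norm (f x) * (1 + norm x) ^ (CARD('n) + 1) \<le> schwartz_sup ?N f" by linarith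
    moreover have "(1 + norm x) ^ (CARD('n) + 1) > 0" by (simp add: add_pos_nonneg del: power_Suc)
    ultimately show "norm ((norm x)\<^sup>2 * norm (f x)) \<le> schwartz_sup ?N f * decay x"
      unfolding decay_def by (simp add: pos_le_divide_eq norm_mult del: power_Suc)
  qed (use f in measurable)
  fix v x :: "real^'n"
  have s: "(\<Sum>i\<in>UNIV. (v $ i) *\<^sub>R (exp (\<i> * of_real (x \<bullet> \<xi>)) * (\<i> * (of_real (x $ i) * f x))))
      = exp (\<i> * of_real (x \<bullet> \<xi>)) * f x * (\<i> * of_real (x \<bullet> v))"
  proof -
    have "(\<Sum>i\<in>UNIV. (v $ i) *\<^sub>R (E * (\<i> * (of_real (x $ i) * f x)))) = E * f x * (\<i> * of_real (x \<bullet> v))" for E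
      unfolding inner_as_sum[of x v] of_real_sum sum_distrib_left
      by (intro sum.cong refl) (simp add: scaleR_conv_of_real)
    then show ?thesis .
  qed
  have "exp (\<i> * of_real (x \<bullet> (\<xi> + v))) * f x - exp (\<i> * of_real (x \<bullet> \<xi>)) * f x
     - (\<Sum>i\<in>UNIV. (v $ i) *\<^sub>R (exp (\<i> * of_real (x \<bullet> \<xi>)) * (\<i> * (of_real (x $ i) * f x))))
     = exp (\<i> * of_real (x \<bullet> \<xi>)) * f x * (exp (\<i> * of_real (x \<bullet> v)) - 1 - \<i> * of_real (x \<bullet> v))"
    unfolding s by (simp add: inner_add_right distrib_left exp_add algebra_simps)
  also have "norm \<dots> \<le> norm (f x) * (x \<bullet> v)\<^sup>2"
    by (simp add: norm_mult mult_left_mono norm_exp_remainder)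
  also have "\<dots> \<le> norm (f x) * (norm x * norm v)\<^sup>2"
    by (intro mult_left_mono) (auto simp: abs_le_square_iff[symmetric] Cauchy_Schwarz_ineq2)
  finally show "norm (exp (\<i> * of_real (x \<bullet> (\<xi> + v))) * f x - exp (\<i> * of_real (x \<bullet> \<xi>)) * f x
     - (\<Sum>i\<in>UNIV. (v $ i) *\<^sub>R (exp (\<i> * of_real (x \<bullet> \<xi>)) * (\<i> * (of_real (x $ i) * f x)))))
     \<le> (norm x)\<^sup>2 * norm (f x) * (norm v)\<^sup>2"
    by (simp add: power_mult_distrib mult_ac)
qed

lemma fourier_has_derivative:
  fixes f :: "'n::finite cfun"
  assumes f: "f \<in> schwartz"
  shows "(fourier f has_derivative (\<lambda>v. \<Sum>i\<in>UNIV. (v $ i) *\<^sub>R fourier (\<lambda>x. - \<i> * (of_real (x $ i) * f x)) \<xi>)) (at \<xi>)"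
proof -
  let ?I = "\<lambda>\<xi>. LINT x|lborel. exp (\<i> * of_real (x \<bullet> \<xi>)) * f x"
  let ?c = "complex_of_real (fourier_const TYPE('n))"
  have "((?I \<circ> uminus) has_derivative
     ((\<lambda>v. \<Sum>i\<in>UNIV. (v $ i) *\<^sub>R (LINT x|lborel. exp (\<i> * of_real (x \<bullet> - \<xi>)) * (\<i> * (of_real (x $ i) * f x)))) \<circ> uminus)) (at \<xi>)"
    by (intro diff_chain_at exp_inner_integral_has_derivative f) (auto intro!: derivative_eq_intros)
  then have "((\<lambda>x. ?c * (?I \<circ> uminus) x) has_derivative
     (\<lambda>v. ?c * ((\<lambda>v. \<Sum>i\<in>UNIV. (v $ i) *\<^sub>R (LINT x|lborel. exp (\<i> * of_real (x \<bullet> - \<xi>)) * (\<i> * (of_real (x $ i) * f x)))) \<circ> uminus) v)) (at \<xi>)"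
    by (rule has_derivative_mult_right)
  moreover have "(\<lambda>x. ?c * (?I \<circ> uminus) x) = fourier f"
    by (intro ext) (simp add: fourier_eq[OF schwartz_borel[OF f]])
  moreover have "?c * ((\<lambda>v. \<Sum>i\<in>UNIV. (v $ i) *\<^sub>R (LINT x|lborel. exp (\<i> * of_real (x \<bullet> - \<xi>)) * (\<i> * (of_real (x $ i) * f x)))) \<circ> uminus) v
     = (\<Sum>i\<in>UNIV. (v $ i) *\<^sub>R fourier (\<lambda>x. - \<i> * (of_real (x $ i) * f x)) \<xi>)" for v
    using schwartz_borel[OF schwartz_cmult[OF schwartz_coord_mult[OF f], of "-\<i>"]]
    by (simp add: fourier_eq sum_distrib_left scaleR_conv_of_real sum_negf[symmetric] mult_ac)
  ultimately show ?thesis by simp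
qed

lemma partial_deriv_fourier:
  assumes "f \<in> schwartz"
  shows "partial_deriv i (fourier f) = fourier (\<lambda>x. - \<i> * (of_real (x $ i) * f x))"
  using partial_deriv_from_has_derivative[OF fourier_has_derivative[OF assms]] .

lemma smooth_fourier: "f \<in> schwartz \<Longrightarrow> smooth (fourier f)"
proof (rule smooth_coinduct[of "\<lambda>g. \<exists>f\<in>schwartz. g = fourier f"])
  fix g x assume "\<exists>f\<in>schwartz. g = fourier f"
  then show "g differentiable (at x)"
    using fourier_has_derivative differentiableI by blast
next
  fix g :: "'a cfun" and i assume "\<exists>f\<in>schwartz. g = fourier f"
  then obtain f where "f \<in> schwartz" "g = fourier f" by blast
  then show "\<exists>f\<in>schwartz. partial_deriv i g = fourier f"
    using schwartz_cmult[OF schwartz_coord_mult] partial_deriv_fourier by blast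
qed blast

text \<open>The translate of a Schwartz function, differentiated under the integral in two ways, gives the
  transform of a partial derivative without an integration by parts.\<close>

lemma translate_integral_has_derivative:
  fixes f :: "'n::finite cfun"
  assumes f: "f \<in> schwartz"
  shows "((\<lambda>y. LINT x|lborel. exp (\<i> * of_real (x \<bullet> \<xi>)) * f (y + x)) has_derivative
     (\<lambda>v. \<Sum>i\<in>UNIV. (v $ i) *\<^sub>R (LINT x|lborel. exp (\<i> * of_real (x \<bullet> \<xi>)) * partial_deriv i f x))) (at 0)"
proof (rule has_derivative_integral)
  show "integrable lborel (\<lambda>x. exp (\<i> * of_real (x \<bullet> \<xi>)) * f (y + x))" for y
    by (intro exp_mult_integrable integrable_translate schwartz_integrable f)
  show "integrable lborel (\<lambda>x. exp (\<i> * of_real (x \<bullet> \<xi>)) * partial_deriv i f x)" for i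
    by (intro exp_mult_integrable schwartz_integrable schwartz_partial_deriv f)
  let ?N = "CARD('n) + 1"
  \<comment> \<open>The power of 2 compares weights: for \<open>norm v \<le> 1\<close> every point
    \<open>y\<close> of the segment from \<open>x\<close> to \<open>x + v\<close> satisfies
    \<open>1 + norm x \<le> 2 * (1 + norm y)\<close>. The index \<open>?N + 1\<close> is also at
    least 2, the order of the Taylor remainder.\<close>
  let ?B = "2 ^ ?N * schwartz_sup (?N + 1) f"
  show "integrable lborel (\<lambda>x. real CARD('n) * (?B * decay (x::real^'n)))"
    by (intro integrable_mult_right decay_integrable_self)
  fix v x :: "real^'n" assume v: "norm v \<le> 1"
  have "norm (f (x + v) - f x - (\<Sum>i\<in>UNIV. (v $ i) *\<^sub>R partial_deriv i f x)) \<le> real CARD('n) * (?B * decay x) * (norm v)\<^sup>2"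
  proof (rule smooth_taylor2[OF schwartz_smooth[OF f]])
    fix t :: real assume t: "t \<in> {0..1}"
    let ?y = "x + t *\<^sub>R v"
    have "norm x \<le> norm ?y + norm (t *\<^sub>R v)" using norm_triangle_ineq4[of ?y "t *\<^sub>R v"] by simp
    also have "\<dots> \<le> norm ?y + 1" using t v by (simp add: mult_le_one)
    finally have "1 + norm x \<le> 2 * (1 + norm ?y)" using norm_ge_zero[of ?y] by argo
    then have "(1 + norm x) ^ ?N \<le> (2 * (1 + norm ?y)) ^ ?N" by (intro power_mono) auto
    then have "(1 + norm x) ^ ?N * deriv_sum 2 f ?y \<le> 2 ^ ?N * ((1 + norm ?y) ^ ?N * deriv_sum 2 f ?y)"
      unfolding power_mult_distrib mult.assoc[symmetric] by (intro mult_right_mono) auto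
    also have "\<dots> \<le> 2 ^ ?N * ((1 + norm ?y) ^ (?N + 1) * deriv_sum (?N + 1) f ?y)"
      by (intro mult_left_mono mult_mono power_increasing deriv_sum_mono) auto
    also have "\<dots> \<le> ?B"
      by (intro mult_left_mono schwartz_sup_upper f) auto
    finally have "(1 + norm x) ^ ?N * deriv_sum 2 f ?y \<le> ?B" .
    moreover have "(1 + norm x) ^ ?N > 0" by (simp add: add_pos_nonneg del: power_Suc)
    ultimately show "deriv_sum 2 f ?y \<le> ?B * decay x"
      unfolding decay_def by (simp add: pos_le_divide_eq mult.commute del: power_Suc)
  qed
  then have "norm (exp (\<i> * of_real (x \<bullet> \<xi>)) * (f (x + v) - f x - (\<Sum>i\<in>UNIV. (v $ i) *\<^sub>R partial_deriv i f x)))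
     \<le> real CARD('n) * (?B * decay x) * (norm v)\<^sup>2"
    by (simp add: norm_mult)
  moreover have "exp (\<i> * of_real (x \<bullet> \<xi>)) * (f (x + v) - f x - (\<Sum>i\<in>UNIV. (v $ i) *\<^sub>R partial_deriv i f x))
    = exp (\<i> * of_real (x \<bullet> \<xi>)) * f (0 + v + x) - exp (\<i> * of_real (x \<bullet> \<xi>)) * f (0 + x)
        - (\<Sum>i\<in>UNIV. (v $ i) *\<^sub>R (exp (\<i> * of_real (x \<bullet> \<xi>)) * partial_deriv i f x))"
    by (simp add: right_diff_distrib sum_distrib_left add.commute scaleR_conv_of_real mult.left_commute)
  ultimately show "norm (exp (\<i> * of_real (x \<bullet> \<xi>)) * f (0 + v + x) - exp (\<i> * of_real (x \<bullet> \<xi>)) * f (0 + x)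
        - (\<Sum>i\<in>UNIV. (v $ i) *\<^sub>R (exp (\<i> * of_real (x \<bullet> \<xi>)) * partial_deriv i f x)))
     \<le> real CARD('n) * (?B * decay x) * (norm v)\<^sup>2" by simp
qed

lemma fourier_partial_deriv:
  fixes f :: "'n::finite cfun"
  assumes f: "f \<in> schwartz"
  shows "fourier (partial_deriv i f) \<xi> = \<i> * of_real (\<xi> $ i) * fourier f \<xi>"
proof -
  let ?I = "LINT x|lborel. exp (\<i> * of_real (x \<bullet> - \<xi>)) * f x"
  note [measurable] = schwartz_borel[OF f]
  \<comment> \<open>The substitution moves the translation by \<open>y\<close> onto the character,
    so that the dependence on \<open>y\<close> becomes explicit and can be differentiated at
    0.\<close>
  have eq: "(LINT x|lborel. exp (\<i> * of_real (x \<bullet> - \<xi>)) * f (y + x)) = exp (\<i> * of_real (y \<bullet> \<xi>)) * ?I" for y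
  proof -
    have "exp (\<i> * of_real (y \<bullet> \<xi>)) * ?I = (LINT x|lborel. exp (\<i> * of_real (y \<bullet> \<xi>)) * (exp (\<i> * of_real (x \<bullet> - \<xi>)) * f x))"
      by simp
    also have "\<dots> = (LINT x|lborel. exp (\<i> * of_real (y \<bullet> \<xi>)) * (exp (\<i> * of_real ((y + x) \<bullet> - \<xi>)) * f (y + x)))"
      by (rule integral_translate[symmetric]) measurable
    also have "\<dots> = (LINT x|lborel. exp (\<i> * of_real (x \<bullet> - \<xi>)) * f (y + x))"
      by (intro Bochner_Integration.integral_cong refl)
        (simp add: inner_add_left exp_add[symmetric] mult.assoc[symmetric] algebra_simps)
    finally show ?thesis by simp
  qed
  have "((\<lambda>y. exp (\<i> * of_real (y \<bullet> \<xi>)) * ?I) has_derivative (\<lambda>v. (\<i> * of_real (v \<bullet> \<xi>)) * ?I)) (at 0)"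
  proof -
    have "((\<lambda>y. of_real (y \<bullet> \<xi>)) has_derivative (\<lambda>v. complex_of_real (v \<bullet> \<xi>))) (at 0)"
      by (intro bounded_linear_imp_has_derivative bounded_linear_compose[OF bounded_linear_of_real] bounded_linear_inner_left)
    then have "((\<lambda>y. \<i> * complex_of_real (y \<bullet> \<xi>)) has_derivative (\<lambda>v. \<i> * complex_of_real (v \<bullet> \<xi>))) (at 0)"
      by (rule has_derivative_mult_right)
    from diff_chain_at[OF this, of exp "(*) (exp (\<i> * of_real (0 \<bullet> \<xi>)))"]
    have "((\<lambda>y. exp (\<i> * of_real (y \<bullet> \<xi>))) has_derivative (\<lambda>v. \<i> * of_real (v \<bullet> \<xi>))) (at 0)"
      using DERIV_exp[of "\<i> * of_real (0 \<bullet> \<xi>)"] by (simp add: has_field_derivative_def o_def)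
    then show ?thesis by (rule has_derivative_mult_left)
  qed
  moreover have "((\<lambda>y. exp (\<i> * of_real (y \<bullet> \<xi>)) * ?I) has_derivative
     (\<lambda>v. \<Sum>i\<in>UNIV. (v $ i) *\<^sub>R (LINT x|lborel. exp (\<i> * of_real (x \<bullet> - \<xi>)) * partial_deriv i f x))) (at 0)"
    using translate_integral_has_derivative[OF f, of "- \<xi>"] by (simp only: eq)
  ultimately have "(\<lambda>v. (\<i> * of_real (v \<bullet> \<xi>)) * ?I) = (\<lambda>v. \<Sum>i\<in>UNIV. (v $ i) *\<^sub>R (LINT x|lborel. exp (\<i> * of_real (x \<bullet> - \<xi>)) * partial_deriv i f x))"
    by (rule has_derivative_unique)
  from fun_cong[OF this, of "axis i 1"]
  have "(\<i> * of_real (\<xi> $ i)) * ?I = (\<Sum>j\<in>UNIV. (axis i 1 $ j) *\<^sub>R (LINT x|lborel. exp (\<i> * of_real (x \<bullet> - \<xi>)) * partial_deriv j f x))"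
    by (simp add: inner_axis')
  also have "\<dots> = (\<Sum>j\<in>UNIV. if j = i then (LINT x|lborel. exp (\<i> * of_real (x \<bullet> - \<xi>)) * partial_deriv j f x) else 0)"
    by (intro sum.cong) (auto simp: axis_def)
  finally have "(\<i> * of_real (\<xi> $ i)) * ?I = (LINT x|lborel. exp (\<i> * of_real (x \<bullet> - \<xi>)) * partial_deriv i f x)"
    by simp
  from this[symmetric] show ?thesis
    by (simp only: fourier_eq[OF schwartz_borel[OF f]] fourier_eq[OF schwartz_borel[OF schwartz_partial_deriv(1)[OF f]]] mult_ac)
qed

text \<open>Induction on \<open>N\<close>: each factor \<open>1 + norm \<xi>\<close> is estimated
  through the coordinates of \<open>\<xi>\<close>, and multiplying the transform by a coordinate
  amounts to transforming a partial derivative of \<open>f\<close>.\<close>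

lemma fourier_weighted_bound:
  "\<exists>K M. K \<ge> 0 \<and> (\<forall>f\<in>schwartz. \<forall>\<xi>. (1 + norm \<xi>) ^ N * norm (fourier f (\<xi>::real^'n::finite)) \<le> K * schwartz_sup M f)"
proof (induction N)
  case 0
  show ?case
    using fourier_norm_le[where 'n = 'n] fourier_const_pos[where 'n = 'n] decay_mass_nonneg[where 'n = 'n]
    by (intro exI[of _ "fourier_const TYPE('n) * decay_mass TYPE('n)"] exI[of _ "CARD('n) + 1"]) simp
next
  case (Suc N)
  then obtain K M where K: "K \<ge> 0" "\<And>f \<xi>. f\<in>schwartz \<Longrightarrow> (1 + norm \<xi>) ^ N * norm (fourier f (\<xi>::real^'n)) \<le> K * schwartz_sup M f"
    by blast
  have "(1 + norm \<xi>) ^ Suc N * norm (fourier f \<xi>) \<le> (K * (1 + real CARD('n))) * schwartz_sup (Suc M) f"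
    if f: "f \<in> schwartz" for f :: "'n cfun" and \<xi>
  proof -
    have K': "(1 + norm \<xi>) ^ N * norm (fourier f \<xi>) \<le> K * schwartz_sup (Suc M) f"
      by (intro order_trans[OF K(2)[OF f] mult_left_mono[OF schwartz_sup_mono[OF f]]] K(1)) simp
    have "(1 + norm \<xi>) * norm (fourier f \<xi>) \<le> (1 + (\<Sum>i\<in>UNIV. \<bar>\<xi> $ i\<bar>)) * norm (fourier f \<xi>)"
      by (intro mult_right_mono add_left_mono norm_le_l1_cart) auto
    also have "\<dots> = norm (fourier f \<xi>) + (\<Sum>i\<in>UNIV. norm (fourier (partial_deriv i f) \<xi>))"
      by (simp add: fourier_partial_deriv[OF f] norm_mult distrib_right sum_distrib_right)
    finally have "(1 + norm \<xi>) ^ N * ((1 + norm \<xi>) * norm (fourier f \<xi>))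
       \<le> (1 + norm \<xi>) ^ N * (norm (fourier f \<xi>) + (\<Sum>i\<in>UNIV. norm (fourier (partial_deriv i f) \<xi>)))"
      by (intro mult_left_mono) auto
    also have "\<dots> = (1 + norm \<xi>) ^ N * norm (fourier f \<xi>) + (\<Sum>i\<in>UNIV. (1 + norm \<xi>) ^ N * norm (fourier (partial_deriv i f) \<xi>))"
      by (simp add: distrib_left sum_distrib_left)
    also have "\<dots> \<le> K * schwartz_sup (Suc M) f + (\<Sum>i\<in>(UNIV::'n set). K * schwartz_sup (Suc M) f)"
      by (intro add_mono K' sum_mono order_trans[OF K(2)] schwartz_partial_deriv(1) mult_left_mono
          schwartz_partial_deriv(2) K(1) f)
    finally show ?thesis by (simp add: algebra_simps)
  qed
  then show ?case using K(1) by (intro exI[of _ "K * (1 + real CARD('n))"] exI[of _ "Suc M"]) auto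
qed

text \<open>Dual to the weighted bound: each derivative of the transform is the transform of a
  coordinate multiple of \<open>f\<close>, and such a multiple costs one order in
  \<open>schwartz_sup\<close>.\<close>

lemma fourier_deriv_bound:
  "\<exists>K M. K \<ge> 0 \<and> (\<forall>f\<in>schwartz. \<forall>\<xi>. (1 + norm \<xi>) ^ N * deriv_sum L (fourier f) (\<xi>::real^'n::finite) \<le> K * schwartz_sup M f)"
proof (induction L)
  case 0
  then show ?case using fourier_weighted_bound[of N, where 'n = 'n] by (simp add: deriv_sum_0)
next
  case (Suc L)
  then obtain K M where K: "K \<ge> 0" "\<And>f \<xi>. f\<in>schwartz \<Longrightarrow> (1 + norm \<xi>) ^ N * deriv_sum L (fourier f) (\<xi>::real^'n) \<le> K * schwartz_sup M f"
    by blast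
  obtain K' M' where K': "K' \<ge> 0" "\<And>f \<xi>. f\<in>schwartz \<Longrightarrow> (1 + norm \<xi>) ^ N * norm (fourier f (\<xi>::real^'n)) \<le> K' * schwartz_sup M' f"
    using fourier_weighted_bound[of N, where 'n = 'n] by blast
  obtain C where C: "C \<ge> 0" "\<And>f i. f \<in> schwartz \<Longrightarrow> schwartz_sup M (\<lambda>x::real^'n. of_real (x $ i) * f x) \<le> C * schwartz_sup (Suc M) f"
    using schwartz_sup_coord_mult[of M, where 'n = 'n] by blast
  let ?L = "max M' (Suc M)"
  have "(1 + norm \<xi>) ^ N * deriv_sum (Suc L) (fourier f) \<xi> \<le> (K' + real CARD('n) * (K * C)) * schwartz_sup ?L f"
    if f: "f \<in> schwartz" for f :: "'n cfun" and \<xi>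
  proof -
    have a: "(1 + norm \<xi>) ^ N * deriv_sum L (partial_deriv i (fourier f)) \<xi> \<le> K * C * schwartz_sup ?L f" for i
    proof -
      have s: "(\<lambda>x. - \<i> * (of_real (x $ i) * f x)) \<in> schwartz"
        by (intro schwartz_cmult schwartz_coord_mult f)
      have "schwartz_sup M (\<lambda>x. - \<i> * (of_real (x $ i) * f x)) \<le> schwartz_sup M (\<lambda>x. of_real (x $ i) * f x)"
        using schwartz_sup_cmult_le[OF schwartz_coord_mult[OF f], of M "- \<i>" i] by simp
      also have "\<dots> \<le> C * schwartz_sup (Suc M) f" by (rule C(2)[OF f])
      also have "\<dots> \<le> C * schwartz_sup ?L f"
        by (intro mult_left_mono schwartz_sup_mono f C) auto
      finally have "K * schwartz_sup M (\<lambda>x. - \<i> * (of_real (x $ i) * f x)) \<le> K * (C * schwartz_sup ?L f)"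
        by (intro mult_left_mono K)
      then show ?thesis using K(2)[OF s, of \<xi>] by (simp add: partial_deriv_fourier[OF f] mult.assoc)
    qed
    have b: "(1 + norm \<xi>) ^ N * norm (fourier f \<xi>) \<le> K' * schwartz_sup ?L f"
      by (intro order_trans[OF K'(2)[OF f]] mult_left_mono schwartz_sup_mono f K') auto
    have "(1 + norm \<xi>) ^ N * deriv_sum (Suc L) (fourier f) \<xi>
      = (1 + norm \<xi>) ^ N * norm (fourier f \<xi>) + (\<Sum>i\<in>UNIV. (1 + norm \<xi>) ^ N * deriv_sum L (partial_deriv i (fourier f)) \<xi>)"
      by (simp add: deriv_sum_Suc distrib_left sum_distrib_left)
    also have "\<dots> \<le> K' * schwartz_sup ?L f + (\<Sum>i\<in>(UNIV::'n set). K * C * schwartz_sup ?L f)"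
      by (intro add_mono sum_mono a b)
    finally show ?thesis by (simp add: algebra_simps)
  qed
  then show ?case using K(1) K'(1) C(1)
    by (intro exI[of _ "K' + real CARD('n) * (K * C)"] exI[of _ ?L]) auto
qed

lemma fourier_schwartz: "f \<in> schwartz \<Longrightarrow> fourier f \<in> schwartz"
proof (rule schwartzI)
  fix N assume f: "f \<in> schwartz"
  obtain K M where "\<And>f \<xi>. f\<in>schwartz \<Longrightarrow> (1 + norm \<xi>) ^ N * deriv_sum N (fourier f) (\<xi>::real^'a) \<le> K * schwartz_sup M f"
    using fourier_deriv_bound[of N N, where 'n = 'a] by blast
  then show "\<exists>B. \<forall>x. (1 + norm x) ^ N * deriv_sum N (fourier f) x \<le> B" using f by blast
qed (rule smooth_fourier)

lemma fourier_bound: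
  "\<exists>K M. K \<ge> 0 \<and> (\<forall>f::'n::finite cfun. f \<in> schwartz \<longrightarrow> schwartz_sup N (fourier f) \<le> K * schwartz_sup M f)"
proof -
  obtain K M where "K \<ge> 0" "\<And>f \<xi>. f\<in>schwartz \<Longrightarrow> (1 + norm \<xi>) ^ N * deriv_sum N (fourier f) (\<xi>::real^'n) \<le> K * schwartz_sup M f"
    using fourier_deriv_bound[of N N, where 'n = 'n] by blast
  then show ?thesis by (intro exI[of _ K] exI[of _ M]) (auto intro: schwartz_sup_le)
qed

lemma inv_fourier_reflect: "f \<in> schwartz \<Longrightarrow> inv_fourier f = (\<lambda>x. fourier f (- x))"
  by (intro ext inv_fourier_eq_fourier schwartz_borel)

lemma inv_fourier_schwartz: "f \<in> schwartz \<Longrightarrow> inv_fourier f \<in> schwartz"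
  by (simp add: inv_fourier_reflect fourier_schwartz schwartz_reflect)

lemma inv_fourier_bound:
  "\<exists>K M. K \<ge> 0 \<and> (\<forall>f::'n::finite cfun. f \<in> schwartz \<longrightarrow> schwartz_sup N (inv_fourier f) \<le> K * schwartz_sup M f)"
proof -
  obtain K M where "K \<ge> 0" "\<And>f::'n cfun. f \<in> schwartz \<Longrightarrow> schwartz_sup N (fourier f) \<le> K * schwartz_sup M f"
    using fourier_bound by blast
  then show ?thesis
    using schwartz_sup_reflect_le[OF fourier_schwartz] order_trans
    by (intro exI[of _ K] exI[of _ M]) (auto simp: inv_fourier_reflect, blast)
qed

section \<open>Fubini for dominated kernels\<close>

lemma pair_integrable_dominated:
  fixes h :: "'a \<times> 'b \<Rightarrow> complex"
  assumes M: "sigma_finite_measure M1" "sigma_finite_measure M2"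
    and h [measurable]: "h \<in> borel_measurable (M1 \<Otimes>\<^sub>M M2)"
    and f: "integrable M1 f" "\<And>x. 0 \<le> f x" and g: "integrable M2 g" "\<And>y. 0 \<le> g y"
    and bd: "\<And>x y. norm (h (x, y)) \<le> f x * g y"
  shows "integrable (M1 \<Otimes>\<^sub>M M2) h"
proof (rule integrableI_bounded)
  interpret pair_sigma_finite M1 M2 using M by (simp add: pair_sigma_finite_def)
  note [measurable] = borel_measurable_integrable[OF f(1)] borel_measurable_integrable[OF g(1)]
  have "(\<integral>\<^sup>+z. ennreal (norm (h z)) \<partial>(M1 \<Otimes>\<^sub>M M2)) = (\<integral>\<^sup>+x. \<integral>\<^sup>+y. ennreal (norm (h (x, y))) \<partial>M2 \<partial>M1)"
    by (rule M2.nn_integral_fst[symmetric]) measurable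
  also have "\<dots> \<le> (\<integral>\<^sup>+x. \<integral>\<^sup>+y. ennreal (f x) * ennreal (g y) \<partial>M2 \<partial>M1)"
    by (intro nn_integral_mono) (simp add: bd ennreal_leI f g flip: ennreal_mult)
  also have "\<dots> = (\<integral>\<^sup>+x. ennreal (f x) \<partial>M1) * (\<integral>\<^sup>+y. ennreal (g y) \<partial>M2)"
    by (simp add: nn_integral_cmult nn_integral_multc)
  also have "\<dots> < \<infinity>"
    using f g by (simp add: nn_integral_eq_integral ennreal_mult_less_top)
  finally show "(\<integral>\<^sup>+z. ennreal (norm (h z)) \<partial>(M1 \<Otimes>\<^sub>M M2)) < \<infinity>" .
qed fact

lemma fubini_dominated:
  fixes h :: "'a \<Rightarrow> 'b \<Rightarrow> complex"
  assumes M: "sigma_finite_measure M1" "sigma_finite_measure M2"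
    and h: "(\<lambda>z. h (fst z) (snd z)) \<in> borel_measurable (M1 \<Otimes>\<^sub>M M2)"
    and f: "integrable M1 f" "\<And>x. 0 \<le> f x" and g: "integrable M2 g" "\<And>y. 0 \<le> g y"
    and bd: "\<And>x y. norm (h x y) \<le> f x * g y"
  shows "(LINT x|M1. LINT y|M2. h x y) = (LINT y|M2. LINT x|M1. h x y)"
proof -
  interpret pair_sigma_finite M1 M2 using M by (simp add: pair_sigma_finite_def)
  have "integrable (M1 \<Otimes>\<^sub>M M2) (\<lambda>z. h (fst z) (snd z))"
    by (rule pair_integrable_dominated[OF M h f g]) (simp add: bd)
  then show ?thesis by (intro Fubini_integral[symmetric]) (simp add: case_prod_beta')
qed

text \<open>Convolution kernels are not dominated by a product of a function of \<open>x\<close> and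
  a function of \<open>y\<close>; the bound \<open>a x * b (x - y)\<close> is integrable over pairs
  because the inner integral of \<open>b\<close> is invariant under reflection and
  translation.\<close>

lemma fubini_conv_dominated:
  fixes h :: "'a::euclidean_space \<Rightarrow> 'a \<Rightarrow> complex"
  assumes h: "(\<lambda>z. h (fst z) (snd z)) \<in> borel_measurable (lborel \<Otimes>\<^sub>M lborel)"
    and a: "integrable lborel a" "\<And>x. 0 \<le> a x" and b: "integrable lborel b" "\<And>y. 0 \<le> b y"
    and bd: "\<And>x y. norm (h x y) \<le> a x * b (x - y)"
  shows "(LINT x|lborel. LINT y|lborel. h x y) = (LINT y|lborel. LINT x|lborel. h x y)"
proof -
  note [measurable] = borel_measurable_integrable[OF a(1), simplified] borel_measurable_integrable[OF b(1), simplified] h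
  have "integrable (lborel \<Otimes>\<^sub>M lborel) (\<lambda>z. h (fst z) (snd z))"
  proof (rule integrableI_bounded)
    have "(\<integral>\<^sup>+z. ennreal (norm (h (fst z) (snd z))) \<partial>(lborel \<Otimes>\<^sub>M lborel)) = (\<integral>\<^sup>+x. \<integral>\<^sup>+y. ennreal (norm (h x y)) \<partial>lborel \<partial>lborel)"
      by (subst lborel.nn_integral_fst[symmetric]) simp_all
    also have "\<dots> \<le> (\<integral>\<^sup>+x. \<integral>\<^sup>+y. ennreal (a x) * ennreal (b (x - y)) \<partial>lborel \<partial>lborel)"
      by (intro nn_integral_mono) (simp add: bd ennreal_leI a b flip: ennreal_mult)
    also have "\<dots> = (\<integral>\<^sup>+x. ennreal (a x) * (\<integral>\<^sup>+y. ennreal (b y) \<partial>lborel) \<partial>lborel)"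
      by (intro nn_integral_cong) (simp add: nn_integral_cmult nn_integral_reflect[of "\<lambda>y. ennreal (b y)"])
    also have "\<dots> = (\<integral>\<^sup>+x. ennreal (a x) \<partial>lborel) * (\<integral>\<^sup>+y. ennreal (b y) \<partial>lborel)"
      by (simp add: nn_integral_multc)
    also have "\<dots> < \<infinity>"
      using a b by (simp add: nn_integral_eq_integral ennreal_mult_less_top)
    finally show "(\<integral>\<^sup>+z. ennreal (norm (h (fst z) (snd z))) \<partial>(lborel \<Otimes>\<^sub>M lborel)) < \<infinity>" .
  qed fact
  then show ?thesis by (intro lborel_pair.Fubini_integral[symmetric]) (simp add: case_prod_beta')
qed

section \<open>Fourier inversion\<close>

definition gaussian :: "real ^ 'n::finite \<Rightarrow> real" where
  "gaussian x = exp (- (norm x)\<^sup>2 / 2)"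

lemma gaussian_nonneg [simp]: "0 \<le> gaussian x" and gaussian_le_1: "gaussian x \<le> 1"
  by (simp_all add: gaussian_def)

lemma gaussian_borel [measurable]: "gaussian \<in> borel_measurable borel"
  unfolding gaussian_def by measurable

text \<open>Obtained from the characteristic function of the standard normal distribution after
  clearing the normalisation \<open>1 / sqrt (2 * pi)\<close>.\<close>

lemma gaussian_1d:
  "integrable lborel (\<lambda>x. iexp (t * x) * complex_of_real (exp (- x\<^sup>2 / 2)))"
  "(CLINT x|lborel. iexp (t * x) * complex_of_real (exp (- x\<^sup>2 / 2))) = of_real (sqrt (2 * pi) * exp (- t\<^sup>2 / 2))"
proof -
  have "integrable lborel (\<lambda>x. sqrt (2 * pi) * std_normal_density x)"
    by (intro integrable_mult_right) simp
  then have i: "integrable lborel (\<lambda>x::real. exp (- x\<^sup>2 / 2))"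
    by (simp add: std_normal_density_def)
  show "integrable lborel (\<lambda>x. iexp (t * x) * complex_of_real (exp (- x\<^sup>2 / 2)))"
    by (rule Bochner_Integration.integrable_bound[OF i]) (auto simp: norm_mult)
  have "complex_of_real (exp (- t\<^sup>2 / 2)) = char std_normal_distribution t"
    by (simp add: char_std_normal_distribution)
  also have "\<dots> = (CLINT x|lborel. std_normal_density x *\<^sub>R iexp (t * x))"
    unfolding char_def by (subst integral_density) (auto simp: normal_density_nonneg)
  also have "\<dots> = (CLINT x|lborel. of_real (1 / sqrt (2 * pi)) * (iexp (t * x) * complex_of_real (exp (- x\<^sup>2 / 2))))"
    by (intro Bochner_Integration.integral_cong) (simp_all add: std_normal_density_def scaleR_conv_of_real)
  also have "\<dots> = of_real (1 / sqrt (2 * pi)) * (CLINT x|lborel. iexp (t * x) * complex_of_real (exp (- x\<^sup>2 / 2)))"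
    by (rule integral_mult_right_zero)
  finally have e: "complex_of_real (exp (- t\<^sup>2 / 2)) = of_real (1 / sqrt (2 * pi)) * (CLINT x|lborel. iexp (t * x) * complex_of_real (exp (- x\<^sup>2 / 2)))" .
  have "complex_of_real (sqrt (2 * pi)) * of_real (1 / sqrt (2 * pi)) = 1"
    by (simp flip: of_real_mult)
  then show "(CLINT x|lborel. iexp (t * x) * complex_of_real (exp (- x\<^sup>2 / 2))) = of_real (sqrt (2 * pi) * exp (- t\<^sup>2 / 2))"
    unfolding of_real_mult e mult.assoc[symmetric] by simp
qed

text \<open>In coordinates both the Gaussian and the character are products of functions of one
  variable, so integrability and the value of the integral reduce to
  \<open>gaussian_1d\<close>.\<close>

lemma gaussian_integrable: "integrable lborel (gaussian :: real ^ 'n::finite \<Rightarrow> real)" (is ?I)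
  and gaussian_transform: "(LINT x|lborel. exp (\<i> * of_real ((x::real^'n) \<bullet> \<xi>)) * of_real (gaussian x))
    = of_real ((2 * pi) powr (real CARD('n) / 2) * gaussian \<xi>)" (is ?T)
proof -
  let ?B = "Basis :: (real^'n) set"
  let ?g = "\<lambda>\<xi> b x. iexp ((\<xi> \<bullet> b) * x) * complex_of_real (exp (- x\<^sup>2 / 2))"
  interpret product_sigma_finite "\<lambda>_::real^'n. lborel :: real measure" ..
  let ?\<Phi> = "\<lambda>f. \<Sum>b\<in>?B. f b *\<^sub>R b"
  let ?F = "\<lambda>\<xi> x. exp (\<i> * of_real ((x::real^'n) \<bullet> \<xi>)) * complex_of_real (gaussian x)"
  have prod_eq: "?F \<xi> (?\<Phi> f) = (\<Prod>b\<in>?B. ?g \<xi> b (f b))" for f \<xi>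
  proof -
    have n: "(norm (?\<Phi> f))\<^sup>2 = (\<Sum>b\<in>?B. (f b)\<^sup>2)"
      unfolding power2_norm_eq_inner
      by (subst euclidean_inner) (simp add: inner_sum_left inner_Basis power2_eq_square if_distrib cong: if_cong)
    have i: "?\<Phi> f \<bullet> \<xi> = (\<Sum>b\<in>?B. (\<xi> \<bullet> b) * f b)"
      unfolding inner_sum_left inner_scaleR_left by (intro sum.cong) (simp_all add: inner_commute)
    have "exp (\<i> * of_real (?\<Phi> f \<bullet> \<xi>)) = (\<Prod>b\<in>?B. iexp ((\<xi> \<bullet> b) * f b))"
      unfolding i by (simp add: exp_sum sum_distrib_left)
    moreover have "gaussian (?\<Phi> f) = (\<Prod>b\<in>?B. exp (- (f b)\<^sup>2 / 2))"
      unfolding gaussian_def n by (simp add: exp_sum[symmetric] sum_negf sum_divide_distrib)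
    ultimately show ?thesis by (simp add: prod.distrib)
  qed
  have [measurable]: "?\<Phi> \<in> borel_measurable (\<Pi>\<^sub>M b\<in>?B. lborel)" by measurable
  have m: "?F \<xi> \<in> borel_measurable borel" for \<xi> by measurable
  have int: "integrable (lborel :: (real^'n) measure) (?F \<xi>)" for \<xi>
  proof -
    have "integrable (\<Pi>\<^sub>M b\<in>?B. lborel) (\<lambda>f. ?F \<xi> (?\<Phi> f))"
      unfolding prod_eq by (intro product_integrable_prod gaussian_1d finite_Basis)
    then show ?thesis
      by (subst lborel_eq[where 'a = "real^'n"], subst integrable_distr_eq) (auto intro: m)
  qed
  show ?I using integrable_norm[OF int[of 0]] by simp
  have "(LINT x|lborel. ?F \<xi> x) = (LINT f|(\<Pi>\<^sub>M b\<in>?B. lborel). ?F \<xi> (?\<Phi> f))"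
    by (subst lborel_eq[where 'a = "real^'n"], subst integral_distr) (auto intro: m)
  also have "\<dots> = (\<Prod>b\<in>?B. CLINT x|lborel. ?g \<xi> b x)"
    unfolding prod_eq by (rule product_integral_prod[OF finite_Basis gaussian_1d(1)])
  also have "\<dots> = of_real (sqrt (2 * pi) ^ CARD('n) * gaussian \<xi>)"
  proof -
    have "gaussian \<xi> = (\<Prod>b\<in>?B. exp (- (\<xi> \<bullet> b)\<^sup>2 / 2))"
      unfolding gaussian_def power2_norm_eq_inner
      by (subst euclidean_inner) (simp add: exp_sum[symmetric] sum_negf sum_divide_distrib power2_eq_square)
    then show ?thesis unfolding gaussian_1d(2) by (simp add: prod.distrib)
  qed
  also have "sqrt (2 * pi) ^ CARD('n) = (2 * pi) powr (real CARD('n) / 2)"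
    by (simp add: powr_half_sqrt[symmetric] powr_power)
  finally show ?T by simp
qed

lemma fourier_const_sq: "(fourier_const TYPE('n::finite))\<^sup>2 * ((2 * pi) powr (real CARD('n) / 2))\<^sup>2 = 1"
proof -
  have "fourier_const TYPE('n) * (2 * pi) powr (real CARD('n) / 2) = 1"
    unfolding fourier_const_def powr_add[symmetric] by simp
  then show ?thesis unfolding power_mult_distrib[symmetric] by simp
qed

text \<open>The Gaussian factor makes the double integral over \<open>y\<close> and
  \<open>\<xi>\<close> absolutely convergent, which it is not without that factor. After exchanging
  the order, the integral over \<open>\<xi>\<close> is a Gaussian of width
  \<open>\<epsilon>\<close>, and rescaling leaves an average of \<open>f\<close> near
  \<open>x\<close>.\<close>

lemma gaussian_regularised_inversion:
  fixes f :: "'n::finite cfun"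
  assumes f: "f \<in> schwartz" and e: "\<epsilon> > 0"
  shows "(LINT \<xi>|lborel. exp (\<i> * of_real (\<xi> \<bullet> x)) * fourier f \<xi> * of_real (gaussian (\<epsilon> *\<^sub>R \<xi>)))
    = of_real (fourier_const TYPE('n) * (2 * pi) powr (real CARD('n) / 2)) * (LINT y|lborel. f (x - \<epsilon> *\<^sub>R y) * of_real (gaussian y))"
proof -
  let ?c = "complex_of_real (fourier_const TYPE('n))"
  let ?a = "(2 * pi) powr (real CARD('n) / 2)"
  note [measurable] = schwartz_borel[OF f]
  have ge: "integrable lborel (\<lambda>\<xi>::real^'n. gaussian (\<epsilon> *\<^sub>R \<xi>))"
    using integrable_dilate[OF gaussian_integrable, of \<epsilon>] e by simp
  have "(LINT \<xi>|lborel. exp (\<i> * of_real (\<xi> \<bullet> x)) * fourier f \<xi> * of_real (gaussian (\<epsilon> *\<^sub>R \<xi>)))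
     = (LINT \<xi>|lborel. ?c * (LINT y|lborel. exp (\<i> * of_real (\<xi> \<bullet> (x - y))) * of_real (gaussian (\<epsilon> *\<^sub>R \<xi>)) * f y))"
  proof (intro Bochner_Integration.integral_cong refl)
    fix \<xi> :: "real^'n"
    let ?E = "exp (\<i> * of_real (\<xi> \<bullet> x)) * complex_of_real (gaussian (\<epsilon> *\<^sub>R \<xi>))"
    have "exp (\<i> * of_real (\<xi> \<bullet> x)) * fourier f \<xi> * of_real (gaussian (\<epsilon> *\<^sub>R \<xi>))
      = ?c * (?E * (LINT y|lborel. exp (\<i> * of_real (y \<bullet> - \<xi>)) * f y))"
      by (simp add: fourier_eq mult_ac)
    also have "?E * (LINT y|lborel. exp (\<i> * of_real (y \<bullet> - \<xi>)) * f y) = (LINT y|lborel. ?E * (exp (\<i> * of_real (y \<bullet> - \<xi>)) * f y))"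
      by (rule integral_mult_right_zero[symmetric])
    also have "\<dots> = (LINT y|lborel. exp (\<i> * of_real (\<xi> \<bullet> (x - y))) * of_real (gaussian (\<epsilon> *\<^sub>R \<xi>)) * f y)"
      by (intro Bochner_Integration.integral_cong refl)
        (simp add: inner_diff_right exp_diff exp_minus inner_commute right_diff_distrib divide_simps)
    finally show "exp (\<i> * of_real (\<xi> \<bullet> x)) * fourier f \<xi> * of_real (gaussian (\<epsilon> *\<^sub>R \<xi>))
      = ?c * (LINT y|lborel. exp (\<i> * of_real (\<xi> \<bullet> (x - y))) * of_real (gaussian (\<epsilon> *\<^sub>R \<xi>)) * f y)" .
  qed
  also have "\<dots> = ?c * (LINT \<xi>|lborel. LINT y|lborel. exp (\<i> * of_real (\<xi> \<bullet> (x - y))) * of_real (gaussian (\<epsilon> *\<^sub>R \<xi>)) * f y)"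
    by (rule integral_mult_right_zero)
  also have "(LINT \<xi>|lborel. LINT y|lborel. exp (\<i> * of_real (\<xi> \<bullet> (x - y))) * of_real (gaussian (\<epsilon> *\<^sub>R \<xi>)) * f y)
     = (LINT y|lborel. LINT \<xi>|lborel. exp (\<i> * of_real (\<xi> \<bullet> (x - y))) * of_real (gaussian (\<epsilon> *\<^sub>R \<xi>)) * f y)"
    by (rule fubini_dominated[OF _ _ _ ge _ integrable_norm[OF schwartz_integrable[OF f]]])
      (auto simp: norm_mult sigma_finite_lborel)
  also have "\<dots> = (LINT y|lborel. (LINT \<xi>|lborel. exp (\<i> * of_real (\<xi> \<bullet> (x - y))) * of_real (gaussian (\<epsilon> *\<^sub>R \<xi>))) * f y)"
    by simp
  also have "\<dots> = (LINT y|lborel. of_real (?a * (1 / \<epsilon> ^ CARD('n)) * gaussian ((1/\<epsilon>) *\<^sub>R (x - y))) * f y)"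
  proof (intro Bochner_Integration.integral_cong refl)
    fix y
    have i: "integrable lborel (\<lambda>\<xi>::real^'n. exp (\<i> * of_real (\<xi> \<bullet> ((1/\<epsilon>) *\<^sub>R (x - y)))) * complex_of_real (gaussian \<xi>))"
      by (rule Bochner_Integration.integrable_bound[OF gaussian_integrable]) (auto simp: norm_mult)
    have "of_real (?a * gaussian ((1/\<epsilon>) *\<^sub>R (x - y))) = (LINT \<xi>|lborel. exp (\<i> * of_real (\<xi> \<bullet> ((1/\<epsilon>) *\<^sub>R (x - y)))) * complex_of_real (gaussian \<xi>))"
      by (rule gaussian_transform[symmetric])
    also have "\<dots> = \<epsilon> ^ CARD('n) *\<^sub>R (LINT \<xi>|lborel. exp (\<i> * of_real (\<xi> \<bullet> (x - y))) * complex_of_real (gaussian (\<epsilon> *\<^sub>R \<xi>)))"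
      using integral_dilate[OF i, of \<epsilon>] e by simp
    finally have "complex_of_real (?a * gaussian ((1/\<epsilon>) *\<^sub>R (x - y))) = of_real (\<epsilon> ^ CARD('n)) * (LINT \<xi>|lborel. exp (\<i> * of_real (\<xi> \<bullet> (x - y))) * complex_of_real (gaussian (\<epsilon> *\<^sub>R \<xi>)))"
      by (simp add: scaleR_conv_of_real)
    then show "(LINT \<xi>|lborel. exp (\<i> * of_real (\<xi> \<bullet> (x - y))) * of_real (gaussian (\<epsilon> *\<^sub>R \<xi>))) * f y
       = of_real (?a * (1 / \<epsilon> ^ CARD('n)) * gaussian ((1/\<epsilon>) *\<^sub>R (x - y))) * f y"
      using e by (simp add: field_simps)
  qed
  also have "\<dots> = (LINT y|lborel. of_real (?a * (1 / \<epsilon> ^ CARD('n)) * gaussian ((1/\<epsilon>) *\<^sub>R y)) * f (x - y))"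
    using integral_reflect[of "\<lambda>y. of_real (?a * (1 / \<epsilon> ^ CARD('n)) * gaussian ((1/\<epsilon>) *\<^sub>R y)) * f (x - y)" x] by simp
  also have "\<dots> = \<bar>\<epsilon>\<bar> ^ DIM(real^'n) *\<^sub>R (LINT y|lborel. of_real (?a * (1 / \<epsilon> ^ CARD('n)) * gaussian ((1/\<epsilon>) *\<^sub>R (\<epsilon> *\<^sub>R y))) * f (x - \<epsilon> *\<^sub>R y))"
  proof (rule integral_dilate)
    have [measurable]: "f \<in> borel_measurable borel" using f by simp
    show "integrable lborel (\<lambda>y. of_real (?a * (1 / \<epsilon> ^ CARD('n)) * gaussian ((1/\<epsilon>) *\<^sub>R y)) * f (x - y))"
      by (rule Bochner_Integration.integrable_bound[OF integrable_mult_right[OF integrable_reflect[OF schwartz_integrable[OF f], of x], of "of_real (?a * (1 / \<epsilon> ^ CARD('n)))"]])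
        (auto simp: norm_mult norm_divide norm_power intro!: mult_mono mult_left_le divide_right_mono gaussian_le_1)
  qed (use e in auto)
  also have "\<dots> = of_real ?a * (LINT y|lborel. f (x - \<epsilon> *\<^sub>R y) * of_real (gaussian y))"
  proof -
    have "(LINT y|lborel. of_real (?a * (1 / \<epsilon> ^ CARD('n)) * gaussian ((1/\<epsilon>) *\<^sub>R (\<epsilon> *\<^sub>R y))) * f (x - \<epsilon> *\<^sub>R y))
      = (LINT y|lborel. of_real (?a * (1 / \<epsilon> ^ CARD('n))) * (f (x - \<epsilon> *\<^sub>R y) * of_real (gaussian y)))"
      using e by (intro Bochner_Integration.integral_cong refl) simp
    also have "\<dots> = of_real (?a * (1 / \<epsilon> ^ CARD('n))) * (LINT y|lborel. f (x - \<epsilon> *\<^sub>R y) * of_real (gaussian y))"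
      by (rule integral_mult_right_zero)
    finally show ?thesis using e by (simp add: scaleR_conv_of_real)
  qed
  finally show ?thesis by simp
qed

text \<open>Both sides of the regularised formula converge as \<open>\<epsilon>\<close> tends to 0,
  by dominated convergence with majorants \<open>norm (fourier f \<xi>)\<close> and a multiple of
  the Gaussian; the powers of \<open>2 * pi\<close> cancel.\<close>

lemma inv_fourier_fourier:
  fixes f :: "'n::finite cfun"
  assumes f: "f \<in> schwartz"
  shows "inv_fourier (fourier f) = f"
proof
  fix x
  let ?c = "fourier_const TYPE('n)" and ?a = "(2 * pi) powr (real CARD('n) / 2)"
  let ?e = "\<lambda>k. 1 / real (Suc k)"
  note [measurable] = schwartz_borel[OF f] schwartz_borel[OF fourier_schwartz[OF f]]
  have e0: "(\<lambda>k. ?e k) \<longlonglongrightarrow> 0" using LIMSEQ_inverse_real_of_nat by (simp add: inverse_eq_divide)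
  obtain B where B: "\<And>y. norm (f y) \<le> B"
    using schwartz_decay0[OF f, of _ 0] by auto

  have "(\<lambda>k. LINT \<xi>|lborel. exp (\<i> * of_real (\<xi> \<bullet> x)) * fourier f \<xi> * of_real (gaussian (?e k *\<^sub>R \<xi>)))
    \<longlonglongrightarrow> (LINT \<xi>|lborel. exp (\<i> * of_real (\<xi> \<bullet> x)) * fourier f \<xi> * of_real (gaussian (0::real^'n)))"
  proof (rule integral_dominated_convergence[where w = "\<lambda>\<xi>. norm (fourier f \<xi>)"])
    show "AE \<xi> in lborel. (\<lambda>k. exp (\<i> * of_real (\<xi> \<bullet> x)) * fourier f \<xi> * of_real (gaussian (?e k *\<^sub>R \<xi>)))
       \<longlonglongrightarrow> exp (\<i> * of_real (\<xi> \<bullet> x)) * fourier f \<xi> * of_real (gaussian (0::real^'n))"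
    proof (intro AE_I2 tendsto_mult tendsto_const tendsto_of_real)
      fix \<xi> :: "real^'n"
      have "(\<lambda>k. ?e k *\<^sub>R \<xi>) \<longlonglongrightarrow> 0 *\<^sub>R \<xi>" by (intro tendsto_scaleR e0 tendsto_const)
      then have "(\<lambda>k. ?e k *\<^sub>R \<xi>) \<longlonglongrightarrow> 0" by (simp only: scaleR_zero_left)
      then show "(\<lambda>k. gaussian (?e k *\<^sub>R \<xi>)) \<longlonglongrightarrow> gaussian (0 :: real^'n)"
        unfolding gaussian_def by (intro tendsto_intros) auto
    qed
    show "AE \<xi> in lborel. norm (exp (\<i> * of_real (\<xi> \<bullet> x)) * fourier f \<xi> * of_real (gaussian (?e k *\<^sub>R \<xi>))) \<le> norm (fourier f \<xi>)" for k
      by (intro AE_I2) (simp add: norm_mult mult_left_le gaussian_le_1)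
  qed (use schwartz_integrable[OF fourier_schwartz[OF f]] in auto)
  moreover have "(\<lambda>k. LINT y|lborel. f (x - ?e k *\<^sub>R y) * of_real (gaussian y)) \<longlonglongrightarrow> (LINT y|lborel. f x * of_real (gaussian (y::real^'n)))"
  proof (rule integral_dominated_convergence[where w = "\<lambda>y::real^'n. B * gaussian y"])
    show "AE y in lborel. (\<lambda>k. f (x - ?e k *\<^sub>R y) * of_real (gaussian y)) \<longlonglongrightarrow> f x * of_real (gaussian y)"
    proof (intro AE_I2 tendsto_mult tendsto_const)
      fix y :: "real^'n"
      have "(\<lambda>k. x - ?e k *\<^sub>R y) \<longlonglongrightarrow> x - 0 *\<^sub>R y" by (intro tendsto_diff tendsto_scaleR e0 tendsto_const)
      then have "(\<lambda>k. x - ?e k *\<^sub>R y) \<longlonglongrightarrow> x" by (simp only: scaleR_zero_left diff_zero)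
      then show "(\<lambda>k. f (x - ?e k *\<^sub>R y)) \<longlonglongrightarrow> f x"
        by (rule isCont_tendsto_compose[OF smooth_isCont[OF schwartz_smooth[OF f]]])
    qed
    show "AE y in lborel. norm (f (x - ?e k *\<^sub>R y) * of_real (gaussian y)) \<le> B * gaussian y" for k
      by (intro AE_I2) (simp add: norm_mult mult_right_mono B)
  qed (auto intro: gaussian_integrable integrable_mult_right)
  ultimately have lim: "(LINT \<xi>|lborel. exp (\<i> * of_real (\<xi> \<bullet> x)) * fourier f \<xi> * of_real (gaussian (0::real^'n)))
     = of_real (?c * ?a) * (LINT y|lborel. f x * of_real (gaussian (y::real^'n)))"
    using tendsto_mult[OF tendsto_const, of _ _ sequentially "complex_of_real (?c * ?a)"] LIMSEQ_unique
    by (simp only: gaussian_regularised_inversion[OF f] zero_less_divide_1_iff of_nat_0_less_iff zero_less_Suc) blast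
  have g: "(LINT y|lborel. complex_of_real (gaussian (y::real^'n))) = of_real ?a"
    using gaussian_transform[of "0 :: real^'n"] by (simp add: gaussian_def)
  have "inv_fourier (fourier f) x = of_real ?c * (LINT \<xi>|lborel. exp (\<i> * of_real (\<xi> \<bullet> x)) * fourier f \<xi> * of_real (gaussian (0::real^'n)))"
    by (simp add: inv_fourier_eq gaussian_def)
  also have "\<dots> = of_real (?c\<^sup>2 * ?a\<^sup>2) * f x"
  proof -
    have "(LINT y|lborel. f x * complex_of_real (gaussian (y::real^'n))) = f x * of_real ?a"
      unfolding g[symmetric] by (rule integral_mult_right_zero)
    then show ?thesis unfolding lim by (simp only: power2_eq_square mult_ac of_real_mult)
  qed
  finally show "inv_fourier (fourier f) x = f x" by (simp add: fourier_const_sq)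
qed

lemma fourier_reflect:
  fixes f :: "'n::finite cfun"
  assumes [measurable]: "f \<in> borel_measurable borel"
  shows "fourier (\<lambda>x. f (- x)) \<xi> = fourier f (- \<xi>)"
proof -
  have "(LINT x|lborel. exp (\<i> * of_real (x \<bullet> - \<xi>)) * f (- x)) = (LINT x|lborel. exp (\<i> * of_real (x \<bullet> \<xi>)) * f x)"
    using integral_reflect[of "\<lambda>x. exp (\<i> * of_real (x \<bullet> \<xi>)) * f x" 0] by simp
  then show ?thesis by (simp add: fourier_eq)
qed

text \<open>The two transforms differ by a reflection, which commutes with the Fourier transform, so
  this reduces to the other order of composition.\<close>

lemma fourier_inv_fourier:
  assumes f: "f \<in> schwartz"
  shows "fourier (inv_fourier f) = f"
proof -
  have "fourier (inv_fourier f) = inv_fourier (fourier f)"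
    unfolding inv_fourier_reflect[OF f] inv_fourier_reflect[OF fourier_schwartz[OF f]]
    by (intro ext fourier_reflect schwartz_borel fourier_schwartz f)
  then show ?thesis by (simp add: inv_fourier_fourier f)
qed

section \<open>Cut-offs and test functions\<close>

lemma partial_derivs_vanish_open:
  assumes "open U" "\<And>x. x \<in> U \<Longrightarrow> f x = 0" "x \<in> U"
  shows "partial_derivs \<alpha> f x = 0"
  using assms(3)
proof (induction \<alpha> arbitrary: x)
  case (Cons i \<alpha>)
  have "((\<lambda>y. 0) has_derivative (\<lambda>v. 0)) (at x)" by simp
  then have "(partial_derivs \<alpha> f has_derivative (\<lambda>v. 0)) (at x)"
    by (rule has_derivative_transform_within_open[OF _ assms(1) Cons.prems]) (simp add: Cons.IH)
  then show ?case by (simp add: partial_deriv_eqI)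
qed (simp add: assms)

lemma deriv_sum_vanish_open:
  "open U \<Longrightarrow> (\<And>x. x \<in> U \<Longrightarrow> f x = 0) \<Longrightarrow> x \<in> U \<Longrightarrow> deriv_sum N f x = 0"
  unfolding deriv_sum_def by (intro sum.neutral ballI) (simp add: partial_derivs_vanish_open)

lemma deriv_sum_le_sup: 
  assumes "f \<in> schwartz" shows "deriv_sum N f x \<le> schwartz_sup N f"
  using order_trans[OF mult_right_mono[OF one_le_power[of "1 + norm x" N] deriv_sum_nonneg]
      schwartz_sup_upper[OF assms, of x N]] by simp

text \<open>Where \<open>g\<close> is nonzero the weight \<open>1 + norm x\<close> exceeds
  \<open>R\<close>, so \<open>M\<close> spare orders of \<open>f\<close> are exchanged for
  \<open>R ^ (- M)\<close>. This gives both the convergence of cut-offs to the identity and the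
  rapid decay of the dyadic pieces of a Schwartz function.\<close>

lemma schwartz_sup_cut:
  "\<exists>K\<ge>0. \<forall>g f :: 'n::finite cfun. \<forall>C R. R > 0 \<longrightarrow> smooth g \<longrightarrow> (\<forall>x. deriv_sum (N + M) g x \<le> C) \<longrightarrow>
     (\<forall>x. norm x < R \<longrightarrow> g x = 0) \<longrightarrow> f \<in> schwartz \<longrightarrow>
     schwartz_sup N (\<lambda>x. g x * f x) \<le> K * C * schwartz_sup (N + M) f / R ^ M"
proof -
  obtain K where K: "K \<ge> 0" "\<forall>g f :: 'n::finite cfun. \<forall>C m. smooth g \<longrightarrow> (\<forall>x. deriv_sum (N + M) g x \<le> C * (1 + norm x) ^ m) \<longrightarrow> f \<in> schwartz \<longrightarrow>
     (\<forall>x. (1 + norm x) ^ (N + M) * deriv_sum (N + M) (\<lambda>x. g x * f x) x \<le> K * C * schwartz_sup (N + M + m) f)"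
    using schwartz_mult_gen[of "N + M", where 'n = 'n] by blast
  show ?thesis
  proof (intro exI[of _ K] conjI allI impI K(1))
    fix g f :: "'n cfun" and C R :: real
    assume R: "R > 0" and g: "smooth g" "\<forall>x. deriv_sum (N + M) g x \<le> C" "\<forall>x. norm x < R \<longrightarrow> g x = 0" and f: "f \<in> schwartz"
    have C: "C \<ge> 0" using g(2) deriv_sum_nonneg order_trans by blast
    have b: "(1 + norm x) ^ (N + M) * deriv_sum (N + M) (\<lambda>x. g x * f x) x \<le> K * C * schwartz_sup (N + M) f" for x
      using K(2)[rule_format, of g C 0 f x] g f by simp
    show "schwartz_sup N (\<lambda>x. g x * f x) \<le> K * C * schwartz_sup (N + M) f / R ^ M"
    proof (rule schwartz_sup_le)
      fix x
      show "(1 + norm x) ^ N * deriv_sum N (\<lambda>x. g x * f x) x \<le> K * C * schwartz_sup (N + M) f / R ^ M"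
      proof (cases "norm x < R")
        case True
        have "deriv_sum N (\<lambda>x. g x * f x) x = 0"
          by (rule deriv_sum_vanish_open[of "ball 0 R"]) (use True g(3) in auto)
        then show ?thesis using K(1) C R schwartz_sup_nonneg[OF f] by simp
      next
        case False
        have "R ^ M * ((1 + norm x) ^ N * deriv_sum N (\<lambda>x. g x * f x) x) \<le> (1 + norm x) ^ M * ((1 + norm x) ^ N * deriv_sum (N + M) (\<lambda>x. g x * f x) x)"
          using False R by (intro mult_mono power_mono mult_left_mono deriv_sum_mono) auto
        also have "\<dots> \<le> K * C * schwartz_sup (N + M) f"
          using b[of x] by (simp add: power_add mult_ac)
        finally show ?thesis using R by (simp add: pos_le_divide_eq mult_ac)
      qed
    qed
  qed
qed

lemma continuous_deriv_sum: "smooth f \<Longrightarrow> continuous_on S (deriv_sum N f)"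
  unfolding deriv_sum_def
  by (intro continuous_on_sum continuous_on_norm smooth_continuous_on smooth_partial_derivs)

text \<open>Weighted derivatives are continuous, hence bounded on the compact support, and they
  vanish on its open complement.\<close>

lemma test_function_schwartz:
  assumes "\<phi> \<in> test_functions" shows "\<phi> \<in> schwartz"
proof (rule schwartzI)
  let ?K = "closure {x. \<phi> x \<noteq> 0}"
  have s: "smooth \<phi>" and K: "compact ?K" using assms by (auto simp: test_functions_def)
  show "smooth \<phi>" by fact
  fix N
  have "continuous_on ?K (\<lambda>x. (1 + norm x) ^ N)"
    by (intro continuous_on_power continuous_on_add continuous_on_const continuous_on_norm_id)
  then have "continuous_on ?K (\<lambda>x. (1 + norm x) ^ N * deriv_sum N \<phi> x)"
    by (rule continuous_on_mult[OF _ continuous_deriv_sum[OF s]])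
  then have "compact ((\<lambda>x. (1 + norm x) ^ N * deriv_sum N \<phi> x) ` ?K)"
    using K by (rule compact_continuous_image)
  from compact_imp_bounded[OF this]
  obtain B where "\<forall>y\<in>(\<lambda>x. (1 + norm x) ^ N * deriv_sum N \<phi> x) ` ?K. norm y \<le> B"
    unfolding bounded_iff by (elim exE)
  then have B: "\<And>x. x \<in> ?K \<Longrightarrow> norm ((1 + norm x) ^ N * deriv_sum N \<phi> x) \<le> B"
    by (rule bspec) (rule imageI)
  have "(1 + norm x) ^ N * deriv_sum N \<phi> x \<le> max B 0" for x
  proof (cases "x \<in> ?K")
    case False
    have "deriv_sum N \<phi> x = 0"
      by (rule deriv_sum_vanish_open[of "- ?K"]) (use False closure_subset[of "{x. \<phi> x \<noteq> 0}"] in auto)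
    then show ?thesis by simp
  qed (use B[of x] in auto)
  then show "\<exists>B. \<forall>x. (1 + norm x) ^ N * deriv_sum N \<phi> x \<le> B" by blast
qed

lemma test_functionI:
  assumes "smooth \<phi>" "\<And>x. norm x > R \<Longrightarrow> \<phi> x = 0"
  shows "\<phi> \<in> test_functions"
proof -
  have "{x. \<phi> x \<noteq> 0} \<subseteq> cball 0 R" using assms(2) by (auto simp: not_less[symmetric])
  then have "bounded {x. \<phi> x \<noteq> 0}" using bounded_cball bounded_subset by blast
  then show ?thesis using assms(1) by (simp add: test_functions_def compact_closure)
qed

lemma test_function_support:
  assumes "\<phi> \<in> test_functions" shows "\<exists>R. \<forall>x. norm x > R \<longrightarrow> \<phi> x = 0"
proof -
  have "bounded (closure {x. \<phi> x \<noteq> 0})" using assms by (auto simp: test_functions_def compact_imp_bounded)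
  then obtain R where "\<And>x. x \<in> closure {x. \<phi> x \<noteq> 0} \<Longrightarrow> norm x \<le> R" by (auto simp: bounded_iff)
  then have "\<forall>x. norm x > R \<longrightarrow> \<phi> x = 0" using closure_subset[of "{x. \<phi> x \<noteq> 0}"] by force
  then show ?thesis by blast
qed

text \<open>Serves to make \<open>\<phi>0 x * cnj (\<phi>0 x)\<close> a smooth nonnegative function;
  \<open>\<phi>0\<close> itself may take complex values of any phase outside the unit ball.\<close>

lemma smooth_cnj: assumes "smooth f" shows "smooth (\<lambda>x. cnj (f x))"
proof -
  have d: "((\<lambda>x. cnj (g x)) has_derivative (\<lambda>v. \<Sum>i\<in>UNIV. (v $ i) *\<^sub>R cnj (partial_deriv i g x))) (at x)"
    if "smooth g" for g :: "'a cfun" and x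
    using bounded_linear.has_derivative[OF bounded_linear_cnj has_derivative_partial_deriv[OF smooth_differentiable[OF that, of x]]]
    by (simp add: scaleR_conv_of_real)
  show ?thesis
  proof (rule smooth_coinduct[of "\<lambda>h. \<exists>g. smooth g \<and> h = (\<lambda>x. cnj (g x))"])
    fix h :: "'a cfun" and x assume "\<exists>g. smooth g \<and> h = (\<lambda>x. cnj (g x))"
    then obtain g where g: "smooth g" "h = (\<lambda>x. cnj (g x))" by blast
    show "h differentiable (at x)" unfolding g(2) by (rule differentiableI[OF d[OF g(1)]])
  next
    fix h :: "'a cfun" and i assume "\<exists>g. smooth g \<and> h = (\<lambda>x. cnj (g x))"
    then obtain g where g: "smooth g" "h = (\<lambda>x. cnj (g x))" by blast
    have "partial_deriv i h = (\<lambda>x. cnj (partial_deriv i g x))"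
      unfolding g(2) by (rule partial_deriv_from_has_derivative) (rule d[OF g(1)])
    then show "\<exists>g. smooth g \<and> partial_deriv i h = (\<lambda>x. cnj (g x))"
      using smooth_partial_deriv[OF g(1)] by blast
  qed (use assms in blast)
qed

text \<open>The Taylor estimate holds with the global constant
  \<open>schwartz_sup 2 \<kappa>\<close>, so the remainder is dominated by a multiple of
  \<open>norm (h y)\<close> and all derivatives fall on \<open>\<kappa>\<close>.\<close>

lemma convolution_has_derivative:
  fixes h :: "'n::finite cfun"
  assumes \<kappa>: "\<kappa> \<in> schwartz" and h: "integrable lborel h"
  shows "((\<lambda>x. LINT y|lborel. \<kappa> (x - y) * h y) has_derivative
     (\<lambda>v. \<Sum>i\<in>UNIV. (v $ i) *\<^sub>R (LINT y|lborel. partial_deriv i \<kappa> (x - y) * h y))) (at x)"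
proof -
  note [measurable] = borel_measurable_integrable[OF h, simplified]
  have i: "integrable lborel (\<lambda>y. \<kappa> (x - y) * h y)" if "\<kappa> \<in> schwartz" for \<kappa> :: "'n cfun" and x
  proof (rule Bochner_Integration.integrable_bound[OF integrable_mult_right[OF h, of "of_real (schwartz_sup 0 \<kappa>)"]])
    note [measurable] = schwartz_borel[OF that]
    show "(\<lambda>y. \<kappa> (x - y) * h y) \<in> borel_measurable lborel" by measurable
    show "AE y in lborel. norm (\<kappa> (x - y) * h y) \<le> norm (of_real (schwartz_sup 0 \<kappa>) * h y)"
      using schwartz_decay0[OF that, of _ 0] schwartz_sup_nonneg[OF that, of 0]
      by (intro AE_I2) (simp add: norm_mult mult_right_mono)
  qed
  show ?thesis
  proof (rule has_derivative_integral)
    show "integrable lborel (\<lambda>t. real CARD('n) * schwartz_sup 2 \<kappa> * norm (h t))"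
      by (intro integrable_mult_right integrable_norm h)
    fix v y :: "real^'n"
    let ?z = "x - y"
    have "norm ((\<kappa> (?z + v) - \<kappa> ?z - (\<Sum>i\<in>UNIV. (v $ i) *\<^sub>R partial_deriv i \<kappa> ?z)) * h y) \<le> (real CARD('n) * schwartz_sup 2 \<kappa> * (norm v)\<^sup>2) * norm (h y)"
      unfolding norm_mult
      by (intro mult_right_mono smooth_taylor2 schwartz_smooth \<kappa> deriv_sum_le_sup) auto
    moreover have "(\<kappa> (?z + v) - \<kappa> ?z - (\<Sum>i\<in>UNIV. (v $ i) *\<^sub>R partial_deriv i \<kappa> ?z)) * h y
       = \<kappa> (x + v - y) * h y - \<kappa> (x - y) * h y - (\<Sum>i\<in>UNIV. (v $ i) *\<^sub>R (partial_deriv i \<kappa> (x - y) * h y))"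
    proof -
      have e: "x - y + v = x + v - y" by simp
      show ?thesis unfolding e by (simp add: left_diff_distrib sum_distrib_right)
    qed
    ultimately show "norm (\<kappa> (x + v - y) * h y - \<kappa> (x - y) * h y - (\<Sum>i\<in>UNIV. (v $ i) *\<^sub>R (partial_deriv i \<kappa> (x - y) * h y)))
       \<le> real CARD('n) * schwartz_sup 2 \<kappa> * norm (h y) * (norm v)\<^sup>2" by (simp add: mult_ac)
  qed (auto intro: i schwartz_partial_deriv \<kappa>)
qed

lemma smooth_convolution:
  fixes h :: "'n::finite cfun"
  assumes \<kappa>: "\<kappa> \<in> schwartz" and h: "integrable lborel h"
  shows "smooth (\<lambda>x. LINT y|lborel. \<kappa> (x - y) * h y)"
proof -
  have d: "((\<lambda>x. LINT y|lborel. \<kappa> (x - y) * h y) has_derivative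
     (\<lambda>v. \<Sum>i\<in>UNIV. (v $ i) *\<^sub>R (LINT y|lborel. partial_deriv i \<kappa> (x - y) * h y))) (at x)"
    if \<kappa>: "\<kappa> \<in> schwartz" for \<kappa> :: "'n cfun" and x
    by (rule convolution_has_derivative[OF that h])
  show ?thesis
  proof (rule smooth_coinduct[of "\<lambda>f. \<exists>\<kappa>\<in>schwartz. f = (\<lambda>x. LINT y|lborel. \<kappa> (x - y) * h y)"])
    fix f x assume "\<exists>\<kappa>\<in>schwartz. f = (\<lambda>x. LINT y|lborel. \<kappa> (x - y) * h y)"
    then show "f differentiable (at x)" using d differentiableI by blast
  next
    fix f i assume "\<exists>\<kappa>\<in>schwartz. f = (\<lambda>x. LINT y|lborel. \<kappa> (x - y) * h y)"
    then obtain \<kappa> where k: "\<kappa> \<in> schwartz" "f = (\<lambda>x. LINT y|lborel. \<kappa> (x - y) * h y)" by blast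
    show "\<exists>\<kappa>\<in>schwartz. partial_deriv i f = (\<lambda>x. LINT y|lborel. \<kappa> (x - y) * h y)"
    proof (rule bexI[OF _ schwartz_partial_deriv(1)[OF k(1), of i]])
      show "partial_deriv i f = (\<lambda>x. LINT y|lborel. partial_deriv i \<kappa> (x - y) * h y)"
        unfolding k(2) by (rule partial_deriv_from_has_derivative) (rule d[OF k(1)])
    qed
  qed (use \<kappa> in blast)
qed

section \<open>Cut-offs attached to a dyadic resolution of unity\<close>

locale dyadic_resolution =
  fixes \<phi>0 :: "real ^ 'n::finite \<Rightarrow> complex"
  assumes schwartz_\<phi>0: "\<phi>0 \<in> schwartz"
    and \<phi>0_eq_1: "\<And>x. norm x \<le> 1 \<Longrightarrow> \<phi>0 x = 1"
    and \<phi>0_eq_0: "\<And>x. norm x \<ge> 3 / 2 \<Longrightarrow> \<phi>0 x = 0"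
begin

text \<open>By telescoping this is the partial sum of \<open>dyadic \<phi>0\<close> up to index
  \<open>j\<close>. Identities for bands are proved for these partial sums because they have a
  plateau.\<close>

definition cutoff :: "nat \<Rightarrow> 'n cfun" where
  "cutoff j x = \<phi>0 ((1 / 2 ^ j) *\<^sub>R x)"

lemma cutoff_schwartz: "cutoff j \<in> schwartz"
  unfolding cutoff_def[abs_def] by (intro schwartz_dilate schwartz_\<phi>0) auto

lemma cutoff_eq_1: "norm x \<le> 2 ^ j \<Longrightarrow> cutoff j x = 1"
  unfolding cutoff_def by (intro \<phi>0_eq_1) (simp add: divide_simps)

lemma cutoff_eq_0: "norm x \<ge> 3 / 2 * 2 ^ j \<Longrightarrow> cutoff j x = 0"
  unfolding cutoff_def by (intro \<phi>0_eq_0) (simp add: divide_simps)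

lemma deriv_sum_cutoff_le: "deriv_sum N (cutoff j) x \<le> schwartz_sup N \<phi>0"
  unfolding cutoff_def[abs_def]
  by (rule order_trans[OF deriv_sum_dilate_le deriv_sum_le_sup]) (auto simp: schwartz_smooth schwartz_\<phi>0)

lemma dyadic_0_eq: "dyadic \<phi>0 0 = cutoff 0"
  by (simp add: cutoff_def[abs_def])

lemma dyadic_Suc_eq: "dyadic \<phi>0 (Suc k) = (\<lambda>x. cutoff (Suc k) x - cutoff k x)"
  by (simp add: cutoff_def[abs_def])

lemma dyadic_schwartz: "dyadic \<phi>0 j \<in> schwartz"
  by (cases j) (simp_all only: dyadic_0_eq dyadic_Suc_eq cutoff_schwartz schwartz_diff)

lemma cutoff_mult_test: "f \<in> schwartz \<Longrightarrow> (\<lambda>x. cutoff j x * f x) \<in> test_functions"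
  by (rule test_functionI[of _ "3 / 2 * 2 ^ j"])
    (auto intro: schwartz_smooth schwartz_mult cutoff_schwartz simp: cutoff_eq_0)

text \<open>\<open>cutoff j - 1\<close> vanishes on the ball of radius \<open>2 ^ j\<close> while
  its derivatives are bounded uniformly in \<open>j\<close>, so one spare order of \<open>f\<close>
  yields the rate \<open>2 ^ (- j)\<close>.\<close>

lemma cutoff_mult_tendsto:
  assumes f: "f \<in> schwartz"
  shows "(\<lambda>j. schwartz_sup N (\<lambda>x. cutoff j x * f x - f x)) \<longlonglongrightarrow> 0"
proof -
  obtain K where K: "K \<ge> 0" "\<And>g f :: 'n cfun. \<And>C R. R > 0 \<Longrightarrow> smooth g \<Longrightarrow> \<forall>x. deriv_sum (N + 1) g x \<le> C \<Longrightarrow>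
     \<forall>x. norm x < R \<longrightarrow> g x = 0 \<Longrightarrow> f \<in> schwartz \<Longrightarrow>
     schwartz_sup N (\<lambda>x. g x * f x) \<le> K * C * schwartz_sup (N + 1) f / R ^ 1"
    using schwartz_sup_cut[of N 1, where 'n = 'n] by blast
  let ?C = "schwartz_sup (N + 1) \<phi>0 + schwartz_sup (N + 1) \<phi>0"
  have s1: "smooth (\<lambda>x. cutoff j x - cutoff l x)" for j l
    by (intro smooth_diff schwartz_smooth cutoff_schwartz)
  \<comment> \<open>The constant function has \<open>deriv_sum\<close> equal to 1, which is the
    value of \<open>\<phi>0\<close> at 0; so the constant that bounds the cut-offs also bounds
    it.\<close>
  have c1: "deriv_sum (N + 1) (\<lambda>x. 1::complex) x \<le> schwartz_sup (N + 1) \<phi>0" for x :: "real^'n"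
  proof -
    have "partial_derivs \<alpha> (\<lambda>x::real^'n. 1::complex) x = (if \<alpha> = [] then 1 else 0)" for \<alpha> x
    proof (induction \<alpha> arbitrary: x)
      case (Cons i \<alpha>)
      then have e: "partial_derivs \<alpha> (\<lambda>x::real^'n. 1::complex) = (\<lambda>x. if \<alpha> = [] then 1 else 0)" by blast
      show ?case by (simp add: e partial_deriv_const)
    qed simp
    then have "deriv_sum (N + 1) (\<lambda>x::real^'n. 1::complex) x = (\<Sum>\<alpha>\<in>{\<alpha>::'n list. length \<alpha> \<le> N + 1}. if \<alpha> = [] then 1 else 0)"
      unfolding deriv_sum_def by (intro sum.cong) auto
    also have "\<dots> = 1" by (simp add: finite_multi)
    also have "1 = norm (\<phi>0 0)" by (simp add: \<phi>0_eq_1)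
    also have "\<dots> \<le> schwartz_sup (N + 1) \<phi>0"
      using norm_le_deriv_sum deriv_sum_le_sup[OF schwartz_\<phi>0] order_trans by blast
    finally show ?thesis .
  qed
  have bd: "schwartz_sup N (\<lambda>x. cutoff j x * f x - f x) \<le> K * ?C * schwartz_sup (N + 1) f / 2 ^ j" for j
  proof -
    have "schwartz_sup N (\<lambda>x. (cutoff j x - 1) * f x) \<le> K * ?C * schwartz_sup (N + 1) f / (2 ^ j) ^ 1"
    proof (rule K(2))
      show "smooth (\<lambda>x. cutoff j x - 1)"
        by (intro smooth_diff schwartz_smooth cutoff_schwartz smooth_const)
      show "\<forall>x. deriv_sum (N + 1) (\<lambda>x. cutoff j x - 1) x \<le> ?C"
        by (intro allI order_trans[OF deriv_sum_diff_le] add_mono deriv_sum_cutoff_le c1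
            schwartz_smooth cutoff_schwartz smooth_const)
    qed (use f in \<open>auto simp: cutoff_eq_1\<close>)
    then show ?thesis by (simp add: left_diff_distrib)
  qed
  have "(\<lambda>j. K * ?C * schwartz_sup (N + 1) f * (1 / 2) ^ j) \<longlonglongrightarrow> K * ?C * schwartz_sup (N + 1) f * 0"
    by (intro tendsto_mult tendsto_const LIMSEQ_power_zero) auto
  then have "(\<lambda>j. K * ?C * schwartz_sup (N + 1) f * (1 / 2) ^ j) \<longlonglongrightarrow> 0" by simp
  then show ?thesis
  proof (rule Lim_null_comparison[OF always_eventually, rotated], intro allI)
    fix j
    have "0 \<le> schwartz_sup N (\<lambda>x. cutoff j x * f x - f x)"
      by (intro schwartz_sup_nonneg schwartz_diff schwartz_mult cutoff_schwartz f)
    then show "norm (schwartz_sup N (\<lambda>x. cutoff j x * f x - f x)) \<le> K * ?C * schwartz_sup (N + 1) f * (1 / 2) ^ j"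
      using bd[of j] by (simp add: power_one_over)
  qed
qed

lemma tempered_cutoff_tendsto:
  assumes T: "T \<in> tempered" and f: "f \<in> schwartz"
  shows "(\<lambda>j. T (\<lambda>x. cutoff j x * f x)) \<longlonglongrightarrow> T f"
proof -
  obtain N C where C: "C \<ge> 0" "\<And>\<phi>. \<phi> \<in> schwartz \<Longrightarrow> norm (T \<phi>) \<le> C * schwartz_sup N \<phi>"
    using tempered_bound[OF T] by blast
  have s: "(\<lambda>x. cutoff j x * f x) \<in> schwartz" for j by (intro schwartz_mult cutoff_schwartz f)
  have "(\<lambda>j. T (\<lambda>x. cutoff j x * f x) - T f) \<longlonglongrightarrow> 0"
  proof (rule Lim_null_comparison[OF always_eventually])
    show "\<forall>j. norm (T (\<lambda>x. cutoff j x * f x) - T f) \<le> C * schwartz_sup N (\<lambda>x. cutoff j x * f x - f x)"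
      using C(2)[OF schwartz_diff[OF s f]] by (simp add: tempered_diff[OF T s f])
    show "(\<lambda>j. C * schwartz_sup N (\<lambda>x. cutoff j x * f x - f x)) \<longlonglongrightarrow> 0"
      using tendsto_mult[OF tendsto_const cutoff_mult_tendsto[OF f]] by simp
  qed
  then show ?thesis by (simp add: LIM_zero_iff)
qed

text \<open>Multiplication by \<open>cutoff j\<close> turns a Schwartz function into test functions
  that converge to it, so test functions are dense.\<close>

lemma tempered_eqI:
  fixes S T :: "'n distr"
  assumes "S \<in> tempered" "T \<in> tempered" "\<And>\<phi>. \<phi> \<in> test_functions \<Longrightarrow> S \<phi> = T \<phi>"
  shows "S = T"
proof
  fix \<phi>
  show "S \<phi> = T \<phi>"
  proof (cases "\<phi> \<in> schwartz")
    case True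
    have "(\<lambda>j. S (\<lambda>x. cutoff j x * \<phi> x)) \<longlonglongrightarrow> T \<phi>"
      using tempered_cutoff_tendsto[OF assms(2) True] assms(3)[OF cutoff_mult_test[OF True]] by simp
    then show ?thesis using tempered_cutoff_tendsto[OF assms(1) True] LIMSEQ_unique by blast
  qed (simp add: tempered_outside assms)
qed

text \<open>The normalised square modulus of \<open>\<phi>0\<close>; its mass is positive because
  \<open>\<phi>0\<close> equals 1 on the unit ball. That \<open>norm (\<rho> x)\<close> also has
  integral 1 is what bounds the mollified functions by 1.\<close>

lemma mollifier_exists:
  "\<exists>\<rho> :: 'n cfun. \<rho> \<in> test_functions \<and> (\<forall>x. norm x > 2 \<longrightarrow> \<rho> x = 0) \<and> (LINT x|lborel. \<rho> x) = 1
     \<and> (LINT x|lborel. norm (\<rho> x)) = 1"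
proof -
  let ?r = "\<lambda>x. \<phi>0 x * cnj (\<phi>0 x)"
  have r: "?r x = of_real ((norm (\<phi>0 x))\<^sup>2)" for x using complex_norm_square[of "\<phi>0 x"] by simp
  have rt: "?r \<in> test_functions"
    by (rule test_functionI[of _ "3/2"])
      (auto intro!: smooth_mult smooth_cnj schwartz_smooth[OF schwartz_\<phi>0] simp: \<phi>0_eq_0)
  have ri: "integrable lborel ?r" by (rule schwartz_integrable[OF test_function_schwartz[OF rt]])
  let ?m = "LINT x|lborel. (norm (\<phi>0 x))\<^sup>2"
  have ri': "integrable lborel (\<lambda>x. (norm (\<phi>0 x))\<^sup>2)" using integrable_norm[OF ri] unfolding r by (simp add: norm_power)
  have m: "?m > 0"
  proof -
    have "measure lborel (ball (0::real^'n) 1) = (LINT x|lborel. indicator (ball (0::real^'n) 1) x)"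
      by (simp add: integral_indicator)
    also have "\<dots> \<le> ?m"
      by (intro integral_mono integrable_real_indicator ri')
        (auto simp: indicator_def \<phi>0_eq_1 simp flip: infinity_ennreal_def intro: emeasure_lborel_ball_finite)
    finally show ?thesis
      using content_ball_pos[of 1 "0::real^'n"] by linarith
  qed
  let ?\<rho> = "\<lambda>x. of_real (1 / ?m) * ?r x"
  have "smooth ?\<rho>" by (rule smooth_cmult) (use rt in \<open>simp add: test_functions_def\<close>)
  then have "?\<rho> \<in> test_functions"
    by (rule test_functionI[of _ "3/2"]) (simp add: \<phi>0_eq_0)
  moreover have "\<forall>x. norm x > 2 \<longrightarrow> ?\<rho> x = 0" by (auto simp: \<phi>0_eq_0)
  moreover have "(LINT x|lborel. ?\<rho> x) = 1"
  proof -
    have "(LINT x|lborel. ?r x) = of_real ?m" unfolding r by (rule integral_complex_of_real)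
    then show ?thesis using m by (subst integral_mult_right_zero) simp
  qed
  moreover have "(LINT x|lborel. norm (?\<rho> x)) = 1"
  proof -
    have "(LINT x|lborel. norm (?\<rho> x)) = (LINT x|lborel. (1 / ?m) * (norm (\<phi>0 x))\<^sup>2)"
      using m unfolding r by (intro Bochner_Integration.integral_cong) (auto simp: norm_mult norm_divide norm_power)
    then show ?thesis using m by simp
  qed
  ultimately show ?thesis by (intro exI[of _ ?\<rho>]) simp
qed

end

section \<open>Locally integrable functions as distributions\<close>

lemma cball_pred [measurable]: "Measurable.pred borel (\<lambda>x. x \<in> cball (a :: real^'n::finite) r)"
  using borel_closed[OF closed_cball[of a r]] by (simp add: pred_def)

text \<open>The Borel counterpart of \<open>L1_loc\<close>. Elements of \<open>L1_loc\<close> are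
  only Lebesgue measurable, whereas later integrals are taken over \<open>lborel\<close> with Borel
  integrands. Balls are enough, as every compact set lies in one.\<close>

definition locally_integrable :: "'n::finite cfun \<Rightarrow> bool" where
  "locally_integrable g \<longleftrightarrow> g \<in> borel_measurable borel \<and>
     (\<forall>R. integrable lborel (\<lambda>x. indicator (cball 0 R) x *\<^sub>R g x))"

lemma locally_integrable_borel: "locally_integrable g \<Longrightarrow> g \<in> borel_measurable borel"
  by (simp add: locally_integrable_def)

lemma locally_integrable_mult:
  fixes g \<psi> :: "'n::finite cfun"
  assumes g: "locally_integrable g" and \<psi> [measurable]: "\<psi> \<in> borel_measurable borel"
    and bd: "\<And>x. norm (\<psi> x) \<le> B" and supp: "\<And>x. norm x > R \<Longrightarrow> \<psi> x = 0"
  shows "integrable lborel (\<lambda>x. g x * \<psi> x)"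
proof (rule Bochner_Integration.integrable_bound[of lborel "\<lambda>x. B *\<^sub>R (indicator (cball 0 R) x *\<^sub>R g x)"])
  note [measurable] = locally_integrable_borel[OF g]
  show "integrable lborel (\<lambda>x. B *\<^sub>R (indicator (cball 0 R) x *\<^sub>R g x))"
    using g by (intro integrable_scaleR_right) (simp add: locally_integrable_def)
  show "(\<lambda>x. g x * \<psi> x) \<in> borel_measurable lborel" by measurable
  show "AE x in lborel. norm (g x * \<psi> x) \<le> norm (B *\<^sub>R (indicator (cball 0 R) x *\<^sub>R g x))"
  proof (intro AE_I2)
    fix x
    have "B \<ge> 0" using bd[of 0] norm_ge_zero order_trans by blast
    show "norm (g x * \<psi> x) \<le> norm (B *\<^sub>R (indicator (cball 0 R) x *\<^sub>R g x))"
    proof (cases "norm x > R")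
      case False
      then show ?thesis using mult_left_mono[OF bd[of x], of "norm (g x)"] \<open>B \<ge> 0\<close>
        by (simp add: norm_mult mult.commute)
    qed (simp add: supp)
  qed
qed

lemma L1_loc_integrable:
  "g \<in> L1_loc \<Longrightarrow> integrable lebesgue (\<lambda>x. indicator (cball 0 R) x *\<^sub>R g x)"
  using compact_cball[of 0 R] by (auto simp: L1_loc_def set_integrable_def)

lemma L1_loc_measurable:
  fixes g :: "'n::finite cfun"
  assumes "g \<in> L1_loc" shows "g \<in> borel_measurable lebesgue"
proof (rule borel_measurable_LIMSEQ_metric)
    show "(\<lambda>x. indicator (cball 0 (real k)) x *\<^sub>R g x) \<in> borel_measurable lebesgue" for k
      using L1_loc_integrable[OF assms] by (rule borel_measurable_integrable)
    fix x :: "real^'n"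
    have "\<forall>\<^sub>F k in sequentially. indicator (cball 0 (real k)) x *\<^sub>R g x = g x"
      using eventually_ge_at_top[of "nat \<lceil>norm x\<rceil>"]
    proof eventually_elim
      case (elim k)
      then have "norm x \<le> real k" using real_nat_ceiling_ge[of "norm x"] by linarith
      then show ?case by simp
    qed
    then show "(\<lambda>k. indicator (cball 0 (real k)) x *\<^sub>R g x) \<longlonglongrightarrow> g x"
      by (rule tendsto_eventually)
qed

text \<open>The real and the imaginary part are replaced separately by Borel functions equal to them
  almost everywhere; integrals over balls do not notice the change.\<close>

lemma L1_loc_borel_version:
  fixes g :: "'n::finite cfun"
  assumes "g \<in> L1_loc"
  shows "\<exists>g'. locally_integrable g' \<and> (AE x in lebesgue. g x = g' x)"
proof -
  note int = L1_loc_integrable[OF assms]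
  note [measurable] = L1_loc_measurable[OF assms]
  have re: "(\<lambda>x. Re (g x)) \<in> borel_measurable lebesgue" and im: "(\<lambda>x. Im (g x)) \<in> borel_measurable lebesgue"
    by measurable
  obtain a where a: "a \<in> borel_measurable lborel" "AE x in lborel. Re (g x) = a x"
    using completion_ex_borel_measurable_real[OF re] by (elim bexE)
  obtain b where b: "b \<in> borel_measurable lborel" "AE x in lborel. Im (g x) = b x"
    using completion_ex_borel_measurable_real[OF im] by (elim bexE)
  have [measurable]: "a \<in> borel_measurable borel" "b \<in> borel_measurable borel" using a b by auto
  let ?g = "\<lambda>x. Complex (a x) (b x)"
  have m [measurable]: "?g \<in> borel_measurable borel"
    by (simp add: borel_measurable_complex_iff)
  have ae: "AE x in lebesgue. g x = ?g x"
    using AE_completion[OF a(2)] AE_completion[OF b(2)] by eventually_elim (simp add: complex_eq_iff)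
  have "integrable lborel (\<lambda>x. indicator (cball 0 R) x *\<^sub>R ?g x)" for R
  proof -
    have i: "(\<lambda>x. indicator (cball 0 R) x *\<^sub>R ?g x) \<in> borel_measurable lborel"
      using m by measurable
    have "integrable lebesgue (\<lambda>x. indicator (cball 0 R) x *\<^sub>R ?g x)"
    proof (rule integrable_cong_AE_imp[OF int[of R] measurable_completion[OF i]])
      show "AE x in lebesgue. indicator (cball 0 R) x *\<^sub>R g x = indicator (cball 0 R) x *\<^sub>R ?g x"
        using ae by eventually_elim simp
    qed
    then show ?thesis by (simp only: integrable_completion[OF i])
  qed
  then show ?thesis using ae m by (intro exI[of _ ?g]) (simp add: locally_integrable_def)
qed

lemma locally_integrable_L1_loc:
  assumes "locally_integrable g" shows "g \<in> L1_loc"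
proof -
  have "g absolutely_integrable_on K" if K: "compact K" for K
  proof -
    obtain R where "\<forall>x\<in>K. norm x \<le> R" using compact_imp_bounded[OF K] unfolding bounded_iff by (elim exE)
    then have R: "K \<subseteq> cball 0 R" by auto
    have "set_integrable lborel (cball 0 R) g" using assms by (simp add: locally_integrable_def set_integrable_def)
    then have "g absolutely_integrable_on (cball 0 R)"
      unfolding set_integrable_def using assms
      by (subst integrable_completion) (auto simp: locally_integrable_def)
    then show ?thesis
      by (rule set_integrable_subset) (use R K in \<open>auto intro!: lmeasurable_compact fmeasurableD\<close>)
  qed
  then show ?thesis by (simp add: L1_loc_def)
qed

lemma represents_test:
  fixes g g' :: "'n::finite cfun"
  assumes "represents g T" "locally_integrable g'" "AE x in lebesgue. g x = g' x" "\<phi> \<in> test_functions"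
  shows "T \<phi> = (LINT x|lborel. g' x * \<phi> x)"
proof -
  have m: "g' \<in> borel_measurable borel" "\<phi> \<in> borel_measurable borel"
    using assms test_function_schwartz by (auto intro: schwartz_borel locally_integrable_borel)
  note [measurable] = m
  have [measurable]: "g' \<in> borel_measurable lebesgue" "\<phi> \<in> borel_measurable lebesgue"
    using m by (auto intro: measurable_completion)
  have [measurable]: "g \<in> borel_measurable lebesgue"
    using assms(1) L1_loc_measurable by (auto simp: represents_def)
  have "T \<phi> = (LINT x|lebesgue. g x * \<phi> x)" using assms by (simp add: represents_def)
  also have "\<dots> = (LINT x|lebesgue. g' x * \<phi> x)"
    by (rule integral_cong_AE) (use assms(3) in \<open>auto elim!: eventually_mono\<close>)
  also have "\<dots> = (LINT x|lborel. g' x * \<phi> x)"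
    by (rule lebesgue_integral_lborel) measurable
  finally show ?thesis .
qed

section \<open>Functions of polynomial growth as tempered distributions\<close>

definition poly_bounded :: "real \<Rightarrow> nat \<Rightarrow> 'n::finite cfun \<Rightarrow> bool" where
  "poly_bounded A N g \<longleftrightarrow> g \<in> borel_measurable borel \<and> (\<forall>x. norm (g x) \<le> A * (1 + norm x) ^ N)"

text \<open>In contrast to \<open>represents\<close>, the pairing is taken with every Schwartz
  function; for functions of polynomial growth the integral converges absolutely.\<close>

definition distr_of :: "'n::finite cfun \<Rightarrow> 'n distr" where
  "distr_of g = (\<lambda>\<phi>. if \<phi> \<in> schwartz then (LINT x|lborel. g x * \<phi> x) else 0)"

lemma poly_bounded_borel: "poly_bounded A N g \<Longrightarrow> g \<in> borel_measurable borel"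
  by (simp add: poly_bounded_def)

lemma poly_bounded_nonneg:
  fixes g :: "'n::finite cfun"
  assumes "poly_bounded A N g" shows "0 \<le> A"
proof -
  have "norm (g 0) \<le> A * (1 + norm (0 :: real^'n)) ^ N" using assms unfolding poly_bounded_def by blast
  then have "norm (g 0) \<le> A" by simp
  then show ?thesis using norm_ge_zero[of "g 0"] by linarith
qed

lemma poly_bounded_mult_decay:
  fixes g \<phi> :: "'n::finite cfun"
  assumes g: "poly_bounded A N g" and \<phi>: "\<phi> \<in> schwartz"
  shows "norm (g x * \<phi> x) \<le> A * schwartz_sup (N + (CARD('n) + 1)) \<phi> * decay x"
proof -
  let ?M = "CARD('n) + 1"
  have p: "(1 + norm x) ^ k > 0" for k by (simp add: add_pos_nonneg)
  have "norm (g x * \<phi> x) \<le> (A * (1 + norm x) ^ N) * (schwartz_sup (N + ?M) \<phi> / (1 + norm x) ^ (N + ?M))"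
    unfolding norm_mult using g poly_bounded_nonneg[OF g]
    by (intro mult_mono schwartz_decay0 \<phi>) (auto simp: poly_bounded_def)
  also have "\<dots> = A * schwartz_sup (N + ?M) \<phi> * decay x"
    unfolding decay_def power_add using p[of N] by (simp add: divide_simps)
  finally show ?thesis .
qed

lemma poly_bounded_mult_integrable:
  assumes g: "poly_bounded A N g" and \<phi>: "\<phi> \<in> schwartz"
  shows "integrable lborel (\<lambda>x. g x * \<phi> x)"
  by (rule decay_integrable[OF _ poly_bounded_mult_decay[OF g \<phi>]])
    (use poly_bounded_borel[OF g] schwartz_borel[OF \<phi>] in measurable)

lemma distr_of_tempered:
  fixes g :: "'n::finite cfun"
  assumes g: "poly_bounded A N g"
  shows "distr_of g \<in> tempered"
proof (rule temperedI)
  fix \<phi> :: "'n cfun" assume \<phi>: "\<phi> \<in> schwartz"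
  have "norm (LINT x|lborel. g x * \<phi> x) \<le> (LINT x|lborel. norm (g x * \<phi> x))" by (rule integral_norm_bound)
  also have "\<dots> \<le> A * schwartz_sup (N + (CARD('n) + 1)) \<phi> * decay_mass TYPE('n)"
    by (rule decay_integral_le[OF _ poly_bounded_mult_decay[OF g \<phi>]])
      (use poly_bounded_borel[OF g] schwartz_borel[OF \<phi>] in measurable)
  finally show "norm (distr_of g \<phi>) \<le> (A * decay_mass TYPE('n)) * schwartz_sup (N + (CARD('n) + 1)) \<phi>"
    using \<phi> by (simp add: distr_of_def mult_ac)
next
  fix \<phi> \<psi> :: "'n cfun" assume "\<phi> \<in> schwartz" "\<psi> \<in> schwartz"
  then show "distr_of g (\<lambda>x. \<phi> x + \<psi> x) = distr_of g \<phi> + distr_of g \<psi>"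
    by (simp add: distr_of_def schwartz_add distrib_left poly_bounded_mult_integrable[OF g])
next
  fix \<phi> :: "'n cfun" and c assume \<phi>: "\<phi> \<in> schwartz"
  have "(LINT x|lborel. g x * (c * \<phi> x)) = (LINT x|lborel. c * (g x * \<phi> x))" by (simp add: mult_ac)
  also have "\<dots> = c * (LINT x|lborel. g x * \<phi> x)" by (rule integral_mult_right_zero)
  finally show "distr_of g (\<lambda>x. c * \<phi> x) = c * distr_of g \<phi>"
    using \<phi> by (simp add: distr_of_def schwartz_cmult)
qed (simp add: distr_of_def)

lemma poly_bounded_locally_integrable:
  fixes g :: "'n::finite cfun"
  assumes g: "poly_bounded A N g" shows "locally_integrable g"
  unfolding locally_integrable_def
proof (intro conjI allI)
  note [measurable] = poly_bounded_borel[OF g]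
  show "g \<in> borel_measurable borel" by measurable
  fix R
  have "integrable lborel (\<lambda>x. indicator (cball (0::real^'n) R) x *\<^sub>R (A * (1 + norm x) ^ N))"
    by (rule borel_integrable_compact) (auto intro!: continuous_intros)
  then show "integrable lborel (\<lambda>x. indicator (cball 0 R) x *\<^sub>R g x)"
  proof (rule Bochner_Integration.integrable_bound)
    show "AE x in lborel. norm (indicator (cball 0 R) x *\<^sub>R g x) \<le> norm (indicator (cball 0 R) x *\<^sub>R (A * (1 + norm x) ^ N))"
      using g by (intro AE_I2) (auto simp: indicator_def poly_bounded_def intro: order_trans)
  qed measurable
qed

lemma distr_of_represents:
  fixes g :: "'n::finite cfun"
  assumes g: "poly_bounded A N g" shows "represents g (distr_of g)"
proof -
  have "distr_of g \<phi> = (LINT x|lebesgue. g x * \<phi> x)" if "\<phi> \<in> test_functions" for \<phi>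
  proof -
    note [measurable] = poly_bounded_borel[OF g] schwartz_borel[OF test_function_schwartz[OF that]]
    have "(LINT x|lebesgue. g x * \<phi> x) = (LINT x|lborel. g x * \<phi> x)"
      by (rule lebesgue_integral_lborel) measurable
    then show ?thesis using test_function_schwartz[OF that] by (simp add: distr_of_def)
  qed
  then show ?thesis
    using distr_of_tempered[OF g] locally_integrable_L1_loc[OF poly_bounded_locally_integrable[OF g]]
    by (simp add: represents_def)
qed

section \<open>Recovering a locally integrable function from its integrals against test
  functions\<close>

context dyadic_resolution
begin

lemma tempered_eq_distr_of:
  assumes "poly_bounded A N g" "T \<in> tempered" "\<And>\<phi>. \<phi> \<in> test_functions \<Longrightarrow> T \<phi> = (LINT x|lborel. g x * \<phi> x)"
  shows "T = distr_of (g :: 'n cfun)"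
  by (rule tempered_eqI[OF assms(2) distr_of_tempered[OF assms(1)]])
    (simp add: assms(3) distr_of_def test_function_schwartz)

text \<open>The indicator is convolved with a mollifier at scale \<open>2 ^ (- k)\<close>. Pointwise
  convergence can only fail on the boundary of the box, which is a null set.\<close>

lemma box_indicator_approximation:
  fixes a b :: "real^'n"
  shows "\<exists>\<psi> R. (\<forall>k::nat. \<psi> k \<in> test_functions) \<and> (\<forall>k x. norm (\<psi> k x) \<le> 1) \<and> (\<forall>k x. norm x > R \<longrightarrow> \<psi> k x = 0) \<and>
     (AE x in lborel. (\<lambda>k. \<psi> k x) \<longlonglongrightarrow> indicator (cbox a b) x)"
proof -
  let ?Q = "cbox a b"
  obtain \<rho> :: "'n cfun" where \<rho>: "\<rho> \<in> test_functions" "\<And>x. norm x > 2 \<Longrightarrow> \<rho> x = 0" "(LINT x|lborel. \<rho> x) = 1"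
    "(LINT x|lborel. norm (\<rho> x)) = 1"
    using mollifier_exists by blast
  have \<rho>s: "\<rho> \<in> schwartz" by (rule test_function_schwartz[OF \<rho>(1)])
  have \<rho>i: "integrable lborel \<rho>" by (rule schwartz_integrable[OF \<rho>s])
  note [measurable] = schwartz_borel[OF \<rho>s]
  define \<kappa> where "\<kappa> k x = of_real ((2 ^ k) ^ CARD('n)) * \<rho> (2 ^ k *\<^sub>R x)" for k :: nat and x
  define \<psi> where "\<psi> k x = (LINT y|lborel. \<kappa> k (x - y) * indicator ?Q y)" for k x
  have \<kappa>s: "\<kappa> k \<in> schwartz" for k
    unfolding \<kappa>_def[abs_def] by (intro schwartz_cmult schwartz_dilate \<rho>s) auto
  have Qi: "integrable lborel (indicator ?Q :: real^'n \<Rightarrow> complex)"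
  proof (rule Bochner_Integration.integrable_bound)
    show "integrable lborel (indicator ?Q :: real^'n \<Rightarrow> real)"
      using emeasure_lborel_cbox_finite[of a b] by (intro integrable_real_indicator) auto
  qed (auto simp: indicator_def)
  \<comment> \<open>After rescaling, the dependence on \<open>k\<close> sits in the argument of the
    indicator alone, so \<open>norm (\<rho> z)\<close> dominates the integrand for all
    \<open>k\<close>.\<close>
  have eq: "\<psi> k x = (LINT z|lborel. \<rho> z * indicator ?Q (x - (1 / 2 ^ k) *\<^sub>R z))" for k x
  proof -
    have i: "integrable lborel (\<lambda>y. \<kappa> k y * indicator ?Q (x - y))"
    proof (rule Bochner_Integration.integrable_bound[OF schwartz_integrable[OF \<kappa>s[of k]]])
      note [measurable] = schwartz_borel[OF \<kappa>s[of k]]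
      show "(\<lambda>y. \<kappa> k y * indicator ?Q (x - y)) \<in> borel_measurable lborel" by measurable
    qed (auto simp: indicator_def)
    have "\<psi> k x = (LINT y|lborel. \<kappa> k y * indicator ?Q (x - y))"
      unfolding \<psi>_def using integral_reflect[of "\<lambda>y. \<kappa> k y * indicator ?Q (x - y)" x] schwartz_borel[OF \<kappa>s[of k]]
      by simp
    also have "\<dots> = \<bar>1 / 2 ^ k\<bar> ^ DIM(real^'n) *\<^sub>R (LINT z|lborel. \<kappa> k ((1 / 2 ^ k) *\<^sub>R z) * indicator ?Q (x - (1 / 2 ^ k) *\<^sub>R z))"
      by (rule integral_dilate[OF i]) simp
    also have "(LINT z|lborel. \<kappa> k ((1 / 2 ^ k) *\<^sub>R z) * indicator ?Q (x - (1 / 2 ^ k) *\<^sub>R z))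
       = (LINT z|lborel. of_real ((2 ^ k) ^ CARD('n)) * (\<rho> z * indicator ?Q (x - (1 / 2 ^ k) *\<^sub>R z)))"
      by (intro Bochner_Integration.integral_cong refl) (simp add: \<kappa>_def)
    also have "\<dots> = of_real ((2 ^ k) ^ CARD('n)) * (LINT z|lborel. \<rho> z * indicator ?Q (x - (1 / 2 ^ k) *\<^sub>R z))"
      by (rule integral_mult_right_zero)
    finally show ?thesis by (simp add: scaleR_conv_of_real power_one_over)
  qed
  obtain R0 where R0: "\<forall>x\<in>?Q. norm x \<le> R0"
    using bounded_cbox[of a b] unfolding bounded_iff by (elim exE)
  \<comment> \<open>\<open>\<rho>\<close> lives in the ball of radius 2 and is contracted by
    \<open>2 ^ (- k) \<le> 1\<close>, so the radius of the support grows by at most 2.\<close>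
  have supp: "\<psi> k x = 0" if "norm x > R0 + 2" for k x
  proof -
    have "\<rho> z * indicator ?Q (x - (1 / 2 ^ k) *\<^sub>R z) = 0" for z
    proof (cases "norm z > 2")
      case False
      have "norm ((1 / 2 ^ k) *\<^sub>R z) \<le> 1 * norm z" unfolding norm_scaleR by (intro mult_right_mono) auto
      then have "norm (x - (1 / 2 ^ k) *\<^sub>R z) > R0"
        using norm_triangle_ineq2[of x "(1 / 2 ^ k) *\<^sub>R z"] that False by simp
      then show ?thesis using R0 by (auto simp: indicator_def not_le[symmetric])
    qed (simp add: \<rho>)
    then show ?thesis unfolding eq by (simp only: Bochner_Integration.integral_zero)
  qed
  have "\<psi> k \<in> test_functions" for k
    unfolding \<psi>_def[abs_def]
    by (rule test_functionI[OF smooth_convolution[OF \<kappa>s Qi]]) (use supp[unfolded \<psi>_def] in blast)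
  moreover have "norm (\<psi> k x) \<le> 1" for k x
  proof -
    have "norm (\<psi> k x) \<le> (LINT z|lborel. norm (\<rho> z * indicator ?Q (x - (1 / 2 ^ k) *\<^sub>R z)))"
      unfolding eq by (rule integral_norm_bound)
    also have "\<dots> \<le> (LINT z|lborel. norm (\<rho> z))"
    proof (intro integral_mono integrable_norm \<rho>i)
      show "integrable lborel (\<lambda>z. \<rho> z * indicator ?Q (x - (1 / 2 ^ k) *\<^sub>R z))"
        by (rule Bochner_Integration.integrable_bound[OF \<rho>i]) (auto simp: indicator_def)
    qed (auto simp: indicator_def)
    finally show ?thesis using \<rho> by simp
  qed
  moreover have "AE x in lborel. (\<lambda>k. \<psi> k x) \<longlonglongrightarrow> indicator ?Q x"
  proof -
    have "AE x in lborel. x \<notin> cbox a b - box a b"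
      using negligible_frontier_interval[of a b]
      by (intro AE_not_in) (simp add: negligible_iff_null_sets null_sets_completion_iff)
    then show ?thesis
    proof eventually_elim
      case (elim x)
      have ev: "\<forall>\<^sub>F k in sequentially. indicator ?Q (x - (1 / 2 ^ k) *\<^sub>R z) = (indicator ?Q x :: complex)" for z
      proof -
        have "(\<lambda>k. (1 / 2) ^ k) \<longlonglongrightarrow> (0::real)" by (rule LIMSEQ_power_zero) simp
        then have "(\<lambda>k. x - ((1 / 2) ^ k) *\<^sub>R z) \<longlonglongrightarrow> x - 0 *\<^sub>R z"
          by (intro tendsto_diff tendsto_scaleR tendsto_const)
        then have l: "(\<lambda>k. x - (1 / 2 ^ k) *\<^sub>R z) \<longlonglongrightarrow> x" by (simp add: power_one_over)
        show ?thesis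
        proof (cases "x \<in> box a b")
          case True
          show ?thesis
            using topological_tendstoD[OF l open_box True] by eventually_elim (use True box_subset_cbox in \<open>auto simp: indicator_def\<close>)
        next
          case False
          then have x: "x \<in> - ?Q" using elim by auto
          show ?thesis
            using topological_tendstoD[OF l _ x] closed_cbox[of a b] by (auto elim!: eventually_mono simp: indicator_def x[simplified])
        qed
      qed
      have "(\<lambda>k. LINT z|lborel. \<rho> z * indicator ?Q (x - (1 / 2 ^ k) *\<^sub>R z)) \<longlonglongrightarrow> (LINT z|lborel. \<rho> z * indicator ?Q x)"
      proof (rule integral_dominated_convergence[where w = "\<lambda>z. norm (\<rho> z)"])
        show "AE z in lborel. (\<lambda>k. \<rho> z * indicator ?Q (x - (1 / 2 ^ k) *\<^sub>R z)) \<longlonglongrightarrow> \<rho> z * indicator ?Q x"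
          by (intro AE_I2 tendsto_mult tendsto_const tendsto_eventually ev)
      qed (use \<rho>i in \<open>auto simp: indicator_def\<close>)
      then show ?case unfolding eq by (simp add: \<rho>)
    qed
  qed
  ultimately show ?thesis using supp by blast
qed

text \<open>Test functions approximate indicators of boxes, so the hypothesis passes to averages over small
  cubes, which converge to \<open>g\<close> almost everywhere.\<close>

lemma ae_bound_from_test:
  fixes g :: "'n cfun" and w :: "real^'n \<Rightarrow> real"
  assumes g: "locally_integrable g" and w: "continuous_on UNIV w" "\<And>x. 0 \<le> w x"
    and bd: "\<And>\<phi>. \<phi> \<in> test_functions \<Longrightarrow> norm (LINT x|lborel. g x * \<phi> x) \<le> (LINT x|lborel. w x * norm (\<phi> x))"
  shows "AE x in lborel. norm (g x) \<le> w x"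
proof -
  note [measurable] = locally_integrable_borel[OF g] borel_measurable_continuous_onI[OF w(1)]
  have wi: "integrable lborel (\<lambda>x. indicator K x *\<^sub>R w x)" if "compact K" for K
    using that by (rule borel_integrable_compact) (rule continuous_on_subset[OF w(1)], simp)
  have gi: "integrable lborel (\<lambda>x. indicator (cbox a b) x *\<^sub>R g x)" for a b
  proof -
    obtain R where "\<forall>x\<in>cbox a b. norm x \<le> R" using bounded_cbox[of a b] unfolding bounded_iff by (elim exE)
    then have R: "cbox a b \<subseteq> cball 0 R" by auto
    have "integrable lborel (\<lambda>x. indicator (cball 0 R) x *\<^sub>R g x)" using g by (simp add: locally_integrable_def)
    then show ?thesis
    proof (rule Bochner_Integration.integrable_bound)
      show "AE x in lborel. norm (indicator (cbox a b) x *\<^sub>R g x) \<le> norm (indicator (cball 0 R) x *\<^sub>R g x)"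
        using R by (intro AE_I2) (auto simp: indicator_def subset_iff)
    qed measurable
  qed
  have box: "norm (LINT x|lborel. indicator (cbox a b) x *\<^sub>R g x) \<le> (LINT x|lborel. indicator (cbox a b) x *\<^sub>R w x)" for a b
  proof -
    obtain \<psi> R where \<psi>: "\<And>k::nat. \<psi> k \<in> test_functions" "\<And>k x. norm (\<psi> k x) \<le> 1" "\<And>k x. norm x > R \<Longrightarrow> \<psi> k x = 0"
      and ae: "AE x in lborel. (\<lambda>k. \<psi> k x) \<longlonglongrightarrow> indicator (cbox a b) x"
      using box_indicator_approximation[of a b] by blast
    have [measurable]: "\<psi> k \<in> borel_measurable borel" for k
      by (intro schwartz_borel test_function_schwartz \<psi>)
    have le: "norm (\<psi> k x) \<le> indicator (cball 0 R) x" for k x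
      using \<psi>(2)[of k x] \<psi>(3)[of x k] by (auto simp: indicator_def not_le)
    have "(\<lambda>k. LINT x|lborel. g x * \<psi> k x) \<longlonglongrightarrow> (LINT x|lborel. g x * indicator (cbox a b) x)"
    proof (rule integral_dominated_convergence[where w = "\<lambda>x. norm (indicator (cball 0 R) x *\<^sub>R g x)"])
      show "integrable lborel (\<lambda>x. norm (indicator (cball 0 R) x *\<^sub>R g x))"
        using g by (intro integrable_norm) (simp add: locally_integrable_def)
      show "AE x in lborel. norm (g x * \<psi> k x) \<le> norm (indicator (cball 0 R) x *\<^sub>R g x)" for k
      proof (intro AE_I2)
        fix x
        show "norm (g x * \<psi> k x) \<le> norm (indicator (cball 0 R) x *\<^sub>R g x)"
          using mult_right_mono[OF le[of k x] norm_ge_zero[of "g x"]] by (simp add: norm_mult mult.commute)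
      qed
      show "AE x in lborel. (\<lambda>k. g x * \<psi> k x) \<longlonglongrightarrow> g x * indicator (cbox a b) x"
        using ae by eventually_elim (intro tendsto_mult tendsto_const)
    qed measurable
    moreover have "(\<lambda>k. LINT x|lborel. w x * norm (\<psi> k x)) \<longlonglongrightarrow> (LINT x|lborel. w x * norm (indicator (cbox a b) x :: complex))"
    proof (rule integral_dominated_convergence[where w = "\<lambda>x. indicator (cball 0 R) x *\<^sub>R w x"])
      show "AE x in lborel. norm (w x * norm (\<psi> k x)) \<le> indicator (cball 0 R) x *\<^sub>R w x" for k
      proof (intro AE_I2)
        fix x
        show "norm (w x * norm (\<psi> k x)) \<le> indicator (cball 0 R) x *\<^sub>R w x"
          using mult_right_mono[OF le[of k x] w(2)[of x]] by (simp add: abs_mult w(2) mult.commute)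
      qed
      show "AE x in lborel. (\<lambda>k. w x * norm (\<psi> k x)) \<longlonglongrightarrow> w x * norm (indicator (cbox a b) x :: complex)"
        using ae by eventually_elim (intro tendsto_mult tendsto_const tendsto_norm)
    qed (use wi[of "cball 0 R"] in auto)
    ultimately have "norm (LINT x|lborel. g x * indicator (cbox a b) x) \<le> (LINT x|lborel. w x * norm (indicator (cbox a b) x :: complex))"
      using bd[OF \<psi>(1)] by (intro LIMSEQ_le[OF tendsto_norm[of "\<lambda>k. LINT x|lborel. g x * \<psi> k x"]]) auto
    moreover have "g x * indicator (cbox a b) x = indicator (cbox a b) x *\<^sub>R g x"
      "w x * norm (indicator (cbox a b) x :: complex) = indicator (cbox a b) x *\<^sub>R w x" for x
      by (auto simp: indicator_def)
    ultimately show ?thesis by simp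
  qed
  have gset: "set_integrable lborel (cbox a b) g" for a b using gi by (simp add: set_integrable_def)
  have gint: "g integrable_on cbox a b" for a b
    by (rule set_borel_integral_eq_integral(1)[OF gset])
  obtain N where N: "negligible N" and lim: "\<And>x e. x \<notin> N \<Longrightarrow> 0 < e \<Longrightarrow>
       \<exists>d>0. \<forall>h. 0 < h \<and> h < d \<longrightarrow> norm (integral (cbox x (x + h *\<^sub>R One)) g /\<^sub>R h ^ DIM(real^'n) - g x) < e"
    by (rule integrable_ccontinuous_explicit[OF gint]) blast
  have "norm (g x) \<le> w x" if x: "x \<notin> N" for x
  proof (rule field_le_epsilon)
    fix e :: real assume e: "e > 0"
    obtain d where d: "d > 0" "\<And>h. 0 < h \<Longrightarrow> h < d \<Longrightarrow> norm (integral (cbox x (x + h *\<^sub>R One)) g /\<^sub>R h ^ DIM(real^'n) - g x) < e/2"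
      using lim[OF x, of "e/2"] e by auto
    obtain \<delta> where \<delta>: "\<delta> > 0" "\<And>y. dist y x < \<delta> \<Longrightarrow> dist (w y) (w x) < e/2"
      using w(1)[unfolded continuous_on_iff, rule_format, of x "e/2"] e by auto
    \<comment> \<open>Small enough for the averaging estimate, and for the cube of side
      \<open>h\<close>, whose points have distance at most \<open>CARD('n) * h\<close> from
      \<open>x\<close>, to stay where \<open>w\<close> varies by less than
      \<open>e / 2\<close>.\<close>
    define h where "h = min (d/2) (\<delta> / (2 * (real CARD('n))))"
    have h: "h > 0" "h < d" "real CARD('n) * h < \<delta>"
      using d(1) \<delta>(1) by (auto simp: h_def min_def field_simps)
    let ?Q = "cbox x (x + h *\<^sub>R One)"
    have wQ: "w y \<le> w x + e/2" if "y \<in> ?Q" for y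
    proof -
      have c: "\<bar>(y - x) \<bullet> b\<bar> \<le> h" if "b \<in> Basis" for b
        using \<open>y \<in> ?Q\<close> that by (auto simp: mem_box inner_diff_left inner_add_left)
      have "norm (y - x) \<le> (\<Sum>b\<in>Basis. \<bar>(y - x) \<bullet> b\<bar>)" by (rule norm_le_l1)
      also have "\<dots> \<le> (\<Sum>b\<in>(Basis :: (real^'n) set). h)" by (intro sum_mono c)
      also have "\<dots> < \<delta>" using h(3) by simp
      finally have "dist (w y) (w x) < e/2" by (intro \<delta>) (simp add: dist_norm)
      then show ?thesis unfolding dist_real_def by linarith
    qed
    have mQ: "measure lborel ?Q = h ^ DIM(real^'n)"
      using h(1) by (subst content_cbox) (auto simp: inner_add_left)
    have "norm (integral ?Q g) = norm (LINT y|lborel. indicator ?Q y *\<^sub>R g y)"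
      using set_borel_integral_eq_integral(2)[OF gset, of x "x + h *\<^sub>R One"] by (simp add: set_lebesgue_integral_def)
    also have "\<dots> \<le> (LINT y|lborel. indicator ?Q y *\<^sub>R w y)" by (rule box)
    also have "\<dots> \<le> (LINT y|lborel. indicator ?Q y *\<^sub>R (w x + e/2))"
      by (intro integral_mono wi compact_cbox borel_integrable_compact continuous_on_const) (auto simp: indicator_def wQ)
    also have "\<dots> = h ^ DIM(real^'n) * (w x + e/2)"
      by (simp add: mQ)
    finally have "norm (integral ?Q g /\<^sub>R h ^ DIM(real^'n)) \<le> w x + e/2"
      using h(1) by (simp add: divide_inverse[symmetric] field_simps)
    moreover have "norm (g x) \<le> norm (integral ?Q g /\<^sub>R h ^ DIM(real^'n)) + norm (integral ?Q g /\<^sub>R h ^ DIM(real^'n) - g x)"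
      by (metis norm_minus_commute norm_triangle_sub)
    ultimately show "norm (g x) \<le> w x + e" using d(2)[OF h(1,2)] by linarith
  qed
  moreover have "AE x in lebesgue. x \<notin> N" using N by (intro AE_not_in) (simp add: negligible_iff_null_sets)
  ultimately have "AE x in lebesgue. norm (g x) \<le> w x" by (auto elim: eventually_mono)
  then show ?thesis by (simp add: AE_completion_iff)
qed

text \<open>The weight \<open>w = 0\<close> in \<open>ae_bound_from_test\<close>, applied to the
  difference.\<close>

lemma locally_integrable_ae_unique:
  fixes g h :: "'n cfun"
  assumes g: "locally_integrable g" and h: "locally_integrable h"
    and eq: "\<And>\<phi>. \<phi> \<in> test_functions \<Longrightarrow> (LINT x|lborel. g x * \<phi> x) = (LINT x|lborel. h x * \<phi> x)"
  shows "AE x in lborel. g x = h x"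
proof -
  have "AE x in lborel. norm (g x - h x) \<le> 0"
  proof (rule ae_bound_from_test)
    show "locally_integrable (\<lambda>x. g x - h x)"
      using g h by (auto simp: locally_integrable_def scaleR_diff_right)
    fix \<phi> :: "'n cfun" assume \<phi>: "\<phi> \<in> test_functions"
    obtain R where R: "\<And>x. norm x > R \<Longrightarrow> \<phi> x = 0" using test_function_support[OF \<phi>] by blast
    have s: "\<phi> \<in> schwartz" by (rule test_function_schwartz[OF \<phi>])
    have i: "integrable lborel (\<lambda>x. g x * \<phi> x)" "integrable lborel (\<lambda>x. h x * \<phi> x)"
      using schwartz_decay0[OF s, of _ 0] R
      by (auto intro!: locally_integrable_mult[OF g schwartz_borel[OF s], of "schwartz_sup 0 \<phi>"]
          locally_integrable_mult[OF h schwartz_borel[OF s], of "schwartz_sup 0 \<phi>"])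
    show "norm (LINT x|lborel. (g x - h x) * \<phi> x) \<le> (LINT x|lborel. 0 * norm (\<phi> x))"
      by (simp add: left_diff_distrib i eq[OF \<phi>])
  qed auto
  then show ?thesis by (auto elim: eventually_mono)
qed

lemma represents_ae_unique:
  fixes g :: "'n cfun"
  assumes g: "represents g T" and h: "locally_integrable h"
    and eq: "\<And>\<phi>. \<phi> \<in> test_functions \<Longrightarrow> T \<phi> = (LINT x|lborel. h x * \<phi> x)"
  shows "AE x in lebesgue. g x = h x"
proof -
  obtain g' where g': "locally_integrable g'" "AE x in lebesgue. g x = g' x"
    using L1_loc_borel_version g by (auto simp: represents_def)
  have "AE x in lborel. g' x = h x"
    by (rule locally_integrable_ae_unique[OF g'(1) h]) (metis represents_test[OF g g'] eq)
  from AE_completion[OF this] g'(2) show ?thesis by eventually_elim simp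
qed

end

section \<open>Fourier multipliers on functions of polynomial growth\<close>

text \<open>Convolution with \<open>inv_fourier \<sigma>\<close>, that is, the operator which
  multiplies the Fourier transform by \<open>\<sigma>\<close>. The kernel form makes sense for every
  \<open>u\<close> of polynomial growth; \<open>fourier_const\<close> compensates the normalisation
  of the transform.\<close>

definition multiplier :: "'n::finite cfun \<Rightarrow> 'n cfun \<Rightarrow> 'n cfun" where
  "multiplier \<sigma> u x = of_real (fourier_const TYPE('n)) * (LINT y|lborel. inv_fourier \<sigma> (x - y) * u y)"

lemma weighted_integrable:
  fixes \<phi> :: "'n::finite cfun"
  assumes "\<phi> \<in> schwartz"
  shows "integrable lborel (\<lambda>x. (1 + norm x) ^ N * norm (\<phi> x))"
proof -
  have n: "norm (complex_of_real ((1 + norm x) ^ N)) = (1 + norm x) ^ N" for x :: "real^'n"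
    by (subst norm_of_real) simp
  have "(\<lambda>x::real^'n. complex_of_real ((1 + norm x) ^ N)) \<in> borel_measurable borel" by measurable
  then have "poly_bounded 1 N (\<lambda>x::real^'n. of_real ((1 + norm x) ^ N))"
    unfolding poly_bounded_def n by simp
  from integrable_norm[OF poly_bounded_mult_integrable[OF this assms]]
  show ?thesis unfolding norm_mult n .
qed

text \<open>An inequality of Peetre type. It moves a polynomial weight from \<open>y\<close> to
  \<open>x\<close> at the expense of a weight in \<open>x - y\<close>, which a Schwartz kernel
  absorbs.\<close>

lemma weight_shift: "(1 + norm (y::'a::real_normed_vector)) ^ N \<le> (1 + norm x) ^ N * (1 + norm (x - y)) ^ N"
proof -
  have "norm y \<le> norm x + norm (x - y)" by (metis norm_minus_commute norm_triangle_sub)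
  moreover have "0 \<le> norm x * norm (x - y)" by simp
  moreover have "(1 + a) * (1 + b) = 1 + a + b + a * b" for a b :: real by (simp add: algebra_simps)
  ultimately have "1 + norm y \<le> (1 + norm x) * (1 + norm (x - y))" by (simp only:)
  then show ?thesis unfolding power_mult_distrib[symmetric] by (intro power_mono) auto
qed

lemma poly_bounded_shift:
  assumes "poly_bounded A N u"
  shows "norm (u y) \<le> A * (1 + norm x) ^ N * (1 + norm (x - y)) ^ N"
proof -
  have "norm (u y) \<le> A * (1 + norm y) ^ N" using assms by (simp add: poly_bounded_def)
  also have "\<dots> \<le> A * ((1 + norm x) ^ N * (1 + norm (x - y)) ^ N)"
    by (intro mult_left_mono weight_shift poly_bounded_nonneg[OF assms])
  finally show ?thesis by (simp add: mult.assoc)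
qed

lemma convolution_integrable:
  fixes \<kappa> u :: "'n::finite cfun"
  assumes \<kappa>: "\<kappa> \<in> schwartz" and u: "poly_bounded A N u"
  shows "integrable lborel (\<lambda>y. \<kappa> (x - y) * u y)"
proof (rule Bochner_Integration.integrable_bound)
  note [measurable] = schwartz_borel[OF \<kappa>] poly_bounded_borel[OF u]
  show "(\<lambda>y. \<kappa> (x - y) * u y) \<in> borel_measurable lborel" by measurable
  show "integrable lborel (\<lambda>y. A * (1 + norm x) ^ N * ((1 + norm (x - y)) ^ N * norm (\<kappa> (x - y))))"
    by (intro integrable_mult_right integrable_reflect[OF weighted_integrable[OF \<kappa>]])
  show "AE y in lborel. norm (\<kappa> (x - y) * u y) \<le> norm (A * (1 + norm x) ^ N * ((1 + norm (x - y)) ^ N * norm (\<kappa> (x - y))))"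
  proof (intro AE_I2)
    fix y
    have "norm (u y) * norm (\<kappa> (x - y)) \<le> A * (1 + norm x) ^ N * (1 + norm (x - y)) ^ N * norm (\<kappa> (x - y))"
      by (intro mult_right_mono poly_bounded_shift u) auto
    then show "norm (\<kappa> (x - y) * u y) \<le> norm (A * (1 + norm x) ^ N * ((1 + norm (x - y)) ^ N * norm (\<kappa> (x - y))))"
      using poly_bounded_nonneg[OF u] by (simp add: norm_mult abs_mult mult_ac)
  qed
qed

lemma multiplier_integrable:
  "\<sigma> \<in> schwartz \<Longrightarrow> poly_bounded A N u \<Longrightarrow> integrable lborel (\<lambda>y. inv_fourier \<sigma> (x - y) * u y)"
  by (intro convolution_integrable inv_fourier_schwartz)

lemma multiplier_borel:
  fixes u :: "'n::finite cfun"
  assumes "\<sigma> \<in> schwartz" "u \<in> borel_measurable borel"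
  shows "multiplier \<sigma> u \<in> borel_measurable borel"
proof -
  note [measurable] = assms(2) schwartz_borel[OF inv_fourier_schwartz[OF assms(1)]]
  have "(\<lambda>x. LINT y|lborel. inv_fourier \<sigma> (x - y) * u y) \<in> borel_measurable (borel :: (real^'n) measure)"
    by (rule lborel.borel_measurable_lebesgue_integral) measurable
  then show ?thesis unfolding multiplier_def[abs_def] by measurable
qed

lemma multiplier_norm_le:
  fixes u :: "'n::finite cfun"
  assumes \<sigma>: "\<sigma> \<in> schwartz" and u: "u \<in> borel_measurable borel"
  shows "ennreal (norm (multiplier \<sigma> u x)) \<le> ennreal (fourier_const TYPE('n)) * (\<integral>\<^sup>+y. ennreal (norm (inv_fourier \<sigma> (x - y)) * norm (u y)) \<partial>lborel)"
proof -
  let ?f = "\<lambda>y. inv_fourier \<sigma> (x - y) * u y"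
  \<comment> \<open>If the kernel integral does not converge, its default value 0 satisfies the
    bound trivially.\<close>
  have "ennreal (norm (LINT y|lborel. ?f y)) \<le> (\<integral>\<^sup>+y. ennreal (norm (?f y)) \<partial>lborel)"
    by (cases "integrable lborel ?f") (auto intro: integral_norm_bound_ennreal simp: not_integrable_integral_eq)
  then have "ennreal (fourier_const TYPE('n)) * ennreal (norm (LINT y|lborel. ?f y)) \<le> ennreal (fourier_const TYPE('n)) * (\<integral>\<^sup>+y. ennreal (norm (?f y)) \<partial>lborel)"
    by (intro mult_left_mono) auto
  then show ?thesis using fourier_const_pos[where 'n = 'n]
    by (simp add: multiplier_def norm_mult ennreal_mult)
qed

lemma multiplier_poly_bounded:
  fixes u :: "'n::finite cfun"
  assumes \<sigma>: "\<sigma> \<in> schwartz" and u: "poly_bounded A N u"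
  shows "poly_bounded (fourier_const TYPE('n) * A * (LINT z|lborel. (1 + norm z) ^ N * norm (inv_fourier \<sigma> z))) N (multiplier \<sigma> u)"
  unfolding poly_bounded_def
proof (intro conjI allI multiplier_borel \<sigma> poly_bounded_borel[OF u])
  fix x
  let ?K = "inv_fourier \<sigma>"
  note Ks = inv_fourier_schwartz[OF \<sigma>]
  note [measurable] = schwartz_borel[OF Ks]
  have "norm (LINT y|lborel. ?K (x - y) * u y) \<le> (LINT y|lborel. norm (?K (x - y) * u y))" by (rule integral_norm_bound)
  also have "\<dots> \<le> (LINT y|lborel. A * (1 + norm x) ^ N * ((1 + norm (x - y)) ^ N * norm (?K (x - y))))"
  proof (intro integral_mono integrable_norm multiplier_integrable[OF \<sigma> u] integrable_mult_right
      integrable_reflect[OF weighted_integrable[OF Ks]])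
    fix y
    have "norm (u y) * norm (?K (x - y)) \<le> A * (1 + norm x) ^ N * (1 + norm (x - y)) ^ N * norm (?K (x - y))"
      by (intro mult_right_mono poly_bounded_shift u) auto
    then show "norm (?K (x - y) * u y) \<le> A * (1 + norm x) ^ N * ((1 + norm (x - y)) ^ N * norm (?K (x - y)))"
      by (simp add: norm_mult mult_ac)
  qed
  also have "\<dots> = A * (1 + norm x) ^ N * (LINT z|lborel. (1 + norm z) ^ N * norm (?K z))"
    using integral_reflect[of "\<lambda>z. (1 + norm z) ^ N * norm (?K z)" x] by simp
  finally have "fourier_const TYPE('n) * norm (LINT y|lborel. ?K (x - y) * u y) \<le> fourier_const TYPE('n) * (A * (1 + norm x) ^ N * (LINT z|lborel. (1 + norm z) ^ N * norm (?K z)))"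
    using fourier_const_pos[where 'n = 'n] by (intro mult_left_mono) auto
  then show "norm (multiplier \<sigma> u x) \<le> fourier_const TYPE('n) * A * (LINT z|lborel. (1 + norm z) ^ N * norm (?K z)) * (1 + norm x) ^ N"
    using fourier_const_pos[where 'n = 'n] by (simp add: multiplier_def norm_mult mult_ac)
qed

text \<open>The operator depends on \<open>u\<close> up to null sets only, while its value is
  defined at every point. An identity \<open>u = multiplier \<sigma> u\<close> that holds almost
  everywhere thus becomes exact once \<open>u\<close> is replaced by the right side.\<close>

lemma multiplier_cong_AE:
  fixes u v :: "'n::finite cfun"
  assumes \<sigma>: "\<sigma> \<in> schwartz" and u: "u \<in> borel_measurable borel" "v \<in> borel_measurable borel"
    and ae: "AE x in lborel. u x = v x"
  shows "multiplier \<sigma> u = multiplier \<sigma> v"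
proof
  fix x
  note [measurable] = u schwartz_borel[OF inv_fourier_schwartz[OF \<sigma>]]
  have "(LINT y|lborel. inv_fourier \<sigma> (x - y) * u y) = (LINT y|lborel. inv_fourier \<sigma> (x - y) * v y)"
    by (rule integral_cong_AE) (use ae in \<open>auto elim!: eventually_mono\<close>)
  then show "multiplier \<sigma> u x = multiplier \<sigma> v x" by (simp add: multiplier_def)
qed

lemma inv_fourier_diff:
  assumes "f \<in> schwartz" "g \<in> schwartz"
  shows "inv_fourier (\<lambda>\<xi>. f \<xi> - g \<xi>) x = inv_fourier f x - inv_fourier g x"
  by (simp add: inv_fourier_eq schwartz_borel schwartz_diff assms right_diff_distrib exp_mult_integrable schwartz_integrable)

lemma multiplier_symbol_diff:
  assumes "\<sigma> \<in> schwartz" "\<psi> \<in> schwartz" "poly_bounded A N u"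
  shows "multiplier (\<lambda>\<xi>. \<sigma> \<xi> - \<psi> \<xi>) u x = multiplier \<sigma> u x - multiplier \<psi> u x"
  using multiplier_integrable[OF assms(1,3), of x] multiplier_integrable[OF assms(2,3), of x]
  by (simp add: multiplier_def inv_fourier_diff assms left_diff_distrib right_diff_distrib)

lemma multiplier_add:
  assumes "\<sigma> \<in> schwartz" "poly_bounded A N u" "poly_bounded B M v"
  shows "multiplier \<sigma> (\<lambda>x. u x + v x) x = multiplier \<sigma> u x + multiplier \<sigma> v x"
  using multiplier_integrable[OF assms(1,2), of x] multiplier_integrable[OF assms(1,3), of x]
  by (simp add: multiplier_def distrib_left)

lemma multiplier_cmult: "multiplier \<sigma> (\<lambda>x. c * u x) x = c * multiplier \<sigma> u x"
proof -
  have "(LINT y|lborel. inv_fourier \<sigma> (x - y) * (c * u y)) = (LINT y|lborel. c * (inv_fourier \<sigma> (x - y) * u y))"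
    by (simp add: mult_ac)
  then show ?thesis by (simp add: multiplier_def)
qed

text \<open>The convolution theorem in the form needed for the adjoint: filtering a test function by
  \<open>\<sigma>\<close> on the Fourier side is integration against the kernel
  \<open>inv_fourier \<sigma>\<close>.\<close>

lemma fourier_mult_inv_fourier:
  fixes \<sigma> \<phi> :: "'n::finite cfun"
  assumes \<sigma>: "\<sigma> \<in> schwartz" and \<phi>: "\<phi> \<in> schwartz"
  shows "fourier (\<lambda>\<xi>. \<sigma> \<xi> * inv_fourier \<phi> \<xi>) y = of_real (fourier_const TYPE('n)) * (LINT x|lborel. inv_fourier \<sigma> (x - y) * \<phi> x)"
proof -
  let ?c = "complex_of_real (fourier_const TYPE('n))"
  note [measurable] = schwartz_borel[OF \<sigma>] schwartz_borel[OF \<phi>] schwartz_borel[OF inv_fourier_schwartz[OF \<phi>]]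
  have "(LINT \<xi>|lborel. exp (\<i> * of_real (\<xi> \<bullet> - y)) * (\<sigma> \<xi> * inv_fourier \<phi> \<xi>))
    = (LINT \<xi>|lborel. LINT x|lborel. ?c * (exp (\<i> * of_real (\<xi> \<bullet> (x - y))) * \<sigma> \<xi>) * \<phi> x)"
  proof (intro Bochner_Integration.integral_cong refl)
    fix \<xi> :: "real^'n"
    have "exp (\<i> * of_real (\<xi> \<bullet> - y)) * (\<sigma> \<xi> * inv_fourier \<phi> \<xi>)
      = (?c * exp (\<i> * of_real (\<xi> \<bullet> - y)) * \<sigma> \<xi>) * (LINT x|lborel. exp (\<i> * of_real (x \<bullet> \<xi>)) * \<phi> x)"
      by (simp add: inv_fourier_eq mult_ac)
    also have "\<dots> = (LINT x|lborel. (?c * exp (\<i> * of_real (\<xi> \<bullet> - y)) * \<sigma> \<xi>) * (exp (\<i> * of_real (x \<bullet> \<xi>)) * \<phi> x))"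
      by (rule integral_mult_right_zero[symmetric])
    also have "\<dots> = (LINT x|lborel. ?c * (exp (\<i> * of_real (\<xi> \<bullet> (x - y))) * \<sigma> \<xi>) * \<phi> x)"
      by (intro Bochner_Integration.integral_cong refl)
        (simp add: inner_diff_right exp_diff exp_minus inner_commute right_diff_distrib divide_simps)
    finally show "exp (\<i> * of_real (\<xi> \<bullet> - y)) * (\<sigma> \<xi> * inv_fourier \<phi> \<xi>) = (LINT x|lborel. ?c * (exp (\<i> * of_real (\<xi> \<bullet> (x - y))) * \<sigma> \<xi>) * \<phi> x)" .
  qed
  also have "\<dots> = (LINT x|lborel. LINT \<xi>|lborel. ?c * (exp (\<i> * of_real (\<xi> \<bullet> (x - y))) * \<sigma> \<xi>) * \<phi> x)"
    by (rule fubini_dominated[OF _ _ _ integrable_mult_right[OF integrable_norm[OF schwartz_integrable[OF \<sigma>]], of "norm ?c"] _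
          integrable_norm[OF schwartz_integrable[OF \<phi>]]])
      (auto simp: norm_mult sigma_finite_lborel)
  also have "\<dots> = (LINT x|lborel. inv_fourier \<sigma> (x - y) * \<phi> x)"
    by (simp add: inv_fourier_eq)
  finally show ?thesis
    using schwartz_borel[OF schwartz_mult[OF \<sigma> inv_fourier_schwartz[OF \<phi>]]] by (simp add: fourier_eq)
qed

text \<open>Identifies the operator, defined by a kernel, with the transpose of filtering test
  functions. Through this the distributional definition of a band of \<open>f\<close> becomes a
  statement about functions.\<close>

lemma multiplier_adjoint:
  fixes \<sigma> \<phi> u :: "'n::finite cfun"
  assumes \<sigma>: "\<sigma> \<in> schwartz" and \<phi>: "\<phi> \<in> schwartz" and u: "poly_bounded A N u"
  shows "(LINT y|lborel. u y * fourier (\<lambda>\<xi>. \<sigma> \<xi> * inv_fourier \<phi> \<xi>) y) = (LINT x|lborel. multiplier \<sigma> u x * \<phi> x)"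
proof -
  let ?c = "complex_of_real (fourier_const TYPE('n))"
  let ?K = "inv_fourier \<sigma>"
  note Ks = inv_fourier_schwartz[OF \<sigma>]
  note [measurable] = schwartz_borel[OF Ks] schwartz_borel[OF \<phi>] poly_bounded_borel[OF u]
  have "(LINT y|lborel. u y * fourier (\<lambda>\<xi>. \<sigma> \<xi> * inv_fourier \<phi> \<xi>) y)
    = (LINT y|lborel. ?c * (LINT x|lborel. u y * ?K (x - y) * \<phi> x))"
  proof (intro Bochner_Integration.integral_cong refl)
    fix y
    have "u y * (LINT x|lborel. ?K (x - y) * \<phi> x) = (LINT x|lborel. u y * (?K (x - y) * \<phi> x))"
      by (rule integral_mult_right_zero[symmetric])
    then show "u y * fourier (\<lambda>\<xi>. \<sigma> \<xi> * inv_fourier \<phi> \<xi>) y = ?c * (LINT x|lborel. u y * ?K (x - y) * \<phi> x)"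
      by (simp add: fourier_mult_inv_fourier[OF \<sigma> \<phi>] mult.left_commute mult.assoc)
  qed
  also have "\<dots> = ?c * (LINT y|lborel. LINT x|lborel. u y * ?K (x - y) * \<phi> x)"
    by (rule integral_mult_right_zero)
  also have "(LINT y|lborel. LINT x|lborel. u y * ?K (x - y) * \<phi> x) = (LINT x|lborel. LINT y|lborel. u y * ?K (x - y) * \<phi> x)"
  proof (rule fubini_conv_dominated[symmetric, where a = "\<lambda>x. A * ((1 + norm x) ^ N * norm (\<phi> x))" and b = "\<lambda>z. (1 + norm z) ^ N * norm (?K z)"])
    fix x y
    have "norm (u y) * (norm (?K (x - y)) * norm (\<phi> x)) \<le> A * (1 + norm x) ^ N * (1 + norm (x - y)) ^ N * (norm (?K (x - y)) * norm (\<phi> x))"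
      by (intro mult_right_mono poly_bounded_shift u) auto
    then show "norm (u y * ?K (x - y) * \<phi> x) \<le> A * ((1 + norm x) ^ N * norm (\<phi> x)) * ((1 + norm (x - y)) ^ N * norm (?K (x - y)))"
      by (simp add: norm_mult mult_ac)
  qed (auto intro!: integrable_mult_right weighted_integrable Ks \<phi> mult_nonneg_nonneg poly_bounded_nonneg[OF u])
  also have "?c * \<dots> = (LINT x|lborel. ?c * (LINT y|lborel. u y * ?K (x - y) * \<phi> x))"
    by (rule integral_mult_right_zero[symmetric])
  also have "\<dots> = (LINT x|lborel. multiplier \<sigma> u x * \<phi> x)"
  proof (intro Bochner_Integration.integral_cong refl)
    fix x
    have "(LINT y|lborel. u y * ?K (x - y) * \<phi> x) = (LINT y|lborel. ?K (x - y) * u y) * \<phi> x"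
      by (simp add: mult.commute[of "u _"])
    then show "?c * (LINT y|lborel. u y * ?K (x - y) * \<phi> x) = multiplier \<sigma> u x * \<phi> x" by (simp add: multiplier_def)
  qed
  finally show ?thesis .
qed

text \<open>Characters are eigenfunctions of convolutions; the eigenvalue is the transform of the
  kernel, which by Fourier inversion is \<open>\<sigma> \<theta>\<close>.\<close>

lemma kernel_exp_integral:
  fixes \<sigma> :: "'n::finite cfun"
  assumes \<sigma>: "\<sigma> \<in> schwartz"
  shows "of_real (fourier_const TYPE('n)) * (LINT y|lborel. inv_fourier \<sigma> (x - y) * exp (\<i> * of_real (y \<bullet> \<theta>))) = exp (\<i> * of_real (x \<bullet> \<theta>)) * \<sigma> \<theta>"
proof -
  let ?c = "complex_of_real (fourier_const TYPE('n))" and ?K = "inv_fourier \<sigma>"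
  note Ks = inv_fourier_schwartz[OF \<sigma>]
  note [measurable] = schwartz_borel[OF Ks]
  have "(LINT y|lborel. ?K (x - y) * exp (\<i> * of_real (y \<bullet> \<theta>))) = (LINT z|lborel. ?K z * exp (\<i> * of_real ((x - z) \<bullet> \<theta>)))"
    using integral_reflect[of "\<lambda>z. ?K z * exp (\<i> * of_real ((x - z) \<bullet> \<theta>))" x] by simp
  also have "\<dots> = (LINT z|lborel. exp (\<i> * of_real (x \<bullet> \<theta>)) * (exp (\<i> * of_real (z \<bullet> - \<theta>)) * ?K z))"
    by (intro Bochner_Integration.integral_cong refl)
      (simp add: inner_diff_left exp_diff exp_minus right_diff_distrib divide_simps)
  also have "\<dots> = exp (\<i> * of_real (x \<bullet> \<theta>)) * (LINT z|lborel. exp (\<i> * of_real (z \<bullet> - \<theta>)) * ?K z)"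
    by (rule integral_mult_right_zero)
  also have "?c * \<dots> = exp (\<i> * of_real (x \<bullet> \<theta>)) * fourier ?K \<theta>"
    by (simp add: fourier_eq mult_ac)
  finally show ?thesis by (simp add: fourier_inv_fourier[OF \<sigma>])
qed

text \<open>A superposition of characters is multiplied by \<open>\<sigma>\<close> frequency by
  frequency. The parameter space \<open>M\<close> is arbitrary so that it can be the frequency space
  itself or, for products, the space of pairs of frequencies.\<close>

lemma multiplier_spectral:
  fixes \<sigma> :: "'n::finite cfun" and \<theta> :: "'t \<Rightarrow> real ^ 'n"
  assumes M: "sigma_finite_measure M" and \<sigma>: "\<sigma> \<in> schwartz" and \<psi>: "integrable M \<psi>"
    and \<theta> [measurable]: "\<theta> \<in> borel_measurable M"
  shows "multiplier \<sigma> (\<lambda>x. LINT t|M. exp (\<i> * of_real (x \<bullet> \<theta> t)) * \<psi> t) x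
     = (LINT t|M. exp (\<i> * of_real (x \<bullet> \<theta> t)) * (\<sigma> (\<theta> t) * \<psi> t))"
proof -
  let ?c = "complex_of_real (fourier_const TYPE('n))" and ?K = "inv_fourier \<sigma>"
  note Ks = inv_fourier_schwartz[OF \<sigma>]
  note [measurable] = schwartz_borel[OF Ks] borel_measurable_integrable[OF \<psi>]
  have "(LINT y|lborel. ?K (x - y) * (LINT t|M. exp (\<i> * of_real (y \<bullet> \<theta> t)) * \<psi> t))
    = (LINT y|lborel. LINT t|M. ?K (x - y) * (exp (\<i> * of_real (y \<bullet> \<theta> t)) * \<psi> t))"
    by simp
  also have "\<dots> = (LINT t|M. LINT y|lborel. ?K (x - y) * (exp (\<i> * of_real (y \<bullet> \<theta> t)) * \<psi> t))"
    by (rule fubini_dominated[OF _ M _ integrable_norm[OF integrable_reflect[OF schwartz_integrable[OF Ks], of x]] _ integrable_norm[OF \<psi>]])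
      (auto simp: norm_mult sigma_finite_lborel)
  finally have "multiplier \<sigma> (\<lambda>x. LINT t|M. exp (\<i> * of_real (x \<bullet> \<theta> t)) * \<psi> t) x
     = (LINT t|M. ?c * (LINT y|lborel. ?K (x - y) * (exp (\<i> * of_real (y \<bullet> \<theta> t)) * \<psi> t)))"
    by (simp add: multiplier_def)
  also have "\<dots> = (LINT t|M. exp (\<i> * of_real (x \<bullet> \<theta> t)) * (\<sigma> (\<theta> t) * \<psi> t))"
  proof (intro Bochner_Integration.integral_cong refl)
    fix t
    have "(LINT y|lborel. ?K (x - y) * (exp (\<i> * of_real (y \<bullet> \<theta> t)) * \<psi> t)) = (LINT y|lborel. ?K (x - y) * exp (\<i> * of_real (y \<bullet> \<theta> t))) * \<psi> t"
      by (simp add: mult.assoc[symmetric])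
    then have "?c * (LINT y|lborel. ?K (x - y) * (exp (\<i> * of_real (y \<bullet> \<theta> t)) * \<psi> t))
      = (?c * (LINT y|lborel. ?K (x - y) * exp (\<i> * of_real (y \<bullet> \<theta> t)))) * \<psi> t" by (simp only: mult.assoc)
    then show "?c * (LINT y|lborel. ?K (x - y) * (exp (\<i> * of_real (y \<bullet> \<theta> t)) * \<psi> t)) = exp (\<i> * of_real (x \<bullet> \<theta> t)) * (\<sigma> (\<theta> t) * \<psi> t)"
      unfolding kernel_exp_integral[OF \<sigma>] by (simp only: mult.assoc)
  qed
  finally show ?thesis .
qed

text \<open>As a function of \<open>y\<close> the kernel \<open>inv_fourier \<phi> (x - y)\<close>
  consists of the frequencies \<open>- \<xi>\<close> with \<open>\<phi> \<xi> \<noteq> 0\<close>,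
  which explains the sign in the hypothesis.\<close>

lemma multiplier_reflected_kernel:
  fixes \<sigma> \<phi> :: "'n::finite cfun"
  assumes \<sigma>: "\<sigma> \<in> schwartz" and \<phi>: "\<phi> \<in> schwartz" and eq: "\<And>\<xi>. \<sigma> (- \<xi>) * \<phi> \<xi> = \<phi> \<xi>"
  shows "multiplier \<sigma> (\<lambda>y. inv_fourier \<phi> (x - y)) = (\<lambda>y. inv_fourier \<phi> (x - y))"
proof -
  let ?c = "complex_of_real (fourier_const TYPE('n))"
  let ?\<psi> = "\<lambda>\<xi>. ?c * (exp (\<i> * of_real (\<xi> \<bullet> x)) * \<phi> \<xi>)"
  have k: "inv_fourier \<phi> (x - y) = (LINT \<xi>|lborel. exp (\<i> * of_real (y \<bullet> - \<xi>)) * ?\<psi> \<xi>)" for y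
  proof -
    have "inv_fourier \<phi> (x - y) = (LINT \<xi>|lborel. ?c * (exp (\<i> * of_real (\<xi> \<bullet> (x - y))) * \<phi> \<xi>))"
      by (simp add: inv_fourier_eq schwartz_borel[OF \<phi>])
    also have "\<dots> = (LINT \<xi>|lborel. exp (\<i> * of_real (y \<bullet> - \<xi>)) * ?\<psi> \<xi>)"
      by (intro Bochner_Integration.integral_cong refl)
        (simp add: inner_diff_right exp_diff exp_minus inner_commute right_diff_distrib divide_simps)
    finally show ?thesis .
  qed
  show ?thesis
    unfolding k
  proof
    fix y
    have e: "\<sigma> (- \<xi>) * ?\<psi> \<xi> = ?\<psi> \<xi>" for \<xi>
      using eq[of \<xi>] by (metis mult.left_commute)
    have "integrable lborel ?\<psi>"
      by (intro integrable_mult_right exp_mult_integrable schwartz_integrable \<phi>)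
    from multiplier_spectral[OF sigma_finite_lborel \<sigma> this, of uminus y]
    show "multiplier \<sigma> (\<lambda>y. LINT \<xi>|lborel. exp (\<i> * of_real (y \<bullet> - \<xi>)) * ?\<psi> \<xi>) y = (LINT \<xi>|lborel. exp (\<i> * of_real (y \<bullet> - \<xi>)) * ?\<psi> \<xi>)"
      unfolding e by simp
  qed
qed

text \<open>Frequencies add under multiplication: the product of the two kernels is a superposition,
  over pairs \<open>(\<xi>, \<eta>)\<close>, of characters with frequency
  \<open>\<xi> + \<eta>\<close>, and \<open>\<sigma>\<close> acts as 1 on those that occur.\<close>

lemma multiplier_kernel_product:
  fixes \<sigma> \<phi>1 \<phi>2 :: "'n::finite cfun"
  assumes \<sigma>: "\<sigma> \<in> schwartz" and \<phi>1: "\<phi>1 \<in> schwartz" and \<phi>2: "\<phi>2 \<in> schwartz"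
    and eq: "\<And>\<xi> \<eta>. \<sigma> (\<xi> + \<eta>) * (\<phi>1 \<xi> * \<phi>2 \<eta>) = \<phi>1 \<xi> * \<phi>2 \<eta>"
  shows "multiplier \<sigma> (\<lambda>x. inv_fourier \<phi>1 (x - y) * inv_fourier \<phi>2 (x - z)) w = inv_fourier \<phi>1 (w - y) * inv_fourier \<phi>2 (w - z)"
proof -
  let ?c = "complex_of_real (fourier_const TYPE('n))"
  let ?M = "lborel \<Otimes>\<^sub>M lborel :: ((real^'n) \<times> (real^'n)) measure"
  let ?\<psi> = "\<lambda>t. (?c * (exp (\<i> * of_real (fst t \<bullet> - y)) * \<phi>1 (fst t))) * (?c * (exp (\<i> * of_real (snd t \<bullet> - z)) * \<phi>2 (snd t)))"
  note [measurable] = schwartz_borel[OF \<phi>1] schwartz_borel[OF \<phi>2]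
  have sf: "sigma_finite_measure ?M" by (simp add: lborel_prod sigma_finite_lborel)
  have i1: "integrable lborel (\<lambda>\<xi>. norm (?c * \<phi>1 \<xi>))" "integrable lborel (\<lambda>\<xi>. norm (?c * \<phi>2 \<xi>))"
    by (intro integrable_norm integrable_mult_right schwartz_integrable \<phi>1 \<phi>2)+
  have \<psi>i: "integrable ?M ?\<psi>"
    by (rule pair_integrable_dominated[OF sigma_finite_lborel sigma_finite_lborel _ i1(1) _ i1(2)])
      (auto simp: norm_mult)
  have k: "inv_fourier \<phi>1 (x - y) * inv_fourier \<phi>2 (x - z) = (LINT t|?M. exp (\<i> * of_real (x \<bullet> (fst t + snd t))) * ?\<psi> t)" for x
  proof -
    let ?a = "\<lambda>\<xi>. ?c * (exp (\<i> * of_real (\<xi> \<bullet> (x - y))) * \<phi>1 \<xi>)"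
    let ?b = "\<lambda>\<eta>. ?c * (exp (\<i> * of_real (\<eta> \<bullet> (x - z))) * \<phi>2 \<eta>)"
    have ex: "exp (\<i> * of_real (x \<bullet> (\<xi> + \<eta>))) * (exp (\<i> * of_real (\<xi> \<bullet> - y)) * exp (\<i> * of_real (\<eta> \<bullet> - z)))
       = exp (\<i> * of_real (\<xi> \<bullet> (x - y))) * exp (\<i> * of_real (\<eta> \<bullet> (x - z)))" for \<xi> \<eta> :: "real^'n"
      unfolding mult_exp_exp by (simp add: inner_add_right inner_diff_right inner_commute algebra_simps)
    have "exp (\<i> * of_real (x \<bullet> (fst t + snd t))) * ?\<psi> t = ?a (fst t) * ?b (snd t)" for t
    proof -
      have "exp (\<i> * of_real (x \<bullet> (fst t + snd t))) * ?\<psi> t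
        = (exp (\<i> * of_real (x \<bullet> (fst t + snd t))) * (exp (\<i> * of_real (fst t \<bullet> - y)) * exp (\<i> * of_real (snd t \<bullet> - z)))) * (?c * \<phi>1 (fst t) * (?c * \<phi>2 (snd t)))"
        by (simp only: mult_ac)
      also have "\<dots> = ?a (fst t) * ?b (snd t)" unfolding ex by (simp only: mult_ac)
      finally show ?thesis .
    qed
    then have "(LINT t|?M. exp (\<i> * of_real (x \<bullet> (fst t + snd t))) * ?\<psi> t) = (LINT t|?M. ?a (fst t) * ?b (snd t))"
      by (simp only:)
    also have "\<dots> = (LINT \<xi>|lborel. LINT \<eta>|lborel. ?a \<xi> * ?b \<eta>)"
    proof -
      have "integrable ?M (\<lambda>t. ?a (fst t) * ?b (snd t))"
        by (rule pair_integrable_dominated[OF sigma_finite_lborel sigma_finite_lborel _ i1(1) _ i1(2)])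
          (auto simp: norm_mult)
      from lborel_pair.integral_fst'[OF this] show ?thesis by simp
    qed
    also have "\<dots> = inv_fourier \<phi>1 (x - y) * inv_fourier \<phi>2 (x - z)"
      by (simp add: inv_fourier_eq)
    finally show ?thesis by simp
  qed
  have e: "\<sigma> (fst t + snd t) * ?\<psi> t = ?\<psi> t" for t
  proof -
    have "\<sigma> (fst t + snd t) * ?\<psi> t = (?c * exp (\<i> * of_real (fst t \<bullet> - y)) * ?c * exp (\<i> * of_real (snd t \<bullet> - z))) * (\<sigma> (fst t + snd t) * (\<phi>1 (fst t) * \<phi>2 (snd t)))"
      by (simp only: mult_ac)
    also have "\<dots> = ?\<psi> t" unfolding eq by (simp only: mult_ac)
    finally show ?thesis .
  qed
  have "multiplier \<sigma> (\<lambda>x. LINT t|?M. exp (\<i> * of_real (x \<bullet> (fst t + snd t))) * ?\<psi> t) w = (LINT t|?M. exp (\<i> * of_real (w \<bullet> (fst t + snd t))) * ?\<psi> t)"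
    using multiplier_spectral[OF sf \<sigma> \<psi>i, of "\<lambda>t. fst t + snd t" w] unfolding e by simp
  then show ?thesis unfolding k .
qed

lemma poly_bounded_0D: "poly_bounded B 0 v \<Longrightarrow> norm (v x) \<le> B"
  by (simp add: poly_bounded_def)

text \<open>The factor \<open>v\<close> is replaced by its own kernel integral and the order of
  integration is exchanged, so that under the inner integral only values of the kernel remain in
  place of \<open>v\<close>.\<close>

lemma reproduced_integral:
  fixes \<phi> v a :: "'n::finite cfun"
  assumes \<phi>: "\<phi> \<in> schwartz" and v: "poly_bounded B 0 v" and rep: "multiplier \<phi> v = v" and a: "integrable lborel a"
  shows "(LINT x|lborel. a x * v x) = of_real (fourier_const TYPE('n)) * (LINT z|lborel. (LINT x|lborel. a x * inv_fourier \<phi> (x - z)) * v z)"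
proof -
  let ?c = "complex_of_real (fourier_const TYPE('n))" and ?K = "inv_fourier \<phi>"
  note Ks = inv_fourier_schwartz[OF \<phi>]
  note [measurable] = schwartz_borel[OF Ks] poly_bounded_borel[OF v] borel_measurable_integrable[OF a, simplified]
  have "(LINT x|lborel. a x * v x) = (LINT x|lborel. ?c * (LINT z|lborel. a x * ?K (x - z) * v z))"
  proof (intro Bochner_Integration.integral_cong refl)
    fix x :: "real^'n"
    have "a x * v x = a x * (?c * (LINT z|lborel. ?K (x - z) * v z))"
      using fun_cong[OF rep, of x] by (simp add: multiplier_def)
    also have "\<dots> = ?c * (a x * (LINT z|lborel. ?K (x - z) * v z))" by (simp only: mult_ac)
    also have "a x * (LINT z|lborel. ?K (x - z) * v z) = (LINT z|lborel. a x * (?K (x - z) * v z))"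
      by (rule integral_mult_right_zero[symmetric])
    finally show "a x * v x = ?c * (LINT z|lborel. a x * ?K (x - z) * v z)" by (simp only: mult.assoc)
  qed
  also have "\<dots> = ?c * (LINT x|lborel. LINT z|lborel. a x * ?K (x - z) * v z)" by (rule integral_mult_right_zero)
  also have "(LINT x|lborel. LINT z|lborel. a x * ?K (x - z) * v z) = (LINT z|lborel. LINT x|lborel. a x * ?K (x - z) * v z)"
  proof (rule fubini_conv_dominated[where a = "\<lambda>x. B * norm (a x)" and b = "\<lambda>z. norm (?K z)"])
    fix x z
    have "(norm (a x) * norm (?K (x - z))) * norm (v z) \<le> (norm (a x) * norm (?K (x - z))) * B"
      by (intro mult_left_mono poly_bounded_0D[OF v]) auto
    then show "norm (a x * ?K (x - z) * v z) \<le> B * norm (a x) * norm (?K (x - z))"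
      by (simp add: norm_mult mult_ac)
  qed (auto intro!: integrable_mult_right integrable_norm a schwartz_integrable Ks mult_nonneg_nonneg poly_bounded_nonneg[OF v])
  finally show ?thesis by simp
qed

text \<open>Both factors are expanded by their reproducing kernels. What remains under the integrals
  is a product of two kernels, which \<open>\<sigma>\<close> reproduces by
  \<open>multiplier_kernel_product\<close>; integrating back over \<open>y\<close> and then over
  \<open>z\<close> restores \<open>u\<close> and \<open>v\<close>.\<close>

lemma multiplier_product:
  fixes \<sigma> \<phi>1 \<phi>2 u v :: "'n::finite cfun"
  assumes \<sigma>: "\<sigma> \<in> schwartz" and \<phi>1: "\<phi>1 \<in> schwartz" and \<phi>2: "\<phi>2 \<in> schwartz"
    and eq: "\<And>\<xi> \<eta>. \<sigma> (\<xi> + \<eta>) * (\<phi>1 \<xi> * \<phi>2 \<eta>) = \<phi>1 \<xi> * \<phi>2 \<eta>"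
    and u: "poly_bounded A 0 u" "multiplier \<phi>1 u = u" and v: "poly_bounded B 0 v" "multiplier \<phi>2 v = v"
  shows "multiplier \<sigma> (\<lambda>x. u x * v x) = (\<lambda>x. u x * v x)"
proof
  fix w
  let ?c = "complex_of_real (fourier_const TYPE('n))"
  let ?K = "inv_fourier \<sigma>" and ?K1 = "inv_fourier \<phi>1" and ?K2 = "inv_fourier \<phi>2"
  note Ks = inv_fourier_schwartz[OF \<sigma>] inv_fourier_schwartz[OF \<phi>1] inv_fourier_schwartz[OF \<phi>2]
  note [measurable] = Ks[THEN schwartz_borel] poly_bounded_borel[OF u(1)] poly_bounded_borel[OF v(1)]
  \<comment> \<open>Here \<open>u\<close> is expanded while the kernel of \<open>v\<close> at the
    fixed point \<open>z\<close> stands in for \<open>v\<close>.\<close>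
  have inner: "?c * (LINT x|lborel. (?K (w - x) * u x) * ?K2 (x - z)) = ?K2 (w - z) * u w" for z
  proof -
    have i: "integrable lborel (\<lambda>x. ?K (w - x) * ?K2 (x - z))"
    proof -
      have "poly_bounded (schwartz_sup 0 ?K2) 0 (\<lambda>x. ?K2 (x - z))"
        using schwartz_decay0[OF Ks(3), of _ 0] by (auto simp: poly_bounded_def)
      then show ?thesis by (rule convolution_integrable[OF Ks(1)])
    qed
    have "(LINT x|lborel. (?K (w - x) * u x) * ?K2 (x - z)) = (LINT x|lborel. (?K (w - x) * ?K2 (x - z)) * u x)"
      by (simp add: mult_ac)
    also have "\<dots> = ?c * (LINT y|lborel. (LINT x|lborel. (?K (w - x) * ?K2 (x - z)) * ?K1 (x - y)) * u y)"
      by (rule reproduced_integral[OF \<phi>1 u i])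
    also have "?c * \<dots> = ?c * (LINT y|lborel. (?c * (LINT x|lborel. (?K (w - x) * ?K2 (x - z)) * ?K1 (x - y))) * u y)"
      by (simp only: mult.assoc integral_mult_right_zero)
    also have "\<dots> = ?c * (LINT y|lborel. (?c * (LINT x|lborel. ?K (w - x) * (?K1 (x - y) * ?K2 (x - z)))) * u y)"
      by (simp only: mult_ac)
    also have "\<dots> = ?c * (LINT y|lborel. (?K1 (w - y) * ?K2 (w - z)) * u y)"
      using multiplier_kernel_product[OF \<sigma> \<phi>1 \<phi>2 eq, of _ z w] unfolding multiplier_def by simp
    also have "\<dots> = ?c * (LINT y|lborel. ?K2 (w - z) * (?K1 (w - y) * u y))" by (simp add: mult_ac)
    also have "\<dots> = ?K2 (w - z) * multiplier \<phi>1 u w" by (simp add: multiplier_def)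
    finally show ?thesis unfolding u(2) .
  qed
  have "(LINT x|lborel. (?K (w - x) * u x) * v x) = ?c * (LINT z|lborel. (LINT x|lborel. (?K (w - x) * u x) * ?K2 (x - z)) * v z)"
    by (rule reproduced_integral[OF \<phi>2 v multiplier_integrable[OF \<sigma> u(1)]])
  then have "multiplier \<sigma> (\<lambda>x. u x * v x) w = ?c * (LINT z|lborel. (?c * (LINT x|lborel. (?K (w - x) * u x) * ?K2 (x - z))) * v z)"
    by (simp add: multiplier_def mult.assoc)
  also have "\<dots> = ?c * (LINT z|lborel. u w * (?K2 (w - z) * v z))" unfolding inner by (simp add: mult_ac)
  also have "\<dots> = u w * multiplier \<phi>2 v w" by (simp add: multiplier_def)
  finally show "multiplier \<sigma> (\<lambda>x. u x * v x) w = u w * v w" unfolding v(2) .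
qed

section \<open>Band-limited functions\<close>

text \<open>Allows an estimate whose proof divides by a quantity \<open>c\<close> to be shown for
  \<open>c + e\<close> only, so that \<open>c = 0\<close> needs no separate treatment.\<close>

lemma le_mult_epsilon:
  fixes a b c :: real
  assumes "0 \<le> b" "\<And>e. e > 0 \<Longrightarrow> a \<le> b * (c + e)"
  shows "a \<le> b * c"
proof (rule field_le_epsilon)
  fix e :: real assume e: "e > 0"
  have "a \<le> b * (c + e / (b + 1))" using assms e by simp
  also have "\<dots> = b * c + (b / (b + 1)) * e" by (simp add: distrib_left)
  also have "\<dots> \<le> b * c + 1 * e" using assms(1) e by (intro add_left_mono mult_right_mono) auto
  finally show "a \<le> b * c + e" by simp
qed

text \<open>This replaces Jensen's inequality below, at the cost of a constant, by choosing \<open>L\<close> to be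
  the mean value of \<open>t\<close>.\<close>

lemma le_power_split:
  fixes t L p :: real
  assumes "1 \<le> p" "0 \<le> t" "0 < L"
  shows "t \<le> L powr (1 - p) * t powr p + L"
proof (cases "t \<le> L")
  case True
  then show ?thesis by (simp add: add_increasing)
next
  case False
  then have "t = t powr (1 - p) * t powr p" using assms by (simp flip: powr_add)
  also have "\<dots> \<le> L powr (1 - p) * t powr p"
    using False assms by (intro mult_right_mono powr_mono2') auto
  finally show ?thesis using assms by simp
qed

text \<open>For \<open>p \<le> 1\<close> the power \<open>1 - p\<close> of \<open>t\<close> is
  estimated by an upper bound \<open>B\<close>. Applied pointwise, this bounds an
  \<open>L\<^sub>1\<close> integral by the integral of the \<open>p\<close>-th power times a power
  of the supremum.\<close>

lemma le_sup_power_split: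
  fixes t B p :: real
  assumes "0 < p" "p \<le> 1" "0 \<le> t" "t \<le> B"
  shows "t \<le> B powr (1 - p) * t powr p"
proof (cases "t = 0")
  case False
  then have "t = t powr (1 - p) * t powr p" using assms by (simp flip: powr_add)
  also have "\<dots> \<le> B powr (1 - p) * t powr p"
    using assms by (intro mult_right_mono powr_mono2) auto
  finally show ?thesis .
qed simp

lemma multiplier_one:
  fixes \<sigma> :: "'n::finite cfun"
  assumes "\<sigma> \<in> schwartz" shows "multiplier \<sigma> (\<lambda>x. 1) x = \<sigma> 0"
  using kernel_exp_integral[OF assms, of x 0] by (simp add: multiplier_def)

text \<open>The reproducing identity and \<open>le_sup_power_split\<close> bound the supremum
  \<open>a\<close> of \<open>u\<close> by a multiple of \<open>a powr (1 - p)\<close> times the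
  integral, and dividing by that power gives the claim. This needs \<open>a\<close> to be finite,
  whereas \<open>u\<close> is only known to grow polynomially; so \<open>u\<close> is divided by
  \<open>(1 + \<delta> * norm x) ^ N\<close>, and \<open>\<delta>\<close> tends to 0 at the
  end.\<close>

lemma small_exponent_bound:
  fixes u :: "'n::finite cfun"
  assumes \<sigma>: "\<sigma> \<in> schwartz" and u: "poly_bounded A N u" "multiplier \<sigma> u = u"
    and p: "0 < p" "p \<le> 1" and S: "\<And>z. norm (inv_fourier \<sigma> z) * (1 + norm z) ^ N \<le> S"
    and I: "0 \<le> I" "(\<integral>\<^sup>+y. ennreal (norm (u y) powr p) \<partial>lborel) \<le> ennreal I"
  shows "norm (u x) powr p \<le> fourier_const TYPE('n) * S * I"
proof -
  let ?c = "fourier_const TYPE('n)"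
  note [measurable] = poly_bounded_borel[OF u(1)]
  have c: "?c \<ge> 0" using fourier_const_pos[where 'n = 'n] by simp
  have S0: "S \<ge> 0" using order_trans[OF _ S[of 0]] by simp
  have A0: "A \<ge> 0" by (rule poly_bounded_nonneg[OF u(1)])
  have key: "norm (u x) powr p \<le> ?c * S * I * (1 + \<delta> * norm x) ^ N" if \<delta>: "0 < \<delta>" "\<delta> \<le> 1" for \<delta> x
  proof -
    define W where "W y = (1 + \<delta> * norm y) ^ N" for y :: "real^'n"
    have W1: "W y \<ge> 1" for y unfolding W_def using \<delta> by (intro one_le_power) simp
    have Wsh: "W y \<le> W x * (1 + norm (x - y)) ^ N" for x y :: "real^'n"
    proof -
      have "norm y \<le> norm x + norm (x - y)" by (metis norm_minus_commute norm_triangle_sub)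
      then have "\<delta> * norm y \<le> \<delta> * norm x + \<delta> * norm (x - y)"
        using \<delta> by (simp flip: distrib_left)
      also have "\<delta> * norm (x - y) \<le> 1 * norm (x - y)" using \<delta> by (intro mult_right_mono) auto
      finally have "1 + \<delta> * norm y \<le> (1 + \<delta> * norm x) + norm (x - y)" by simp
      also have "\<dots> \<le> (1 + \<delta> * norm x) + norm (x - y) + \<delta> * norm x * norm (x - y)" using \<delta> by simp
      also have "\<dots> = (1 + \<delta> * norm x) * (1 + norm (x - y))" by (simp add: algebra_simps)
      finally show ?thesis unfolding W_def power_mult_distrib[symmetric] using \<delta> by (intro power_mono) auto
    qed
    \<comment> \<open>Finite because \<open>W\<close> grows as fast as the polynomial bound of
      \<open>u\<close>. The bound \<open>A / \<delta> ^ N\<close> for it deteriorates as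
      \<open>\<delta>\<close> tends to 0 but does not enter the result.\<close>
    define a where "a = (SUP y. norm (u y) / W y)"
    have bdd: "bdd_above (range (\<lambda>y. norm (u y) / W y))"
    proof (rule bdd_aboveI2)
      fix y :: "real^'n"
      have "\<delta> * (1 + norm y) \<le> 1 + \<delta> * norm y" using \<delta> by (simp add: distrib_left)
      then have "(\<delta> * (1 + norm y)) ^ N \<le> W y" unfolding W_def using \<delta> by (intro power_mono) auto
      then have "A * (\<delta> ^ N * (1 + norm y) ^ N) \<le> A * W y" unfolding power_mult_distrib by (intro mult_left_mono A0)
      moreover have "\<delta> ^ N * norm (u y) \<le> \<delta> ^ N * (A * (1 + norm y) ^ N)"
        using u(1) \<delta> by (intro mult_left_mono) (auto simp: poly_bounded_def)
      ultimately have "\<delta> ^ N * norm (u y) \<le> A * W y" by (simp add: mult_ac)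
      then show "norm (u y) / W y \<le> A / \<delta> ^ N"
        using W1[of y] \<delta> by (simp add: field_simps)
    qed
    have ua: "norm (u y) \<le> a * W y" for y
    proof -
      have "norm (u y) / W y \<le> a" unfolding a_def by (rule cSUP_upper[OF _ bdd]) simp
      then show ?thesis using W1[of y] by (simp add: field_simps)
    qed
    have a0: "a \<ge> 0"
    proof -
      have "0 \<le> norm (u 0) / W 0" using W1[of 0] by simp
      also have "\<dots> \<le> a" unfolding a_def by (rule cSUP_upper[OF _ bdd]) simp
      finally show ?thesis .
    qed
    have est: "norm (u x) \<le> ?c * (a powr (1 - p) * W x * S * I)" for x
    proof -
      have pt: "norm (inv_fourier \<sigma> (x - y)) * norm (u y) \<le> (a powr (1 - p) * W x * S) * norm (u y) powr p" for y
      proof -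
        have "norm (u y) \<le> (a * W y) powr (1 - p) * norm (u y) powr p"
          using p by (intro le_sup_power_split ua) auto
        also have "\<dots> \<le> (a powr (1 - p) * W y) * norm (u y) powr p"
        proof (intro mult_right_mono)
          have "W y powr (1 - p) \<le> W y powr 1" using W1[of y] p by (intro powr_mono) auto
          then show "(a * W y) powr (1 - p) \<le> a powr (1 - p) * W y"
            using W1[of y] a0 by (simp add: powr_mult mult_left_mono)
        qed simp
        also have "\<dots> \<le> (a powr (1 - p) * (W x * (1 + norm (x - y)) ^ N)) * norm (u y) powr p"
          by (intro mult_right_mono mult_left_mono Wsh) auto
        finally have "norm (inv_fourier \<sigma> (x - y)) * norm (u y)
           \<le> norm (inv_fourier \<sigma> (x - y)) * ((a powr (1 - p) * (W x * (1 + norm (x - y)) ^ N)) * norm (u y) powr p)"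
          by (intro mult_left_mono) auto
        also have "\<dots> = (a powr (1 - p) * W x * norm (u y) powr p) * (norm (inv_fourier \<sigma> (x - y)) * (1 + norm (x - y)) ^ N)"
          by (simp only: mult_ac)
        also have "\<dots> \<le> (a powr (1 - p) * W x * norm (u y) powr p) * S"
          using W1[of x] by (intro mult_left_mono S mult_nonneg_nonneg) auto
        finally show ?thesis by (simp only: mult_ac)
      qed
      have nn: "0 \<le> a powr (1 - p) * W x * S" using W1[of x] S0 by (intro mult_nonneg_nonneg) auto
      have "ennreal (norm (u x)) \<le> ennreal ?c * (\<integral>\<^sup>+y. ennreal (norm (inv_fourier \<sigma> (x - y)) * norm (u y)) \<partial>lborel)"
        using multiplier_norm_le[OF \<sigma> poly_bounded_borel[OF u(1)], of x] unfolding u(2) .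
      also have "\<dots> \<le> ennreal ?c * (\<integral>\<^sup>+y. ennreal (a powr (1 - p) * W x * S) * ennreal (norm (u y) powr p) \<partial>lborel)"
        using nn by (intro mult_left_mono nn_integral_mono) (auto simp: pt ennreal_leI simp flip: ennreal_mult)
      also have "\<dots> = ennreal ?c * (ennreal (a powr (1 - p) * W x * S) * (\<integral>\<^sup>+y. ennreal (norm (u y) powr p) \<partial>lborel))"
        by (subst nn_integral_cmult) auto
      also have "\<dots> \<le> ennreal ?c * (ennreal (a powr (1 - p) * W x * S) * ennreal I)"
        by (intro mult_left_mono I) auto
      also have "\<dots> = ennreal (?c * (a powr (1 - p) * W x * S * I))"
        using c nn I by (simp add: ennreal_mult)
      finally show ?thesis
        using c nn I by (subst (asm) ennreal_le_iff) auto
    qed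
    \<comment> \<open>The supremum now stands on both sides, on the right with the smaller exponent
      \<open>1 - p\<close>.\<close>
    have "a \<le> ?c * S * I * a powr (1 - p)"
      unfolding a_def
    proof (rule cSUP_least)
      fix y
      show "norm (u y) / W y \<le> ?c * S * I * (SUP y. norm (u y) / W y) powr (1 - p)"
        using est[of y] W1[of y] unfolding a_def[symmetric] by (simp add: pos_divide_le_eq mult_ac)
    qed simp
    then have ap: "a powr p \<le> ?c * S * I"
    proof (cases "a = 0")
      case False
      then have "a powr (1 - p) > 0" "a = a powr p * a powr (1 - p)" using a0 by (auto simp flip: powr_add)
      with \<open>a \<le> ?c * S * I * a powr (1 - p)\<close> show ?thesis by (metis mult_le_cancel_right_pos)
    qed (use c S0 I in auto)
    have "norm (u x) powr p \<le> (a * W x) powr p" using p by (intro powr_mono2 ua) auto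
    also have "\<dots> = a powr p * W x powr p" using a0 W1[of x] by (simp add: powr_mult)
    also have "\<dots> \<le> (?c * S * I) * W x powr 1"
      using ap W1[of x] p by (intro mult_mono powr_mono) (auto intro: order_trans[OF _ ap])
    finally show ?thesis using W1[of x] by (simp add: W_def)
  qed
  have "(\<lambda>k. ?c * S * I * (1 + 1 / real (Suc k) * norm x) ^ N) \<longlonglongrightarrow> ?c * S * I * (1 + 0 * norm x) ^ N"
    using LIMSEQ_inverse_real_of_nat unfolding inverse_eq_divide
    by (intro tendsto_mult tendsto_const tendsto_power tendsto_add) auto
  moreover have "norm (u x) powr p \<le> ?c * S * I * (1 + 1 / real (Suc k) * norm x) ^ N" for k
    by (rule key) auto
  ultimately have "norm (u x) powr p \<le> ?c * S * I * (1 + 0 * norm x) ^ N"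
    by (intro LIMSEQ_le_const) blast+
  then show ?thesis by simp
qed

text \<open>\<open>n = CARD('n)\<close> powers of \<open>2 ^ l\<close> come from the scaling \<open>K\<^sub>l(x) = 2 ^ (l n) K\<^sub>0(2 ^ l x)\<close>.\<close>

definition scaled_kernels :: "(nat \<Rightarrow> 'n::finite cfun) \<Rightarrow> bool" where
  "scaled_kernels K \<longleftrightarrow> (\<forall>l. K l \<in> borel_measurable borel) \<and>
    (\<forall>M. \<exists>C\<ge>0. \<forall>l x. norm (K l x) \<le> C * (2 ^ l) ^ CARD('n) / (1 + 2 ^ l * norm x) ^ M)"

lemma scaled_kernels_sup:
  fixes K :: "nat \<Rightarrow> 'n::finite cfun"
  assumes "scaled_kernels K"
  shows "\<exists>C\<ge>0. \<forall>l z. norm (K l z) * (1 + norm z) ^ N \<le> C * (2 ^ l) ^ CARD('n)"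
proof -
  obtain C where C: "C \<ge> 0" "\<And>l x. norm (K l x) \<le> C * (2 ^ l) ^ CARD('n) / (1 + 2 ^ l * norm x) ^ N"
    using assms unfolding scaled_kernels_def by metis
  have "norm (K l z) * (1 + norm z) ^ N \<le> C * (2 ^ l) ^ CARD('n)" for l z
  proof -
    have "1 * norm z \<le> 2 ^ l * norm z" by (intro mult_right_mono) auto
    then have "(1 + norm z) ^ N \<le> (1 + 2 ^ l * norm z) ^ N" by (intro power_mono) auto
    then have "norm (K l z) * (1 + norm z) ^ N \<le> norm (K l z) * (1 + 2 ^ l * norm z) ^ N"
      by (intro mult_left_mono) auto
    also have "\<dots> \<le> C * (2 ^ l) ^ CARD('n)"
      using C(2)[of l z] by (simp add: pos_le_divide_eq add_pos_nonneg)
    finally show ?thesis .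
  qed
  then show ?thesis using C(1) by blast
qed

text \<open>Scaling: with \<open>n = CARD('n)\<close>, the bound for \<open>K l\<close> has height
  \<open>2 ^ (l n)\<close> and width \<open>2 ^ (- l)\<close>, so its \<open>r\<close>-th power has
  mass of order \<open>2 ^ (l n (r - 1))\<close>. For \<open>r = 1\<close> this does not depend on
  \<open>l\<close>.\<close>

lemma scaled_kernels_power_integral:
  fixes K :: "nat \<Rightarrow> 'n::finite cfun"
  assumes K: "scaled_kernels K" and r: "0 < r" "r \<le> 1"
  shows "\<exists>C>0. \<forall>l. (\<integral>\<^sup>+z. ennreal (norm (K l z) powr r) \<partial>lborel) \<le> ennreal (C * 2 powr (real l * real CARD('n) * (r - 1)))"
proof -
  let ?n = "CARD('n)"
  \<comment> \<open>With this \<open>M\<close> the \<open>r\<close>-th power of the decay still has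
    exponent at least \<open>CARD('n) + 1\<close>, hence is integrable.\<close>
  obtain M :: nat where M: "real (?n + 1) / r \<le> real M" using real_arch_simple by blast
  obtain C where C: "C \<ge> 0" "\<And>l x. norm (K l x) \<le> C * (2 ^ l) ^ ?n / (1 + 2 ^ l * norm x) ^ M"
    using K unfolding scaled_kernels_def by metis
  have bd: "(\<integral>\<^sup>+z. ennreal (norm (K l z) powr r) \<partial>lborel) \<le> ennreal ((C powr r * decay_mass TYPE('n)) * 2 powr (real l * real ?n * (r - 1)))" for l
  proof -
    have pt: "norm (K l z) powr r \<le> (C powr r * 2 powr (real l * real ?n * (r - 1))) * ((2 ^ l) ^ ?n * decay (2 ^ l *\<^sub>R z))" for z
    proof -
      let ?t = "1 + 2 ^ l * norm z"
      have t: "?t \<ge> 1" by simp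
      have "norm (K l z) powr r \<le> (C * (2 ^ l) ^ ?n / ?t ^ M) powr r"
        using r by (intro powr_mono2 C) auto
      also have "\<dots> = C powr r * ((2 ^ l) ^ ?n) powr r / (?t ^ M) powr r"
        using C(1) t by (simp add: powr_mult powr_divide)
      also have "\<dots> \<le> C powr r * ((2 ^ l) ^ ?n) powr r / ?t ^ (?n + 1)"
      proof (intro divide_left_mono)
        have "?t ^ (?n + 1) = ?t powr real (?n + 1)" using t by (intro powr_realpow[symmetric]) linarith
        also have "\<dots> \<le> ?t powr (real M * r)" using M r t by (intro powr_mono) (auto simp: field_simps)
        also have "\<dots> = (?t powr real M) powr r" by (simp only: powr_powr)
        also have "?t powr real M = ?t ^ M" using t by (intro powr_realpow) linarith
        finally show "?t ^ (?n + 1) \<le> (?t ^ M) powr r" .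
        have "0 < ?t ^ (?n + 1)" using t by (intro zero_less_power) linarith
        moreover have "0 < ?t ^ M" using t by (intro zero_less_power) linarith
        then have "0 < (?t ^ M) powr r" unfolding powr_gt_zero by linarith
        ultimately show "0 < (?t ^ M) powr r * ?t ^ (?n + 1)" by simp
      qed simp
      also have "((2 ^ l) ^ ?n) powr r = 2 powr (real l * real ?n * (r - 1)) * (2 ^ l) ^ ?n"
      proof -
        have "((2::real) ^ l) ^ ?n = 2 powr (real l * real ?n)"
          by (simp add: powr_realpow[symmetric] powr_powr)
        then show ?thesis by (simp add: powr_powr powr_add[symmetric] algebra_simps)
      qed
      finally show ?thesis unfolding decay_def by (simp add: mult_ac del: power_Suc)
    qed
    have nn: "0 \<le> C powr r * 2 powr (real l * real ?n * (r - 1))" by simp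
    have [measurable]: "(\<lambda>z. decay (2 ^ l *\<^sub>R z :: real^'n)) \<in> borel_measurable borel" by measurable
    have "(\<integral>\<^sup>+z. ennreal (norm (K l z) powr r) \<partial>lborel)
       \<le> (\<integral>\<^sup>+z. ennreal (C powr r * 2 powr (real l * real ?n * (r - 1))) * (ennreal ((2 ^ l) ^ ?n) * ennreal (decay (2 ^ l *\<^sub>R (z::real^'n)))) \<partial>lborel)"
      using pt by (intro nn_integral_mono) (simp add: ennreal_leI flip: ennreal_mult)
    also have "\<dots> = ennreal (C powr r * 2 powr (real l * real ?n * (r - 1))) * (ennreal ((2 ^ l) ^ ?n) * (\<integral>\<^sup>+z. ennreal (decay (2 ^ l *\<^sub>R (z::real^'n))) \<partial>lborel))"
      by (simp add: nn_integral_cmult)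
    also have "ennreal ((2 ^ l) ^ ?n) * (\<integral>\<^sup>+z. ennreal (decay (2 ^ l *\<^sub>R (z::real^'n))) \<partial>lborel) = (\<integral>\<^sup>+z. ennreal (decay (z::real^'n)) \<partial>lborel)"
      by (subst (2) nn_integral_dilate[of _ "2 ^ l"]) auto
    also have "\<dots> = ennreal (decay_mass TYPE('n))"
      unfolding decay_mass_def by (rule nn_integral_eq_integral[OF decay_integrable_self]) simp
    finally show ?thesis using decay_mass_nonneg[where 'n = 'n] by (simp add: ennreal_mult[symmetric] mult_ac)
  qed
  have "(\<integral>\<^sup>+z. ennreal (norm (K l z) powr r) \<partial>lborel) \<le> ennreal ((C powr r * decay_mass TYPE('n) + 1) * 2 powr (real l * real ?n * (r - 1)))" for l
    by (rule order_trans[OF bd]) (intro ennreal_leI mult_right_mono, auto)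
  then show ?thesis
    using decay_mass_nonneg[where 'n = 'n] by (intro exI[of _ "C powr r * decay_mass TYPE('n) + 1"]) (auto intro: add_nonneg_pos)
qed

section \<open>Bands, their products, and the inequality of Nikolskii\<close>

context dyadic_resolution
begin

text \<open>States without the Fourier transform of \<open>u\<close> that the spectrum lies where
  \<open>cutoff j\<close> equals 1. Boundedness is included because the product rule for multipliers
  requires it.\<close>

definition band :: "nat \<Rightarrow> 'n cfun \<Rightarrow> bool" where
  "band j u \<longleftrightarrow> (\<exists>B. poly_bounded B 0 u) \<and> multiplier (cutoff j) u = u"

text \<open>Where the symbols do not vanish, \<open>\<xi>\<close> and \<open>\<eta>\<close> are
  shorter than \<open>3 / 2 * 2 ^ i\<close>, so their sum is shorter than \<open>3 * 2 ^ i\<close>,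
  where a cut-off two levels higher equals 1.\<close>

lemma cutoff_product_symbol:
  assumes "i + 2 \<le> k"
  shows "cutoff k (\<xi> + \<eta>) * (cutoff i \<xi> * cutoff i \<eta>) = cutoff i \<xi> * cutoff i \<eta>"
proof (cases "cutoff i \<xi> = 0 \<or> cutoff i \<eta> = 0")
  case False
  then have "norm \<xi> < 3 / 2 * 2 ^ i" "norm \<eta> < 3 / 2 * 2 ^ i"
    using cutoff_eq_0 not_less by blast+
  then have "norm (\<xi> + \<eta>) < 3 * 2 ^ i" using norm_triangle_ineq[of \<xi> \<eta>] by simp
  also have "\<dots> \<le> 2 ^ (i + 2)" by simp
  also have "\<dots> \<le> 2 ^ k" using assms by (intro power_increasing) auto
  finally show ?thesis by (simp add: cutoff_eq_1)
qed auto

lemma poly_bounded_0_mult: "poly_bounded A 0 u \<Longrightarrow> poly_bounded B 0 v \<Longrightarrow> poly_bounded (A * B) 0 (\<lambda>x. u x * v x)"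
  using poly_bounded_nonneg[of A 0 u]
  by (auto simp: poly_bounded_def norm_mult intro!: mult_mono)

lemma band_mult:
  assumes "band i u" "band i v" "i + 2 \<le> k"
  shows "band k (\<lambda>x. u x * v x)"
proof -
  obtain A B where "poly_bounded A 0 u" "poly_bounded B 0 v" using assms by (auto simp: band_def)
  then show ?thesis
    using assms multiplier_product[OF cutoff_schwartz cutoff_schwartz cutoff_schwartz cutoff_product_symbol[OF assms(3)]]
      poly_bounded_0_mult unfolding band_def by blast
qed

lemma band_one: "band i (\<lambda>x. 1)"
proof -
  have "poly_bounded 1 0 (\<lambda>x::real^'n. 1)" by (simp add: poly_bounded_def)
  then show ?thesis unfolding band_def
    by (auto simp: multiplier_one[OF cutoff_schwartz] cutoff_eq_1 intro!: ext)
qed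

text \<open>Obtained as the product with the constant function 1, which lies in every band; hence
  the loss of two levels.\<close>

lemma band_mono: "band i u \<Longrightarrow> i + 2 \<le> k \<Longrightarrow> band k u"
  using band_mult[OF _ band_one, of i u k] by simp

lemma poly_bounded_add:
  "poly_bounded A N u \<Longrightarrow> poly_bounded B N v \<Longrightarrow> poly_bounded (A + B) N (\<lambda>x. u x + v x)"
  by (auto simp: poly_bounded_def distrib_right intro!: norm_triangle_mono)

lemma band_add:
  assumes "band i u" "band i v" shows "band i (\<lambda>x. u x + v x)"
proof -
  obtain A B where "poly_bounded A 0 u" "poly_bounded B 0 v" using assms by (auto simp: band_def)
  then show ?thesis
    using assms multiplier_add[OF cutoff_schwartz] poly_bounded_add[of A 0 u B v] unfolding band_def
    by (auto intro!: ext)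
qed

lemma band_zero: "band i (\<lambda>x. 0)"
proof -
  have "poly_bounded 0 0 (\<lambda>x::real^'n. 0)" by (simp add: poly_bounded_def)
  then show ?thesis unfolding band_def by (auto simp: multiplier_def)
qed

lemma band_sum: "(\<And>k. k \<in> F \<Longrightarrow> band i (u k)) \<Longrightarrow> band i (\<lambda>x. \<Sum>k\<in>F. u k x)"
  by (induction F rule: infinite_finite_induct) (simp_all add: band_add band_zero)

text \<open>\<open>dyadic \<phi>0 l\<close> is the difference of the cut-offs of levels
  \<open>l\<close> and \<open>l - 1\<close>, and both reproduce \<open>h\<close> as soon as
  \<open>l - 1 \<ge> i + 2\<close>.\<close>

lemma multiplier_dyadic_vanish:
  assumes "band i h" "i + 3 \<le> l"
  shows "multiplier (dyadic \<phi>0 l) h x = 0"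
proof -
  obtain k where k: "l = Suc k" "i + 2 \<le> k" using assms(2) by (cases l) auto
  obtain B where B: "poly_bounded B 0 h" using assms by (auto simp: band_def)
  have "band (Suc k) h" "band k h" using k by (auto intro: band_mono[OF assms(1)])
  then show ?thesis unfolding k(1) dyadic_Suc_eq
    by (subst multiplier_symbol_diff[OF cutoff_schwartz cutoff_schwartz B]) (simp add: band_def)
qed

lemma inv_fourier_cutoff: "inv_fourier (cutoff l) x = of_real ((2 ^ l) ^ CARD('n)) * inv_fourier \<phi>0 (2 ^ l *\<^sub>R x)"
proof -
  have "(LINT \<xi>|lborel. exp (\<i> * of_real (\<xi> \<bullet> x)) * cutoff l \<xi>)
     = \<bar>2 ^ l\<bar> ^ DIM(real^'n) *\<^sub>R (LINT \<xi>|lborel. exp (\<i> * of_real ((2 ^ l *\<^sub>R \<xi>) \<bullet> x)) * cutoff l (2 ^ l *\<^sub>R \<xi>))"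
    by (rule integral_dilate) (auto intro: exp_mult_integrable schwartz_integrable cutoff_schwartz)
  also have "\<dots> = of_real ((2 ^ l) ^ CARD('n)) * (LINT \<xi>|lborel. exp (\<i> * of_real (\<xi> \<bullet> (2 ^ l *\<^sub>R x))) * \<phi>0 \<xi>)"
    by (simp add: cutoff_def scaleR_conv_of_real[where 'a = complex])
  finally show ?thesis
    by (simp add: inv_fourier_eq schwartz_borel[OF cutoff_schwartz] schwartz_borel[OF schwartz_\<phi>0] mult_ac)
qed

lemma scaled_kernels_cutoff: "scaled_kernels (\<lambda>l. inv_fourier (cutoff l))"
  unfolding scaled_kernels_def
proof (intro conjI allI)
  show "inv_fourier (cutoff l) \<in> borel_measurable borel" for l
    by (intro schwartz_borel inv_fourier_schwartz cutoff_schwartz)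
  fix M
  let ?C = "schwartz_sup M (inv_fourier \<phi>0)"
  have s: "inv_fourier \<phi>0 \<in> schwartz" by (intro inv_fourier_schwartz schwartz_\<phi>0)
  have "norm (inv_fourier (cutoff l) x) \<le> ?C * (2 ^ l) ^ CARD('n) / (1 + 2 ^ l * norm x) ^ M" for l x
  proof -
    have "norm (inv_fourier (cutoff l) x) = (2 ^ l) ^ CARD('n) * norm (inv_fourier \<phi>0 (2 ^ l *\<^sub>R x))"
      unfolding inv_fourier_cutoff norm_mult norm_of_real by simp
    also have "\<dots> \<le> (2 ^ l) ^ CARD('n) * (?C / (1 + norm (2 ^ l *\<^sub>R x)) ^ M)"
      by (intro mult_left_mono schwartz_decay0 s) simp
    finally show ?thesis by (simp add: mult_ac)
  qed
  then show "\<exists>C\<ge>0. \<forall>l x. norm (inv_fourier (cutoff l) x) \<le> C * (2 ^ l) ^ CARD('n) / (1 + 2 ^ l * norm x) ^ M"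
    using schwartz_sup_nonneg[OF s, of M] by blast
qed

lemma scaled_kernels_dyadic: "scaled_kernels (\<lambda>l. inv_fourier (dyadic \<phi>0 l))"
  unfolding scaled_kernels_def
proof (intro conjI allI)
  show "inv_fourier (dyadic \<phi>0 l) \<in> borel_measurable borel" for l
    by (intro schwartz_borel inv_fourier_schwartz dyadic_schwartz)
  fix M
  obtain C where C: "C \<ge> 0" "\<And>l x. norm (inv_fourier (cutoff l) x) \<le> C * (2 ^ l) ^ CARD('n) / (1 + 2 ^ l * norm x) ^ M"
    using scaled_kernels_cutoff unfolding scaled_kernels_def by metis
  have "norm (inv_fourier (dyadic \<phi>0 l) x) \<le> (C + C * 2 ^ M) * (2 ^ l) ^ CARD('n) / (1 + 2 ^ l * norm x) ^ M" for l x
  proof (cases l)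
    case 0
    have "norm (inv_fourier (dyadic \<phi>0 0) x) \<le> C * (2 ^ 0) ^ CARD('n) / (1 + 2 ^ 0 * norm x) ^ M"
      unfolding dyadic_0_eq by (rule C(2))
    also have "\<dots> \<le> (C + C * 2 ^ M) * (2 ^ 0) ^ CARD('n) / (1 + 2 ^ 0 * norm x) ^ M"
      using C(1) by (intro divide_right_mono mult_right_mono) auto
    finally show ?thesis unfolding 0 .
  next
    case (Suc k)
    have t: "0 < (1 + 2 ^ l * norm x) ^ M" "0 < (1 + 2 ^ k * norm x) ^ M" by (simp_all add: add_pos_nonneg)
    \<comment> \<open>Passing from level \<open>k\<close> to \<open>l = k + 1\<close> weakens the
      decay by a factor of at most \<open>2 ^ M\<close>.\<close>
    have "(1 + 2 ^ l * norm x) ^ M \<le> (2 * (1 + 2 ^ k * norm x)) ^ M" unfolding Suc by (intro power_mono) auto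
    then have "(1 + 2 ^ l * norm x) ^ M \<le> 2 ^ M * (1 + 2 ^ k * norm x) ^ M" by (simp only: power_mult_distrib)
    then have "1 / (1 + 2 ^ k * norm x) ^ M \<le> 2 ^ M / (1 + 2 ^ l * norm x) ^ M"
      using t by (simp add: divide_simps)
    moreover have "((2::real) ^ k) ^ CARD('n) \<le> (2 ^ l) ^ CARD('n)" unfolding Suc by (intro power_mono) auto
    ultimately have "(C * (2 ^ k) ^ CARD('n)) * (1 / (1 + 2 ^ k * norm x) ^ M) \<le> (C * (2 ^ l) ^ CARD('n)) * (2 ^ M / (1 + 2 ^ l * norm x) ^ M)"
      using C(1) by (intro mult_mono mult_left_mono) auto
    then have k: "norm (inv_fourier (cutoff k) x) \<le> C * 2 ^ M * (2 ^ l) ^ CARD('n) / (1 + 2 ^ l * norm x) ^ M"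
      using C(2)[of k x] by (simp add: mult_ac)
    have "norm (inv_fourier (dyadic \<phi>0 l) x) \<le> norm (inv_fourier (cutoff l) x) + norm (inv_fourier (cutoff k) x)"
      unfolding Suc dyadic_Suc_eq inv_fourier_diff[OF cutoff_schwartz cutoff_schwartz] by (rule norm_triangle_ineq4)
    also have "\<dots> \<le> C * (2 ^ l) ^ CARD('n) / (1 + 2 ^ l * norm x) ^ M + C * 2 ^ M * (2 ^ l) ^ CARD('n) / (1 + 2 ^ l * norm x) ^ M"
      by (intro add_mono C k)
    finally show ?thesis by (simp add: distrib_right add_divide_distrib)
  qed
  then show "\<exists>C\<ge>0. \<forall>l x. norm (inv_fourier (dyadic \<phi>0 l) x) \<le> C * (2 ^ l) ^ CARD('n) / (1 + 2 ^ l * norm x) ^ M"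
    using C(1) by (intro exI[of _ "C + C * 2 ^ M"]) auto
qed

text \<open>For \<open>p \<le> 1\<close> this is \<open>small_exponent_bound\<close>. For
  \<open>p > 1\<close> the integrand of the reproducing identity is split by
  \<open>le_power_split\<close>: one part is controlled by the supremum of the kernel, the other by
  a bound for its integral that does not depend on \<open>j\<close>.\<close>

lemma nikolskii:
  assumes p: "0 < p"
  shows "\<exists>C>0. \<forall>j (u::'n cfun) A N I x. poly_bounded A N u \<longrightarrow> multiplier (cutoff j) u = u \<longrightarrow> 0 \<le> I \<longrightarrow>
     (\<integral>\<^sup>+y. ennreal (norm (u y) powr p) \<partial>lborel) \<le> ennreal I \<longrightarrow> norm (u x) powr p \<le> C * (2 ^ j) ^ CARD('n) * I"
proof -
  let ?c = "fourier_const TYPE('n)"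
  have c: "?c > 0" by (rule fourier_const_pos)
  obtain C0 where C0: "C0 \<ge> 0" "\<And>l z. norm (inv_fourier (cutoff l) z) * (1 + norm z) ^ 0 \<le> C0 * (2 ^ l) ^ CARD('n)"
    using scaled_kernels_sup[OF scaled_kernels_cutoff, of 0] by blast
  show ?thesis
  proof (cases "p \<le> 1")
    case True
    have "norm (u x) powr p \<le> (?c * C0 + 1) * (2 ^ j) ^ CARD('n) * I"
      if u: "poly_bounded A N u" "multiplier (cutoff j) u = u" and I: "0 \<le> I" "(\<integral>\<^sup>+y. ennreal (norm (u y) powr p) \<partial>lborel) \<le> ennreal I"
      for j and u :: "'n cfun" and A N I x
    proof -
      obtain C where C: "C \<ge> 0" "\<And>l z. norm (inv_fourier (cutoff l) z) * (1 + norm z) ^ N \<le> C * (2 ^ l) ^ CARD('n)"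
        using scaled_kernels_sup[OF scaled_kernels_cutoff, of N] by blast
      \<comment> \<open>The decay constant \<open>C\<close> depends on \<open>N\<close>. This bound
        therefore only serves to show that \<open>u\<close> is bounded, after which the estimate is
        repeated with \<open>N = 0\<close> and the uniform constant \<open>C0\<close>.\<close>
      define B where "B = (?c * (C * (2 ^ j) ^ CARD('n)) * I) powr (1 / p)"
      have "norm (u y) \<le> B" for y
      proof -
        have "norm (u y) powr p \<le> ?c * (C * (2 ^ j) ^ CARD('n)) * I"
          by (rule small_exponent_bound[OF cutoff_schwartz u p True C(2) I])
        then have "(norm (u y) powr p) powr (1 / p) \<le> B" unfolding B_def using p by (intro powr_mono2) auto
        then show ?thesis using p by (simp add: powr_powr)
      qed
      then have u0: "poly_bounded B 0 u" using u(1) by (simp add: poly_bounded_def)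
      have "norm (u x) powr p \<le> ?c * (C0 * (2 ^ j) ^ CARD('n)) * I"
        by (rule small_exponent_bound[OF cutoff_schwartz u0 u(2) p True C0(2) I])
      also have "\<dots> = (?c * C0) * ((2 ^ j) ^ CARD('n) * I)" by (simp only: mult.assoc)
      also have "\<dots> \<le> (?c * C0 + 1) * ((2 ^ j) ^ CARD('n) * I)"
        using I(1) by (intro mult_right_mono) auto
      also have "\<dots> = (?c * C0 + 1) * (2 ^ j) ^ CARD('n) * I" by (simp only: mult.assoc)
      finally show ?thesis .
    qed
    then show ?thesis using c C0(1) by (intro exI[of _ "?c * C0 + 1"]) (auto intro: add_nonneg_pos)
  next
    case False
    then have p1: "1 \<le> p" by simp
    obtain C1 where C1: "C1 > 0" "\<And>l. (\<integral>\<^sup>+z. ennreal (norm (inv_fourier (cutoff l) z) powr 1) \<partial>lborel) \<le> ennreal (C1 * 2 powr (real l * real CARD('n) * (1 - 1)))"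
      using scaled_kernels_power_integral[OF scaled_kernels_cutoff, of 1] by auto
    let ?C = "(?c * (C0 + C1)) powr p"
    have pos: "norm (u x) powr p \<le> ?C * (2 ^ j) ^ CARD('n) * I"
      if u: "poly_bounded A N u" "multiplier (cutoff j) u = u" and I: "0 < I" "(\<integral>\<^sup>+y. ennreal (norm (u y) powr p) \<partial>lborel) \<le> ennreal I"
      for j and u :: "'n cfun" and A N I x
    proof -
      let ?K = "inv_fourier (cutoff j)"
      note Ks = inv_fourier_schwartz[OF cutoff_schwartz]
      note [measurable] = poly_bounded_borel[OF u(1)] schwartz_borel[OF Ks[of j]]
      define T where "T = (2 ^ j) ^ CARD('n) * I"
      have T: "T > 0" using I by (simp add: T_def)
      \<comment> \<open>The threshold at which the two parts of the split have the same size, up to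
        constants: \<open>\<Lambda> powr (1 - p) * T = \<Lambda>\<close>.\<close>
      define \<Lambda> where "\<Lambda> = T powr (1 / p)"
      have \<Lambda>: "\<Lambda> > 0" using T by (simp add: \<Lambda>_def)
      have \<Lambda>T: "\<Lambda> powr (1 - p) * T = \<Lambda>"
      proof -
        have "T = \<Lambda> powr p" using T p by (simp add: \<Lambda>_def powr_powr)
        then show ?thesis using \<Lambda> by (simp flip: powr_add)
      qed
      have pt: "norm (?K (x - y)) * norm (u y) \<le> (\<Lambda> powr (1 - p) * (C0 * (2 ^ j) ^ CARD('n))) * norm (u y) powr p + \<Lambda> * norm (?K (x - y))" for y
      proof -
        have "norm (?K (x - y)) * norm (u y) \<le> norm (?K (x - y)) * (\<Lambda> powr (1 - p) * norm (u y) powr p + \<Lambda>)"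
          using p1 \<Lambda> by (intro mult_left_mono le_power_split) auto
        also have "\<dots> = norm (?K (x - y)) * (\<Lambda> powr (1 - p) * norm (u y) powr p) + \<Lambda> * norm (?K (x - y))"
          by (simp add: distrib_left mult.commute)
        also have "\<dots> \<le> (C0 * (2 ^ j) ^ CARD('n)) * (\<Lambda> powr (1 - p) * norm (u y) powr p) + \<Lambda> * norm (?K (x - y))"
          using C0(2)[of j "x - y"] by (intro add_right_mono mult_right_mono) auto
        finally show ?thesis by (simp add: mult_ac)
      qed
      have K1: "(\<integral>\<^sup>+y. ennreal (norm (?K (x - y))) \<partial>lborel) \<le> ennreal C1"
        using C1(2)[of j] nn_integral_reflect[of "\<lambda>z. ennreal (norm (?K z))" x] by simp
      have nn: "0 \<le> \<Lambda> powr (1 - p) * (C0 * (2 ^ j) ^ CARD('n))" using C0(1) by simp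
      have "ennreal (norm (u x)) \<le> ennreal ?c * (\<integral>\<^sup>+y. ennreal (norm (?K (x - y)) * norm (u y)) \<partial>lborel)"
        using multiplier_norm_le[OF cutoff_schwartz poly_bounded_borel[OF u(1)], of j x] unfolding u(2) .
      also have "\<dots> \<le> ennreal ?c * (\<integral>\<^sup>+y. ennreal (\<Lambda> powr (1 - p) * (C0 * (2 ^ j) ^ CARD('n))) * ennreal (norm (u y) powr p) + ennreal \<Lambda> * ennreal (norm (?K (x - y))) \<partial>lborel)"
        using pt nn \<Lambda> by (intro mult_left_mono nn_integral_mono) (auto simp: ennreal_leI simp flip: ennreal_mult ennreal_plus)
      also have "\<dots> = ennreal ?c * (ennreal (\<Lambda> powr (1 - p) * (C0 * (2 ^ j) ^ CARD('n))) * (\<integral>\<^sup>+y. ennreal (norm (u y) powr p) \<partial>lborel) + ennreal \<Lambda> * (\<integral>\<^sup>+y. ennreal (norm (?K (x - y))) \<partial>lborel))"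
        by (simp add: nn_integral_add nn_integral_cmult)
      also have "\<dots> \<le> ennreal ?c * (ennreal (\<Lambda> powr (1 - p) * (C0 * (2 ^ j) ^ CARD('n))) * ennreal I + ennreal \<Lambda> * ennreal C1)"
        by (intro mult_left_mono add_mono I K1) auto
      also have "\<dots> = ennreal (?c * (\<Lambda> powr (1 - p) * (C0 * (2 ^ j) ^ CARD('n)) * I + \<Lambda> * C1))"
        using c nn I \<Lambda> C1(1) by (simp add: ennreal_mult ennreal_plus)
      also have "?c * (\<Lambda> powr (1 - p) * (C0 * (2 ^ j) ^ CARD('n)) * I + \<Lambda> * C1) = ?c * (C0 + C1) * \<Lambda>"
      proof -
        have "\<Lambda> powr (1 - p) * (C0 * (2 ^ j) ^ CARD('n)) * I = C0 * (\<Lambda> powr (1 - p) * T)" by (simp add: T_def)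
        then have e: "\<Lambda> powr (1 - p) * (C0 * (2 ^ j) ^ CARD('n)) * I = C0 * \<Lambda>" unfolding \<Lambda>T .
        show ?thesis unfolding e by (simp add: algebra_simps)
      qed
      finally have "norm (u x) \<le> ?c * (C0 + C1) * \<Lambda>"
        using c C0 C1 \<Lambda> by (subst (asm) ennreal_le_iff) auto
      then have "norm (u x) powr p \<le> (?c * (C0 + C1) * \<Lambda>) powr p" using p by (intro powr_mono2) auto
      also have "\<dots> = ?C * \<Lambda> powr p" using c C0 C1 \<Lambda> by (simp add: powr_mult)
      also have "\<Lambda> powr p = T" using T p by (simp add: \<Lambda>_def powr_powr)
      finally show ?thesis by (simp add: T_def mult.assoc)
    qed
    have "norm (u x) powr p \<le> ?C * (2 ^ j) ^ CARD('n) * I"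
      if u: "poly_bounded A N u" "multiplier (cutoff j) u = u" and I: "0 \<le> I" "(\<integral>\<^sup>+y. ennreal (norm (u y) powr p) \<partial>lborel) \<le> ennreal I"
      for j and u :: "'n cfun" and A N I x
    \<comment> \<open>For \<open>I = 0\<close> the threshold above would vanish, so the integral is
      enlarged by \<open>e\<close>.\<close>
    proof (rule le_mult_epsilon)
      fix e :: real assume "e > 0"
      then show "norm (u x) powr p \<le> ?C * (2 ^ j) ^ CARD('n) * (I + e)"
        using I by (intro pos[OF u]) (auto intro: order_trans ennreal_leI)
    qed simp
    moreover have "?C > 0" using c C0 C1 by simp
    ultimately show ?thesis by (intro exI[of _ ?C]) auto
  qed
qed

end

section \<open>Filtering a band-limited function to a lower band, for every finite positive
  exponent\<close>

context dyadic_resolution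
begin

text \<open>The support of \<open>dyadic \<phi>0 l\<close> lies in the ball of radius
  \<open>3 / 2 * 2 ^ l\<close>, inside the plateau of \<open>cutoff m\<close>. For fixed
  \<open>x\<close> this makes the integrand of the convolution a product of two functions of the
  same band.\<close>

lemma reflected_kernel_band:
  assumes "l + 1 \<le> m"
  shows "band m (\<lambda>y. inv_fourier (dyadic \<phi>0 l) (x - y))"
  unfolding band_def
proof (intro conjI exI)
  let ?K = "inv_fourier (dyadic \<phi>0 l)"
  have s: "?K \<in> schwartz" by (intro inv_fourier_schwartz dyadic_schwartz)
  show "poly_bounded (schwartz_sup 0 ?K) 0 (\<lambda>y. ?K (x - y))"
    using schwartz_decay0[OF s, of _ 0] schwartz_borel[OF s] by (simp add: poly_bounded_def)
  show "multiplier (cutoff m) (\<lambda>y. ?K (x - y)) = (\<lambda>y. ?K (x - y))"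
  proof (rule multiplier_reflected_kernel[OF cutoff_schwartz dyadic_schwartz])
    fix \<xi>
    show "cutoff m (- \<xi>) * dyadic \<phi>0 l \<xi> = dyadic \<phi>0 l \<xi>"
    proof (cases "norm \<xi> \<le> 2 ^ m")
      case False
      have "(2::real) ^ (l + 1) \<le> 2 ^ m" using assms by (intro power_increasing) auto
      then have "2 * 2 ^ l \<le> norm \<xi>" using False by simp
      then have n: "norm \<xi> \<ge> 3 / 2 * 2 ^ l" using zero_le_power[of "2::real" l] by linarith
      have "cutoff l \<xi> = 0" by (rule cutoff_eq_0[OF n])
      moreover have "cutoff k \<xi> = 0" if "l = Suc k" for k
      proof (rule cutoff_eq_0)
        have "3 * 2 ^ k \<le> norm \<xi>" using n that by simp
        then show "3 / 2 * 2 ^ k \<le> norm \<xi>" using zero_le_power[of "2::real" k] by linarith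
      qed
      ultimately show ?thesis by (cases l) (simp_all add: dyadic_0_eq dyadic_Suc_eq del: dyadic.simps)
    qed (simp add: cutoff_eq_1)
  qed
qed

text \<open>For \<open>p < 1\<close> the integrand of the convolution at a fixed \<open>x\<close> is
  itself band-limited at level \<open>m + 2\<close>, so Nikolskii bounds its supremum by its
  \<open>L\<^sub>p\<close> size, and \<open>le_sup_power_split\<close> then bounds its integral. In
  the \<open>p\<close>-th power this costs \<open>2 ^ (m n (1 - p))\<close> with
  \<open>n = CARD('n)\<close>. For \<open>p \<ge> 1\<close> the integral is split by
  \<open>le_power_split\<close> with the kernel as a weight, and no power of \<open>2 ^ m\<close> is
  lost.\<close>

lemma smoothing_pointwise:
  assumes p: "0 < p" and r: "r = min 1 p"
  shows "\<exists>C>0. \<forall>l m h x. l + 1 \<le> m \<longrightarrow> band m h \<longrightarrow>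
    ennreal (norm (multiplier (dyadic \<phi>0 l) h x) powr p) \<le> ennreal (C * 2 powr (real m * real CARD('n) * (1 - r))) *
      (\<integral>\<^sup>+y. ennreal (norm (inv_fourier (dyadic \<phi>0 l) (x - y)) powr r) * ennreal (norm (h y) powr p) \<partial>lborel)"
proof -
  let ?n = "CARD('n)"
  let ?c = "fourier_const TYPE('n)"
  have c: "?c > 0" by (rule fourier_const_pos)
  let ?Q = "\<lambda>l h x. \<integral>\<^sup>+y. ennreal (norm (inv_fourier (dyadic \<phi>0 l) (x - y)) powr r) * ennreal (norm (h y) powr p) \<partial>lborel"
  have main: "\<exists>C>0. \<forall>l m h x J. l + 1 \<le> m \<longrightarrow> band m h \<longrightarrow> 0 \<le> J \<longrightarrow> ?Q l h x = ennreal J \<longrightarrow>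
    norm (multiplier (dyadic \<phi>0 l) h x) powr p \<le> C * 2 powr (real m * real ?n * (1 - r)) * J"
  proof (cases "p < 1")
    case True
    then have rp: "r = p" using r by simp
    obtain C where C: "C > 0" "\<And>j (u::'n cfun) A N I x. poly_bounded A N u \<Longrightarrow> multiplier (cutoff j) u = u \<Longrightarrow> 0 \<le> I \<Longrightarrow>
        (\<integral>\<^sup>+y. ennreal (norm (u y) powr p) \<partial>lborel) \<le> ennreal I \<Longrightarrow> norm (u x) powr p \<le> C * (2 ^ j) ^ ?n * I"
      using nikolskii[OF p] by blast
    let ?C = "?c powr p * (C * (2 ^ 2) ^ ?n) powr (1 - p)"
    have "norm (multiplier (dyadic \<phi>0 l) h x) powr p \<le> ?C * 2 powr (real m * real ?n * (1 - r)) * J"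
      if lm: "l + 1 \<le> m" and h: "band m h" and J: "0 \<le> J" "?Q l h x = ennreal J" for l m h x J
    proof -
      let ?K = "inv_fourier (dyadic \<phi>0 l)"
      let ?v = "\<lambda>y. ?K (x - y) * h y"
      obtain B where B: "poly_bounded B 0 h" using h by (auto simp: band_def)
      have "band (m + 2) ?v" by (rule band_mult[OF reflected_kernel_band[OF lm] h]) simp
      then obtain B' where v: "poly_bounded B' 0 ?v" "multiplier (cutoff (m + 2)) ?v = ?v" by (auto simp: band_def)
      have vp: "(\<integral>\<^sup>+y. ennreal (norm (?v y) powr p) \<partial>lborel) = ennreal J"
        unfolding J(2)[symmetric] rp by (intro nn_integral_cong) (simp add: norm_mult powr_mult ennreal_mult)
      \<comment> \<open>The value that Nikolskii gives for the \<open>p\<close>-th power of the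
        supremum of \<open>?v\<close>.\<close>
      define T where "T = C * (2 ^ (m + 2)) ^ ?n * J"
      have T: "T \<ge> 0" using C(1) J by (simp add: T_def)
      have vT: "norm (?v y) powr p \<le> T" for y
        unfolding T_def by (rule C(2)[OF v J(1)]) (simp only: vp)
      have vb: "norm (?v y) \<le> T powr (1 / p)" for y
      proof -
        have "(norm (?v y) powr p) powr (1 / p) \<le> T powr (1 / p)" using p by (intro powr_mono2 vT) auto
        then show ?thesis using p by (simp add: powr_powr)
      qed
      let ?D = "T powr ((1 - p) / p)"
      have v1: "norm (?v y) \<le> ?D * norm (?v y) powr p" for y
      proof -
        have "norm (?v y) \<le> (T powr (1 / p)) powr (1 - p) * norm (?v y) powr p"
          by (rule le_sup_power_split) (use p True vb in auto)
        then show ?thesis by (simp add: powr_powr mult.commute)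
      qed
      note [measurable] = poly_bounded_borel[OF v(1)]
      have "ennreal (norm (multiplier (dyadic \<phi>0 l) h x)) \<le> ennreal ?c * (\<integral>\<^sup>+y. ennreal (norm (?K (x - y)) * norm (h y)) \<partial>lborel)"
        by (rule multiplier_norm_le[OF dyadic_schwartz poly_bounded_borel[OF B]])
      also have "\<dots> \<le> ennreal ?c * (\<integral>\<^sup>+y. ennreal ?D * ennreal (norm (?v y) powr p) \<partial>lborel)"
        using v1 by (intro mult_left_mono nn_integral_mono) (auto simp: norm_mult[symmetric] ennreal_leI simp flip: ennreal_mult)
      also have "\<dots> = ennreal ?c * (ennreal ?D * ennreal J)"
        by (subst nn_integral_cmult) (auto simp: vp)
      also have "\<dots> = ennreal (?c * (?D * J))" using c J by (simp add: ennreal_mult)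
      finally have "norm (multiplier (dyadic \<phi>0 l) h x) \<le> ?c * (?D * J)"
        using c J by (subst (asm) ennreal_le_iff) auto
      then have "norm (multiplier (dyadic \<phi>0 l) h x) powr p \<le> (?c * (?D * J)) powr p"
        using p by (intro powr_mono2) auto
      also have "\<dots> = ?c powr p * (T powr (1 - p) * J powr p)"
        using c J p by (simp add: powr_mult powr_powr)
      also have "T powr (1 - p) = (C * (2 ^ 2) ^ ?n) powr (1 - p) * 2 powr (real m * real ?n * (1 - p)) * J powr (1 - p)"
      proof -
        have "((2::real) ^ (m + 2)) ^ ?n = (2 ^ 2) ^ ?n * 2 powr (real m * real ?n)"
          by (simp add: power_add power_mult_distrib powr_realpow[symmetric] powr_powr)
        then have "T = (C * (2 ^ 2) ^ ?n) * (2 powr (real m * real ?n) * J)" by (simp add: T_def)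
        then show ?thesis using C(1) J(1) by (simp add: powr_mult powr_powr)
      qed
      also have "?c powr p * ((C * (2 ^ 2) ^ ?n) powr (1 - p) * 2 powr (real m * real ?n * (1 - p)) * J powr (1 - p) * J powr p)
         = ?C * 2 powr (real m * real ?n * (1 - r)) * (J powr (1 - p) * J powr p)"
        unfolding rp by (simp only: mult_ac)
      also have "J powr (1 - p) * J powr p = J" using J(1) p by (cases "J = 0") (simp_all flip: powr_add)
      finally show ?thesis .
    qed
    moreover have "?C > 0" using c C(1) by simp
    ultimately show ?thesis by (intro exI[of _ ?C]) auto
  next
    case False
    then have r1: "r = 1" and p1: "1 \<le> p" using r by auto
    obtain C1 where C1: "C1 > 0" "\<And>l. (\<integral>\<^sup>+z. ennreal (norm (inv_fourier (dyadic \<phi>0 l) z) powr 1) \<partial>lborel) \<le> ennreal (C1 * 2 powr (real l * real CARD('n) * (1 - 1)))"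
      using scaled_kernels_power_integral[OF scaled_kernels_dyadic, of 1] by auto
    let ?C = "(?c * (1 + C1)) powr p"
    have "norm (multiplier (dyadic \<phi>0 l) h x) powr p \<le> ?C * J"
      if h: "band m h" and J: "0 \<le> J" "?Q l h x = ennreal J" for l m h x J
    proof (rule le_mult_epsilon)
      fix e :: real assume e: "e > 0"
      let ?K = "inv_fourier (dyadic \<phi>0 l)"
      have Ks: "?K \<in> schwartz" by (intro inv_fourier_schwartz dyadic_schwartz)
      obtain B where B: "poly_bounded B 0 h" using h by (auto simp: band_def)
      note [measurable] = poly_bounded_borel[OF B] schwartz_borel[OF Ks]
      \<comment> \<open>Strictly positive even for \<open>J = 0\<close>, so that the threshold
        \<open>\<Lambda>\<close> below is positive as well.\<close>
      define T where "T = J + e"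
      have T: "T > 0" using J e by (simp add: T_def)
      define \<Lambda> where "\<Lambda> = T powr (1 / p)"
      have \<Lambda>: "\<Lambda> > 0" using T by (simp add: \<Lambda>_def)
      have \<Lambda>p: "\<Lambda> powr p = T" using T p by (simp add: \<Lambda>_def powr_powr)
      have \<Lambda>T: "\<Lambda> powr (1 - p) * T = \<Lambda>" unfolding \<Lambda>p[symmetric] using \<Lambda> by (simp flip: powr_add)
      have pt: "norm (?K (x - y)) * norm (h y) \<le> \<Lambda> powr (1 - p) * (norm (?K (x - y)) * norm (h y) powr p) + \<Lambda> * norm (?K (x - y))" for y
      proof -
        have "norm (?K (x - y)) * norm (h y) \<le> norm (?K (x - y)) * (\<Lambda> powr (1 - p) * norm (h y) powr p + \<Lambda>)"
          using p1 \<Lambda> by (intro mult_left_mono le_power_split) auto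
        then show ?thesis by (simp add: algebra_simps)
      qed
      have K1: "(\<integral>\<^sup>+y. ennreal (norm (?K (x - y))) \<partial>lborel) \<le> ennreal C1"
        using C1(2)[of l] nn_integral_reflect[of "\<lambda>z. ennreal (norm (?K z))" x] by simp
      have "?Q l h x = (\<integral>\<^sup>+y. ennreal (norm (?K (x - y)) * norm (h y) powr p) \<partial>lborel)"
        unfolding r1 by (intro nn_integral_cong) (simp add: ennreal_mult)
      then have Jq: "(\<integral>\<^sup>+y. ennreal (norm (?K (x - y)) * norm (h y) powr p) \<partial>lborel) = ennreal J" using J by simp
      have "ennreal (norm (multiplier (dyadic \<phi>0 l) h x)) \<le> ennreal ?c * (\<integral>\<^sup>+y. ennreal (norm (?K (x - y)) * norm (h y)) \<partial>lborel)"
        by (rule multiplier_norm_le[OF dyadic_schwartz poly_bounded_borel[OF B]])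
      also have "\<dots> \<le> ennreal ?c * (\<integral>\<^sup>+y. ennreal (\<Lambda> powr (1 - p)) * ennreal (norm (?K (x - y)) * norm (h y) powr p) + ennreal \<Lambda> * ennreal (norm (?K (x - y))) \<partial>lborel)"
        using pt \<Lambda> by (intro mult_left_mono nn_integral_mono) (auto simp: ennreal_leI simp flip: ennreal_mult ennreal_plus)
      also have "\<dots> = ennreal ?c * (ennreal (\<Lambda> powr (1 - p)) * ennreal J + ennreal \<Lambda> * (\<integral>\<^sup>+y. ennreal (norm (?K (x - y))) \<partial>lborel))"
        by (simp add: nn_integral_add nn_integral_cmult Jq)
      also have "\<dots> \<le> ennreal ?c * (ennreal (\<Lambda> powr (1 - p)) * ennreal J + ennreal \<Lambda> * ennreal C1)"
        by (intro mult_left_mono add_left_mono K1) auto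
      also have "\<dots> = ennreal (?c * (\<Lambda> powr (1 - p) * J + \<Lambda> * C1))"
        using c J \<Lambda> C1(1) by (simp add: ennreal_mult ennreal_plus)
      finally have "norm (multiplier (dyadic \<phi>0 l) h x) \<le> ?c * (\<Lambda> powr (1 - p) * J + \<Lambda> * C1)"
        using c J \<Lambda> C1(1) by (subst (asm) ennreal_le_iff) auto
      also have "\<dots> \<le> ?c * (\<Lambda> powr (1 - p) * T + \<Lambda> * C1)"
        using c e by (intro mult_left_mono add_right_mono) (auto simp: T_def)
      also have "\<dots> = ?c * (1 + C1) * \<Lambda>" unfolding \<Lambda>T by (simp add: algebra_simps)
      finally have "norm (multiplier (dyadic \<phi>0 l) h x) powr p \<le> (?c * (1 + C1) * \<Lambda>) powr p"
        using p by (intro powr_mono2) auto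
      also have "\<dots> = ?C * (J + e)" using c C1(1) \<Lambda> by (simp add: powr_mult \<Lambda>p T_def)
      finally show "norm (multiplier (dyadic \<phi>0 l) h x) powr p \<le> ?C * (J + e)" .
    qed simp
    moreover have "?C > 0" using c C1(1) by simp
    ultimately show ?thesis unfolding r1 by (intro exI[of _ ?C]) auto
  qed
  then obtain C where C: "C > 0" "\<And>l m h x J. l + 1 \<le> m \<Longrightarrow> band m h \<Longrightarrow> 0 \<le> J \<Longrightarrow> ?Q l h x = ennreal J \<Longrightarrow>
    norm (multiplier (dyadic \<phi>0 l) h x) powr p \<le> C * 2 powr (real m * real ?n * (1 - r)) * J" by blast
  have "ennreal (norm (multiplier (dyadic \<phi>0 l) h x) powr p) \<le> ennreal (C * 2 powr (real m * real ?n * (1 - r))) * ?Q l h x"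
    if "l + 1 \<le> m" "band m h" for l m h x
  proof (cases "?Q l h x")
    case (real J)
    then show ?thesis using C(2)[OF that real(1,2)] C(1) by (simp add: ennreal_leI flip: ennreal_mult)
  next
    case top
    then show ?thesis using C(1) by (simp add: ennreal_mult_top)
  qed
  then show ?thesis using C(1) by blast
qed

text \<open>Integrating the pointwise bound in \<open>x\<close>, the kernel contributes its mass
  \<open>2 ^ (l n (r - 1))\<close>, \<open>n = CARD('n)\<close>, by Tonelli. Together with the loss
  \<open>2 ^ (m n (1 - r))\<close> this leaves a factor that depends on the difference
  \<open>m - l\<close> alone.\<close>

lemma smoothing_integral:
  assumes p: "0 < p" and r: "r = min 1 p"
  shows "\<exists>C>0. \<forall>l m h. l + 1 \<le> m \<longrightarrow> band m h \<longrightarrow>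
    (\<integral>\<^sup>+x. ennreal (norm (multiplier (dyadic \<phi>0 l) h x) powr p) \<partial>lborel)
      \<le> ennreal (C * 2 powr ((real m - real l) * real CARD('n) * (1 - r))) * (\<integral>\<^sup>+y. ennreal (norm (h y) powr p) \<partial>lborel)"
proof -
  let ?n = "CARD('n)"
  obtain C where C: "C > 0" "\<And>l m h x. l + 1 \<le> m \<Longrightarrow> band m h \<Longrightarrow>
    ennreal (norm (multiplier (dyadic \<phi>0 l) h x) powr p) \<le> ennreal (C * 2 powr (real m * real ?n * (1 - r))) *
      (\<integral>\<^sup>+y. ennreal (norm (inv_fourier (dyadic \<phi>0 l) (x - y)) powr r) * ennreal (norm (h y) powr p) \<partial>lborel)"
    using smoothing_pointwise[OF p r] by blast
  have r': "0 < r" "r \<le> 1" using p r by auto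
  obtain C1 where C1: "C1 > 0" "\<And>l. (\<integral>\<^sup>+z. ennreal (norm (inv_fourier (dyadic \<phi>0 l) z) powr r) \<partial>lborel) \<le> ennreal (C1 * 2 powr (real l * real ?n * (r - 1)))"
    using scaled_kernels_power_integral[OF scaled_kernels_dyadic r'] by blast
  have "(\<integral>\<^sup>+x. ennreal (norm (multiplier (dyadic \<phi>0 l) h x) powr p) \<partial>lborel)
      \<le> ennreal ((C * C1) * 2 powr ((real m - real l) * real ?n * (1 - r))) * (\<integral>\<^sup>+y. ennreal (norm (h y) powr p) \<partial>lborel)"
    if lm: "l + 1 \<le> m" and h: "band m h" for l m h
  proof -
    let ?K = "inv_fourier (dyadic \<phi>0 l)"
    let ?D = "C * 2 powr (real m * real ?n * (1 - r))"
    obtain B where B: "poly_bounded B 0 h" using h by (auto simp: band_def)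
    note [measurable] = poly_bounded_borel[OF B] schwartz_borel[OF inv_fourier_schwartz[OF dyadic_schwartz[of l]]]
    have "(\<integral>\<^sup>+x. ennreal (norm (multiplier (dyadic \<phi>0 l) h x) powr p) \<partial>lborel)
      \<le> (\<integral>\<^sup>+x. ennreal ?D * (\<integral>\<^sup>+y. ennreal (norm (?K (x - y)) powr r) * ennreal (norm (h y) powr p) \<partial>lborel) \<partial>lborel)"
      by (intro nn_integral_mono C lm h)
    also have "\<dots> = ennreal ?D * (\<integral>\<^sup>+x. \<integral>\<^sup>+y. ennreal (norm (?K (x - y)) powr r) * ennreal (norm (h y) powr p) \<partial>lborel \<partial>lborel)"
      by (rule nn_integral_cmult) measurable
    also have "(\<integral>\<^sup>+x. \<integral>\<^sup>+y. ennreal (norm (?K (x - y)) powr r) * ennreal (norm (h y) powr p) \<partial>lborel \<partial>lborel)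
      = (\<integral>\<^sup>+y. \<integral>\<^sup>+x. ennreal (norm (?K (x - y)) powr r) * ennreal (norm (h y) powr p) \<partial>lborel \<partial>lborel)"
      by (rule lborel_pair.Fubini'[symmetric]) measurable
    also have "\<dots> = (\<integral>\<^sup>+y. (\<integral>\<^sup>+z. ennreal (norm (?K z) powr r) \<partial>lborel) * ennreal (norm (h y) powr p) \<partial>lborel)"
    proof (intro nn_integral_cong)
      fix y
      have "(\<integral>\<^sup>+x. ennreal (norm (?K (x - y)) powr r) \<partial>lborel) = (\<integral>\<^sup>+z. ennreal (norm (?K z) powr r) \<partial>lborel)"
        using nn_integral_translate[of "\<lambda>z. ennreal (norm (?K z) powr r)" "- y"] by simp
      then show "(\<integral>\<^sup>+x. ennreal (norm (?K (x - y)) powr r) * ennreal (norm (h y) powr p) \<partial>lborel) = (\<integral>\<^sup>+z. ennreal (norm (?K z) powr r) \<partial>lborel) * ennreal (norm (h y) powr p)"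
        by (subst nn_integral_multc) auto
    qed
    also have "\<dots> = (\<integral>\<^sup>+z. ennreal (norm (?K z) powr r) \<partial>lborel) * (\<integral>\<^sup>+y. ennreal (norm (h y) powr p) \<partial>lborel)"
      by (rule nn_integral_cmult) measurable
    also have "ennreal ?D * \<dots> \<le> ennreal ?D * (ennreal (C1 * 2 powr (real l * real ?n * (r - 1))) * (\<integral>\<^sup>+y. ennreal (norm (h y) powr p) \<partial>lborel))"
      by (intro mult_left_mono mult_right_mono C1) auto
    also have "\<dots> = ennreal (?D * (C1 * 2 powr (real l * real ?n * (r - 1)))) * (\<integral>\<^sup>+y. ennreal (norm (h y) powr p) \<partial>lborel)"
      using C(1) C1(1) by (simp add: ennreal_mult mult.assoc)
    also have "?D * (C1 * 2 powr (real l * real ?n * (r - 1))) = (C * C1) * (2 powr (real m * real ?n * (1 - r)) * 2 powr (real l * real ?n * (r - 1)))"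
      by (simp only: mult_ac)
    also have "2 powr (real m * real ?n * (1 - r)) * 2 powr (real l * real ?n * (r - 1)) = 2 powr ((real m - real l) * real ?n * (1 - r))"
      unfolding powr_add[symmetric] by (simp add: algebra_simps)
    finally show ?thesis .
  qed
  then show ?thesis using C(1) C1(1) by (intro exI[of _ "C * C1"]) auto
qed

lemma multiplier_sup_le:
  fixes \<sigma> h :: "'n cfun"
  assumes \<sigma>: "\<sigma> \<in> schwartz" and h: "h \<in> borel_measurable borel" and B: "0 \<le> B" "AE y in lborel. norm (h y) \<le> B"
    and C: "0 \<le> C" "(\<integral>\<^sup>+z. ennreal (norm (inv_fourier \<sigma> z)) \<partial>lborel) \<le> ennreal C"
  shows "norm (multiplier \<sigma> h x) \<le> fourier_const TYPE('n) * C * B"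
proof -
  let ?c = "fourier_const TYPE('n)"
  have c: "?c > 0" by (rule fourier_const_pos)
  note [measurable] = h schwartz_borel[OF inv_fourier_schwartz[OF \<sigma>]]
  have "ennreal (norm (multiplier \<sigma> h x)) \<le> ennreal ?c * (\<integral>\<^sup>+y. ennreal (norm (inv_fourier \<sigma> (x - y)) * norm (h y)) \<partial>lborel)"
    by (rule multiplier_norm_le[OF \<sigma> h])
  also have "\<dots> \<le> ennreal ?c * (\<integral>\<^sup>+y. ennreal (norm (inv_fourier \<sigma> (x - y))) * ennreal B \<partial>lborel)"
  proof (intro mult_left_mono nn_integral_mono_AE)
    show "AE y in lborel. ennreal (norm (inv_fourier \<sigma> (x - y)) * norm (h y)) \<le> ennreal (norm (inv_fourier \<sigma> (x - y))) * ennreal B"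
      using B(2) by eventually_elim (simp add: B(1) ennreal_leI mult_left_mono flip: ennreal_mult)
  qed simp
  also have "\<dots> = ennreal ?c * ((\<integral>\<^sup>+z. ennreal (norm (inv_fourier \<sigma> z)) \<partial>lborel) * ennreal B)"
    using nn_integral_reflect[of "\<lambda>z. ennreal (norm (inv_fourier \<sigma> z))" x] by (subst nn_integral_multc) auto
  also have "\<dots> \<le> ennreal ?c * (ennreal C * ennreal B)"
    by (intro mult_left_mono mult_right_mono C) auto
  also have "\<dots> = ennreal (?c * C * B)" using c C B by (simp add: ennreal_mult mult.assoc)
  finally show ?thesis using c C B by (subst (asm) ennreal_le_iff) auto
qed

end

section \<open>Bounds for the Lebesgue and sequence quasi-norms\<close>

text \<open>Bounds by real numbers take the place of quasi-norms with values in
  \<open>ennreal\<close>. Both sides are raised to the power \<open>p\<close>, which keeps roots out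
  of the estimates, and the convention for infinite \<open>p\<close> is dealt with here
  once.\<close>

definition Lp_le :: "ereal \<Rightarrow> 'n::finite cfun \<Rightarrow> real \<Rightarrow> bool" where
  "Lp_le p u B \<longleftrightarrow> (if p = \<infinity> then AE x in lborel. norm (u x) \<le> B
     else (\<integral>\<^sup>+x. ennreal (norm (u x) powr real_of_ereal p) \<partial>lborel) \<le> ennreal (B powr real_of_ereal p))"

definition lq_le :: "ereal \<Rightarrow> (nat \<Rightarrow> real) \<Rightarrow> real \<Rightarrow> bool" where
  "lq_le q b B \<longleftrightarrow> (if q = \<infinity> then \<forall>j. b j \<le> B
     else (\<Sum>j. ennreal (b j powr real_of_ereal q)) \<le> ennreal (B powr real_of_ereal q))"

lemma ennreal_le_suminf: "(f :: nat \<Rightarrow> ennreal) j \<le> (\<Sum>j. f j)"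
proof -
  have "sum f {j} \<le> (\<Sum>j. f j)" by (rule sum_le_suminf) auto
  then show ?thesis by simp
qed

lemma real_of_ereal_pos_finite: "0 < p \<Longrightarrow> p \<noteq> \<infinity> \<Longrightarrow> 0 < real_of_ereal p"
  by (cases p) auto

lemma ennreal_powr_le_iff:
  assumes "0 < r" "0 \<le> B"
  shows "ennreal_powr x (1 / r) \<le> ennreal B \<longleftrightarrow> x \<le> ennreal (B powr r)"
proof (cases x)
  case (real a)
  have "a powr (1 / r) \<le> B \<longleftrightarrow> a \<le> B powr r"
  proof
    assume "a powr (1 / r) \<le> B"
    then have "(a powr (1 / r)) powr r \<le> B powr r" using assms by (intro powr_mono2) auto
    then show "a \<le> B powr r" using assms real by (simp add: powr_powr)
  next
    assume "a \<le> B powr r"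
    then have "a powr (1 / r) \<le> (B powr r) powr (1 / r)" using assms real by (intro powr_mono2) auto
    then show "a powr (1 / r) \<le> B" using assms by (simp add: powr_powr)
  qed
  then show ?thesis using real assms by (simp add: ennreal_powr_def)
next
  case top
  then show ?thesis by (simp add: ennreal_powr_def top_unique)
qed

lemma Lp_norm_le_iff:
  fixes u :: "'n::finite cfun"
  assumes p: "0 < p" and u [measurable]: "u \<in> borel_measurable borel" and B: "0 \<le> B"
  shows "Lp_norm p u \<le> ennreal B \<longleftrightarrow> Lp_le p u B"
proof (cases "p = \<infinity>")
  case True
  have m: "(\<lambda>x. ennreal (norm (u x))) \<in> borel_measurable lebesgue"
    by (rule measurable_completion) measurable
  have "esssup lebesgue (\<lambda>x. ennreal (norm (u x))) \<le> ennreal B \<longleftrightarrow> (AE x in lebesgue. ennreal (norm (u x)) \<le> ennreal B)"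
  proof
    assume "esssup lebesgue (\<lambda>x. ennreal (norm (u x))) \<le> ennreal B"
    then show "AE x in lebesgue. ennreal (norm (u x)) \<le> ennreal B"
      using esssup_AE[of "\<lambda>x. ennreal (norm (u x))" lebesgue] by (auto elim!: eventually_mono intro: order_trans)
  qed (rule esssup_I[OF m])
  also have "\<dots> \<longleftrightarrow> (AE x in lborel. norm (u x) \<le> B)"
    using B by (simp add: AE_completion_iff)
  finally show ?thesis using True by (simp add: Lp_norm_def Lp_le_def)
next
  case False
  then show ?thesis using real_of_ereal_pos_finite[OF p False] B
    by (simp add: Lp_norm_def Lp_le_def ennreal_powr_le_iff nn_integral_completion)
qed

lemma Lp_le_AE_mono:
  assumes p: "0 < p" and m [measurable]: "u \<in> borel_measurable borel" and u: "Lp_le p u B" "0 \<le> B"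
    and M: "0 \<le> M" and w: "AE x in lborel. norm (w x) \<le> M * norm (u x)"
  shows "Lp_le p w (M * B)"
proof (cases "p = \<infinity>")
  case True
  have "AE x in lborel. norm (u x) \<le> B" using u True by (simp add: Lp_le_def)
  with w have "AE x in lborel. norm (w x) \<le> M * B"
    by eventually_elim (use M in \<open>meson mult_left_mono order_trans\<close>)
  then show ?thesis using True by (simp add: Lp_le_def)
next
  case False
  let ?p = "real_of_ereal p"
  have p': "?p > 0" by (rule real_of_ereal_pos_finite[OF p False])
  have "(\<integral>\<^sup>+x. ennreal (norm (w x) powr ?p) \<partial>lborel) \<le> (\<integral>\<^sup>+x. ennreal (M powr ?p) * ennreal (norm (u x) powr ?p) \<partial>lborel)"
  proof (rule nn_integral_mono_AE)
    show "AE x in lborel. ennreal (norm (w x) powr ?p) \<le> ennreal (M powr ?p) * ennreal (norm (u x) powr ?p)"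
      using w
    proof eventually_elim
      case (elim x)
      then have "norm (w x) powr ?p \<le> (M * norm (u x)) powr ?p" using p' by (intro powr_mono2) auto
      then show ?case using M by (simp add: powr_mult ennreal_leI flip: ennreal_mult)
    qed
  qed
  also have "\<dots> = ennreal (M powr ?p) * (\<integral>\<^sup>+x. ennreal (norm (u x) powr ?p) \<partial>lborel)"
    by (rule nn_integral_cmult) measurable
  also have "\<dots> \<le> ennreal (M powr ?p) * ennreal (B powr ?p)"
    using u False by (intro mult_left_mono) (auto simp: Lp_le_def)
  also have "\<dots> = ennreal ((M * B) powr ?p)" using M u by (simp add: powr_mult ennreal_mult)
  finally show ?thesis using False by (simp add: Lp_le_def)
qed

lemma Lp_le_mono: 
  assumes "0 < p" "Lp_le p u A" "0 \<le> A" "A \<le> B" shows "Lp_le p u B"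
proof (cases "p = \<infinity>")
  case False
  then have "ennreal (A powr real_of_ereal p) \<le> ennreal (B powr real_of_ereal p)"
    using assms real_of_ereal_pos_finite[OF assms(1) False] by (intro ennreal_leI powr_mono2) auto
  with assms(2) False show ?thesis unfolding Lp_le_def by (simp only: if_False)
qed (use assms in \<open>auto simp: Lp_le_def elim!: eventually_mono\<close>)

lemma summable_powr_neg:
  assumes "0 < \<epsilon>" shows "summable (\<lambda>i::nat. 2 powr (- (real i * \<epsilon>)))"
proof -
  have "2 powr (- (real i * \<epsilon>)) = (2 powr (- \<epsilon>)) ^ i" for i :: nat
    by (simp add: powr_realpow[symmetric] powr_powr mult.commute)
  moreover have "2 powr (- \<epsilon>) < 2 powr 0" using assms by (intro powr_less_mono) auto
  ultimately show ?thesis by (simp add: summable_geometric)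
qed

text \<open>A substitute for Minkowski's inequality that covers \<open>p < 1\<close> as well: the geometric decay allows to
  replace sums by suprema, and suprema by sums of \<open>p\<close>-th powers.\<close>

lemma Lp_le_series:
  assumes p: "0 < p" and e: "0 < \<epsilon>"
  shows "\<exists>C>0. \<forall>(u :: nat \<Rightarrow> 'n::finite cfun) w D. 0 \<le> D \<longrightarrow> (\<forall>i. u i \<in> borel_measurable borel) \<longrightarrow>
     (\<forall>i. Lp_le p (u i) (2 powr (- (real i * \<epsilon>)) * D)) \<longrightarrow>
     (AE x in lborel. ennreal (norm (w x)) \<le> (\<Sum>i. ennreal (norm (u i x)))) \<longrightarrow> Lp_le p w (C * D)"
proof (cases "p = \<infinity>")
  case True
  let ?Z = "\<Sum>i::nat. 2 powr (- (real i * \<epsilon>))"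
  have Z: "?Z > 0" by (intro suminf_pos summable_powr_neg e) simp
  have "Lp_le p w (?Z * D)"
    if D: "0 \<le> D" and u: "\<And>i. Lp_le p (u i) (2 powr (- (real i * \<epsilon>)) * D)"
      and w: "AE x in lborel. ennreal (norm (w x)) \<le> (\<Sum>i. ennreal (norm (u i x)))" for u :: "nat \<Rightarrow> 'n cfun" and w D
  proof -
    have "AE x in lborel. \<forall>i. norm (u i x) \<le> 2 powr (- (real i * \<epsilon>)) * D"
      using u True by (simp add: Lp_le_def AE_all_countable)
    with w have "AE x in lborel. norm (w x) \<le> ?Z * D"
    proof eventually_elim
      case (elim x)
      have "ennreal (norm (w x)) \<le> (\<Sum>i. ennreal (2 powr (- (real i * \<epsilon>)) * D))"
        using elim by (intro order_trans[OF elim(1)] suminf_le summableI) (auto intro: ennreal_leI)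
      also have "\<dots> = ennreal (\<Sum>i. 2 powr (- (real i * \<epsilon>)) * D)"
        using D by (intro suminf_ennreal2 summable_mult2 summable_powr_neg e) auto
      also have "(\<Sum>i. 2 powr (- (real i * \<epsilon>)) * D) = ?Z * D"
        by (rule suminf_mult2[symmetric, OF summable_powr_neg[OF e]])
      finally show ?case using Z D by (subst (asm) ennreal_le_iff) auto
    qed
    then show ?thesis using True by (simp add: Lp_le_def)
  qed
  then show ?thesis using Z by (intro exI[of _ ?Z]) auto
next
  case False
  define P where "P = real_of_ereal p"
  have P: "P > 0" unfolding P_def by (rule real_of_ereal_pos_finite[OF p False])
  \<comment> \<open>Half of the decay makes the sum over \<open>i\<close> converge once every term
    is bounded by a common supremum; the other half makes the sum of the \<open>p\<close>-th powers
    converge.\<close>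
  let ?h = "\<epsilon> / 2"
  let ?Z = "\<Sum>i::nat. 2 powr (- (real i * ?h))"
  let ?Y = "\<Sum>i::nat. 2 powr (- (real i * (?h * P)))"
  have Z: "?Z > 0" using e by (intro suminf_pos summable_powr_neg) auto
  have Y: "?Y > 0" using e P by (intro suminf_pos summable_powr_neg) auto
  let ?C = "?Z * ?Y powr (1 / P)"
  have "Lp_le p w (?C * D)"
    if D: "0 \<le> D" and m: "\<And>i. u i \<in> borel_measurable borel" and u: "\<And>i. Lp_le p (u i) (2 powr (- (real i * \<epsilon>)) * D)"
      and w: "AE x in lborel. ennreal (norm (w x)) \<le> (\<Sum>i. ennreal (norm (u i x)))" for u :: "nat \<Rightarrow> 'n cfun" and w D
  proof -
    note [measurable] = m
    let ?S = "\<lambda>x. \<Sum>i. ennreal (2 powr (real i * ?h * P)) * ennreal (norm (u i x) powr P)"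
    have pt: "AE x in lborel. ennreal (norm (w x) powr P) \<le> ennreal (?Z powr P) * ?S x"
      using w
    proof eventually_elim
      case (elim x)
      show ?case
      proof (cases "?S x")
        case (real s)
        \<comment> \<open>Each single term is at most the whole sum \<open>s\<close> of weighted
          \<open>P\<close>-th powers; its root takes the place of the supremum over
          \<open>i\<close>.\<close>
        have ui: "norm (u i x) \<le> 2 powr (- (real i * ?h)) * s powr (1 / P)" for i
        proof -
          have "ennreal (2 powr (real i * ?h * P)) * ennreal (norm (u i x) powr P) \<le> ?S x"
            by (rule ennreal_le_suminf[of "\<lambda>i. ennreal (2 powr (real i * ?h * P)) * ennreal (norm (u i x) powr P)" i])
          then have "2 powr (real i * ?h * P) * norm (u i x) powr P \<le> s"
            using real by (simp flip: ennreal_mult)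
          then have "(2 powr (real i * ?h) * norm (u i x)) powr P \<le> s" by (simp add: powr_mult powr_powr)
          then have "((2 powr (real i * ?h) * norm (u i x)) powr P) powr (1 / P) \<le> s powr (1 / P)"
            using P by (intro powr_mono2) auto
          then have "2 powr (real i * ?h) * norm (u i x) \<le> s powr (1 / P)" using P by (simp add: powr_powr)
          then show ?thesis by (simp add: powr_minus field_simps)
        qed
        have "ennreal (norm (w x)) \<le> (\<Sum>i. ennreal (2 powr (- (real i * ?h)) * s powr (1 / P)))"
          using elim ui by (intro order_trans[OF elim] suminf_le summableI) (auto intro: ennreal_leI)
        also have "\<dots> = ennreal (\<Sum>i. 2 powr (- (real i * ?h)) * s powr (1 / P))"
          using e by (intro suminf_ennreal2 summable_mult2 summable_powr_neg) auto
        also have "(\<Sum>i. 2 powr (- (real i * ?h)) * s powr (1 / P)) = ?Z * s powr (1 / P)"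
          using e by (intro suminf_mult2[symmetric] summable_powr_neg) auto
        finally have "norm (w x) \<le> ?Z * s powr (1 / P)" using Z by (subst (asm) ennreal_le_iff) auto
        then have "norm (w x) powr P \<le> (?Z * s powr (1 / P)) powr P" using P by (intro powr_mono2) auto
        also have "\<dots> = ?Z powr P * s" using Z real P by (simp add: powr_mult powr_powr)
        finally show ?thesis using real by (simp add: ennreal_leI flip: ennreal_mult)
      qed (use Z in \<open>simp add: ennreal_mult_top\<close>)
    qed
    have "(\<integral>\<^sup>+x. ennreal (norm (w x) powr P) \<partial>lborel) \<le> (\<integral>\<^sup>+x. ennreal (?Z powr P) * ?S x \<partial>lborel)"
      by (rule nn_integral_mono_AE[OF pt])
    also have "\<dots> = ennreal (?Z powr P) * (\<Sum>i. \<integral>\<^sup>+x. ennreal (2 powr (real i * ?h * P)) * ennreal (norm (u i x) powr P) \<partial>lborel)"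
      by (subst nn_integral_cmult, measurable, subst nn_integral_suminf) auto
    also have "\<dots> \<le> ennreal (?Z powr P) * (\<Sum>i. ennreal (2 powr (- (real i * (?h * P))) * D powr P))"
    proof (intro mult_left_mono suminf_le summableI)
      fix i
      have "(\<integral>\<^sup>+x. ennreal (2 powr (real i * ?h * P)) * ennreal (norm (u i x) powr P) \<partial>lborel)
         = ennreal (2 powr (real i * ?h * P)) * (\<integral>\<^sup>+x. ennreal (norm (u i x) powr P) \<partial>lborel)"
        by (rule nn_integral_cmult) measurable
      also have "\<dots> \<le> ennreal (2 powr (real i * ?h * P)) * ennreal ((2 powr (- (real i * \<epsilon>)) * D) powr P)"
        using u[of i] False by (intro mult_left_mono) (auto simp: Lp_le_def P_def)
      also have "\<dots> = ennreal (2 powr (real i * ?h * P) * (2 powr (- (real i * \<epsilon>) * P) * D powr P))"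
        using D by (simp add: powr_mult powr_powr ennreal_mult)
      also have "2 powr (real i * ?h * P) * (2 powr (- (real i * \<epsilon>) * P) * D powr P) = 2 powr (- (real i * (?h * P))) * D powr P"
        unfolding mult.assoc[symmetric] powr_add[symmetric] by (simp add: field_simps)
      finally show "(\<integral>\<^sup>+x. ennreal (2 powr (real i * ?h * P)) * ennreal (norm (u i x) powr P) \<partial>lborel) \<le> ennreal (2 powr (- (real i * (?h * P))) * D powr P)" .
    qed auto
    also have "(\<Sum>i. ennreal (2 powr (- (real i * (?h * P))) * D powr P)) = ennreal (\<Sum>i. 2 powr (- (real i * (?h * P))) * D powr P)"
      using e P by (intro suminf_ennreal2 summable_mult2 summable_powr_neg) auto
    also have "(\<Sum>i. 2 powr (- (real i * (?h * P))) * D powr P) = ?Y * D powr P"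
      using e P by (intro suminf_mult2[symmetric] summable_powr_neg) auto
    also have "ennreal (?Z powr P) * ennreal (?Y * D powr P) = ennreal ((?C * D) powr P)"
      using Z Y P D by (simp add: powr_mult powr_powr mult.assoc flip: ennreal_mult)
    finally show ?thesis using False by (simp add: Lp_le_def P_def)
  qed
  then show ?thesis using Z Y by (intro exI[of _ ?C]) auto
qed

lemma lq_le_sup:
  assumes q: "0 < q" and b: "lq_le q b B" "\<And>j. 0 \<le> b j" "0 \<le> B"
  shows "b j \<le> B"
proof (cases "q = \<infinity>")
  case False
  let ?q = "real_of_ereal q"
  have q': "?q > 0" by (rule real_of_ereal_pos_finite[OF q False])
  have "ennreal (b j powr ?q) \<le> (\<Sum>j. ennreal (b j powr ?q))"
    by (rule ennreal_le_suminf[of "\<lambda>j. ennreal (b j powr ?q)" j])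
  also have "\<dots> \<le> ennreal (B powr ?q)" using b False by (simp add: lq_le_def)
  finally have "b j powr ?q \<le> B powr ?q" by (simp add: ennreal_le_iff)
  then have "(b j powr ?q) powr (1 / ?q) \<le> (B powr ?q) powr (1 / ?q)" using q' by - (rule powr_mono2, auto)
  then show ?thesis using q' b by (simp add: powr_powr)
qed (use b in \<open>simp add: lq_le_def\<close>)

lemma lq_le_mono:
  assumes q: "0 < q" and b: "lq_le q b A" "\<And>j. 0 \<le> b' j" "\<And>j. b' j \<le> b j" and A: "0 \<le> A" "A \<le> B"
  shows "lq_le q b' B"
proof (cases "q = \<infinity>")
  case False
  let ?q = "real_of_ereal q"
  have q': "?q > 0" by (rule real_of_ereal_pos_finite[OF q False])
  have "(\<Sum>j. ennreal (b' j powr ?q)) \<le> (\<Sum>j. ennreal (b j powr ?q))"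
    using q' b by (intro suminf_le summableI ennreal_leI powr_mono2) auto
  also have "\<dots> \<le> ennreal (A powr ?q)" using b False by (simp add: lq_le_def)
  also have "\<dots> \<le> ennreal (B powr ?q)" using A q' by (intro ennreal_leI powr_mono2) auto
  finally show ?thesis using False by (simp add: lq_le_def)
next
  case True
  have "b' j \<le> B" for j
  proof -
    have "b j \<le> A" using b(1) True by (simp add: lq_le_def)
    then show ?thesis using b(3)[of j] A(2) by linarith
  qed
  then show ?thesis using True by (simp add: lq_le_def)
qed

lemma suminf_commute_ennreal:
  fixes f :: "nat \<Rightarrow> nat \<Rightarrow> ennreal"
  shows "(\<Sum>i. \<Sum>j. f i j) = (\<Sum>j. \<Sum>i. f i j)"
  using nn_integral_suminf[of "\<lambda>j i. f i j" "count_space UNIV"] by (simp add: nn_integral_count_space_nat)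

text \<open>The last hypothesis expresses that \<open>e l\<close> is at most \<open>C\<close> times
  the supremum of \<open>c i l\<close> over \<open>i\<close>, without forming it. For finite
  \<open>q\<close> that supremum is bounded by the \<open>q\<close>-th root of the sum of
  \<open>q\<close>-th powers, and after exchanging the two sums the geometric factor makes the sum
  over \<open>i\<close> converge.\<close>

lemma lq_le_series:
  assumes q: "0 < q" and d: "0 < \<delta>"
  shows "\<exists>K>0. \<forall>c e C B. 0 \<le> B \<longrightarrow> 0 \<le> C \<longrightarrow> (\<forall>i l. 0 \<le> c i l) \<longrightarrow> (\<forall>l. 0 \<le> e l) \<longrightarrow>
     (\<forall>i::nat. lq_le q (c i) (2 powr (- (real i * \<delta>)) * B)) \<longrightarrow>
     (\<forall>l D. 0 \<le> D \<longrightarrow> (\<forall>i. c i l \<le> D) \<longrightarrow> e l \<le> C * D) \<longrightarrow> lq_le q e (K * C * B)"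
proof (cases "q = \<infinity>")
  case True
  have "lq_le q e (1 * C * B)"
    if "0 \<le> B" "0 \<le> C" "\<forall>i::nat. lq_le q (c i) (2 powr (- (real i * \<delta>)) * B)" "\<forall>l D. 0 \<le> D \<longrightarrow> (\<forall>i. c i l \<le> D) \<longrightarrow> e l \<le> C * D" for c e C B
  proof -
    have "c i l \<le> B" for i l
    proof -
      have "c i l \<le> 2 powr (- (real i * \<delta>)) * B" using that(3) True by (simp add: lq_le_def)
      also have "2 powr (- (real i * \<delta>)) \<le> 2 powr 0" using d by (intro powr_mono) auto
      then have "2 powr (- (real i * \<delta>)) * B \<le> 1 * B" using that by (intro mult_right_mono) auto
      finally show ?thesis by simp
    qed
    then show ?thesis using that True by (simp add: lq_le_def)
  qed
  then show ?thesis by (intro exI[of _ 1]) auto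
next
  case False
  define Q where "Q = real_of_ereal q"
  have Q: "Q > 0" unfolding Q_def by (rule real_of_ereal_pos_finite[OF q False])
  let ?Y = "\<Sum>i::nat. 2 powr (- (real i * (\<delta> * Q)))"
  have Y: "?Y > 0" using d Q by (intro suminf_pos summable_powr_neg) auto
  let ?K = "?Y powr (1 / Q)"
  have "lq_le q e (?K * C * B)"
    if B: "0 \<le> B" and C: "0 \<le> C" and c0: "\<forall>i l. 0 \<le> c i l" and e0: "\<forall>l. 0 \<le> e l" and c: "\<forall>i::nat. lq_le q (c i) (2 powr (- (real i * \<delta>)) * B)"
      and e: "\<forall>l D. 0 \<le> D \<longrightarrow> (\<forall>i. c i l \<le> D) \<longrightarrow> e l \<le> C * D" for c e C B
  proof -
    let ?S = "\<lambda>l. \<Sum>i. ennreal (c i l powr Q)"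
    have pt: "ennreal (e l powr Q) \<le> ennreal (C powr Q) * ?S l" for l
    \<comment> \<open>In the case \<open>C = 0\<close> an infinite \<open>?S l\<close> would give no
      trivial bound, because \<open>0 * \<infinity> = 0\<close>; there the terms are bounded by
      \<open>B\<close> instead.\<close>
    proof (cases "C = 0")
      case True
      have "e l \<le> 0"
      proof -
        have "c i l \<le> B" for i
        proof -
          have "c i l \<le> 2 powr (- (real i * \<delta>)) * B" by (rule lq_le_sup[OF q]) (use c c0 B in auto)
          also have "2 powr (- (real i * \<delta>)) \<le> 2 powr 0" using d by (intro powr_mono) auto
          then have "2 powr (- (real i * \<delta>)) * B \<le> 1 * B" using B by (intro mult_right_mono) auto
          finally show ?thesis by simp
        qed
        then have "e l \<le> C * B" using e B by blast
        then show ?thesis using True by simp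
      qed
      moreover have "0 \<le> e l" using e0 by blast
      ultimately have "e l = 0" by linarith
      then show ?thesis by simp
    next
      case False
      show ?thesis
      proof (cases "?S l")
        case (real s)
        have "c i l \<le> s powr (1 / Q)" for i
        proof -
          have "ennreal (c i l powr Q) \<le> ?S l"
            by (rule ennreal_le_suminf[of "\<lambda>i. ennreal (c i l powr Q)" i])
          then have "c i l powr Q \<le> s" using real by simp
          then have "(c i l powr Q) powr (1 / Q) \<le> s powr (1 / Q)" using Q by (intro powr_mono2) auto
          then show ?thesis using Q c0 by (simp add: powr_powr)
        qed
        then have "e l \<le> C * s powr (1 / Q)" using e[rule_format, of "s powr (1 / Q)" l] by simp
        then have "e l powr Q \<le> (C * s powr (1 / Q)) powr Q" using e0 Q by (intro powr_mono2) auto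
        also have "\<dots> = C powr Q * s" using C real Q by (simp add: powr_mult powr_powr)
        finally show ?thesis using real by (simp add: ennreal_leI flip: ennreal_mult)
      qed (use False C in \<open>simp add: ennreal_mult_top\<close>)
    qed
    have "(\<Sum>l. ennreal (e l powr Q)) \<le> (\<Sum>l. ennreal (C powr Q) * ?S l)"
      by (intro suminf_le summableI pt)
    also have "\<dots> = ennreal (C powr Q) * (\<Sum>i. \<Sum>l. ennreal (c i l powr Q))"
      by (simp add: ennreal_suminf_cmult suminf_commute_ennreal[of "\<lambda>l i. ennreal (c i l powr Q)"])
    also have "\<dots> \<le> ennreal (C powr Q) * (\<Sum>i. ennreal (2 powr (- (real i * (\<delta> * Q))) * B powr Q))"
    proof (intro mult_left_mono suminf_le summableI)
      fix i
      have "(\<Sum>l. ennreal (c i l powr Q)) \<le> ennreal ((2 powr (- (real i * \<delta>)) * B) powr Q)"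
        using c False by (simp add: lq_le_def Q_def)
      also have "(2 powr (- (real i * \<delta>)) * B) powr Q = 2 powr (- (real i * (\<delta> * Q))) * B powr Q"
        using B by (simp add: powr_mult powr_powr mult.assoc)
      finally show "(\<Sum>l. ennreal (c i l powr Q)) \<le> ennreal (2 powr (- (real i * (\<delta> * Q))) * B powr Q)" .
    qed auto
    also have "(\<Sum>i. ennreal (2 powr (- (real i * (\<delta> * Q))) * B powr Q)) = ennreal (\<Sum>i. 2 powr (- (real i * (\<delta> * Q))) * B powr Q)"
      using d Q by (intro suminf_ennreal2 summable_mult2 summable_powr_neg) auto
    also have "(\<Sum>i. 2 powr (- (real i * (\<delta> * Q))) * B powr Q) = ?Y * B powr Q"
      using d Q by (intro suminf_mult2[symmetric] summable_powr_neg) auto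
    also have "ennreal (C powr Q) * ennreal (?Y * B powr Q) = ennreal ((?K * C * B) powr Q)"
      using Y Q C B by (simp add: powr_mult powr_powr mult_ac flip: ennreal_mult)
    finally show ?thesis using False by (simp add: lq_le_def Q_def)
  qed
  then show ?thesis using Y by (intro exI[of _ ?K]) auto
qed

section \<open>Band pieces of a tempered distribution\<close>

lemma smooth_convolution_partial_derivs:
  fixes h :: "'n::finite cfun"
  assumes \<kappa>: "\<kappa> \<in> schwartz" and h: "integrable lborel h"
  shows "partial_derivs \<alpha> (\<lambda>x. LINT y|lborel. \<kappa> (x - y) * h y) = (\<lambda>x. LINT y|lborel. partial_derivs \<alpha> \<kappa> (x - y) * h y)"
proof (induction \<alpha>)
  case (Cons i \<alpha>)
  show ?case
    unfolding partial_derivs_Cons Cons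
    by (rule partial_deriv_from_has_derivative)
      (rule convolution_has_derivative[OF schwartz_partial_derivs[OF \<kappa>] h])
qed simp

context dyadic_resolution
begin

definition piece :: "nat \<Rightarrow> 'n distr \<Rightarrow> 'n distr" where
  "piece j f = distr_inv_fourier (distr_mult (dyadic \<phi>0 j) (distr_fourier f))"

lemma piece_eq:
  assumes "\<phi> \<in> schwartz"
  shows "piece j f \<phi> = f (fourier (\<lambda>\<xi>. dyadic \<phi>0 j \<xi> * inv_fourier \<phi> \<xi>))"
  using assms schwartz_mult[OF dyadic_schwartz inv_fourier_schwartz[OF assms]]
  by (simp add: piece_def distr_inv_fourier_def distr_mult_def distr_fourier_def inv_fourier_schwartz)

lemma piece_outside: "\<phi> \<notin> schwartz \<Longrightarrow> piece j f \<phi> = 0"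
  by (simp add: piece_def distr_inv_fourier_def)

lemma filtered_schwartz:
  "\<phi> \<in> schwartz \<Longrightarrow> \<sigma> \<in> schwartz \<Longrightarrow> fourier (\<lambda>\<xi>. \<sigma> \<xi> * inv_fourier \<phi> \<xi>) \<in> schwartz"
  by (intro fourier_schwartz schwartz_mult inv_fourier_schwartz)

text \<open>Filtering is convolution with a fixed Schwartz function, and all derivatives fall on it.
  The bound thus involves a weighted integral of \<open>\<phi>\<close> without derivatives, which is
  what forces a band of a tempered distribution to have polynomial growth.\<close>

lemma filtered_sup_le:
  fixes \<sigma> :: "'n cfun"
  assumes \<sigma>: "\<sigma> \<in> schwartz"
  shows "\<exists>C\<ge>0. \<forall>\<phi>\<in>schwartz. schwartz_sup N (fourier (\<lambda>\<xi>. \<sigma> \<xi> * inv_fourier \<phi> \<xi>)) \<le> C * (LINT x|lborel. (1 + norm x) ^ N * norm (\<phi> x))"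
proof -
  let ?c = "fourier_const TYPE('n)"
  have c: "?c > 0" by (rule fourier_const_pos)
  \<comment> \<open>The reflection turns \<open>inv_fourier \<sigma> (x - y)\<close> into a
    convolution kernel in \<open>y - x\<close>, where \<open>y\<close> is the variable with respect
    to which derivatives are taken.\<close>
  let ?\<kappa> = "\<lambda>z. of_real ?c * inv_fourier \<sigma> (- z)"
  have \<kappa>: "?\<kappa> \<in> schwartz" by (intro schwartz_cmult schwartz_reflect inv_fourier_schwartz \<sigma>)
  let ?m = "real (card {\<alpha> :: 'n list. length \<alpha> \<le> N})"
  have "schwartz_sup N (fourier (\<lambda>\<xi>. \<sigma> \<xi> * inv_fourier \<phi> \<xi>)) \<le> (?m * schwartz_sup N ?\<kappa>) * (LINT x|lborel. (1 + norm x) ^ N * norm (\<phi> x))"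
    if \<phi>: "\<phi> \<in> schwartz" for \<phi> :: "'n cfun"
  proof (rule schwartz_sup_le)
    fix y :: "real^'n"
    have eq: "fourier (\<lambda>\<xi>. \<sigma> \<xi> * inv_fourier \<phi> \<xi>) = (\<lambda>y. LINT x|lborel. ?\<kappa> (y - x) * \<phi> x)"
    proof
      fix y
      have "fourier (\<lambda>\<xi>. \<sigma> \<xi> * inv_fourier \<phi> \<xi>) y = (LINT x|lborel. of_real ?c * (inv_fourier \<sigma> (x - y) * \<phi> x))"
        unfolding fourier_mult_inv_fourier[OF \<sigma> \<phi>] by (rule integral_mult_right_zero[symmetric])
      then show "fourier (\<lambda>\<xi>. \<sigma> \<xi> * inv_fourier \<phi> \<xi>) y = (LINT x|lborel. ?\<kappa> (y - x) * \<phi> x)" by (simp add: mult.assoc)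
    qed
    let ?J = "LINT x|lborel. (1 + norm x) ^ N * norm (\<phi> x)"
    have t: "(1 + norm y) ^ N * norm (partial_derivs \<alpha> (fourier (\<lambda>\<xi>. \<sigma> \<xi> * inv_fourier \<phi> \<xi>)) y) \<le> schwartz_sup N ?\<kappa> * ?J"
      if \<alpha>: "length \<alpha> \<le> N" for \<alpha>
    proof -
      let ?d = "partial_derivs \<alpha> ?\<kappa>"
      have ds: "?d \<in> schwartz" by (rule schwartz_partial_derivs[OF \<kappa>])
      note [measurable] = schwartz_borel[OF ds] schwartz_borel[OF \<phi>]
      have "norm (LINT x|lborel. ?d (y - x) * \<phi> x) \<le> (LINT x|lborel. norm (?d (y - x) * \<phi> x))" by (rule integral_norm_bound)
      then have "(1 + norm y) ^ N * norm (LINT x|lborel. ?d (y - x) * \<phi> x) \<le> (1 + norm y) ^ N * (LINT x|lborel. norm (?d (y - x) * \<phi> x))"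
        by (intro mult_left_mono) auto
      also have "\<dots> = (LINT x|lborel. (1 + norm y) ^ N * norm (?d (y - x) * \<phi> x))" by (rule integral_mult_right_zero[symmetric])
      also have "\<dots> \<le> (LINT x|lborel. schwartz_sup N ?\<kappa> * ((1 + norm x) ^ N * norm (\<phi> x)))"
      proof (rule integral_mono)
        show i: "integrable lborel (\<lambda>x. schwartz_sup N ?\<kappa> * ((1 + norm x) ^ N * norm (\<phi> x)))"
          by (intro integrable_mult_right weighted_integrable \<phi>)
        show le: "(1 + norm y) ^ N * norm (?d (y - x) * \<phi> x) \<le> schwartz_sup N ?\<kappa> * ((1 + norm x) ^ N * norm (\<phi> x))" for x
        proof -
          have "(1 + norm y) ^ N \<le> (1 + norm x) ^ N * (1 + norm (y - x)) ^ N"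
            using weight_shift[of y N x] by (simp add: norm_minus_commute)
          then have "(1 + norm y) ^ N * (norm (?d (y - x)) * norm (\<phi> x)) \<le> ((1 + norm x) ^ N * (1 + norm (y - x)) ^ N) * (norm (?d (y - x)) * norm (\<phi> x))"
            by (intro mult_right_mono) auto
          also have "\<dots> = ((1 + norm (y - x)) ^ N * norm (?d (y - x))) * ((1 + norm x) ^ N * norm (\<phi> x))" by (simp only: mult_ac)
          also have "\<dots> \<le> schwartz_sup N ?\<kappa> * ((1 + norm x) ^ N * norm (\<phi> x))"
          proof (intro mult_right_mono)
            show "(1 + norm (y - x)) ^ N * norm (?d (y - x)) \<le> schwartz_sup N ?\<kappa>"
              by (rule order_trans[OF mult_left_mono[OF norm_partial_derivs_le[OF \<alpha>]] schwartz_sup_upper[OF \<kappa>]]) auto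
          qed auto
          finally show ?thesis by (simp add: norm_mult)
        qed
        show "integrable lborel (\<lambda>x. (1 + norm y) ^ N * norm (?d (y - x) * \<phi> x))"
        proof (rule Bochner_Integration.integrable_bound[OF i])
          show "AE x in lborel. norm ((1 + norm y) ^ N * norm (?d (y - x) * \<phi> x)) \<le> norm (schwartz_sup N ?\<kappa> * ((1 + norm x) ^ N * norm (\<phi> x)))"
          proof (intro AE_I2)
            fix x
            have "0 \<le> (1 + norm y) ^ N * norm (?d (y - x) * \<phi> x)" by simp
            then show "norm ((1 + norm y) ^ N * norm (?d (y - x) * \<phi> x)) \<le> norm (schwartz_sup N ?\<kappa> * ((1 + norm x) ^ N * norm (\<phi> x)))"
              using le[of x] unfolding real_norm_def by linarith
          qed
        qed measurable
      qed
      also have "\<dots> = schwartz_sup N ?\<kappa> * ?J" by (rule integral_mult_right_zero)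
      finally show ?thesis unfolding eq smooth_convolution_partial_derivs[OF \<kappa> schwartz_integrable[OF \<phi>]] .
    qed
    have "(1 + norm y) ^ N * deriv_sum N (fourier (\<lambda>\<xi>. \<sigma> \<xi> * inv_fourier \<phi> \<xi>)) y \<le> (\<Sum>\<alpha>\<in>{\<alpha>::'n list. length \<alpha> \<le> N}. schwartz_sup N ?\<kappa> * ?J)"
      unfolding deriv_sum_def sum_distrib_left by (intro sum_mono t) auto
    then show "(1 + norm y) ^ N * deriv_sum N (fourier (\<lambda>\<xi>. \<sigma> \<xi> * inv_fourier \<phi> \<xi>)) y \<le> ?m * schwartz_sup N ?\<kappa> * ?J"
      by simp
  qed
  then show ?thesis using schwartz_sup_nonneg[OF \<kappa>, of N] by (intro exI[of _ "?m * schwartz_sup N ?\<kappa>"]) auto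
qed

text \<open>An estimate of order zero; this is the hypothesis under which
  \<open>ae_bound_from_test\<close> bounds a representative of \<open>piece j f\<close> by a
  polynomial.\<close>

lemma piece_weighted_bound:
  assumes f: "f \<in> tempered"
  shows "\<exists>C N. C \<ge> 0 \<and> (\<forall>\<phi>\<in>schwartz. norm (piece j f \<phi>) \<le> C * (LINT x|lborel. (1 + norm x) ^ N * norm (\<phi> x)))"
proof -
  obtain N A where A: "A \<ge> 0" "\<And>\<phi>. \<phi> \<in> schwartz \<Longrightarrow> norm (f \<phi>) \<le> A * schwartz_sup N \<phi>"
    using tempered_bound[OF f] by blast
  obtain C where C: "C \<ge> 0" "\<And>\<phi>. \<phi> \<in> schwartz \<Longrightarrow> schwartz_sup N (fourier (\<lambda>\<xi>. dyadic \<phi>0 j \<xi> * inv_fourier \<phi> \<xi>)) \<le> C * (LINT x|lborel. (1 + norm x) ^ N * norm (\<phi> x))"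
    using filtered_sup_le[OF dyadic_schwartz] by blast
  have "norm (piece j f \<phi>) \<le> (A * C) * (LINT x|lborel. (1 + norm x) ^ N * norm (\<phi> x))" if \<phi>: "\<phi> \<in> schwartz" for \<phi>
  proof -
    have "norm (piece j f \<phi>) \<le> A * schwartz_sup N (fourier (\<lambda>\<xi>. dyadic \<phi>0 j \<xi> * inv_fourier \<phi> \<xi>))"
      unfolding piece_eq[OF \<phi>] by (rule A(2)[OF filtered_schwartz[OF \<phi> dyadic_schwartz]])
    also have "\<dots> \<le> A * (C * (LINT x|lborel. (1 + norm x) ^ N * norm (\<phi> x)))"
      by (intro mult_left_mono C(2) A(1) \<phi>)
    finally show ?thesis by (simp add: mult.assoc)
  qed
  then show ?thesis using A(1) C(1) by (intro exI[of _ "A * C"] exI[of _ N]) auto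
qed

lemma dyadic_cutoff_mult: "dyadic \<phi>0 j \<xi> * cutoff (j + 1) \<xi> = dyadic \<phi>0 j \<xi>"
proof (cases "norm \<xi> \<le> 2 ^ (j + 1)")
  case False
  then have n: "norm \<xi> \<ge> 2 * 2 ^ j" by simp
  have p: "(0::real) \<le> 2 ^ j" by simp
  have "cutoff j \<xi> = 0" by (rule cutoff_eq_0) (use n p in linarith)
  moreover have "cutoff k \<xi> = 0" if "j = Suc k" for k
  proof (rule cutoff_eq_0)
    have "(2::real) ^ k \<le> 2 ^ j" using that by (intro power_increasing) auto
    then show "3 / 2 * 2 ^ k \<le> norm \<xi>" using n p by linarith
  qed
  ultimately show ?thesis by (cases j) (simp_all add: dyadic_0_eq dyadic_Suc_eq del: dyadic.simps)
qed (simp add: cutoff_eq_1)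

lemma piece_cutoff:
  assumes \<phi>: "\<phi> \<in> schwartz"
  shows "piece j f (fourier (\<lambda>\<xi>. cutoff (j + 1) \<xi> * inv_fourier \<phi> \<xi>)) = piece j f \<phi>"
proof -
  have s: "(\<lambda>\<xi>. cutoff (j + 1) \<xi> * inv_fourier \<phi> \<xi>) \<in> schwartz"
    by (intro schwartz_mult cutoff_schwartz inv_fourier_schwartz \<phi>)
  have "dyadic \<phi>0 j \<xi> * (cutoff (j + 1) \<xi> * inv_fourier \<phi> \<xi>) = dyadic \<phi>0 j \<xi> * inv_fourier \<phi> \<xi>" for \<xi>
    unfolding mult.assoc[symmetric] dyadic_cutoff_mult ..
  then show ?thesis
    by (simp only: piece_eq[OF \<phi>] piece_eq[OF fourier_schwartz[OF s]] inv_fourier_fourier[OF s])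
qed

lemma piece_distr_of:
  assumes g: "poly_bounded A N g"
  shows "piece j (distr_of g) = distr_of (multiplier (dyadic \<phi>0 j) g)"
proof
  fix \<phi>
  show "piece j (distr_of g) \<phi> = distr_of (multiplier (dyadic \<phi>0 j) g) \<phi>"
  proof (cases "\<phi> \<in> schwartz")
    case True
    then show ?thesis
      using filtered_schwartz[OF True dyadic_schwartz] multiplier_adjoint[OF dyadic_schwartz True g]
      by (simp add: piece_eq distr_of_def)
  qed (simp add: piece_outside distr_of_def)
qed

text \<open>The partial sums telescope to the filter \<open>cutoff k\<close>, and
  \<open>cutoff k\<close> times a Schwartz function converges to that function in the Schwartz
  space; the continuity of \<open>f\<close> carries this over.\<close>

lemma piece_sum_tendsto:
  assumes f: "f \<in> tempered" and \<phi>: "\<phi> \<in> schwartz"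
  shows "(\<lambda>k. \<Sum>j\<le>k. piece j f \<phi>) \<longlonglongrightarrow> f \<phi>"
proof -
  let ?\<psi> = "inv_fourier \<phi>"
  have \<psi>: "?\<psi> \<in> schwartz" by (rule inv_fourier_schwartz[OF \<phi>])
  have m: "(\<lambda>\<xi>. \<sigma> \<xi> * ?\<psi> \<xi>) \<in> schwartz" if "\<sigma> \<in> schwartz" for \<sigma> by (intro schwartz_mult that \<psi>)
  have F_add: "fourier (\<lambda>\<xi>. g \<xi> + h \<xi>) = (\<lambda>x. fourier g x + fourier h x)" if "g \<in> schwartz" "h \<in> schwartz" for g h :: "'n cfun"
    using that by (intro ext)
      (simp add: fourier_eq schwartz_borel schwartz_add distrib_left exp_mult_integrable[of _ "- _", simplified inner_minus_right] exp_mult_integrable schwartz_integrable del: inner_minus_right)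
  have sum: "(\<Sum>j\<le>k. piece j f \<phi>) = f (fourier (\<lambda>\<xi>. cutoff k \<xi> * ?\<psi> \<xi>))" for k
  proof (induction k)
    case 0
    then show ?case by (simp add: piece_eq[OF \<phi>] dyadic_0_eq del: dyadic.simps)
  next
    case (Suc k)
    have "f (fourier (\<lambda>\<xi>. cutoff (Suc k) \<xi> * ?\<psi> \<xi>)) = f (fourier (\<lambda>\<xi>. cutoff k \<xi> * ?\<psi> \<xi> + dyadic \<phi>0 (Suc k) \<xi> * ?\<psi> \<xi>))"
      unfolding dyadic_Suc_eq by (simp add: algebra_simps)
    also have "\<dots> = f (fourier (\<lambda>\<xi>. cutoff k \<xi> * ?\<psi> \<xi>)) + f (fourier (\<lambda>\<xi>. dyadic \<phi>0 (Suc k) \<xi> * ?\<psi> \<xi>))"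
      unfolding F_add[OF m[OF cutoff_schwartz] m[OF dyadic_schwartz]]
      by (rule tempered_add[OF f]) (intro fourier_schwartz m cutoff_schwartz dyadic_schwartz)+
    finally show ?case using Suc by (simp add: piece_eq[OF \<phi>] del: dyadic.simps)
  qed
  obtain N C where C: "C \<ge> 0" "\<And>\<phi>. \<phi> \<in> schwartz \<Longrightarrow> norm (f \<phi>) \<le> C * schwartz_sup N \<phi>"
    using tempered_bound[OF f] by blast
  obtain K M where K: "K \<ge> 0" "\<And>g::'n cfun. g \<in> schwartz \<Longrightarrow> schwartz_sup N (fourier g) \<le> K * schwartz_sup M g"
    using fourier_bound[of N, where 'n = 'n] by blast
  have "(\<lambda>k. f (fourier (\<lambda>\<xi>. cutoff k \<xi> * ?\<psi> \<xi>)) - f \<phi>) \<longlonglongrightarrow> 0"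
  proof (rule Lim_null_comparison[OF always_eventually], intro allI)
    fix k
    have d: "(\<lambda>\<xi>. cutoff k \<xi> * ?\<psi> \<xi> - ?\<psi> \<xi>) \<in> schwartz" by (intro schwartz_diff m cutoff_schwartz \<psi>)
    have "fourier (\<lambda>\<xi>. cutoff k \<xi> * ?\<psi> \<xi>) = fourier (\<lambda>\<xi>. (cutoff k \<xi> * ?\<psi> \<xi> - ?\<psi> \<xi>) + ?\<psi> \<xi>)" by simp
    also have "\<dots> = (\<lambda>x. fourier (\<lambda>\<xi>. cutoff k \<xi> * ?\<psi> \<xi> - ?\<psi> \<xi>) x + \<phi> x)"
      unfolding F_add[OF d \<psi>] fourier_inv_fourier[OF \<phi>] ..
    finally have "f (fourier (\<lambda>\<xi>. cutoff k \<xi> * ?\<psi> \<xi>)) = f (fourier (\<lambda>\<xi>. cutoff k \<xi> * ?\<psi> \<xi> - ?\<psi> \<xi>)) + f \<phi>"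
      using tempered_add[OF f fourier_schwartz[OF d] \<phi>] by simp
    then have "norm (f (fourier (\<lambda>\<xi>. cutoff k \<xi> * ?\<psi> \<xi>)) - f \<phi>) \<le> C * schwartz_sup N (fourier (\<lambda>\<xi>. cutoff k \<xi> * ?\<psi> \<xi> - ?\<psi> \<xi>))"
      using C(2)[OF fourier_schwartz[OF d]] by simp
    also have "\<dots> \<le> C * (K * schwartz_sup M (\<lambda>\<xi>. cutoff k \<xi> * ?\<psi> \<xi> - ?\<psi> \<xi>))"
      by (intro mult_left_mono K(2) d C(1))
    finally show "norm (f (fourier (\<lambda>\<xi>. cutoff k \<xi> * ?\<psi> \<xi>)) - f \<phi>) \<le> (C * K) * schwartz_sup M (\<lambda>\<xi>. cutoff k \<xi> * ?\<psi> \<xi> - ?\<psi> \<xi>)"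
      by (simp add: mult.assoc)
  next
    show "(\<lambda>k. (C * K) * schwartz_sup M (\<lambda>\<xi>. cutoff k \<xi> * ?\<psi> \<xi> - ?\<psi> \<xi>)) \<longlonglongrightarrow> 0"
      using tendsto_mult[OF tendsto_const cutoff_mult_tendsto[OF \<psi>]] by simp
  qed
  then show ?thesis unfolding sum by (simp add: LIM_zero_iff)
qed

lemma Lp_norm_AE_cong:
  fixes u :: "'n cfun"
  assumes p: "0 < p" and u: "u \<in> borel_measurable borel" and g: "g \<in> borel_measurable lebesgue" and ae: "AE x in lebesgue. g x = u x"
  shows "Lp_norm p g = Lp_norm p u"
proof (cases "p = \<infinity>")
  case True
  have "esssup lebesgue (\<lambda>x. ennreal (norm (g x))) = esssup lebesgue (\<lambda>x. ennreal (norm (u x)))"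
  proof (rule esssup_AE_cong)
    show "(\<lambda>x. ennreal (norm (g x))) \<in> borel_measurable lebesgue" using g by measurable
    note [measurable] = u
    have "(\<lambda>x. ennreal (norm (u x))) \<in> borel_measurable lborel" by measurable
    then show "(\<lambda>x. ennreal (norm (u x))) \<in> borel_measurable lebesgue" by (rule measurable_completion)
    show "AE x in lebesgue. ennreal (norm (g x)) = ennreal (norm (u x))" using ae by eventually_elim simp
  qed
  then show ?thesis using True by (simp add: Lp_norm_def)
next
  case False
  have "(\<integral>\<^sup>+x. ennreal (norm (g x) powr real_of_ereal p) \<partial>lebesgue) = (\<integral>\<^sup>+x. ennreal (norm (u x) powr real_of_ereal p) \<partial>lebesgue)"
    by (rule nn_integral_cong_AE) (use ae in \<open>eventually_elim, simp\<close>)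
  then show ?thesis using False by (simp add: Lp_norm_def)
qed

text \<open>All representing functions agree almost everywhere, and \<open>g\<close> is one of them,
  so the infimum is taken over a single value.\<close>

lemma distr_Lp_norm_distr_of:
  assumes p: "0 < p" and g: "poly_bounded A N g"
  shows "distr_Lp_norm p (distr_of g) = Lp_norm p (g :: 'n cfun)"
proof -
  have "Lp_norm p h = Lp_norm p g" if h: "represents h (distr_of g)" for h
  proof (rule Lp_norm_AE_cong[OF p poly_bounded_borel[OF g]])
    show "h \<in> borel_measurable lebesgue" using h by (intro L1_loc_measurable) (simp add: represents_def)
    show "AE x in lebesgue. h x = g x"
      by (rule represents_ae_unique[OF h poly_bounded_locally_integrable[OF g]])
        (simp add: distr_of_def test_function_schwartz)
  qed
  then have eq: "Lp_norm p g \<le> Lp_norm p h" if "represents h (distr_of g)" for h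
    by (simp add: that)
  show ?thesis unfolding distr_Lp_norm_def
  proof (rule antisym)
    show "(INF h\<in>{h. represents h (distr_of g)}. Lp_norm p h) \<le> Lp_norm p g"
      by (rule INF_lower) (simp add: distr_of_represents[OF g])
    show "Lp_norm p g \<le> (INF h\<in>{h. represents h (distr_of g)}. Lp_norm p h)"
      by (rule INF_greatest) (simp add: eq)
  qed
qed

text \<open>A representative exists since the infimum over the empty set would be infinite. The
  estimate of order zero bounds it almost everywhere by a polynomial. Since
  \<open>cutoff (j + 1)\<close> equals 1 on the support of \<open>dyadic \<phi>0 j\<close>,
  filtering with it changes the function only on a null set, and the filtered function satisfies the
  reproducing identity at every point.\<close>

lemma piece_function:
  assumes p: "0 < p" and f: "f \<in> tempered" and fin: "distr_Lp_norm p (piece j f) < \<infinity>"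
  shows "\<exists>a A N. poly_bounded A N a \<and> multiplier (cutoff (j + 1)) a = a \<and> piece j f = distr_of a"
proof -
  have "{g. represents g (piece j f)} \<noteq> {}"
  proof
    assume "{g. represents g (piece j f)} = {}"
    then show False using fin unfolding distr_Lp_norm_def by (simp only: image_empty Inf_empty) simp
  qed
  then obtain g where g: "represents g (piece j f)" by blast
  obtain g' where g': "locally_integrable g'" "AE x in lebesgue. g x = g' x"
    using L1_loc_borel_version[of g] g by (auto simp: represents_def)
  have T: "piece j f \<in> tempered" using g by (simp add: represents_def)
  have test: "piece j f \<phi> = (LINT x|lborel. g' x * \<phi> x)" if "\<phi> \<in> test_functions" for \<phi>
    by (rule represents_test[OF g g' that])
  obtain C N where C: "C \<ge> 0" "\<And>\<phi>. \<phi> \<in> schwartz \<Longrightarrow> norm (piece j f \<phi>) \<le> C * (LINT x|lborel. (1 + norm x) ^ N * norm (\<phi> x))"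
    using piece_weighted_bound[OF f, of j] by blast
  let ?w = "\<lambda>x::real^'n. C * (1 + norm x) ^ N"
  have ae: "AE x in lborel. norm (g' x) \<le> ?w x"
  proof (rule ae_bound_from_test[OF g'(1)])
    show "continuous_on UNIV ?w" by (intro continuous_intros)
    show "0 \<le> ?w x" for x using C(1) by simp
    fix \<phi> :: "'n cfun" assume \<phi>: "\<phi> \<in> test_functions"
    have "norm (LINT x|lborel. g' x * \<phi> x) \<le> C * (LINT x|lborel. (1 + norm x) ^ N * norm (\<phi> x))"
      using C(2)[OF test_function_schwartz[OF \<phi>]] by (simp add: test[OF \<phi>])
    also have "\<dots> = (LINT x|lborel. C * ((1 + norm x) ^ N * norm (\<phi> x)))" by (rule integral_mult_right_zero[symmetric])
    finally show "norm (LINT x|lborel. g' x * \<phi> x) \<le> (LINT x|lborel. ?w x * norm (\<phi> x))" by (simp add: mult.assoc)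
  qed
  \<comment> \<open>Redefined on a null set so that the polynomial bound holds everywhere, as
    \<open>poly_bounded\<close> demands.\<close>
  define h where "h x = (if norm (g' x) \<le> ?w x then g' x else 0)" for x
  have [measurable]: "g' \<in> borel_measurable borel" by (rule locally_integrable_borel[OF g'(1)])
  have hm [measurable]: "h \<in> borel_measurable borel" unfolding h_def[abs_def] by measurable
  have h: "poly_bounded C N h" using C(1) hm by (auto simp: poly_bounded_def h_def)
  have hae: "AE x in lborel. g' x = h x" using ae by eventually_elim (simp add: h_def)
  have th: "piece j f = distr_of h"
  proof (rule tempered_eq_distr_of[OF h T])
    fix \<phi> :: "'n cfun" assume \<phi>: "\<phi> \<in> test_functions"
    note [measurable] = schwartz_borel[OF test_function_schwartz[OF \<phi>]]
    have "(LINT x|lborel. g' x * \<phi> x) = (LINT x|lborel. h x * \<phi> x)"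
      by (rule integral_cong_AE) (use hae in \<open>auto elim!: eventually_mono\<close>)
    then show "piece j f \<phi> = (LINT x|lborel. h x * \<phi> x)" by (simp add: test[OF \<phi>])
  qed
  let ?a = "multiplier (cutoff (j + 1)) h"
  have pa: "poly_bounded (fourier_const TYPE('n) * C * (LINT z|lborel. (1 + norm z) ^ N * norm (inv_fourier (cutoff (j + 1)) z))) N ?a"
    by (rule multiplier_poly_bounded[OF cutoff_schwartz h])
  have same: "(LINT x|lborel. h x * \<phi> x) = (LINT x|lborel. ?a x * \<phi> x)" if \<phi>: "\<phi> \<in> schwartz" for \<phi>
  proof -
    have "(LINT x|lborel. h x * \<phi> x) = piece j f \<phi>" using \<phi> by (simp add: th distr_of_def)
    also have "\<dots> = piece j f (fourier (\<lambda>\<xi>. cutoff (j + 1) \<xi> * inv_fourier \<phi> \<xi>))" by (rule piece_cutoff[OF \<phi>, symmetric])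
    also have "\<dots> = (LINT y|lborel. h y * fourier (\<lambda>\<xi>. cutoff (j + 1) \<xi> * inv_fourier \<phi> \<xi>) y)"
      using filtered_schwartz[OF \<phi> cutoff_schwartz] by (simp add: th distr_of_def)
    also have "\<dots> = (LINT x|lborel. ?a x * \<phi> x)" by (rule multiplier_adjoint[OF cutoff_schwartz \<phi> h])
    finally show ?thesis .
  qed
  have aae: "AE x in lborel. h x = ?a x"
    by (rule locally_integrable_ae_unique[OF poly_bounded_locally_integrable[OF h] poly_bounded_locally_integrable[OF pa]])
      (simp add: same test_function_schwartz)
  \<comment> \<open>\<open>?a\<close> is the filtered \<open>h\<close> and agrees with
    \<open>h\<close> almost everywhere, so filtering either of them gives the same function.\<close>
  have "multiplier (cutoff (j + 1)) ?a = ?a"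
    by (rule multiplier_cong_AE[OF cutoff_schwartz poly_bounded_borel[OF h] poly_bounded_borel[OF pa] aae, symmetric])
  moreover have "piece j f = distr_of ?a"
    unfolding th by (intro ext) (simp add: distr_of_def same)
  ultimately show ?thesis using pa by blast
qed

text \<open>Trades the nested extended real norm for a sequence \<open>b\<close> of majorants. Since
  \<open>b\<close> need not consist of the exact norms, later estimates may supply any convenient
  upper bound for each band.\<close>

lemma besov_norm_le_iff:
  assumes q: "0 < q" and B: "0 \<le> B"
  shows "besov_norm \<phi>0 s p q f \<le> ennreal B \<longleftrightarrow>
    (\<exists>b. (\<forall>j. 0 \<le> b j \<and> distr_Lp_norm p (piece j f) \<le> ennreal (b j)) \<and> lq_le q (\<lambda>j. 2 powr (real j * s) * b j) B)"
    (is "?L \<longleftrightarrow> ?R")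
proof (cases "q = \<infinity>")
  case True
  let ?l = "\<lambda>j. distr_Lp_norm p (piece j f)"
  have n: "besov_norm \<phi>0 s p q f = (SUP j. ennreal (2 powr (real j * s)) * ?l j)"
    using True by (simp add: besov_norm_def piece_def Let_def)
  show ?thesis
  proof
    assume L: ?L
    have le: "ennreal (2 powr (real j * s)) * ?l j \<le> ennreal B" for j
      using L unfolding n by (meson SUP_upper UNIV_I order_trans)
    show ?R
    proof (intro exI[of _ "\<lambda>j. B / 2 powr (real j * s)"] conjI allI)
      fix j
      have "ennreal (1 / 2 powr (real j * s)) * (ennreal (2 powr (real j * s)) * ?l j) \<le> ennreal (1 / 2 powr (real j * s)) * ennreal B"
        by (intro mult_left_mono le) simp
      then show "?l j \<le> ennreal (B / 2 powr (real j * s))"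
        using B by (simp add: mult.assoc[symmetric] flip: ennreal_mult)
    qed (use B True in \<open>auto simp: lq_le_def\<close>)
  next
    assume ?R
    then obtain b where b: "\<And>j. 0 \<le> b j" "\<And>j. ?l j \<le> ennreal (b j)" "lq_le q (\<lambda>j. 2 powr (real j * s) * b j) B" by blast
    show ?L unfolding n
    proof (rule SUP_least)
      fix j
      have "ennreal (2 powr (real j * s)) * ?l j \<le> ennreal (2 powr (real j * s)) * ennreal (b j)" by (intro mult_left_mono b) simp
      also have "\<dots> = ennreal (2 powr (real j * s) * b j)" using b by (simp add: ennreal_mult)
      also have "\<dots> \<le> ennreal B" using b(3) True by (intro ennreal_leI) (simp add: lq_le_def)
      finally show "ennreal (2 powr (real j * s)) * ?l j \<le> ennreal B" .
    qed
  qed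
next
  case False
  let ?l = "\<lambda>j. distr_Lp_norm p (piece j f)"
  define Q where "Q = real_of_ereal q"
  have Q: "Q > 0" unfolding Q_def by (rule real_of_ereal_pos_finite[OF q False])
  let ?t = "\<lambda>j. ennreal (2 powr (real j * s * Q)) * ennreal_powr (?l j) Q"
  have n: "?L \<longleftrightarrow> (\<Sum>j. ?t j) \<le> ennreal (B powr Q)"
    using False ennreal_powr_le_iff[OF Q B] by (simp add: besov_norm_def piece_def Let_def Q_def)
  have trm: "?t j = ennreal ((2 powr (real j * s) * x) powr Q)" if "?l j = ennreal x" "0 \<le> x" for j x
    using that by (simp add: ennreal_powr_def powr_mult powr_powr flip: ennreal_mult)
  show ?thesis
  proof
    assume ?L
    then have L: "(\<Sum>j. ?t j) \<le> ennreal (B powr Q)" using n by simp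
    have fin: "?l j < \<infinity>" for j
    proof (rule ccontr)
      assume "\<not> ?l j < \<infinity>"
      then have "?l j = \<infinity>" by (metis infinity_ennreal_def top.not_eq_extremum)
      then have "?t j = \<infinity>" by (simp add: ennreal_powr_def ennreal_mult_top)
      moreover have "?t j \<le> (\<Sum>j. ?t j)" by (rule ennreal_le_suminf[of ?t j])
      ultimately show False using L by (simp add: top_unique)
    qed
    let ?b = "\<lambda>j. enn2real (?l j)"
    have lb: "?l j = ennreal (?b j)" for j using fin[of j] by (simp add: ennreal_enn2real)
    have "lq_le q (\<lambda>j. 2 powr (real j * s) * ?b j) B"
      using L False unfolding trm[OF lb enn2real_nonneg] by (simp add: lq_le_def Q_def)
    then show ?R using lb by (intro exI[of _ ?b]) auto
  next
    assume ?R
    then obtain b where b: "\<And>j. 0 \<le> b j" "\<And>j. ?l j \<le> ennreal (b j)" "lq_le q (\<lambda>j. 2 powr (real j * s) * b j) B" by blast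
    have "(\<Sum>j. ?t j) \<le> (\<Sum>j. ennreal ((2 powr (real j * s) * b j) powr Q))"
    proof (intro suminf_le summableI)
      fix j
      have "?l j \<noteq> \<infinity>" using b(2)[of j] by (auto simp: top_unique)
      then obtain x where x: "?l j = ennreal x" "0 \<le> x" by (cases "?l j") auto
      then have "x \<le> b j" using b by (metis ennreal_le_iff)
      then show "?t j \<le> ennreal ((2 powr (real j * s) * b j) powr Q)"
        unfolding trm[OF x] using x Q by (intro ennreal_leI powr_mono2 mult_left_mono) auto
    qed
    also have "\<dots> \<le> ennreal (B powr Q)" using b(3) False by (simp add: lq_le_def Q_def)
    finally show ?L using n by simp
  qed
qed

end

section \<open>Estimates for band-limited functions in the quasi-norms\<close>

lemma norm_sums_le:
  fixes f :: "nat \<Rightarrow> 'b::real_normed_vector"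
  assumes "f sums l"
  shows "ennreal (norm l) \<le> (\<Sum>i. ennreal (norm (f i)))"
proof (rule LIMSEQ_le_const2)
  have "(\<lambda>k. \<Sum>i<k. f i) \<longlonglongrightarrow> l" using assms by (simp add: sums_def)
  then show "(\<lambda>k. ennreal (norm (\<Sum>i<k. f i))) \<longlonglongrightarrow> ennreal (norm l)" by (intro tendsto_intros)
  have "ennreal (norm (\<Sum>i<k. f i)) \<le> (\<Sum>i. ennreal (norm (f i)))" for k
  proof -
    have "ennreal (norm (\<Sum>i<k. f i)) \<le> ennreal (\<Sum>i<k. norm (f i))" by (intro ennreal_leI norm_sum)
    also have "\<dots> = (\<Sum>i<k. ennreal (norm (f i)))" by simp
    also have "\<dots> \<le> (\<Sum>i. ennreal (norm (f i)))" by (rule sum_le_suminf) auto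
    finally show ?thesis .
  qed
  then show "\<exists>N. \<forall>k\<ge>N. ennreal (norm (\<Sum>i<k. f i)) \<le> (\<Sum>i. ennreal (norm (f i)))" by blast
qed

text \<open>Meant for index shifts on natural numbers, where \<open>P\<close> excludes the indices
  at which a subtraction would be truncated.\<close>

lemma suminf_reindex_le:
  fixes f :: "nat \<Rightarrow> ennreal"
  assumes "inj_on g {i. P i}"
  shows "(\<Sum>i. if P i then f (g i) else 0) \<le> (\<Sum>i. f i)"
proof (rule suminf_le_const)
  show "summable (\<lambda>i. if P i then f (g i) else 0)" by simp
  fix k
  have "(\<Sum>i<k. if P i then f (g i) else 0) = (\<Sum>i\<in>{i\<in>{..<k}. P i}. f (g i))"
    using sum.inter_filter[of "{..<k}" "\<lambda>i. f (g i)" P] by simp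
  also have "\<dots> = (\<Sum>i\<in>g ` {i\<in>{..<k}. P i}. f i)"
    by (subst sum.reindex) (use assms in \<open>auto intro: inj_on_subset\<close>)
  also have "\<dots> \<le> (\<Sum>i. f i)" by (rule sum_le_suminf) auto
  finally show "(\<Sum>i<k. if P i then f (g i) else 0) \<le> (\<Sum>i. f i)" .
qed

lemma lq_le_zero: "0 \<le> B \<Longrightarrow> lq_le q (\<lambda>l. 0) B"
  by (auto simp: lq_le_def)

lemma lq_le_reindex:
  assumes t: "lq_le q t B" "0 \<le> B" and g: "inj_on g {i. P i}"
  shows "lq_le q (\<lambda>i. if P i then t (g i) else 0) B"
proof (cases "q = \<infinity>")
  case False
  have "(\<Sum>i. ennreal ((if P i then t (g i) else 0) powr real_of_ereal q))
      = (\<Sum>i. if P i then ennreal (t (g i) powr real_of_ereal q) else 0)"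
    by (intro arg_cong[where f = suminf] ext) auto
  also have "\<dots> \<le> (\<Sum>i. ennreal (t i powr real_of_ereal q))" by (rule suminf_reindex_le[OF g])
  also have "\<dots> \<le> ennreal (B powr real_of_ereal q)" using t False by (simp add: lq_le_def)
  finally show ?thesis using False by (simp add: lq_le_def)
qed (use t in \<open>auto simp: lq_le_def\<close>)

lemma lq_le_cmult:
  assumes b: "lq_le q b B" "\<And>j. 0 \<le> b j" "0 \<le> B" and M: "0 \<le> M"
  shows "lq_le q (\<lambda>j. M * b j) (M * B)"
proof (cases "q = \<infinity>")
  case True
  then show ?thesis using b M by (auto simp: lq_le_def intro: mult_left_mono)
next
  case False
  let ?q = "real_of_ereal q"
  have "(\<Sum>j. ennreal ((M * b j) powr ?q)) = (\<Sum>j. ennreal (M powr ?q) * ennreal (b j powr ?q))"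
    using b M by (simp add: powr_mult ennreal_mult)
  also have "\<dots> = ennreal (M powr ?q) * (\<Sum>j. ennreal (b j powr ?q))" by (rule ennreal_suminf_cmult)
  also have "\<dots> \<le> ennreal (M powr ?q) * ennreal (B powr ?q)"
    using b(1) False by (intro mult_left_mono) (simp_all add: lq_le_def)
  also have "\<dots> = ennreal ((M * B) powr ?q)" using b M by (simp add: powr_mult ennreal_mult)
  finally show ?thesis using False by (simp add: lq_le_def)
qed

lemma Lp_le_zero: "0 \<le> B \<Longrightarrow> Lp_le p (\<lambda>x. 0) B"
  by (auto simp: Lp_le_def)

text \<open>The quasi-triangle inequality as a series with two nonzero terms. The factor 2 in
  \<open>2 * (A + B)\<close> makes up for the weight \<open>2 powr (- 1)\<close> of the second
  term.\<close>

lemma Lp_le_add: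
  assumes p: "0 < p"
  shows "\<exists>C>0. \<forall>(u::'n::finite cfun) v A B. u \<in> borel_measurable borel \<longrightarrow> v \<in> borel_measurable borel \<longrightarrow>
    Lp_le p u A \<longrightarrow> Lp_le p v B \<longrightarrow> 0 \<le> A \<longrightarrow> 0 \<le> B \<longrightarrow> Lp_le p (\<lambda>x. u x + v x) (C * (A + B))"
proof -
  obtain C where C: "C > 0" "\<And>(u :: nat \<Rightarrow> 'n cfun) w D. \<lbrakk>0 \<le> D; \<And>i. u i \<in> borel_measurable borel;
     \<And>i. Lp_le p (u i) (2 powr (- (real i * 1)) * D);
     AE x in lborel. ennreal (norm (w x)) \<le> (\<Sum>i. ennreal (norm (u i x)))\<rbrakk> \<Longrightarrow> Lp_le p w (C * D)"
    using Lp_le_series[OF p zero_less_one, where 'n='n] by blast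
  have "Lp_le p (\<lambda>x. u x + v x) ((C * 2) * (A + B))"
    if m: "u \<in> borel_measurable borel" "v \<in> borel_measurable borel"
      and b: "Lp_le p u A" "Lp_le p v B" "0 \<le> A" "0 \<le> B" for u v :: "'n cfun" and A B
  proof -
    define w where "w i = (if i = 0 then u else if i = 1 then v else (\<lambda>x. 0))" for i :: nat
    have "Lp_le p (\<lambda>x. u x + v x) (C * (2 * (A + B)))"
    proof (rule C(2)[of _ w])
      show "0 \<le> 2 * (A + B)" using b by simp
      show "w i \<in> borel_measurable borel" for i using m by (simp add: w_def)
      show "Lp_le p (w i) (2 powr (- (real i * 1)) * (2 * (A + B)))" for i
        using Lp_le_mono[OF p b(1,3), of "2 * (A + B)"] Lp_le_mono[OF p b(2,4), of "A + B"] b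
        by (auto simp: w_def powr_minus add_divide_distrib intro!: Lp_le_zero)
      have "(\<lambda>i. w i x) sums (\<Sum>i\<in>{0,1}. w i x)" for x by (rule sums_finite) (auto simp: w_def)
      then have "ennreal (norm (u x + v x)) \<le> (\<Sum>i. ennreal (norm (w i x)))" for x
        using norm_sums_le[of "\<lambda>i. w i x"] by (simp add: w_def)
      then show "AE x in lborel. ennreal (norm (u x + v x)) \<le> (\<Sum>i. ennreal (norm (w i x)))" by simp
    qed
    then show ?thesis by (simp add: mult.assoc)
  qed
  then show ?thesis using C(1) by (intro exI[of _ "C * 2"]) auto
qed

lemma lq_le_add:
  assumes q: "0 < q"
  shows "\<exists>C>0. \<forall>a b A B. lq_le q a A \<longrightarrow> lq_le q b B \<longrightarrow> (\<forall>j. 0 \<le> a j) \<longrightarrow> (\<forall>j. 0 \<le> b j) \<longrightarrow> 0 \<le> A \<longrightarrow> 0 \<le> B \<longrightarrow>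
    lq_le q (\<lambda>j. a j + b j) (C * (A + B))"
proof -
  obtain K where K: "K > 0" "\<And>c e C B. \<lbrakk>0 \<le> B; 0 \<le> C; \<And>i l. 0 \<le> c i l; \<And>l. 0 \<le> e l;
     \<And>i::nat. lq_le q (c i) (2 powr (- (real i * 1)) * B);
     \<And>l D. 0 \<le> D \<Longrightarrow> (\<And>i. c i l \<le> D) \<Longrightarrow> e l \<le> C * D\<rbrakk> \<Longrightarrow> lq_le q e (K * C * B)"
    using lq_le_series[OF q zero_less_one] by blast
  have "lq_le q (\<lambda>j. a j + b j) ((K * 4) * (A + B))"
    if h: "lq_le q a A" "lq_le q b B" "\<And>j. 0 \<le> a j" "\<And>j. 0 \<le> b j" "0 \<le> A" "0 \<le> B" for a b A B
  proof -
    define c where "c i = (if i = 0 then a else if i = 1 then b else (\<lambda>j. 0))" for i :: nat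
    \<comment> \<open>One factor 2 bounds a sum of two terms by twice a common upper bound, the
      other makes up for the weight \<open>2 powr (- 1)\<close> of the second sequence.\<close>
    have "lq_le q (\<lambda>j. a j + b j) (K * 2 * (2 * (A + B)))"
    proof (rule K(2)[of _ _ c])
      show "lq_le q (c i) (2 powr (- (real i * 1)) * (2 * (A + B)))" for i
        using lq_le_mono[OF q h(1,3) order_refl h(5), of "2 * (A + B)"] lq_le_mono[OF q h(2,4) order_refl h(6), of "A + B"] h(5,6)
        by (auto simp: c_def powr_minus add_divide_distrib intro!: lq_le_zero)
      fix l D assume "\<And>i. c i l \<le> D"
      from this[of 0] this[of 1] show "a l + b l \<le> 2 * D" by (simp add: c_def)
    qed (use h in \<open>auto simp: c_def\<close>)
    then show ?thesis by (simp add: mult.assoc)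
  qed
  then show ?thesis using K(1) by (intro exI[of _ "K * 4"]) auto
qed

section \<open>Estimates for fixed parameters \<open>s\<close>, \<open>p\<close> and
  \<open>q\<close>\<close>

locale besov_setting = dyadic_resolution \<phi>0 for \<phi>0 :: "real ^ 'n::finite \<Rightarrow> complex" +
  fixes s :: real and p q :: ereal
  assumes p_pos: "0 < p" and q_pos: "0 < q" and s_large: "ereal (real CARD('n)) / p < ereal s"
begin

text \<open>The power with which the frequency \<open>2 ^ j\<close> enters Nikolskii's
  inequality.\<close>

definition dim_loss :: real where
  "dim_loss = (if p = \<infinity> then 0 else real CARD('n) / real_of_ereal p)"

text \<open>Equals \<open>n * max 0 (1 / p - 1)\<close> for \<open>n = CARD('n)\<close> and finite
  \<open>p\<close>: the exponent lost per level when a function is filtered to a lower band.\<close>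

definition smoothing_loss :: real where
  "smoothing_loss = (if p = \<infinity> then 0 else real CARD('n) * (1 - min 1 (real_of_ereal p)) / real_of_ereal p)"

lemma dim_loss_less: "dim_loss < s"
proof (cases "p = \<infinity>")
  case False
  then obtain r where r: "p = ereal r" "0 < r" using p_pos by (cases p) auto
  then have "real CARD('n) / r < s" using s_large by simp
  moreover have "dim_loss = real CARD('n) / r" unfolding dim_loss_def by (simp add: r)
  ultimately show ?thesis by simp
next
  case True
  moreover from this have "dim_loss = 0" unfolding dim_loss_def by simp
  ultimately show ?thesis using s_large by simp
qed

lemma smoothing_loss_le: "0 \<le> smoothing_loss" "smoothing_loss < s"
proof -
  have "smoothing_loss \<le> dim_loss"
    using real_of_ereal_pos_finite[OF p_pos] by (auto simp: dim_loss_def smoothing_loss_def intro!: divide_right_mono mult_left_le)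
  then show "smoothing_loss < s" using dim_loss_less by simp
  show "0 \<le> smoothing_loss" using real_of_ereal_pos_finite[OF p_pos] by (auto simp: smoothing_loss_def)
qed

lemma dyadic_sup_bound:
  "\<exists>C>0. \<forall>l h B x. h \<in> borel_measurable borel \<longrightarrow> 0 \<le> B \<longrightarrow> (AE y in lborel. norm (h y) \<le> B) \<longrightarrow>
    norm (multiplier (dyadic \<phi>0 l) h x) \<le> C * B"
proof -
  obtain C where C: "C > 0" "\<And>l. (\<integral>\<^sup>+z. ennreal (norm (inv_fourier (dyadic \<phi>0 l) z) powr 1) \<partial>lborel) \<le> ennreal (C * 2 powr (real l * real CARD('n) * (1 - 1)))"
    using scaled_kernels_power_integral[OF scaled_kernels_dyadic, of 1] by auto
  then have C': "(\<integral>\<^sup>+z. ennreal (norm (inv_fourier (dyadic \<phi>0 l) z)) \<partial>lborel) \<le> ennreal C" for l by simp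
  show ?thesis
    using multiplier_sup_le[OF dyadic_schwartz _ _ _ less_imp_le[OF C(1)] C'] fourier_const_pos[where 'n='n] C(1)
    by (intro exI[of _ "fourier_const TYPE('n) * C"]) simp
qed

lemma nikolskii_Lp:
  "\<exists>C>0. \<forall>j u A N B x. poly_bounded A N u \<longrightarrow> multiplier (cutoff j) u = u \<longrightarrow> 0 \<le> B \<longrightarrow> Lp_le p u B \<longrightarrow>
    norm (u x) \<le> C * 2 powr (real j * dim_loss) * B"
proof (cases "p = \<infinity>")
  case True
  obtain C where C: "C > 0" "\<And>l. (\<integral>\<^sup>+z. ennreal (norm (inv_fourier (cutoff l) z) powr 1) \<partial>lborel) \<le> ennreal (C * 2 powr (real l * real CARD('n) * (1 - 1)))"
    using scaled_kernels_power_integral[OF scaled_kernels_cutoff, of 1] by auto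
  then have C': "(\<integral>\<^sup>+z. ennreal (norm (inv_fourier (cutoff l) z)) \<partial>lborel) \<le> ennreal C" for l by simp
  have "norm (u x) \<le> fourier_const TYPE('n) * C * 2 powr (real j * dim_loss) * B"
    if u: "poly_bounded A N u" "multiplier (cutoff j) u = u" "0 \<le> B" "Lp_le p u B" for j u A N B x
  proof -
    have "norm (multiplier (cutoff j) u x) \<le> fourier_const TYPE('n) * C * B"
      using u(4) True
      by (intro multiplier_sup_le cutoff_schwartz poly_bounded_borel[OF u(1)] u(3) less_imp_le[OF C(1)] C') (simp add: Lp_le_def)
    moreover have "dim_loss = 0" unfolding dim_loss_def using True by simp
    ultimately show ?thesis by (simp add: u(2))
  qed
  then show ?thesis using fourier_const_pos[where 'n='n] C(1)
    by (intro exI[of _ "fourier_const TYPE('n) * C"]) auto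
next
  case False
  let ?p = "real_of_ereal p"
  have p': "?p > 0" by (rule real_of_ereal_pos_finite[OF p_pos False])
  obtain C where C: "C > 0" "\<And>j u A N I x. \<lbrakk>poly_bounded A N u; multiplier (cutoff j) u = u; 0 \<le> I;
     (\<integral>\<^sup>+y. ennreal (norm (u y) powr ?p) \<partial>lborel) \<le> ennreal I\<rbrakk> \<Longrightarrow> norm (u x) powr ?p \<le> C * (2 ^ j) ^ CARD('n) * I"
    using nikolskii[OF p'] by blast
  have "norm (u x) \<le> C powr (1 / ?p) * 2 powr (real j * dim_loss) * B"
    if u: "poly_bounded A N u" "multiplier (cutoff j) u = u" "0 \<le> B" "Lp_le p u B" for j u A N B x
  proof -
    have "norm (u x) powr ?p \<le> C * (2 ^ j) ^ CARD('n) * (B powr ?p)"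
      by (rule C(2)[OF u(1,2)]) (use u(4) False in \<open>auto simp: Lp_le_def\<close>)
    then have "(norm (u x) powr ?p) powr (1 / ?p) \<le> (C * (2 ^ j) ^ CARD('n) * (B powr ?p)) powr (1 / ?p)"
      using p' by (intro powr_mono2) auto
    moreover have "((2::real) ^ j) ^ CARD('n) = 2 powr (real j * real CARD('n))"
      by (simp add: powr_realpow[symmetric] powr_powr flip: power_mult)
    ultimately show ?thesis using p' u(3) C(1)
      by (simp add: powr_powr powr_mult dim_loss_def False)
  qed
  then show ?thesis using C(1) by (intro exI[of _ "C powr (1 / ?p)"]) auto
qed

lemma smoothing_Lp:
  "\<exists>C>0. \<forall>l m h B. l + 1 \<le> m \<longrightarrow> band m h \<longrightarrow> 0 \<le> B \<longrightarrow> Lp_le p h B \<longrightarrow>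
    Lp_le p (multiplier (dyadic \<phi>0 l) h) (C * 2 powr ((real m - real l) * smoothing_loss) * B)"
proof (cases "p = \<infinity>")
  case True
  obtain C where C: "C > 0" "\<And>l h B x. \<lbrakk>h \<in> borel_measurable borel; 0 \<le> B; AE y in lborel. norm (h y) \<le> B\<rbrakk> \<Longrightarrow>
    norm (multiplier (dyadic \<phi>0 l) h x) \<le> C * B" using dyadic_sup_bound by blast
  have z: "smoothing_loss = 0" unfolding smoothing_loss_def using True by simp
  have "Lp_le p (multiplier (dyadic \<phi>0 l) h) (C * 2 powr ((real m - real l) * smoothing_loss) * B)"
    if h: "band m h" "0 \<le> B" "Lp_le p h B" for l m h B
  proof -
    have "h \<in> borel_measurable borel" using h(1) by (auto simp: band_def intro: poly_bounded_borel)
    moreover have "AE y in lborel. norm (h y) \<le> B" using h(3) True by (simp add: Lp_le_def)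
    ultimately have "norm (multiplier (dyadic \<phi>0 l) h x) \<le> C * B" for x by (rule C(2)[OF _ h(2)])
    then show ?thesis unfolding z using True by (simp add: Lp_le_def)
  qed
  then show ?thesis using C(1) by blast
next
  case False
  let ?p = "real_of_ereal p"
  have p': "?p > 0" by (rule real_of_ereal_pos_finite[OF p_pos False])
  obtain C where C: "C > 0" "\<And>l m h. \<lbrakk>l + 1 \<le> m; band m h\<rbrakk> \<Longrightarrow>
    (\<integral>\<^sup>+x. ennreal (norm (multiplier (dyadic \<phi>0 l) h x) powr ?p) \<partial>lborel)
      \<le> ennreal (C * 2 powr ((real m - real l) * real CARD('n) * (1 - min 1 ?p))) * (\<integral>\<^sup>+y. ennreal (norm (h y) powr ?p) \<partial>lborel)"
    using smoothing_integral[OF p' refl] by blast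
  have "Lp_le p (multiplier (dyadic \<phi>0 l) h) (C powr (1 / ?p) * 2 powr ((real m - real l) * smoothing_loss) * B)"
    if h: "l + 1 \<le> m" "band m h" "0 \<le> B" "Lp_le p h B" for l m h B
  proof -
    have "(\<integral>\<^sup>+x. ennreal (norm (multiplier (dyadic \<phi>0 l) h x) powr ?p) \<partial>lborel)
      \<le> ennreal (C * 2 powr ((real m - real l) * real CARD('n) * (1 - min 1 ?p))) * (\<integral>\<^sup>+y. ennreal (norm (h y) powr ?p) \<partial>lborel)"
      by (rule C(2)[OF h(1,2)])
    also have "\<dots> \<le> ennreal (C * 2 powr ((real m - real l) * real CARD('n) * (1 - min 1 ?p))) * ennreal (B powr ?p)"
      using h(4) False by (intro mult_left_mono) (simp_all add: Lp_le_def)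
    also have "\<dots> = ennreal (C * 2 powr ((real m - real l) * real CARD('n) * (1 - min 1 ?p)) * B powr ?p)"
      using C(1) by (simp add: ennreal_mult)
    also have "C * 2 powr ((real m - real l) * real CARD('n) * (1 - min 1 ?p)) * B powr ?p
       = (C powr (1 / ?p) * 2 powr ((real m - real l) * smoothing_loss) * B) powr ?p"
    proof -
      have "smoothing_loss * ?p = real CARD('n) * (1 - min 1 ?p)"
        unfolding smoothing_loss_def using False p' by simp
      then have "(real m - real l) * real CARD('n) * (1 - min 1 ?p) = (real m - real l) * smoothing_loss * ?p"
        by (simp only: mult.assoc)
      then have "2 powr ((real m - real l) * real CARD('n) * (1 - min 1 ?p)) = (2 powr ((real m - real l) * smoothing_loss)) powr ?p"
        by (simp only: powr_powr)
      moreover have "(C powr (1 / ?p)) powr ?p = C" using p' C(1) by (simp add: powr_powr)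
      ultimately show ?thesis using C(1) h(3) by (simp only: powr_mult)
    qed
    finally show ?thesis using False by (simp add: Lp_le_def)
  qed
  then show ?thesis using C(1) by (intro exI[of _ "C powr (1 / ?p)"]) auto
qed

text \<open>Common form of the estimates for series and for products: band \<open>l\<close> of a
  function is dominated by terms \<open>v i l\<close> whose weighted sizes \<open>c i l\<close>
  decay geometrically in \<open>i\<close>. The factor
  \<open>2 powr (- (real i * \<epsilon>))\<close> is required twice, once to sum over
  \<open>i\<close> in \<open>L\<^sub>p\<close> for fixed \<open>l\<close> and once to sum over
  \<open>i\<close> in the sequence space.\<close>

lemma besov_sum_bound:
  assumes e: "0 < \<epsilon>"
  shows "\<exists>K>0. \<forall>(v :: nat \<Rightarrow> nat \<Rightarrow> 'n cfun) w c B. 0 \<le> B \<longrightarrow> (\<forall>i l. v i l \<in> borel_measurable borel) \<longrightarrow>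
    (\<forall>i l. 0 \<le> c i l) \<longrightarrow> (\<forall>i l. Lp_le p (v i l) (2 powr (- (real i * \<epsilon>)) * (2 powr (- (real l * s)) * c i l))) \<longrightarrow>
    (\<forall>i. lq_le q (c i) (2 powr (- (real i * \<epsilon>)) * B)) \<longrightarrow>
    (\<forall>l. AE x in lborel. ennreal (norm (w l x)) \<le> (\<Sum>i. ennreal (norm (v i l x)))) \<longrightarrow>
    (\<exists>b. (\<forall>l. 0 \<le> b l \<and> Lp_le p (w l) (b l)) \<and> lq_le q (\<lambda>l. 2 powr (real l * s) * b l) (K * B))"
proof -
  obtain C where C: "C > 0" "\<And>(u :: nat \<Rightarrow> 'n cfun) w D. \<lbrakk>0 \<le> D; \<And>i. u i \<in> borel_measurable borel;
     \<And>i. Lp_le p (u i) (2 powr (- (real i * \<epsilon>)) * D);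
     AE x in lborel. ennreal (norm (w x)) \<le> (\<Sum>i. ennreal (norm (u i x)))\<rbrakk> \<Longrightarrow> Lp_le p w (C * D)"
    using Lp_le_series[OF p_pos e, where 'n='n] by blast
  obtain K where K: "K > 0" "\<And>c e C B. \<lbrakk>0 \<le> B; 0 \<le> C; \<And>i l. 0 \<le> c i l; \<And>l. 0 \<le> e l;
     \<And>i::nat. lq_le q (c i) (2 powr (- (real i * \<epsilon>)) * B);
     \<And>l D. 0 \<le> D \<Longrightarrow> (\<And>i. c i l \<le> D) \<Longrightarrow> e l \<le> C * D\<rbrakk> \<Longrightarrow> lq_le q e (K * C * B)"
    using lq_le_series[OF q_pos e] by blast
  have "\<exists>b. (\<forall>l. 0 \<le> b l \<and> Lp_le p (w l) (b l)) \<and> lq_le q (\<lambda>l. 2 powr (real l * s) * b l) (K * C * B)"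
    if B: "0 \<le> B" and v: "\<And>i l. v i l \<in> borel_measurable borel" and c: "\<And>i l. 0 \<le> c i l"
      and L: "\<And>i l. Lp_le p (v i l) (2 powr (- (real i * \<epsilon>)) * (2 powr (- (real l * s)) * c i l))"
      and q: "\<And>i. lq_le q (c i) (2 powr (- (real i * \<epsilon>)) * B)"
      and w: "\<And>l. AE x in lborel. ennreal (norm (w l x)) \<le> (\<Sum>i. ennreal (norm (v i l x)))"
    for v :: "nat \<Rightarrow> nat \<Rightarrow> 'n cfun" and w c B
  proof -
    have cB: "c i l \<le> B" for i l
    proof -
      have "c i l \<le> 2 powr (- (real i * \<epsilon>)) * B" by (rule lq_le_sup[OF q_pos q c]) (simp add: B)
      also have "\<dots> \<le> 1 * B" using e B by (intro mult_right_mono) (simp_all add: powr_minus inverse_le_1_iff ge_one_powr_ge_zero)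
      finally show ?thesis by simp
    qed
    \<comment> \<open>A genuine supremum, since every \<open>c i l\<close> is at most
      \<open>B\<close>.\<close>
    define d where "d l = (SUP i. c i l)" for l
    have cd: "c i l \<le> d l" for i l
      unfolding d_def by (rule cSUP_upper) (use cB in \<open>auto intro!: bdd_aboveI[of _ B]\<close>)
    have d0: "0 \<le> d l" for l using c[of 0 l] cd[of 0 l] by simp
    have eq: "2 powr (real l * s) * (C * (2 powr (- (real l * s)) * d l)) = C * d l" for l
      by (simp add: powr_minus)
    have "Lp_le p (w l) (C * (2 powr (- (real l * s)) * d l))" for l
    proof (rule C(2)[OF _ v _ w])
      show "0 \<le> 2 powr (- (real l * s)) * d l" using d0 by simp
      show "Lp_le p (v i l) (2 powr (- (real i * \<epsilon>)) * (2 powr (- (real l * s)) * d l))" for i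
        by (rule Lp_le_mono[OF p_pos L]) (use c cd in \<open>auto intro!: mult_left_mono\<close>)
    qed
    moreover have "lq_le q (\<lambda>l. C * d l) (K * C * B)"
    proof (rule K(2)[OF B less_imp_le[OF C(1)] c _ q])
      show "0 \<le> C * d l" for l using C(1) d0 by simp
      fix l D assume "\<And>i. c i l \<le> D"
      then show "C * d l \<le> C * D" unfolding d_def using C(1) by (intro mult_left_mono cSUP_least) auto
    qed
    ultimately show ?thesis using C(1) d0
      by (intro exI[of _ "\<lambda>l. C * (2 powr (- (real l * s)) * d l)"]) (simp add: eq del: powr_minus)
  qed
  note bound = this
  show ?thesis
  proof (intro exI[of _ "K * C"] conjI allI impI, goal_cases)
    case 1
    then show ?case using K(1) C(1) by simp
  next
    case (2 v w c B)
    show ?case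
      by (rule bound[OF 2(1) 2(2)[rule_format] 2(3)[rule_format] 2(4)[rule_format] 2(5)[rule_format] 2(6)[rule_format]])
  qed
qed

text \<open>The tails of the series are uniformly small, and the operator is bounded on bounded
  functions, so it may be applied term by term.\<close>

lemma multiplier_sums:
  assumes \<sigma>: "\<sigma> \<in> schwartz" and G: "\<And>i. G i \<in> borel_measurable borel" and M: "\<And>i x. norm (G i x) \<le> M i" "summable M"
    and H: "\<And>x. (\<lambda>i. G i x) sums H x"
  shows "(\<lambda>i. multiplier \<sigma> (G i) x) sums multiplier \<sigma> (H :: 'n cfun) x"
proof -
  have M0: "0 \<le> M i" for i using M(1)[of i 0] norm_ge_zero order_trans by blast
  have Hm: "H \<in> borel_measurable borel" by (rule borel_measurable_LIMSEQ_metric[of "\<lambda>k x. \<Sum>i<k. G i x"]) (use G H in \<open>auto simp: sums_def\<close>)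
  have tail: "norm (H y - (\<Sum>i<k. G i y)) \<le> (\<Sum>i. M (i + k))" for y k
  proof -
    have "(\<lambda>i. G (i + k) y) sums (H y - (\<Sum>i<k. G i y))" using sums_split_initial_segment[OF H] by simp
    then have "H y - (\<Sum>i<k. G i y) = (\<Sum>i. G (i + k) y)" by (rule sums_unique)
    also have "norm \<dots> \<le> (\<Sum>i. M (i + k))"
      by (rule norm_suminf_le) (use M in \<open>auto simp: summable_iff_shift\<close>)
    finally show ?thesis .
  qed
  have pG: "poly_bounded (M i) 0 (G i)" for i using G M by (simp add: poly_bounded_def)
  have pS: "\<exists>A. poly_bounded A 0 (\<lambda>y. \<Sum>i<k. G i y)" for k
  proof (induction k)
    case 0 show ?case by (intro exI[of _ 0]) (simp add: poly_bounded_def)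
  next
    case (Suc k) then show ?case using poly_bounded_add[OF _ pG[of k]] by (auto simp del: sum.lessThan_Suc simp: sum.lessThan_Suc)
  qed
  have pH: "poly_bounded (\<Sum>i. M i) 0 H" using tail[of _ 0] Hm by (simp add: poly_bounded_def)
  have S: "multiplier \<sigma> (\<lambda>y. \<Sum>i<k. G i y) x = (\<Sum>i<k. multiplier \<sigma> (G i) x)" for k
  proof (induction k)
    case 0 show ?case by (simp add: multiplier_def)
  next
    case (Suc k)
    obtain A where "poly_bounded A 0 (\<lambda>y. \<Sum>i<k. G i y)" using pS by blast
    from multiplier_add[OF \<sigma> this pG[of k]] Suc show ?case by simp
  qed
  define C where "C = (LINT z|lborel. norm (inv_fourier \<sigma> z))"
  have C0: "0 \<le> C" unfolding C_def by simp
  have C: "(\<integral>\<^sup>+z. ennreal (norm (inv_fourier \<sigma> z)) \<partial>lborel) \<le> ennreal C"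
    unfolding C_def using schwartz_integrable[OF inv_fourier_schwartz[OF \<sigma>]] by (simp add: nn_integral_eq_integral)
  have bd: "norm (multiplier \<sigma> H x - (\<Sum>i<k. multiplier \<sigma> (G i) x)) \<le> fourier_const TYPE('n) * C * (\<Sum>i. M (i + k))" for k
  proof -
    obtain A where A: "poly_bounded A 0 (\<lambda>y. \<Sum>i<k. G i y)" using pS by blast
    have pD: "poly_bounded (\<Sum>i. M (i + k)) 0 (\<lambda>y. H y - (\<Sum>i<k. G i y))"
      using tail Hm poly_bounded_borel[OF A] by (simp add: poly_bounded_def)
    have "multiplier \<sigma> (\<lambda>y. (H y - (\<Sum>i<k. G i y)) + (\<Sum>i<k. G i y)) x
        = multiplier \<sigma> (\<lambda>y. H y - (\<Sum>i<k. G i y)) x + multiplier \<sigma> (\<lambda>y. \<Sum>i<k. G i y) x"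
      by (rule multiplier_add[OF \<sigma> pD A])
    then have "multiplier \<sigma> H x - (\<Sum>i<k. multiplier \<sigma> (G i) x) = multiplier \<sigma> (\<lambda>y. H y - (\<Sum>i<k. G i y)) x"
      by (simp add: S)
    moreover have T0: "0 \<le> (\<Sum>i. M (i + k))"
      by (rule suminf_nonneg) (simp_all add: summable_iff_shift M(2) M0)
    have "norm (multiplier \<sigma> (\<lambda>y. H y - (\<Sum>i<k. G i y)) x) \<le> fourier_const TYPE('n) * C * (\<Sum>i. M (i + k))"
      by (rule multiplier_sup_le[OF \<sigma> poly_bounded_borel[OF pD] T0 _ C0 C]) (simp add: tail)
    ultimately show ?thesis by (simp only:)
  qed
  have "(\<lambda>k. fourier_const TYPE('n) * C * (\<Sum>i. M (i + k))) \<longlonglongrightarrow> fourier_const TYPE('n) * C * 0"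
    by (rule tendsto_mult_left[OF suminf_exist_split2[OF M(2)]])
  then have T: "(\<lambda>k. fourier_const TYPE('n) * C * (\<Sum>i. M (i + k))) \<longlonglongrightarrow> 0" by (simp only: mult_zero_right)
  have "(\<lambda>k. multiplier \<sigma> H x - (\<Sum>i<k. multiplier \<sigma> (G i) x)) \<longlonglongrightarrow> 0"
    by (rule Lim_null_comparison[OF always_eventually T]) (rule allI, rule bd)
  then have "(\<lambda>k. (\<Sum>i<k. multiplier \<sigma> (G i) x) - multiplier \<sigma> H x) \<longlonglongrightarrow> 0"
    using tendsto_minus by fastforce
  then show ?thesis unfolding sums_def by (rule LIM_zero_cancel)
qed

section \<open>Decomposition and series in Besov spaces\<close>

text \<open>A bound for the Besov quasi-norm, stated for a function through its bands as functions;
  \<open>besov_norm_distr_of_le\<close> links it to the distribution.\<close>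

definition besov_le :: "'n cfun \<Rightarrow> real \<Rightarrow> bool" where
  "besov_le G B \<longleftrightarrow> (\<exists>b. (\<forall>l. 0 \<le> b l \<and> Lp_le p (multiplier (dyadic \<phi>0 l) G) (b l)) \<and>
    lq_le q (\<lambda>l. 2 powr (real l * s) * b l) B)"

lemma Lp_norm_piece_distr_of:
  assumes G: "poly_bounded A N G" and B: "0 \<le> B"
  shows "distr_Lp_norm p (piece j (distr_of G)) \<le> ennreal B \<longleftrightarrow> Lp_le p (multiplier (dyadic \<phi>0 j) G) B"
proof -
  note pm = multiplier_poly_bounded[OF dyadic_schwartz[of j] G]
  have "distr_Lp_norm p (piece j (distr_of G)) = Lp_norm p (multiplier (dyadic \<phi>0 j) G)"
    unfolding piece_distr_of[OF G] by (rule distr_Lp_norm_distr_of[OF p_pos pm])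
  then show ?thesis using Lp_norm_le_iff[OF p_pos poly_bounded_borel[OF pm] B] by simp
qed

lemma besov_norm_distr_of_le:
  assumes G: "poly_bounded A N G" and B: "0 \<le> B"
  shows "besov_norm \<phi>0 s p q (distr_of G) \<le> ennreal B \<longleftrightarrow> besov_le G B"
  unfolding besov_norm_le_iff[OF q_pos B] besov_le_def
  using Lp_norm_piece_distr_of[OF G] by (intro arg_cong[where f = Ex] ext) blast

text \<open>The \<open>l\<^sub>q\<close> condition gives
  \<open>b j \<le> 2 powr (- (real j * s)) * B\<close>, and Nikolskii then bounds band
  \<open>j\<close> by \<open>2 powr (- (real j * (s - dim_loss)))\<close> up to a constant. The
  series converges uniformly, and its sum represents \<open>f\<close> because the bands of
  \<open>f\<close> sum to \<open>f\<close> as distributions.\<close>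

lemma besov_decomposition:
  "\<exists>C>0. \<forall>f B. f \<in> tempered \<longrightarrow> 0 \<le> B \<longrightarrow> besov_norm \<phi>0 s p q f \<le> ennreal B \<longrightarrow>
    (\<exists>a b. (\<forall>j. band (j + 1) (a j)) \<and> (\<forall>j. 0 \<le> b j) \<and> (\<forall>j. Lp_le p (a j) (b j)) \<and>
      (\<forall>j x. norm (a j x) \<le> C * B * 2 powr (- (real j * (s - dim_loss)))) \<and>
      lq_le q (\<lambda>j. 2 powr (real j * s) * b j) B \<and> f = distr_of (\<lambda>x. \<Sum>j. a j x))"
proof -
  obtain C where C: "C > 0" "\<And>j u A N B x. \<lbrakk>poly_bounded A N u; multiplier (cutoff j) u = u; 0 \<le> B; Lp_le p u B\<rbrakk> \<Longrightarrow>
    norm (u x) \<le> C * 2 powr (real j * dim_loss) * B"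
    using nikolskii_Lp by blast
  \<comment> \<open>Band \<open>j\<close> is reproduced by \<open>cutoff (j + 1)\<close>, so
    Nikolskii is applied one level higher, at the cost of \<open>2 powr dim_loss\<close>.\<close>
  define C1 where "C1 = C * 2 powr dim_loss"
  have C1: "C1 > 0" using C(1) by (simp add: C1_def)
  have main: "\<exists>a b. (\<forall>j. band (j + 1) (a j)) \<and> (\<forall>j. 0 \<le> b j) \<and> (\<forall>j. Lp_le p (a j) (b j)) \<and>
      (\<forall>j x. norm (a j x) \<le> C1 * B * 2 powr (- (real j * (s - dim_loss)))) \<and>
      lq_le q (\<lambda>j. 2 powr (real j * s) * b j) B \<and> f = distr_of (\<lambda>x. \<Sum>j. a j x)"
    if f: "f \<in> tempered" and B: "0 \<le> B" and le: "besov_norm \<phi>0 s p q f \<le> ennreal B" for f B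
  proof -
    obtain b where b: "\<And>j. 0 \<le> b j" "\<And>j. distr_Lp_norm p (piece j f) \<le> ennreal (b j)"
      and bq: "lq_le q (\<lambda>j. 2 powr (real j * s) * b j) B"
      using le besov_norm_le_iff[OF q_pos B, of s p f] by blast
    have "\<exists>a A N. poly_bounded A N a \<and> multiplier (cutoff (j + 1)) a = a \<and> piece j f = distr_of a" for j
      by (rule piece_function[OF p_pos f]) (use b(2)[of j] in \<open>simp add: order_le_less_trans\<close>)
    then obtain a A N where a: "\<And>j. poly_bounded (A j) (N j) (a j)" "\<And>j. multiplier (cutoff (j + 1)) (a j) = a j"
      and pa: "\<And>j. piece j f = distr_of (a j)" by metis
    have La: "Lp_le p (a j) (b j)" for j
      using b(2)[of j] Lp_norm_le_iff[OF p_pos poly_bounded_borel[OF a(1)] b(1), of j j]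
      unfolding pa distr_Lp_norm_distr_of[OF p_pos a(1)] by blast
    define M where "M j = C1 * B * 2 powr (- (real j * (s - dim_loss)))" for j
    have bj: "b j \<le> 2 powr (- (real j * s)) * B" for j
    proof -
      have "2 powr (real j * s) * b j \<le> B"
        by (rule lq_le_sup[OF q_pos bq]) (use b(1) B in auto)
      then have "2 powr (- (real j * s)) * (2 powr (real j * s) * b j) \<le> 2 powr (- (real j * s)) * B"
        by (rule mult_left_mono) simp
      moreover have "2 powr (- (real j * s)) * (2 powr (real j * s) * b j) = b j"
        by (simp only: mult.assoc[symmetric] powr_add[symmetric]) simp
      ultimately show ?thesis by simp
    qed
    have aM: "norm (a j x) \<le> M j" for j x
    proof -
      have "norm (a j x) \<le> C * 2 powr (real (j + 1) * dim_loss) * b j"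
        by (rule C(2)[OF a b(1) La])
      also have "\<dots> \<le> C * 2 powr (real (j + 1) * dim_loss) * (2 powr (- (real j * s)) * B)"
        using C(1) by (intro mult_left_mono bj) simp
      also have "\<dots> = C * B * (2 powr (real (j + 1) * dim_loss) * 2 powr (- (real j * s)))" by (simp only: mult_ac)
      also have "2 powr (real (j + 1) * dim_loss) * 2 powr (- (real j * s)) = 2 powr dim_loss * 2 powr (- (real j * (s - dim_loss)))"
        by (simp only: powr_add[symmetric]) (simp add: algebra_simps)
      finally show ?thesis by (simp only: M_def C1_def mult_ac)
    qed
    have a0: "poly_bounded (M j) 0 (a j)" for j using aM poly_bounded_borel[OF a(1)] by (simp add: poly_bounded_def)
    have sM: "summable M"
      unfolding M_def using dim_loss_less by (intro summable_mult summable_powr_neg) simp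
    have fe: "f = distr_of (\<lambda>x. \<Sum>j. a j x)"
    proof
      fix \<phi>
      show "f \<phi> = distr_of (\<lambda>x. \<Sum>j. a j x) \<phi>"
      proof (cases "\<phi> \<in> schwartz")
        case True
        have int: "integrable lborel (\<lambda>x. a j x * \<phi> x)" for j by (rule poly_bounded_mult_integrable[OF a0 True])
        have int1: "integrable lborel (\<lambda>x. norm (\<phi> x))" using schwartz_integrable[OF True] by simp
        have nm: "norm (a j x * \<phi> x) \<le> M j * norm (\<phi> x)" for j x
          unfolding norm_mult by (rule mult_right_mono[OF aM norm_ge_zero])
        have sx: "summable (\<lambda>j. norm (a j x * \<phi> x))" for x
        proof (rule summable_comparison_test'[OF summable_mult2[OF sM]])
          show "norm (norm (a j x * \<phi> x)) \<le> M j * norm (\<phi> x)" for j using nm[of j x] by (simp only: real_norm_def abs_norm_cancel)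
        qed
        have "(\<lambda>j. LINT x|lborel. a j x * \<phi> x) sums (LINT x|lborel. (\<Sum>j. a j x * \<phi> x))"
        proof (rule sums_integral[OF int])
          show "AE x in lborel. summable (\<lambda>j. norm (a j x * \<phi> x))" using sx by simp
          have "(LINT x|lborel. norm (a j x * \<phi> x)) \<le> M j * (LINT x|lborel. norm (\<phi> x))" for j
          proof -
            have "(LINT x|lborel. norm (a j x * \<phi> x)) \<le> (LINT x|lborel. M j * norm (\<phi> x))"
              by (rule integral_mono[OF integrable_norm[OF int] integrable_mult_right[OF int1] nm])
            then show ?thesis by (simp only: integral_mult_right_zero)
          qed
          then show "summable (\<lambda>j. LINT x|lborel. norm (a j x * \<phi> x))"
            by (intro summable_comparison_test'[OF summable_mult2[OF sM]]) (simp add: integral_nonneg_AE del: norm_mult)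
        qed
        moreover have "(\<Sum>j. a j x * \<phi> x) = (\<Sum>j. a j x) * \<phi> x" for x
        proof (rule suminf_mult2[symmetric])
          show "summable (\<lambda>j. a j x)"
            by (rule summable_comparison_test'[OF sM]) (rule aM)
        qed
        ultimately have "(\<lambda>j. piece j f \<phi>) sums distr_of (\<lambda>x. \<Sum>j. a j x) \<phi>"
          using True by (simp add: pa distr_of_def)
        moreover have "(\<lambda>j. piece j f \<phi>) sums f \<phi>"
          using piece_sum_tendsto[OF f True] by (simp add: sums_def_le)
        ultimately show ?thesis by (rule sums_unique2[symmetric])
      next
        case False
        then show ?thesis using f by (simp add: distr_of_def tempered_def)
      qed
    qed
    have "band (j + 1) (a j)" for j using a0 a(2) by (auto simp: band_def)
    then show ?thesis using b(1) La aM bq fe unfolding M_def by blast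
  qed
  show ?thesis using C1 main by blast
qed

lemma besov_bounded:
  "\<exists>C>0. \<forall>f B. f \<in> tempered \<longrightarrow> 0 \<le> B \<longrightarrow> besov_norm \<phi>0 s p q f \<le> ennreal B \<longrightarrow>
    (\<exists>G. poly_bounded (C * B) 0 G \<and> f = distr_of G)"
proof -
  obtain C where C: "C > 0" and dec: "\<And>f B. \<lbrakk>f \<in> tempered; 0 \<le> B; besov_norm \<phi>0 s p q f \<le> ennreal B\<rbrakk> \<Longrightarrow>
    \<exists>a b. (\<forall>j. band (j + 1) (a j)) \<and> (\<forall>j. 0 \<le> b j) \<and> (\<forall>j. Lp_le p (a j) (b j)) \<and>
      (\<forall>j x. norm (a j x) \<le> C * B * 2 powr (- (real j * (s - dim_loss)))) \<and>
      lq_le q (\<lambda>j. 2 powr (real j * s) * b j) B \<and> f = distr_of (\<lambda>x. \<Sum>j. a j x)"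
    using besov_decomposition by blast
  let ?t = "\<lambda>j::nat. 2 powr (- (real j * (s - dim_loss)))"
  have st: "summable ?t" using dim_loss_less by (intro summable_powr_neg) simp
  have Z: "(\<Sum>j. ?t j) > 0" by (intro suminf_pos st) simp
  have "\<exists>G. poly_bounded (C * (\<Sum>j. ?t j) * B) 0 G \<and> f = distr_of G"
    if f: "f \<in> tempered" "0 \<le> B" "besov_norm \<phi>0 s p q f \<le> ennreal B" for f B
  proof -
    obtain a where a: "\<And>j. band (j + 1) (a j)" "\<And>j x. norm (a j x) \<le> C * B * ?t j"
      and fe: "f = distr_of (\<lambda>x. \<Sum>j. a j x)" using dec[OF f] by metis
    have [measurable]: "a j \<in> borel_measurable borel" for j using a(1)[of j] by (auto simp: band_def intro: poly_bounded_borel)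
    have "norm (\<Sum>j. a j x) \<le> (\<Sum>j. C * B * ?t j)" for x
      by (rule norm_suminf_le[OF a(2) summable_mult[OF st]])
    also have "(\<Sum>j. C * B * ?t j) = C * (\<Sum>j. ?t j) * B" unfolding suminf_mult[OF st] by simp
    finally have "poly_bounded (C * (\<Sum>j. ?t j) * B) 0 (\<lambda>x. \<Sum>j. a j x)"
      by (simp add: poly_bounded_def)
    then show ?thesis using fe by blast
  qed
  moreover have "C * (\<Sum>j. ?t j) > 0" using C Z by simp
  ultimately show ?thesis by blast
qed

lemma besov_le_zero: "0 \<le> B \<Longrightarrow> besov_le (\<lambda>x. 0) B"
proof -
  assume "0 \<le> B"
  moreover have "multiplier \<sigma> (\<lambda>x. 0) = (\<lambda>x. 0)" for \<sigma> :: "'n cfun"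
    by (intro ext) (simp add: multiplier_def)
  ultimately show ?thesis
    unfolding besov_le_def by (intro exI[of _ "\<lambda>l. 0"]) (simp add: Lp_le_zero lq_le_zero)
qed

lemma besov_le_mono: "besov_le G A \<Longrightarrow> 0 \<le> A \<Longrightarrow> A \<le> B \<Longrightarrow> besov_le G B"
proof -
  assume A: "0 \<le> A" "A \<le> B" and "besov_le G A"
  then obtain b where b: "\<And>l. 0 \<le> b l" "\<And>l. Lp_le p (multiplier (dyadic \<phi>0 l) G) (b l)"
    "lq_le q (\<lambda>l. 2 powr (real l * s) * b l) A"
    unfolding besov_le_def by blast
  have "lq_le q (\<lambda>l. 2 powr (real l * s) * b l) B"
    by (rule lq_le_mono[OF q_pos b(3) _ order_refl A]) (simp add: b(1))
  then show ?thesis unfolding besov_le_def using b by blast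
qed

lemma besov_le_cmult:
  assumes G: "poly_bounded A N G" "besov_le G B" "0 \<le> B"
  shows "besov_le (\<lambda>x. c * G x) (norm c * B)"
proof -
  obtain b where b: "\<And>l. 0 \<le> b l" "\<And>l. Lp_le p (multiplier (dyadic \<phi>0 l) G) (b l)"
    "lq_le q (\<lambda>l. 2 powr (real l * s) * b l) B"
    using G(2) unfolding besov_le_def by blast
  have "Lp_le p (multiplier (dyadic \<phi>0 l) (\<lambda>x. c * G x)) (norm c * b l)" for l
    by (rule Lp_le_AE_mono[OF p_pos multiplier_borel[OF dyadic_schwartz poly_bounded_borel[OF G(1)]] b(2,1)])
      (simp_all add: multiplier_cmult norm_mult)
  moreover have "lq_le q (\<lambda>l. norm c * (2 powr (real l * s) * b l)) (norm c * B)"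
    by (rule lq_le_cmult[OF b(3) _ G(3)]) (use b(1) in auto)
  ultimately show ?thesis unfolding besov_le_def using b(1)
    by (intro exI[of _ "\<lambda>l. norm c * b l"]) (simp add: mult.left_commute)
qed

lemma besov_le_series:
  "\<exists>K>0. \<forall>G M H B. (\<forall>i. poly_bounded (M i) 0 (G i)) \<longrightarrow> summable M \<longrightarrow> (\<forall>x. (\<lambda>i. G i x) sums H x) \<longrightarrow> 0 \<le> B \<longrightarrow>
    (\<forall>i. besov_le (G i) (2 powr (- (2 * real i)) * B)) \<longrightarrow> besov_le H (K * B)"
proof -
  obtain K where K: "K > 0" "\<And>(v :: nat \<Rightarrow> nat \<Rightarrow> 'n cfun) w c B. \<lbrakk>0 \<le> B; \<And>i l. v i l \<in> borel_measurable borel;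
    \<And>i l. 0 \<le> c i l; \<And>i l. Lp_le p (v i l) (2 powr (- (real i * 1)) * (2 powr (- (real l * s)) * c i l));
    \<And>i. lq_le q (c i) (2 powr (- (real i * 1)) * B);
    \<And>l. AE x in lborel. ennreal (norm (w l x)) \<le> (\<Sum>i. ennreal (norm (v i l x)))\<rbrakk> \<Longrightarrow>
    \<exists>b. (\<forall>l. 0 \<le> b l \<and> Lp_le p (w l) (b l)) \<and> lq_le q (\<lambda>l. 2 powr (real l * s) * b l) (K * B)"
    using besov_sum_bound[OF zero_less_one] by blast
  have "besov_le H (K * B)" if G: "\<And>i. poly_bounded (M i) 0 (G i)" "summable M" "\<And>x. (\<lambda>i. G i x) sums H x" "0 \<le> B"
    and le: "\<And>i. besov_le (G i) (2 powr (- (2 * real i)) * B)" for G M H B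
  proof -
    obtain b where b: "\<And>i l. 0 \<le> b i l" "\<And>i l. Lp_le p (multiplier (dyadic \<phi>0 l) (G i)) (b i l)"
      "\<And>i. lq_le q (\<lambda>l. 2 powr (real l * s) * b i l) (2 powr (- (2 * real i)) * B)"
      using le unfolding besov_le_def by metis
    \<comment> \<open>The assumed decay \<open>2 powr (- (2 * real i))\<close> is divided evenly
      between the two decay conditions of \<open>besov_sum_bound\<close>, used with exponent
      1.\<close>
    let ?c = "\<lambda>i l. 2 powr real i * (2 powr (real l * s) * b i l)"
    show ?thesis unfolding besov_le_def
    proof (rule K(2)[OF G(4), of "\<lambda>i l. multiplier (dyadic \<phi>0 l) (G i)" ?c])
      show "multiplier (dyadic \<phi>0 l) (G i) \<in> borel_measurable borel" for i l
        by (rule multiplier_borel[OF dyadic_schwartz poly_bounded_borel[OF G(1)]])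
      show "0 \<le> ?c i l" for i l using b(1) by simp
      show "Lp_le p (multiplier (dyadic \<phi>0 l) (G i)) (2 powr (- (real i * 1)) * (2 powr (- (real l * s)) * ?c i l))" for i l
      proof -
        have "2 powr (- (real i * 1)) * (2 powr (- (real l * s)) * ?c i l)
            = (2 powr (- (real i * 1)) * 2 powr real i) * (2 powr (- (real l * s)) * 2 powr (real l * s)) * b i l"
          by (simp only: mult_ac)
        also have "\<dots> = b i l" by (simp only: powr_add[symmetric]) simp
        finally show ?thesis using b(2) by (simp only:)
      qed
      show "lq_le q (?c i) (2 powr (- (real i * 1)) * B)" for i
      proof -
        have "lq_le q (?c i) (2 powr real i * (2 powr (- (2 * real i)) * B))"
          by (rule lq_le_cmult[OF b(3)]) (use b(1) G(4) in auto)
        moreover have "2 powr real i * (2 powr (- (2 * real i)) * B) = 2 powr (- (real i * 1)) * B"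
          by (simp only: mult.assoc[symmetric] powr_add[symmetric]) simp
        ultimately show ?thesis by (simp only:)
      qed
      have "ennreal (norm (multiplier (dyadic \<phi>0 l) H x)) \<le> (\<Sum>i. ennreal (norm (multiplier (dyadic \<phi>0 l) (G i) x)))" for l x
        by (rule norm_sums_le[OF multiplier_sums[OF dyadic_schwartz poly_bounded_borel[OF G(1)] poly_bounded_0D[OF G(1)] G(2,3)]])
      then show "AE x in lborel. ennreal (norm (multiplier (dyadic \<phi>0 l) H x)) \<le> (\<Sum>i. ennreal (norm (multiplier (dyadic \<phi>0 l) (G i) x)))" for l
        by simp
    qed
  qed
  then show ?thesis using K(1) by blast
qed

lemma besov_le_add:
  "\<exists>K>0. \<forall>G H A B M N. poly_bounded M 0 G \<longrightarrow> poly_bounded N 0 H \<longrightarrow> besov_le G A \<longrightarrow> besov_le H B \<longrightarrow> 0 \<le> A \<longrightarrow> 0 \<le> B \<longrightarrow>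
    besov_le (\<lambda>x. G x + H x) (K * (A + B))"
proof -
  obtain K where K: "K > 0" and ser: "\<And>G M H B. \<lbrakk>\<And>i. poly_bounded (M i) 0 (G i); summable M; \<And>x. (\<lambda>i. G i x) sums H x; 0 \<le> B;
    \<And>i. besov_le (G i) (2 powr (- (2 * real i)) * B)\<rbrakk> \<Longrightarrow> besov_le H (K * B)"
    using besov_le_series by blast
  have "besov_le (\<lambda>x. G x + H x) ((K * 4) * (A + B))"
    if h: "poly_bounded M 0 G" "poly_bounded N 0 H" "besov_le G A" "besov_le H B" "0 \<le> A" "0 \<le> B" for G H A B M N
  proof -
    define F where "F i = (if i = 0 then G else if i = 1 then H else (\<lambda>x. 0))" for i :: nat
    \<comment> \<open>The factor 4 makes up for the weight \<open>2 powr (- 2)\<close> that the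
      series estimate attaches to the second term.\<close>
    have "besov_le (\<lambda>x. G x + H x) (K * (4 * (A + B)))"
    proof (rule ser[of "\<lambda>i. if i = 0 then M else if i = 1 then N else 0" F])
      show "poly_bounded (if i = 0 then M else if i = 1 then N else 0) 0 (F i)" for i
        using h(1,2) by (auto simp: F_def poly_bounded_def)
      show "summable (\<lambda>i::nat. if i = 0 then M else if i = 1 then N else 0)"
        by (rule summable_finite[of "{0, 1}"]) auto
      have "(\<lambda>i. F i x) sums (\<Sum>i\<in>{0,1}. F i x)" for x by (rule sums_finite) (auto simp: F_def)
      then show "(\<lambda>i. F i x) sums (G x + H x)" for x by (simp add: F_def)
      show "0 \<le> 4 * (A + B)" using h by simp
      have G': "besov_le G (4 * (A + B))" and H': "besov_le H (A + B)"
        using h by (auto intro: besov_le_mono)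
      show "besov_le (F i) (2 powr (- (2 * real i)) * (4 * (A + B)))" for i
      proof -
        have "2 powr (- (2::real)) * (4 * (A + B)) = A + B" by (simp add: powr_minus)
        then show ?thesis using G' H' h(5,6) by (auto simp: F_def intro!: besov_le_zero)
      qed
    qed
    then show ?thesis by (simp only: mult.assoc)
  qed
  moreover have "0 < K * 4" using K by simp
  ultimately show ?thesis by blast
qed

section \<open>Products\<close>

lemma besov_product:
  "\<exists>c>0. \<forall>f1 f2 B1 B2. f1 \<in> tempered \<longrightarrow> f2 \<in> tempered \<longrightarrow> 0 \<le> B1 \<longrightarrow> 0 \<le> B2 \<longrightarrow>
    besov_norm \<phi>0 s p q f1 \<le> ennreal B1 \<longrightarrow> besov_norm \<phi>0 s p q f2 \<le> ennreal B2 \<longrightarrow>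
    (\<exists>G1 G2 M1 M2. poly_bounded M1 0 G1 \<and> poly_bounded M2 0 G2 \<and> f1 = distr_of G1 \<and> f2 = distr_of G2 \<and>
      besov_le (\<lambda>x. G1 x * G2 x) (c * B1 * B2))"
proof -
  obtain C where C: "C > 0" and dec: "\<And>f B. \<lbrakk>f \<in> tempered; 0 \<le> B; besov_norm \<phi>0 s p q f \<le> ennreal B\<rbrakk> \<Longrightarrow>
    \<exists>a b. (\<forall>j. band (j + 1) (a j)) \<and> (\<forall>j. 0 \<le> b j) \<and> (\<forall>j. Lp_le p (a j) (b j)) \<and>
      (\<forall>j x. norm (a j x) \<le> C * B * 2 powr (- (real j * (s - dim_loss)))) \<and>
      lq_le q (\<lambda>j. 2 powr (real j * s) * b j) B \<and> f = distr_of (\<lambda>x. \<Sum>j. a j x)"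
    using besov_decomposition by blast
  obtain Cs where Cs: "Cs > 0" "\<And>l m h B. \<lbrakk>l + 1 \<le> m; band m h; 0 \<le> B; Lp_le p h B\<rbrakk> \<Longrightarrow>
    Lp_le p (multiplier (dyadic \<phi>0 l) h) (Cs * 2 powr ((real m - real l) * smoothing_loss) * B)"
    using smoothing_Lp by blast
  obtain Ca where Ca: "Ca > 0" "\<And>(u::'n cfun) v A B. \<lbrakk>u \<in> borel_measurable borel; v \<in> borel_measurable borel;
    Lp_le p u A; Lp_le p v B; 0 \<le> A; 0 \<le> B\<rbrakk> \<Longrightarrow> Lp_le p (\<lambda>x. u x + v x) (Ca * (A + B))"
    using Lp_le_add[OF p_pos, where 'n='n] by blast
  obtain Cq where Cq: "Cq > 0" "\<And>a b A B. \<lbrakk>lq_le q a A; lq_le q b B; \<forall>j. 0 \<le> a j; \<forall>j. 0 \<le> b j; 0 \<le> A; 0 \<le> B\<rbrakk> \<Longrightarrow>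
    lq_le q (\<lambda>j. a j + b j) (Cq * (A + B))"
    using lq_le_add[OF q_pos] by blast
  \<comment> \<open>The term \<open>m = l + i - 7\<close> contributes to band \<open>l\<close> with
    total decay \<open>2 ^ (- i (s - smoothing_loss))\<close>; half of it is kept for each of the
    two conditions of \<open>besov_sum_bound\<close>.\<close>
  define \<epsilon> where "\<epsilon> = (s - smoothing_loss) / 2"
  have e: "0 < \<epsilon>" using smoothing_loss_le by (simp add: \<epsilon>_def)
  obtain K where K: "K > 0" "\<And>(v :: nat \<Rightarrow> nat \<Rightarrow> 'n cfun) w c B. \<lbrakk>0 \<le> B; \<And>i l. v i l \<in> borel_measurable borel;
    \<And>i l. 0 \<le> c i l; \<And>i l. Lp_le p (v i l) (2 powr (- (real i * \<epsilon>)) * (2 powr (- (real l * s)) * c i l));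
    \<And>i. lq_le q (c i) (2 powr (- (real i * \<epsilon>)) * B);
    \<And>l. AE x in lborel. ennreal (norm (w l x)) \<le> (\<Sum>i. ennreal (norm (v i l x)))\<rbrakk> \<Longrightarrow>
    \<exists>b. (\<forall>l. 0 \<le> b l \<and> Lp_le p (w l) (b l)) \<and> lq_le q (\<lambda>l. 2 powr (real l * s) * b l) (K * B)"
    using besov_sum_bound[OF e] by blast
  define \<tau> where "\<tau> j = 2 powr (- (real j * (s - dim_loss)))" for j :: nat
  define Z where "Z = (\<Sum>j. \<tau> j)"
  have st: "summable \<tau>" unfolding \<tau>_def using dim_loss_less by (intro summable_powr_neg) simp
  have t0: "0 < \<tau> j" for j by (simp add: \<tau>_def)
  have Z: "Z > 0" unfolding Z_def by (intro suminf_pos st t0)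
  have tZ: "sum \<tau> {..<k} \<le> Z" for k unfolding Z_def by (intro sum_le_suminf st) (simp_all add: less_imp_le[OF t0])
  \<comment> \<open>Collects the shift in \<open>m = l + i - 7\<close>, which costs
    \<open>2 powr (7 * s)\<close>, and the smoothing from level \<open>m + 8 = l + i + 1\<close>,
    whose surplus of one level costs \<open>2 powr smoothing_loss\<close>.\<close>
  define X where "X = Cs * 2 powr (smoothing_loss + 7 * s)"
  have X: "X > 0" using Cs(1) by (simp add: X_def)
  have main: "\<exists>G1 G2 M1 M2. poly_bounded M1 0 G1 \<and> poly_bounded M2 0 G2 \<and> f1 = distr_of G1 \<and> f2 = distr_of G2 \<and>
      besov_le (\<lambda>x. G1 x * G2 x) ((K * X * Ca * Cq * 2 * C * Z) * B1 * B2)"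
    if f: "f1 \<in> tempered" "f2 \<in> tempered" and B: "0 \<le> B1" "0 \<le> B2"
      and n: "besov_norm \<phi>0 s p q f1 \<le> ennreal B1" "besov_norm \<phi>0 s p q f2 \<le> ennreal B2" for f1 f2 B1 B2
  proof -
    obtain a \<alpha> where
      "(\<forall>j. band (j + 1) (a j)) \<and> (\<forall>j. 0 \<le> \<alpha> j) \<and> (\<forall>j. Lp_le p (a j) (\<alpha> j)) \<and>
       (\<forall>j x. norm (a j x) \<le> C * B1 * \<tau> j) \<and>
       lq_le q (\<lambda>j. 2 powr (real j * s) * \<alpha> j) B1 \<and> f1 = distr_of (\<lambda>x. \<Sum>j. a j x)"
      unfolding \<tau>_def using dec[OF f(1) B(1) n(1)] by (elim exE)
    then have a: "\<And>j. band (j + 1) (a j)" "\<And>j. 0 \<le> \<alpha> j" "\<And>j. Lp_le p (a j) (\<alpha> j)"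
      "\<And>j x. norm (a j x) \<le> C * B1 * \<tau> j" "lq_le q (\<lambda>j. 2 powr (real j * s) * \<alpha> j) B1"
      and f1: "f1 = distr_of (\<lambda>x. \<Sum>j. a j x)"
      by simp_all
    obtain b \<beta> where
      "(\<forall>j. band (j + 1) (b j)) \<and> (\<forall>j. 0 \<le> \<beta> j) \<and> (\<forall>j. Lp_le p (b j) (\<beta> j)) \<and>
       (\<forall>j x. norm (b j x) \<le> C * B2 * \<tau> j) \<and>
       lq_le q (\<lambda>j. 2 powr (real j * s) * \<beta> j) B2 \<and> f2 = distr_of (\<lambda>x. \<Sum>j. b j x)"
      unfolding \<tau>_def using dec[OF f(2) B(2) n(2)] by (elim exE)
    then have b: "\<And>j. band (j + 1) (b j)" "\<And>j. 0 \<le> \<beta> j" "\<And>j. Lp_le p (b j) (\<beta> j)"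
      "\<And>j x. norm (b j x) \<le> C * B2 * \<tau> j" "lq_le q (\<lambda>j. 2 powr (real j * s) * \<beta> j) B2"
      and f2: "f2 = distr_of (\<lambda>x. \<Sum>j. b j x)"
      by simp_all
    have am: "a j \<in> borel_measurable borel" for j using a(1)[of j] by (auto simp: band_def intro: poly_bounded_borel)
    have bm: "b j \<in> borel_measurable borel" for j using b(1)[of j] by (auto simp: band_def intro: poly_bounded_borel)
    let ?G1 = "\<lambda>x. \<Sum>j. a j x" and ?G2 = "\<lambda>x. \<Sum>j. b j x"
    note [measurable] = am bm
    have asum: "(\<lambda>j. a j x) sums ?G1 x" for x
      by (rule summable_sums[OF summable_comparison_test'[OF summable_mult[OF st]]]) (rule a(4))
    have bsum: "(\<lambda>j. b j x) sums ?G2 x" for x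
      by (rule summable_sums[OF summable_comparison_test'[OF summable_mult[OF st]]]) (rule b(4))
    have sup: "norm (\<Sum>j<k. u j x) \<le> C * D * Z" if "\<And>j. norm (u j x) \<le> C * D * \<tau> j" "0 \<le> D" for u :: "nat \<Rightarrow> 'n cfun" and D k x
    proof -
      have "norm (\<Sum>j<k. u j x) \<le> (\<Sum>j<k. C * D * \<tau> j)" by (rule sum_norm_le) (rule that(1))
      also have "\<dots> = C * D * sum \<tau> {..<k}" by (rule sum_distrib_left[symmetric])
      also have "\<dots> \<le> C * D * Z" using C that(2) by (intro mult_left_mono tZ) simp
      finally show ?thesis .
    qed
    have G1: "poly_bounded (C * B1 * Z) 0 ?G1" and G2: "poly_bounded (C * B2 * Z) 0 ?G2"
      using norm_suminf_le[OF a(4) summable_mult[OF st]] norm_suminf_le[OF b(4) summable_mult[OF st]]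
      by (simp_all add: poly_bounded_def suminf_mult[OF st] Z_def)
    \<comment> \<open>Summation by parts splits \<open>f1 f2\<close> into terms with frequencies at most of order \<open>2 ^ (m + 5)\<close>, so
      that only the terms with \<open>m \<ge> l - 7\<close> contribute to the \<open>l\<close>-th band.\<close>
    define h where "h m x = a m x * (\<Sum>k<Suc m. b k x) + (\<Sum>k<m. a k x) * b m x" for m x
    have hm [measurable]: "h m \<in> borel_measurable borel" for m unfolding h_def[abs_def] by measurable
    have partial: "(\<Sum>m<k. h m x) = (\<Sum>m<k. a m x) * (\<Sum>m<k. b m x)" for k x
      by (induction k) (simp_all add: h_def algebra_simps)
    have hsum: "(\<lambda>m. h m x) sums (?G1 x * ?G2 x)" for x
      using tendsto_mult[OF asum[of x, unfolded sums_def] bsum[of x, unfolded sums_def]] unfolding sums_def partial .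
    have hM: "norm (h m x) \<le> (2 * C * C * B1 * B2 * Z) * \<tau> m" for m x
    proof -
      have "norm (h m x) \<le> norm (a m x) * norm (\<Sum>k<Suc m. b k x) + norm (\<Sum>k<m. a k x) * norm (b m x)"
        unfolding h_def by (rule order_trans[OF norm_triangle_ineq]) (simp only: norm_mult order_refl)
      also have "\<dots> \<le> (C * B1 * \<tau> m) * (C * B2 * Z) + (C * B1 * Z) * (C * B2 * \<tau> m)"
        using C B Z t0[of m] by (intro add_mono mult_mono a(4) b(4) sup norm_ge_zero) (auto intro!: mult_nonneg_nonneg)
      also have "\<dots> = (2 * C * C * B1 * B2 * Z) * \<tau> m" by (simp add: algebra_simps)
      finally show ?thesis .
    qed
    \<comment> \<open>The bands in each factor have level at most \<open>m + 1\<close>, which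
      \<open>band_mono\<close> raises to the common level \<open>m + 3\<close>; the product adds two
      more.\<close>
    have hb: "band (m + 5) (h m)" for m
    proof -
      have "band (m + 3) (\<lambda>x. \<Sum>k\<in>{..<Suc m}. b k x)" "band (m + 3) (\<lambda>x. \<Sum>k\<in>{..<m}. a k x)"
        by (intro band_sum band_mono[OF b(1)] band_mono[OF a(1)]; simp)+
      moreover have "band (m + 3) (a m)" "band (m + 3) (b m)"
        using band_mono[OF a(1)[of m], of "m + 3"] band_mono[OF b(1)[of m], of "m + 3"] by simp_all
      ultimately show ?thesis unfolding h_def by (intro band_add band_mult[of "m + 3"]) simp_all
    qed
    define Y1 where "Y1 = C * B1 * Z"
    define Y2 where "Y2 = C * B2 * Z"
    have Y: "0 \<le> Y1" "0 \<le> Y2" using C B Z by (simp_all add: Y1_def Y2_def)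
    \<comment> \<open>The partial sums of the two functions are bounded by \<open>Y1\<close> and
      \<open>Y2\<close>, so in each product only the single band enters through its
      \<open>L\<^sub>p\<close> size.\<close>
    define d where "d m = Ca * (Y2 * \<alpha> m + Y1 * \<beta> m)" for m
    have d0: "0 \<le> d m" for m using Ca(1) Y a(2) b(2) by (simp add: d_def)
    have hL: "Lp_le p (h m) (d m)" for m
    proof -
      have L1: "Lp_le p (\<lambda>x. a m x * (\<Sum>k<Suc m. b k x)) (Y2 * \<alpha> m)"
      proof (rule Lp_le_AE_mono[OF p_pos am a(3,2) Y(2)])
        have "norm (a m x * (\<Sum>k<Suc m. b k x)) \<le> Y2 * norm (a m x)" for x
          unfolding norm_mult mult.commute[of "norm (a m x)"] Y2_def by (intro mult_right_mono sup b(4) B(2) norm_ge_zero)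
        then show "AE x in lborel. norm (a m x * (\<Sum>k<Suc m. b k x)) \<le> Y2 * norm (a m x)" by (rule AE_I2)
      qed
      have L2: "Lp_le p (\<lambda>x. (\<Sum>k<m. a k x) * b m x) (Y1 * \<beta> m)"
      proof (rule Lp_le_AE_mono[OF p_pos bm b(3,2) Y(1)])
        have "norm ((\<Sum>k<m. a k x) * b m x) \<le> Y1 * norm (b m x)" for x
          unfolding norm_mult Y1_def by (intro mult_right_mono sup a(4) B(1) norm_ge_zero)
        then show "AE x in lborel. norm ((\<Sum>k<m. a k x) * b m x) \<le> Y1 * norm (b m x)" by (rule AE_I2)
      qed
      have "Lp_le p (\<lambda>x. a m x * (\<Sum>k<Suc m. b k x) + (\<Sum>k<m. a k x) * b m x) (Ca * (Y2 * \<alpha> m + Y1 * \<beta> m))"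
      proof (rule Ca(2)[OF _ _ L1 L2])
        show "(\<lambda>x. a m x * (\<Sum>k<Suc m. b k x)) \<in> borel_measurable borel" by measurable
        show "(\<lambda>x. (\<Sum>k<m. a k x) * b m x) \<in> borel_measurable borel" by measurable
      qed (use Y a(2) b(2) in simp_all)
      then show ?thesis unfolding h_def[abs_def] d_def .
    qed
    define t where "t m = 2 powr (real m * s) * d m" for m
    have tt0: "0 \<le> t m" for m using d0 by (simp add: t_def)
    define W where "W = Ca * (Cq * (Y2 * B1 + Y1 * B2))"
    have W: "0 \<le> W" using Ca(1) Cq(1) Y B by (simp add: W_def)
    have tq: "lq_le q t W"
    proof -
      have "lq_le q (\<lambda>j. Y2 * (2 powr (real j * s) * \<alpha> j) + Y1 * (2 powr (real j * s) * \<beta> j)) (Cq * (Y2 * B1 + Y1 * B2))"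
        by (rule Cq(2)) (use Y B a(2) b(2) in \<open>auto intro!: lq_le_cmult a(5) b(5)\<close>)
      then have "lq_le q (\<lambda>j. Ca * (Y2 * (2 powr (real j * s) * \<alpha> j) + Y1 * (2 powr (real j * s) * \<beta> j))) W"
        unfolding W_def by (rule lq_le_cmult) (use Y B a(2) b(2) Cq(1) Ca(1) in auto)
      moreover have "Ca * (Y2 * (2 powr (real j * s) * \<alpha> j) + Y1 * (2 powr (real j * s) * \<beta> j)) = t j" for j
        by (simp add: t_def d_def algebra_simps)
      ultimately show ?thesis by simp
    qed
    \<comment> \<open>The index \<open>i\<close> counts how far \<open>m = l + i - 7\<close> lies
      above \<open>l - 7\<close>, the lowest level that contributes to band \<open>l\<close>; the
      condition excludes truncated subtraction.\<close>
    define v where "v i l = (if 7 \<le> l + i then multiplier (dyadic \<phi>0 l) (h (l + i - 7)) else (\<lambda>x. 0))" for i l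
    define c where "c i l = (X * 2 powr (- (real i * \<epsilon>))) * (if 7 \<le> l + i then t (l + i - 7) else 0)" for i l
    have "besov_le (\<lambda>x. ?G1 x * ?G2 x) (K * (X * W))" unfolding besov_le_def
    proof (rule K(2)[of _ v c])
      show "0 \<le> X * W" using X W by simp
      show "v i l \<in> borel_measurable borel" for i l
        by (simp add: v_def multiplier_borel[OF dyadic_schwartz hm])
      show "0 \<le> c i l" for i l using X tt0 by (simp add: c_def)
      show "Lp_le p (v i l) (2 powr (- (real i * \<epsilon>)) * (2 powr (- (real l * s)) * c i l))" for i l
      proof (cases "7 \<le> l + i")
        case True
        define m where "m = l + i - 7"
        have m: "real m = real l + real i - 7" using True by (simp add: m_def of_nat_diff)
        \<comment> \<open>Level \<open>m + 8\<close> instead of \<open>m + 5\<close>: filtering to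
          band \<open>l\<close> requires a level of at least \<open>l + 1\<close>, and
          \<open>m\<close> may be as small as \<open>l - 7\<close>.\<close>
        have "Lp_le p (multiplier (dyadic \<phi>0 l) (h m)) (Cs * 2 powr ((real (m + 8) - real l) * smoothing_loss) * d m)"
        proof (rule Cs(2)[OF _ _ d0 hL])
          show "l + 1 \<le> m + 8" using True by (simp add: m_def)
          show "band (m + 8) (h m)" by (rule band_mono[OF hb]) simp
        qed
        moreover have "2 powr (- (real i * \<epsilon>)) * (2 powr (- (real l * s)) * c i l)
          = Cs * 2 powr ((real (m + 8) - real l) * smoothing_loss) * d m"
        proof -
          have "2 powr (- (real i * \<epsilon>)) * (2 powr (- (real l * s)) * c i l)
            = Cs * (2 powr (- (real i * \<epsilon>)) * 2 powr (- (real l * s)) * 2 powr (smoothing_loss + 7 * s) * 2 powr (- (real i * \<epsilon>)) * 2 powr (real m * s)) * d m"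
            using True by (simp add: c_def X_def t_def m_def[symmetric] mult_ac)
          also have "2 powr (- (real i * \<epsilon>)) * 2 powr (- (real l * s)) * 2 powr (smoothing_loss + 7 * s) * 2 powr (- (real i * \<epsilon>)) * 2 powr (real m * s)
            = 2 powr (- (real i * \<epsilon>) + - (real l * s) + (smoothing_loss + 7 * s) + - (real i * \<epsilon>) + real m * s)"
            by (simp only: powr_add)
          also have "- (real i * \<epsilon>) + - (real l * s) + (smoothing_loss + 7 * s) + - (real i * \<epsilon>) + real m * s = (real (m + 8) - real l) * smoothing_loss"
            by (simp add: m \<epsilon>_def field_simps)
          finally show ?thesis .
        qed
        ultimately show ?thesis using True by (simp add: v_def m_def)
      qed (simp add: v_def c_def Lp_le_zero)
      show "lq_le q (c i) (2 powr (- (real i * \<epsilon>)) * (X * W))" for i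
      proof -
        have "lq_le q (\<lambda>l. if 7 \<le> l + i then t (l + i - 7) else 0) W"
          by (rule lq_le_reindex[OF tq W]) (auto simp: inj_on_def)
        then have "lq_le q (\<lambda>l. (X * 2 powr (- (real i * \<epsilon>))) * (if 7 \<le> l + i then t (l + i - 7) else 0)) ((X * 2 powr (- (real i * \<epsilon>))) * W)"
          by (rule lq_le_cmult) (use tt0 W X in auto)
        then show ?thesis unfolding c_def by (simp only: mult_ac)
      qed
      have "ennreal (norm (multiplier (dyadic \<phi>0 l) (\<lambda>x. ?G1 x * ?G2 x) x)) \<le> (\<Sum>i. ennreal (norm (v i l x)))" for l x
      proof -
        have "ennreal (norm (multiplier (dyadic \<phi>0 l) (\<lambda>x. ?G1 x * ?G2 x) x)) \<le> (\<Sum>m. ennreal (norm (multiplier (dyadic \<phi>0 l) (h m) x)))"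
          by (rule norm_sums_le[OF multiplier_sums[OF dyadic_schwartz hm hM summable_mult[OF st] hsum]])
        also have "(\<lambda>m. ennreal (norm (multiplier (dyadic \<phi>0 l) (h m) x))) = (\<lambda>m. if l \<le> m + 7 then ennreal (norm (v (m + 7 - l) l x)) else 0)"
        proof
          fix m
          show "ennreal (norm (multiplier (dyadic \<phi>0 l) (h m) x)) = (if l \<le> m + 7 then ennreal (norm (v (m + 7 - l) l x)) else 0)"
          proof (cases "l \<le> m + 7")
            case False
            \<comment> \<open>Here \<open>m + 8 \<le> l\<close>, so \<open>l\<close> lies at least
              three levels above the level \<open>m + 5\<close> of \<open>h m\<close>.\<close>
            then have "multiplier (dyadic \<phi>0 l) (h m) x = 0" by (intro multiplier_dyadic_vanish[OF hb]) simp
            then show ?thesis using False by simp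
          qed (simp add: v_def)
        qed
        also have "(\<Sum>m. if l \<le> m + 7 then ennreal (norm (v (m + 7 - l) l x)) else 0) \<le> (\<Sum>i. ennreal (norm (v i l x)))"
          by (rule suminf_reindex_le) (auto simp: inj_on_def)
        finally show ?thesis .
      qed
      then show "AE x in lborel. ennreal (norm (multiplier (dyadic \<phi>0 l) (\<lambda>x. ?G1 x * ?G2 x) x)) \<le> (\<Sum>i. ennreal (norm (v i l x)))" for l
        by simp
    qed
    moreover have "K * (X * W) = (K * X * Ca * Cq * 2 * C * Z) * B1 * B2" by (simp add: W_def Y1_def Y2_def algebra_simps)
    ultimately show ?thesis using G1 G2 f1 f2 by (intro exI conjI) (assumption | simp only:)+
  qed
  moreover have "K * X * Ca * Cq * 2 * C * Z > 0" using K(1) X Ca(1) Cq(1) C Z by simp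
  ultimately show ?thesis by (intro exI[of _ "K * X * Ca * Cq * 2 * C * Z"] conjI allI impI) (simp, rule main)
qed

end

section \<open>Schwartz functions in Besov spaces\<close>

lemma Lp_le_schwartz:
  assumes p: "0 < p"
  shows "\<exists>C>0. \<exists>N. \<forall>(u::'n::finite cfun) B. 0 \<le> B \<longrightarrow> (\<forall>x. norm (u x) \<le> B / (1 + norm x) ^ N) \<longrightarrow> Lp_le p u (C * B)"
proof (cases "p = \<infinity>")
  case True
  have "Lp_le p u (1 * B)" if "\<forall>x. norm (u x) \<le> B / (1 + norm x) ^ 0" for u :: "'n cfun" and B
    using that True by (simp add: Lp_le_def)
  then show ?thesis by (intro exI[of _ 1] conjI exI[of _ 0]) simp_all
next
  case False
  let ?p = "real_of_ereal p"
  have p': "?p > 0" by (rule real_of_ereal_pos_finite[OF p False])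
  \<comment> \<open>Enough decay for the \<open>p\<close>-th power to be dominated by
    \<open>decay\<close>; small \<open>p\<close> requires large \<open>N\<close>.\<close>
  obtain N where N: "real (CARD('n) + 1) / ?p \<le> real N" using real_arch_simple by blast
  then have N': "real (CARD('n) + 1) \<le> real N * ?p" using p' by (simp add: pos_divide_le_eq)
  let ?m = "decay_mass TYPE('n) + 1"
  have m: "?m > 0" using decay_mass_nonneg[where 'n='n] by simp
  have "Lp_le p u (?m powr (1 / ?p) * B)" if B: "0 \<le> B" and u: "\<And>x. norm (u x) \<le> B / (1 + norm x) ^ N" for u :: "'n cfun" and B
  proof -
    have "norm (u x) powr ?p \<le> B powr ?p * decay x" for x
    proof -
      have "norm (u x) powr ?p \<le> (B / (1 + norm x) ^ N) powr ?p" using p' by (intro powr_mono2 u) auto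
      also have "\<dots> = B powr ?p / (1 + norm x) powr (real N * ?p)"
      proof -
        have "((1 + norm x) ^ N) powr ?p = (1 + norm x) powr (real N * ?p)"
          by (subst powr_realpow[symmetric]) (simp_all add: powr_powr add_pos_nonneg)
        then show ?thesis using B by (simp add: powr_divide)
      qed
      also have "\<dots> \<le> B powr ?p / (1 + norm x) powr (real (CARD('n) + 1))"
      proof (intro divide_left_mono powr_mono N' mult_pos_pos)
        have "1 + norm x > 0" by (simp add: add_pos_nonneg)
        then show "0 < (1 + norm x) powr (real N * ?p)" "0 < (1 + norm x) powr (real (CARD('n) + 1))" by simp_all
      qed simp_all
      also have "(1 + norm x) powr (real (CARD('n) + 1)) = (1 + norm x) ^ (CARD('n) + 1)"
        by (rule powr_realpow) (simp add: add_pos_nonneg)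
      finally show ?thesis by (simp add: decay_def)
    qed
    then have "(\<integral>\<^sup>+x. ennreal (norm (u x) powr ?p) \<partial>lborel) \<le> (\<integral>\<^sup>+x. ennreal (B powr ?p * decay (x::real^'n)) \<partial>lborel)"
      by (intro nn_integral_mono ennreal_leI)
    also have "\<dots> = ennreal (LINT x|lborel. B powr ?p * decay (x::real^'n))"
      by (rule nn_integral_eq_integral[OF integrable_mult_right[OF decay_integrable_self]]) (simp add: decay_def)
    also have "(LINT x|lborel. B powr ?p * decay (x::real^'n)) = B powr ?p * decay_mass TYPE('n)"
      by (simp add: decay_mass_def)
    also have "\<dots> \<le> ennreal ((?m powr (1 / ?p) * B) powr ?p)"
      using m p' B by (intro ennreal_leI) (simp add: powr_mult powr_powr mult_left_mono mult.commute[of _ "B powr ?p"])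
    finally show ?thesis using False by (simp add: Lp_le_def)
  qed
  then show ?thesis using m by (intro exI[of _ "?m powr (1 / ?p)"] conjI exI[of _ N]) simp_all
qed

lemma lq_le_geometric:
  assumes q: "0 < q"
  shows "\<exists>C>0. \<forall>B. 0 \<le> B \<longrightarrow> lq_le q (\<lambda>l. 2 powr (- real l) * B) (C * B)"
proof (cases "q = \<infinity>")
  case True
  have "2 powr (- real l) * B \<le> 1 * B" if "0 \<le> B" for l B
    using that by (intro mult_right_mono) (simp_all add: powr_minus inverse_le_1_iff ge_one_powr_ge_zero)
  then show ?thesis using True by (intro exI[of _ 1]) (simp add: lq_le_def)
next
  case False
  let ?q = "real_of_ereal q"
  have q': "?q > 0" by (rule real_of_ereal_pos_finite[OF q False])
  let ?t = "\<lambda>l. 2 powr (- (real l * ?q))"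
  have st: "summable ?t" by (rule summable_powr_neg[OF q'])
  let ?Z = "\<Sum>l. ?t l"
  have Z: "?Z > 0" by (intro suminf_pos st) simp
  have "lq_le q (\<lambda>l. 2 powr (- real l) * B) (?Z powr (1 / ?q) * B)" if B: "0 \<le> B" for B
  proof -
    have "(\<Sum>l. ennreal ((2 powr (- real l) * B) powr ?q)) = (\<Sum>l. ennreal (?t l * B powr ?q))"
      using B by (simp add: powr_mult powr_powr)
    also have "\<dots> = ennreal (\<Sum>l. ?t l * B powr ?q)"
      by (rule suminf_ennreal_eq[OF _ summable_sums[OF summable_mult2[OF st]]]) simp
    also have "(\<Sum>l. ?t l * B powr ?q) = ?Z * B powr ?q" by (rule suminf_mult2[OF st, symmetric])
    also have "\<dots> = (?Z powr (1 / ?q) * B) powr ?q" using Z B q' by (simp add: powr_mult powr_powr)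
    finally show ?thesis using False by (simp add: lq_le_def)
  qed
  moreover have "?Z powr (1 / ?q) > 0" using Z by simp
  ultimately show ?thesis by blast
qed

context besov_setting
begin

text \<open>For \<open>l = k + 1\<close> the symbol vanishes on the ball of radius
  \<open>2 ^ k\<close>, so \<open>M\<close> spare orders of \<open>f\<close> give
  \<open>2 ^ (- k M)\<close>; the factor \<open>2 ^ M\<close> in the constant converts
  \<open>k\<close> into \<open>l\<close>. At level 0 the symbol does not vanish near the origin, but
  there no decay is claimed.\<close>

lemma schwartz_sup_dyadic_mult:
  "\<exists>C\<ge>0. \<forall>l (f :: 'n cfun). f \<in> schwartz \<longrightarrow> schwartz_sup N (\<lambda>x. dyadic \<phi>0 l x * f x) \<le> C * schwartz_sup (N + M) f / (2 ^ l) ^ M"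
proof -
  obtain K where K: "K \<ge> 0" "\<And>g f :: 'n cfun. \<And>C R. \<lbrakk>R > 0; smooth g; \<forall>x. deriv_sum (N + M) g x \<le> C;
     \<forall>x. norm x < R \<longrightarrow> g x = 0; f \<in> schwartz\<rbrakk> \<Longrightarrow> schwartz_sup N (\<lambda>x. g x * f x) \<le> K * C * schwartz_sup (N + M) f / R ^ M"
    using schwartz_sup_cut[of N M, where 'n = 'n] by blast
  obtain K0 where K0: "K0 \<ge> 0" "\<And>g f :: 'n cfun. \<And>C m x. \<lbrakk>smooth g; \<forall>x. deriv_sum N g x \<le> C * (1 + norm x) ^ m; f \<in> schwartz\<rbrakk> \<Longrightarrow>
     (1 + norm x) ^ N * deriv_sum N (\<lambda>x. g x * f x) x \<le> K0 * C * schwartz_sup (N + m) f"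
    using schwartz_mult_gen[of N, where 'n = 'n] by blast
  let ?S = "schwartz_sup (N + M) \<phi>0"
  have S: "?S \<ge> 0" by (rule schwartz_sup_nonneg[OF schwartz_\<phi>0])
  let ?C = "K0 * ?S + K * (?S + ?S) * 2 ^ M"
  have "schwartz_sup N (\<lambda>x. dyadic \<phi>0 l x * f x) \<le> ?C * schwartz_sup (N + M) f / (2 ^ l) ^ M" if f: "f \<in> schwartz" for l and f :: "'n cfun"
  proof (cases l)
    case 0
    have fs: "0 \<le> schwartz_sup (N + M) f" by (rule schwartz_sup_nonneg[OF f])
    have "schwartz_sup N (\<lambda>x. \<phi>0 x * f x) \<le> K0 * ?S * schwartz_sup (N + 0) f"
    proof (rule schwartz_sup_le[OF K0(2)[OF schwartz_smooth[OF schwartz_\<phi>0] _ f]], intro allI)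
      fix x
      show "deriv_sum N \<phi>0 x \<le> ?S * (1 + norm x) ^ 0"
        using deriv_sum_le_sup[OF schwartz_\<phi>0, of N x] schwartz_sup_mono[OF schwartz_\<phi>0, of N "N + M"] by simp
    qed
    also have "\<dots> \<le> K0 * ?S * schwartz_sup (N + M) f"
      using K0(1) S by (intro mult_left_mono schwartz_sup_mono[OF f]) auto
    also have "\<dots> \<le> ?C * schwartz_sup (N + M) f"
      using K(1) S fs by (intro mult_right_mono) simp_all
    finally show ?thesis by (simp add: 0)
  next
    case (Suc k)
    have "schwartz_sup N (\<lambda>x. dyadic \<phi>0 (Suc k) x * f x) \<le> K * (?S + ?S) * schwartz_sup (N + M) f / (2 ^ k) ^ M"
    proof (rule K(2)[OF _ schwartz_smooth[OF dyadic_schwartz] _ _ f])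
      show "\<forall>x. deriv_sum (N + M) (dyadic \<phi>0 (Suc k)) x \<le> ?S + ?S"
        unfolding dyadic_Suc_eq
        by (intro allI order_trans[OF deriv_sum_diff_le] add_mono deriv_sum_cutoff_le schwartz_smooth cutoff_schwartz)
      show "\<forall>x. norm x < 2 ^ k \<longrightarrow> dyadic \<phi>0 (Suc k) x = 0"
      proof (intro allI impI)
        fix x :: "real^'n" assume "norm x < 2 ^ k"
        moreover have "(2::real) ^ k \<le> 2 ^ Suc k" by simp
        ultimately have "norm x \<le> 2 ^ k" "norm x \<le> 2 ^ Suc k" by linarith+
        then show "dyadic \<phi>0 (Suc k) x = 0"
          using cutoff_eq_1[of x k] cutoff_eq_1[of x "Suc k"] unfolding dyadic_Suc_eq by (simp del: power_Suc)
      qed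
    qed simp
    also have "\<dots> = (K * (?S + ?S) * 2 ^ M) * schwartz_sup (N + M) f / (2 ^ Suc k) ^ M"
      by (simp add: power_mult_distrib)
    also have "\<dots> \<le> ?C * schwartz_sup (N + M) f / (2 ^ Suc k) ^ M"
      using K0(1) S schwartz_sup_nonneg[OF f] by (intro divide_right_mono mult_right_mono) simp_all
    finally show ?thesis by (simp only: Suc)
  qed
  moreover have "?C \<ge> 0" using K0(1) K(1) S by simp
  ultimately show ?thesis by blast
qed

text \<open>For Schwartz functions the kernel form agrees with the usual definition on the Fourier
  side, because \<open>\<psi>\<close> is a superposition of characters by Fourier inversion.\<close>

lemma multiplier_schwartz:
  assumes \<sigma>: "\<sigma> \<in> schwartz" and \<psi>: "\<psi> \<in> schwartz"
  shows "multiplier \<sigma> (\<psi> :: 'n cfun) = inv_fourier (\<lambda>\<xi>. \<sigma> \<xi> * fourier \<psi> \<xi>)"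
proof
  fix x
  let ?c = "of_real (fourier_const TYPE('n)) :: complex"
  note F = fourier_schwartz[OF \<psi>]
  have e: "\<psi> = (\<lambda>x. ?c * (LINT \<xi>|lborel. exp (\<i> * of_real (x \<bullet> \<xi>)) * fourier \<psi> \<xi>))"
    using inv_fourier_eq[OF schwartz_borel[OF F]] by (subst inv_fourier_fourier[OF \<psi>, symmetric]) (simp add: inner_commute fun_eq_iff)
  have "multiplier \<sigma> \<psi> x = ?c * multiplier \<sigma> (\<lambda>x. LINT \<xi>|lborel. exp (\<i> * of_real (x \<bullet> \<xi>)) * fourier \<psi> \<xi>) x"
    by (subst e) (rule multiplier_cmult)
  also have "multiplier \<sigma> (\<lambda>x. LINT \<xi>|lborel. exp (\<i> * of_real (x \<bullet> \<xi>)) * fourier \<psi> \<xi>) x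
    = (LINT \<xi>|lborel. exp (\<i> * of_real (x \<bullet> \<xi>)) * (\<sigma> \<xi> * fourier \<psi> \<xi>))"
    by (rule multiplier_spectral[OF sigma_finite_lborel \<sigma> schwartz_integrable[OF F]]) simp
  finally show "multiplier \<sigma> \<psi> x = inv_fourier (\<lambda>\<xi>. \<sigma> \<xi> * fourier \<psi> \<xi>) x"
    by (simp add: inv_fourier_eq[OF schwartz_borel[OF schwartz_mult[OF \<sigma> F]]] inner_commute)
qed

lemma besov_le_schwartz: "\<exists>C>0. \<exists>N. \<forall>\<psi>\<in>schwartz. besov_le \<psi> (C * schwartz_sup N \<psi>)"
proof -
  obtain C N where C: "C > 0" "\<And>(u::'n cfun) B. \<lbrakk>0 \<le> B; \<forall>x. norm (u x) \<le> B / (1 + norm x) ^ N\<rbrakk> \<Longrightarrow> Lp_le p u (C * B)"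
    using Lp_le_schwartz[OF p_pos, where 'n='n] by blast
  obtain Cq where Cq: "Cq > 0" "\<And>B. 0 \<le> B \<Longrightarrow> lq_le q (\<lambda>l. 2 powr (- real l) * B) (Cq * B)"
    using lq_le_geometric[OF q_pos] by blast
  \<comment> \<open>Decay of order \<open>M\<close> in the level beats the weight
    \<open>2 powr (real l * s)\<close> and leaves \<open>2 powr (- real l)\<close>, which is
    summable to every power \<open>q\<close>.\<close>
  obtain M where M: "s + 1 \<le> real M" using real_arch_simple by blast
  obtain K1 N1 where K1: "K1 \<ge> 0" "\<And>f::'n cfun. f \<in> schwartz \<Longrightarrow> schwartz_sup N (inv_fourier f) \<le> K1 * schwartz_sup N1 f"
    using inv_fourier_bound[of N, where 'n='n] by blast
  obtain K2 where K2: "K2 \<ge> 0" "\<And>l (f :: 'n cfun). f \<in> schwartz \<Longrightarrow> schwartz_sup N1 (\<lambda>x. dyadic \<phi>0 l x * f x) \<le> K2 * schwartz_sup (N1 + M) f / (2 ^ l) ^ M"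
    using schwartz_sup_dyadic_mult[of N1 M] by blast
  obtain K3 N3 where K3: "K3 \<ge> 0" "\<And>f::'n cfun. f \<in> schwartz \<Longrightarrow> schwartz_sup (N1 + M) (fourier f) \<le> K3 * schwartz_sup N3 f"
    using fourier_bound[of "N1 + M", where 'n='n] by blast
  let ?K = "K1 * K2 * K3 + 1"
  have K: "?K > 0" using K1(1) K2(1) K3(1) by (simp add: add_nonneg_pos)
  have "besov_le \<psi> ((Cq * C * ?K) * schwartz_sup N3 \<psi>)" if \<psi>: "\<psi> \<in> schwartz" for \<psi>
  proof -
    let ?S = "schwartz_sup N3 \<psi>"
    have S: "0 \<le> ?S" by (rule schwartz_sup_nonneg[OF \<psi>])
    define b where "b l = C * (?K * ?S / (2 ^ l) ^ M)" for l :: nat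
    have b0: "0 \<le> b l" for l using C(1) K S by (simp add: b_def)
    have "Lp_le p (multiplier (dyadic \<phi>0 l) \<psi>) (b l)" for l
      unfolding b_def
    proof (rule C(2), goal_cases)
      case 1 then show ?case using K S by simp
    next
      case 2
      let ?f = "\<lambda>\<xi>. dyadic \<phi>0 l \<xi> * fourier \<psi> \<xi>"
      note F = fourier_schwartz[OF \<psi>]
      note m = schwartz_mult[OF dyadic_schwartz F]
      have "schwartz_sup N (inv_fourier ?f) \<le> K1 * schwartz_sup N1 ?f" by (rule K1(2)[OF m])
      also have "\<dots> \<le> K1 * (K2 * schwartz_sup (N1 + M) (fourier \<psi>) / (2 ^ l) ^ M)" by (rule mult_left_mono[OF K2(2)[OF F] K1(1)])
      also have "\<dots> \<le> K1 * (K2 * (K3 * ?S) / (2 ^ l) ^ M)"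
        using K1(1) K2(1) by (intro mult_left_mono divide_right_mono K3(2)[OF \<psi>]) simp_all
      also have "\<dots> \<le> ?K * ?S / (2 ^ l) ^ M" using S by (simp add: divide_right_mono algebra_simps)
      finally have "schwartz_sup N (inv_fourier ?f) \<le> ?K * ?S / (2 ^ l) ^ M" .
      then have "schwartz_sup N (inv_fourier ?f) / (1 + norm x) ^ N \<le> ?K * ?S / (2 ^ l) ^ M / (1 + norm x) ^ N" for x :: "real^'n"
        by (rule divide_right_mono) simp
      then show ?case unfolding multiplier_schwartz[OF dyadic_schwartz \<psi>]
        using schwartz_decay0[OF inv_fourier_schwartz[OF m]] order_trans by blast
    qed
    moreover have "lq_le q (\<lambda>l. 2 powr (real l * s) * b l) (Cq * (C * ?K * ?S))"
    proof (rule lq_le_mono[OF q_pos Cq(2)])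
      show "0 \<le> C * ?K * ?S" using C(1) K S by simp
      then show "0 \<le> Cq * (C * ?K * ?S)" using Cq(1) by simp
      show "0 \<le> 2 powr (real l * s) * b l" for l using b0 by simp
      show "2 powr (real l * s) * b l \<le> 2 powr (- real l) * (C * ?K * ?S)" for l
      proof -
        have "((2::real) ^ l) ^ M = 2 powr (real l * real M)" by (simp add: powr_realpow[symmetric] powr_powr)
        then have "2 powr (real l * s) * b l = 2 powr (real l * s - real l * real M) * (C * ?K * ?S)"
          by (simp add: b_def powr_diff)
        also have "\<dots> \<le> 2 powr (- real l) * (C * ?K * ?S)"
        proof (intro mult_right_mono powr_mono)
          have "real l * (s + 1) \<le> real l * real M" by (intro mult_left_mono M) simp
          then show "real l * s - real l * real M \<le> - real l" by (simp add: algebra_simps)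
        qed (use C(1) K S in auto)
        finally show ?thesis .
      qed
    qed simp
    ultimately show ?thesis unfolding besov_le_def using b0 by (intro exI[of _ b]) (simp add: mult.assoc)
  qed
  moreover have "Cq * C * ?K > 0" using Cq(1) C(1) K by simp
  ultimately show ?thesis by blast
qed

end

section \<open>Besov spaces as multiplication algebras\<close>

lemma distr_of_add:
  assumes "poly_bounded A M G" "poly_bounded B N H"
  shows "distr_of (\<lambda>x. G x + H x) = (\<lambda>\<phi>. distr_of G \<phi> + distr_of H \<phi>)"
  using poly_bounded_mult_integrable[OF assms(1)] poly_bounded_mult_integrable[OF assms(2)]
  by (auto simp: distr_of_def fun_eq_iff distrib_right)

lemma distr_of_cmult: "distr_of (\<lambda>x. c * G x) = (\<lambda>\<phi>. c * distr_of G \<phi>)"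
  by (auto simp: distr_of_def fun_eq_iff mult.assoc)

lemma distr_of_zero: "distr_of (\<lambda>x. 0) = (\<lambda>\<phi>. 0)"
  by (auto simp: distr_of_def)

lemma distr_of_norm_le:
  fixes G :: "'n::finite cfun"
  assumes G: "poly_bounded B 0 G" and B: "0 \<le> B" and \<phi>: "\<phi> \<in> schwartz"
  shows "norm (distr_of G \<phi>) \<le> B * (decay_mass TYPE('n) * schwartz_sup (CARD('n) + 1) \<phi>)"
proof -
  have "norm (distr_of G \<phi>) = norm (LINT x|lborel. G x * \<phi> x)" using \<phi> by (simp add: distr_of_def)
  also have "\<dots> \<le> (LINT x|lborel. norm (G x * \<phi> x))" by (rule integral_norm_bound)
  also have "\<dots> \<le> (B * schwartz_sup (CARD('n) + 1) \<phi>) * decay_mass TYPE('n)"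
  proof (rule decay_integral_le)
    show "(\<lambda>x. G x * \<phi> x) \<in> borel_measurable borel"
      using poly_bounded_borel[OF G] schwartz_borel[OF \<phi>] by measurable
    show "norm (G x * \<phi> x) \<le> B * schwartz_sup (CARD('n) + 1) \<phi> * decay x" for x
      unfolding norm_mult mult.assoc
      by (rule mult_mono[OF poly_bounded_0D[OF G] schwartz_decay_le[OF \<phi>] B norm_ge_zero])
  qed
  finally show ?thesis by (simp add: mult_ac)
qed

lemma distr_of_schwartz_eq: "\<psi> \<in> schwartz \<Longrightarrow> distr_of_schwartz \<psi> = distr_of \<psi>"
  unfolding distr_of_schwartz_def distr_of_def
  by (intro ext) (simp add: lebesgue_integral_lborel schwartz_borel)

lemma schwartz_poly_bounded: "\<psi> \<in> schwartz \<Longrightarrow> poly_bounded (schwartz_sup 0 \<psi>) 0 \<psi>"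
  using schwartz_decay0[of \<psi> _ 0] schwartz_borel by (auto simp: poly_bounded_def)

lemma schwartz_bounded_sup:
  fixes K :: "'n::finite cfun set"
  assumes "schwartz_bounded K"
  shows "\<exists>R. \<forall>\<phi>\<in>K. schwartz_sup N \<phi> \<le> R"
proof -
  have K: "K \<subseteq> schwartz" and bd: "\<And>k \<alpha>. bdd_above (schwartz_seminorm k \<alpha> ` K)"
    using assms by (auto simp: schwartz_bounded_def)
  have "schwartz_sup N \<phi> \<le> (\<Sum>\<alpha>\<in>{\<alpha>. length \<alpha> \<le> N}. SUP \<phi>\<in>K. schwartz_seminorm N \<alpha> \<phi>)" if "\<phi> \<in> K" for \<phi>
    using schwartz_sup_le_seminorms[of \<phi> N] K that
    by (auto elim!: order_trans intro!: sum_mono cSUP_upper bd)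
  then show ?thesis by blast
qed

section \<open>The quasi-normed space, its products, completeness and the two embeddings\<close>

context besov_setting
begin

text \<open>The representatives \<open>g1\<close> and \<open>g2\<close> are arbitrary and agree with
  the bounded functions \<open>G1\<close> and \<open>G2\<close> almost everywhere only, so local
  integrability of the product has to be transferred as well.\<close>

lemma represents_mult:
  fixes G1 G2 :: "'n cfun"
  assumes r: "represents g1 (distr_of G1)" "represents g2 (distr_of G2)"
    and G: "poly_bounded M1 0 G1" "poly_bounded M2 0 G2"
  shows "represents (\<lambda>x. g1 x * g2 x) (distr_of (\<lambda>x. G1 x * G2 x))"
  unfolding represents_def
proof (intro conjI ballI)
  note P = poly_bounded_0_mult[OF G]
  have "AE x in lebesgue. g1 x = G1 x" "AE x in lebesgue. g2 x = G2 x"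
    using represents_ae_unique[OF r(1) poly_bounded_locally_integrable[OF G(1)]]
      represents_ae_unique[OF r(2) poly_bounded_locally_integrable[OF G(2)]]
    by (simp_all add: distr_of_def test_function_schwartz)
  then have ae: "AE x in lebesgue. g1 x * g2 x = G1 x * G2 x" by eventually_elim simp
  have m1: "(\<lambda>x. g1 x * g2 x) \<in> borel_measurable lebesgue"
    using r by (intro borel_measurable_times L1_loc_measurable) (simp_all add: represents_def)
  have m2: "(\<lambda>x. G1 x * G2 x) \<in> borel_measurable lebesgue"
    using poly_bounded_borel[OF P] measurable_completion by (simp add: measurable_completion)
  have rG: "represents (\<lambda>x. G1 x * G2 x) (distr_of (\<lambda>x. G1 x * G2 x))" by (rule distr_of_represents[OF P])
  show "distr_of (\<lambda>x. G1 x * G2 x) \<in> tempered" by (rule distr_of_tempered[OF P])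
  show "(\<lambda>x. g1 x * g2 x) \<in> L1_loc"
    unfolding L1_loc_def
  proof (intro CollectI allI impI)
    fix K :: "(real^'n) set" assume K: "compact K"
    then have KL: "K \<in> sets lebesgue" by (simp add: compact_imp_closed)
    have "integrable lebesgue (\<lambda>x. indicator K x *\<^sub>R (G1 x * G2 x))"
      using rG K by (simp add: represents_def L1_loc_def set_integrable_def)
    then have "integrable lebesgue (\<lambda>x. indicator K x *\<^sub>R (g1 x * g2 x))"
    proof (rule integrable_cong_AE_imp)
      show "(\<lambda>x. indicator K x *\<^sub>R (g1 x * g2 x)) \<in> borel_measurable lebesgue"
        using m1 KL by measurable
      show "AE x in lebesgue. indicator K x *\<^sub>R (G1 x * G2 x) = indicator K x *\<^sub>R (g1 x * g2 x)"
        using ae by eventually_elim simp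
    qed
    then show "(\<lambda>x. g1 x * g2 x) absolutely_integrable_on K" by (simp add: set_integrable_def)
  qed
  fix \<phi> :: "'n cfun" assume \<phi>: "\<phi> \<in> test_functions"
  have m\<phi>: "\<phi> \<in> borel_measurable lebesgue"
    using schwartz_borel[OF test_function_schwartz[OF \<phi>]] by (simp add: measurable_completion)
  have "distr_of (\<lambda>x. G1 x * G2 x) \<phi> = (LINT x|lebesgue. G1 x * G2 x * \<phi> x)"
    using rG \<phi> by (simp add: represents_def)
  also have "\<dots> = (LINT x|lebesgue. g1 x * g2 x * \<phi> x)"
  proof (rule integral_cong_AE)
    show "AE x in lebesgue. G1 x * G2 x * \<phi> x = g1 x * g2 x * \<phi> x" using ae by eventually_elim simp
  qed (intro borel_measurable_times m1 m2 m\<phi>)+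
  finally show "distr_of (\<lambda>x. G1 x * G2 x) \<phi> = (LINT x|lebesgue. g1 x * g2 x * \<phi> x)" .
qed

abbreviation bspace :: "'n distr set" where "bspace \<equiv> besov_space \<phi>0 s p q"

definition bnorm :: "'n distr \<Rightarrow> real" where "bnorm f = enn2real (besov_norm \<phi>0 s p q f)"

lemma bnorm_nonneg: "0 \<le> bnorm f" by (simp add: bnorm_def)

lemma bspace_tempered: "f \<in> bspace \<Longrightarrow> f \<in> tempered" by (simp add: besov_space_def)

lemma bspace_norm: "f \<in> bspace \<Longrightarrow> besov_norm \<phi>0 s p q f \<le> ennreal (bnorm f)"
  by (simp add: besov_space_def bnorm_def ennreal_enn2real)

lemma bspaceI:
  assumes "poly_bounded M 0 G" "0 \<le> B" "besov_le G B"
  shows "distr_of G \<in> bspace" "bnorm (distr_of G) \<le> B"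
proof -
  have le: "besov_norm \<phi>0 s p q (distr_of G) \<le> ennreal B"
    using besov_norm_distr_of_le[OF assms(1,2)] assms(3) by simp
  then show "distr_of G \<in> bspace"
    using distr_of_tempered[OF assms(1)] by (simp add: besov_space_def order_le_less_trans)
  show "bnorm (distr_of G) \<le> B" unfolding bnorm_def by (rule enn2real_leI[OF assms(2) le])
qed

lemma bspaceE:
  "\<exists>C>0. \<forall>f\<in>bspace. \<exists>G. poly_bounded (C * bnorm f) 0 G \<and> f = distr_of G \<and> besov_le G (bnorm f)"
proof -
  obtain C where C: "C > 0" "\<And>f B. \<lbrakk>f \<in> tempered; 0 \<le> B; besov_norm \<phi>0 s p q f \<le> ennreal B\<rbrakk> \<Longrightarrow>
    \<exists>G. poly_bounded (C * B) 0 G \<and> f = distr_of G"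
    using besov_bounded by blast
  have "\<exists>G. poly_bounded (C * bnorm f) 0 G \<and> f = distr_of G \<and> besov_le G (bnorm f)" if f: "f \<in> bspace" for f
  proof -
    obtain G where G: "poly_bounded (C * bnorm f) 0 G" "f = distr_of G"
      using C(2)[OF bspace_tempered[OF f] bnorm_nonneg bspace_norm[OF f]] by blast
    then show ?thesis using besov_norm_distr_of_le[OF G(1) bnorm_nonneg, of f] bspace_norm[OF f] by blast
  qed
  then show ?thesis using C(1) by blast
qed

lemma bspace_zero: "(\<lambda>\<phi>. 0) \<in> bspace" "bnorm (\<lambda>\<phi>. 0) = 0"
proof -
  have "poly_bounded 0 0 (\<lambda>x::real^'n. 0)" by (simp add: poly_bounded_def)
  note I = bspaceI[OF this order_refl besov_le_zero[OF order_refl]]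
  show "(\<lambda>\<phi>. 0) \<in> bspace" "bnorm (\<lambda>\<phi>. 0) = 0"
    using I bnorm_nonneg[of "\<lambda>\<phi>. 0"] unfolding distr_of_zero by simp_all
qed

lemma bspace_cmult:
  assumes f: "f \<in> bspace"
  shows "(\<lambda>\<phi>. c * f \<phi>) \<in> bspace" "bnorm (\<lambda>\<phi>. c * f \<phi>) = norm c * bnorm f"
proof -
  have *: "(\<lambda>\<phi>. c * f \<phi>) \<in> bspace \<and> bnorm (\<lambda>\<phi>. c * f \<phi>) \<le> norm c * bnorm f" if fb: "f \<in> bspace" for c f
  proof -
    obtain C where C: "\<And>f. f \<in> bspace \<Longrightarrow> \<exists>G. poly_bounded (C * bnorm f) 0 G \<and> f = distr_of G \<and> besov_le G (bnorm f)"
      using bspaceE by blast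
    obtain G where G: "poly_bounded (C * bnorm f) 0 G" "f = distr_of G" "besov_le G (bnorm f)" using C[OF fb] by blast
    have "poly_bounded (norm c * (C * bnorm f)) 0 (\<lambda>x. c * G x)"
    proof -
      note [measurable] = poly_bounded_borel[OF G(1)]
      have "(\<lambda>x. c * G x) \<in> borel_measurable borel" by measurable
      moreover have "norm (c * G x) \<le> norm c * (C * bnorm f)" for x
        unfolding norm_mult by (rule mult_left_mono[OF poly_bounded_0D[OF G(1)] norm_ge_zero])
      ultimately show ?thesis by (simp add: poly_bounded_def)
    qed
    note I = bspaceI[OF this _ besov_le_cmult[OF G(1,3) bnorm_nonneg]]
    show ?thesis using I[unfolded distr_of_cmult G(2)[symmetric]] by (simp add: bnorm_nonneg)
  qed
  show "(\<lambda>\<phi>. c * f \<phi>) \<in> bspace" using *[OF f] by blast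
  show "bnorm (\<lambda>\<phi>. c * f \<phi>) = norm c * bnorm f"
  proof (cases "c = 0")
    case True
    then show ?thesis by (simp add: bspace_zero)
  next
    case False
    \<comment> \<open>The upper bound, applied with the factor \<open>1 / c\<close> to the multiple,
      yields the reverse inequality.\<close>
    have "bnorm (\<lambda>\<phi>. (1 / c) * (c * f \<phi>)) \<le> norm (1 / c) * bnorm (\<lambda>\<phi>. c * f \<phi>)"
      using * *[OF f] by blast
    then have "norm c * bnorm f \<le> bnorm (\<lambda>\<phi>. c * f \<phi>)"
      using False by (simp add: norm_divide pos_le_divide_eq mult.commute)
    then show ?thesis using *[OF f, of c] by simp
  qed
qed

lemma bspace_add:
  "\<exists>K\<ge>1. \<forall>f\<in>bspace. \<forall>g\<in>bspace. (\<lambda>\<phi>. f \<phi> + g \<phi>) \<in> bspace \<and> bnorm (\<lambda>\<phi>. f \<phi> + g \<phi>) \<le> K * (bnorm f + bnorm g)"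
proof -
  obtain K where K: "K > 0" "\<And>G H A B M N. \<lbrakk>poly_bounded M 0 G; poly_bounded N 0 H; besov_le G A; besov_le H B; 0 \<le> A; 0 \<le> B\<rbrakk> \<Longrightarrow>
    besov_le (\<lambda>x. G x + H x) (K * (A + B))" using besov_le_add by blast
  obtain C where C: "\<And>f. f \<in> bspace \<Longrightarrow> \<exists>G. poly_bounded (C * bnorm f) 0 G \<and> f = distr_of G \<and> besov_le G (bnorm f)"
    using bspaceE by blast
  have "(\<lambda>\<phi>. f \<phi> + g \<phi>) \<in> bspace \<and> bnorm (\<lambda>\<phi>. f \<phi> + g \<phi>) \<le> max 1 K * (bnorm f + bnorm g)"
    if f: "f \<in> bspace" and g: "g \<in> bspace" for f g
  proof -
    obtain G where G: "poly_bounded (C * bnorm f) 0 G" "f = distr_of G" "besov_le G (bnorm f)" using C[OF f] by blast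
    obtain H where H: "poly_bounded (C * bnorm g) 0 H" "g = distr_of H" "besov_le H (bnorm g)" using C[OF g] by blast
    have nn: "0 \<le> K * (bnorm f + bnorm g)" using K(1) by (simp add: bnorm_nonneg)
    note I = bspaceI[OF poly_bounded_add[OF G(1) H(1)] nn K(2)[OF G(1) H(1) G(3) H(3) bnorm_nonneg bnorm_nonneg],
        unfolded distr_of_add[OF G(1) H(1)] G(2)[symmetric] H(2)[symmetric]]
    have "K * (bnorm f + bnorm g) \<le> max 1 K * (bnorm f + bnorm g)"
      by (intro mult_right_mono) (simp_all add: bnorm_nonneg)
    then show ?thesis using I by simp
  qed
  then show ?thesis by (intro exI[of _ "max 1 K"]) simp
qed

lemma bspace_diff:
  assumes "f \<in> bspace" "g \<in> bspace" shows "(\<lambda>\<phi>. f \<phi> - g \<phi>) \<in> bspace" "bnorm (\<lambda>\<phi>. f \<phi> - g \<phi>) = bnorm (\<lambda>\<phi>. g \<phi> - f \<phi>)"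
proof -
  have *: "(\<lambda>\<phi>. f \<phi> - g \<phi>) \<in> bspace" if "f \<in> bspace" "g \<in> bspace" for f g
    using bspace_add bspace_cmult(1)[OF that(2), of "-1"] that(1) by fastforce
  show "(\<lambda>\<phi>. f \<phi> - g \<phi>) \<in> bspace" using * assms by blast
  show "bnorm (\<lambda>\<phi>. f \<phi> - g \<phi>) = bnorm (\<lambda>\<phi>. g \<phi> - f \<phi>)"
    using bspace_cmult(2)[OF *[OF assms(2,1)], of "-1"] by simp
qed

lemma bspace_quasi_normed: "quasi_normed_space bspace bnorm"
  unfolding quasi_normed_space_def
proof (intro conjI ballI allI)
  show "(\<lambda>\<phi>. 0) \<in> bspace" by (rule bspace_zero)
  show "(\<lambda>\<phi>. f \<phi> + g \<phi>) \<in> bspace" if "f \<in> bspace" "g \<in> bspace" for f g using bspace_add that by blast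
  show "(\<lambda>\<phi>. c * f \<phi>) \<in> bspace" if "f \<in> bspace" for f c by (rule bspace_cmult(1)[OF that])
  show "0 \<le> bnorm f" for f by (rule bnorm_nonneg)
  show "bnorm (\<lambda>\<phi>. c * f \<phi>) = norm c * bnorm f" if "f \<in> bspace" for f c by (rule bspace_cmult(2)[OF that])
  show "\<exists>C\<ge>1. \<forall>f\<in>bspace. \<forall>g\<in>bspace. bnorm (\<lambda>\<phi>. f \<phi> + g \<phi>) \<le> C * (bnorm f + bnorm g)"
    using bspace_add by blast
  show "bnorm f = 0 \<longleftrightarrow> f = (\<lambda>\<phi>. 0)" if f: "f \<in> bspace" for f
  proof
    assume z: "bnorm f = 0"
    obtain C where C: "\<And>f. f \<in> bspace \<Longrightarrow> \<exists>G. poly_bounded (C * bnorm f) 0 G \<and> f = distr_of G \<and> besov_le G (bnorm f)"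
      using bspaceE by blast
    obtain G where G: "poly_bounded (C * bnorm f) 0 G" "f = distr_of G" using C[OF f] by blast
    \<comment> \<open>The bound of the representative is a multiple of the quasi-norm and therefore
      vanishes with it.\<close>
    have "G = (\<lambda>x. 0)" using poly_bounded_0D[OF G(1)] z by (simp add: fun_eq_iff)
    then show "f = (\<lambda>\<phi>. 0)" using G(2) distr_of_zero by simp
  qed (simp add: bspace_zero)
qed

lemma bspace_regular: "f \<in> bspace \<Longrightarrow> \<exists>g. represents g f"
proof -
  obtain C where "\<And>f. f \<in> bspace \<Longrightarrow> \<exists>G. poly_bounded (C * bnorm f) 0 G \<and> f = distr_of G \<and> besov_le G (bnorm f)"
    using bspaceE by blast
  moreover assume "f \<in> bspace"
  ultimately show ?thesis using distr_of_represents by blast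
qed

lemma bspace_mult:
  "\<exists>c>0. \<forall>f1\<in>bspace. \<forall>f2\<in>bspace. \<forall>g1 g2. represents g1 f1 \<longrightarrow> represents g2 f2 \<longrightarrow>
     (\<exists>f\<in>bspace. represents (\<lambda>x. g1 x * g2 x) f \<and> bnorm f \<le> c * bnorm f1 * bnorm f2)"
proof -
  obtain c where c: "c > 0" "\<And>f1 f2 B1 B2. \<lbrakk>f1 \<in> tempered; f2 \<in> tempered; 0 \<le> B1; 0 \<le> B2;
    besov_norm \<phi>0 s p q f1 \<le> ennreal B1; besov_norm \<phi>0 s p q f2 \<le> ennreal B2\<rbrakk> \<Longrightarrow>
    \<exists>G1 G2 M1 M2. poly_bounded M1 0 G1 \<and> poly_bounded M2 0 G2 \<and> f1 = distr_of G1 \<and> f2 = distr_of G2 \<and>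
      besov_le (\<lambda>x. G1 x * G2 x) (c * B1 * B2)" using besov_product by blast
  have "\<exists>f\<in>bspace. represents (\<lambda>x. g1 x * g2 x) f \<and> bnorm f \<le> c * bnorm f1 * bnorm f2"
    if f: "f1 \<in> bspace" "f2 \<in> bspace" and r: "represents g1 f1" "represents g2 f2" for f1 f2 g1 g2
  proof -
    obtain G1 G2 M1 M2 where G: "poly_bounded M1 0 G1" "poly_bounded M2 0 G2" "f1 = distr_of G1" "f2 = distr_of G2"
      "besov_le (\<lambda>x. G1 x * G2 x) (c * bnorm f1 * bnorm f2)"
      using c(2)[OF bspace_tempered[OF f(1)] bspace_tempered[OF f(2)] bnorm_nonneg bnorm_nonneg bspace_norm[OF f(1)] bspace_norm[OF f(2)]] by blast
    have nn: "0 \<le> c * bnorm f1 * bnorm f2" using c(1) by (simp add: bnorm_nonneg)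
    note I = bspaceI[OF poly_bounded_0_mult[OF G(1,2)] nn G(5)]
    then show ?thesis using represents_mult[OF r[unfolded G(3,4)] G(1,2)] by blast
  qed
  then show ?thesis using c(1) by blast
qed

text \<open>Consecutive differences of a rapidly converging subsequence are represented by functions
  \<open>G i\<close> whose sum converges uniformly. The tail \<open>H k\<close> of this sum is what
  separates \<open>F (r k)\<close> from the limit, so the limit is given explicitly and the series
  estimate for the tails yields convergence in the quasi-norm; the Cauchy property extends this to
  the whole sequence.\<close>

lemma bspace_complete:
  assumes F: "\<And>k. F k \<in> bspace"
    and cauchy: "\<And>\<epsilon>. \<epsilon> > 0 \<Longrightarrow> \<exists>M. \<forall>k\<ge>M. \<forall>l\<ge>M. bnorm (\<lambda>\<phi>. F k \<phi> - F l \<phi>) < \<epsilon>"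
  shows "\<exists>f\<in>bspace. (\<lambda>k. bnorm (\<lambda>\<phi>. F k \<phi> - f \<phi>)) \<longlonglongrightarrow> 0"
proof -
  \<comment> \<open>This rate is the one required by \<open>besov_le_series\<close>, and since it is
    multiplicative in the index, the tail from \<open>k\<close> on satisfies the same hypothesis
    with bound \<open>e k\<close>.\<close>
  define e where "e i = 2 powr (- (2 * real i))" for i :: nat
  have e0: "e i > 0" for i by (simp add: e_def)
  have e_add: "e (i + k) = e i * e k" for i k by (simp add: e_def powr_add[symmetric])
  have se: "summable e" unfolding e_def using summable_powr_neg[of 2] by (simp add: mult.commute)
  obtain m where m: "\<And>i k l. m i \<le> k \<Longrightarrow> m i \<le> l \<Longrightarrow> bnorm (\<lambda>\<phi>. F k \<phi> - F l \<phi>) < e i"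
    using cauchy[OF e0] by metis
  \<comment> \<open>Cumulative sums make the subsequence indices monotone while staying above the
    Cauchy indices \<open>m i\<close>.\<close>
  define r where "r i = (\<Sum>j\<le>i. m j)" for i
  have r: "m i \<le> r i" "r i \<le> r (Suc i)" for i by (simp_all add: r_def member_le_sum)
  obtain C where C: "C > 0" "\<And>f. f \<in> bspace \<Longrightarrow> \<exists>G. poly_bounded (C * bnorm f) 0 G \<and> f = distr_of G \<and> besov_le G (bnorm f)"
    using bspaceE by blast
  let ?D = "\<lambda>i \<phi>. F (r (Suc i)) \<phi> - F (r i) \<phi>"
  have D: "?D i \<in> bspace" for i by (rule bspace_diff(1)[OF F F])
  have De: "bnorm (?D i) \<le> e i" for i using m[of i "r (Suc i)" "r i"] r[of i] by simp
  have "\<exists>G. poly_bounded (C * e i) 0 G \<and> ?D i = distr_of G \<and> besov_le G (e i)" for i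
  proof -
    obtain G where G: "poly_bounded (C * bnorm (?D i)) 0 G" "?D i = distr_of G" "besov_le G (bnorm (?D i))"
      using C(2)[OF D] by blast
    have "poly_bounded (C * e i) 0 G"
      using G(1) mult_left_mono[OF De[of i], of C] C(1) by (auto simp: poly_bounded_def intro: order_trans)
    then show ?thesis using G(2) besov_le_mono[OF G(3) bnorm_nonneg De] by blast
  qed
  then obtain G where G: "\<And>i. poly_bounded (C * e i) 0 (G i)" "\<And>i. ?D i = distr_of (G i)" "\<And>i. besov_le (G i) (e i)"
    by metis
  have [measurable]: "G i \<in> borel_measurable borel" for i by (rule poly_bounded_borel[OF G(1)])
  define H where "H k x = (\<Sum>i. G (i + k) x)" for k x
  have Gs: "summable (\<lambda>i. G i x)" for x
    by (rule summable_comparison_test'[OF summable_mult[OF se]]) (rule poly_bounded_0D[OF G(1)])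
  have Hs: "(\<lambda>i. G (i + k) x) sums H k x" for k x
    unfolding H_def by (rule summable_sums[OF summable_ignore_initial_segment[OF Gs]])
  obtain K where K: "K > 0" "\<And>G M H B. \<lbrakk>\<And>i. poly_bounded (M i) 0 (G i); summable M; \<And>x. (\<lambda>i. G i x) sums H x; 0 \<le> B;
    \<And>i. besov_le (G i) (2 powr (- (2 * real i)) * B)\<rbrakk> \<Longrightarrow> besov_le H (K * B)"
    using besov_le_series by blast
  have sCe: "summable (\<lambda>i. C * e (i + k))" for k
    by (rule summable_ignore_initial_segment[OF summable_mult[OF se]])
  have Hle: "besov_le (H k) (K * e k)" for k
  proof (rule K(2)[of "\<lambda>i. C * e (i + k)" "\<lambda>i. G (i + k)", OF G(1) sCe Hs less_imp_le[OF e0]])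
    show "besov_le (G (i + k)) (2 powr (- (2 * real i)) * e k)" for i
      unfolding e_def[of i, symmetric] e_add[symmetric] by (rule G(3))
  qed
  have Hp: "poly_bounded (\<Sum>i. C * e (i + k)) 0 (H k)" for k
  proof -
    have "norm (H k x) \<le> (\<Sum>i. C * e (i + k))" for x
      unfolding H_def
    proof (rule norm_suminf_le[OF _ sCe])
      show "norm (G (i + k) x) \<le> C * e (i + k)" for i by (rule poly_bounded_0D[OF G(1)])
    qed
    moreover have "H k \<in> borel_measurable borel" unfolding H_def[abs_def] by measurable
    ultimately show ?thesis by (simp add: poly_bounded_def)
  qed
  have Hb: "distr_of (H k) \<in> bspace" "bnorm (distr_of (H k)) \<le> K * e k" for k
  proof -
    have "0 \<le> K * e k" using K(1) e0[of k] by simp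
    note I = bspaceI[OF Hp this Hle]
    show "distr_of (H k) \<in> bspace" "bnorm (distr_of (H k)) \<le> K * e k" by (rule I)+
  qed
  have Hstep: "distr_of (H k) \<phi> = ?D k \<phi> + distr_of (H (Suc k)) \<phi>" for k \<phi>
  proof -
    have "H k = (\<lambda>x. G k x + H (Suc k) x)"
    proof
      fix x
      have "summable (\<lambda>i. G (i + k) x)" using Hs by (rule sums_summable)
      from suminf_split_head[OF this] show "H k x = G k x + H (Suc k) x" by (simp add: H_def)
    qed
    note e = this
    have "distr_of (H k) = (\<lambda>\<phi>. distr_of (G k) \<phi> + distr_of (H (Suc k)) \<phi>)"
      by (subst e) (rule distr_of_add[OF G(1) Hp])
    then have "distr_of (H k) \<phi> = distr_of (G k) \<phi> + distr_of (H (Suc k)) \<phi>" by (rule fun_cong)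
    moreover have "?D k \<phi> = distr_of (G k) \<phi>" by (rule fun_cong[OF G(2)])
    ultimately show ?thesis by (simp only:)
  qed
  define f where "f = (\<lambda>\<phi>. F (r 0) \<phi> + distr_of (H 0) \<phi>)"
  have fb: "f \<in> bspace" unfolding f_def using bspace_add F Hb(1) by blast
  have fk: "f \<phi> = F (r k) \<phi> + distr_of (H k) \<phi>" for k \<phi>
  proof (induction k)
    case (Suc k)
    then show ?case using Hstep[of k \<phi>] by simp
  qed (simp add: f_def)
  obtain Q where Q: "Q \<ge> 1" "\<And>f g. f \<in> bspace \<Longrightarrow> g \<in> bspace \<Longrightarrow> bnorm (\<lambda>\<phi>. f \<phi> + g \<phi>) \<le> Q * (bnorm f + bnorm g)"
    using bspace_add by blast
  have le: "bnorm (\<lambda>\<phi>. F k \<phi> - f \<phi>) \<le> Q * (1 + K) * e i" if "r i \<le> k" for i k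
  proof -
    have E: "(\<lambda>\<phi>. F k \<phi> - f \<phi>) = (\<lambda>\<phi>. (F k \<phi> - F (r i) \<phi>) + (F (r i) \<phi> - f \<phi>))" by simp
    have "(\<lambda>\<phi>. f \<phi> - F (r i) \<phi>) = distr_of (H i)" using fk[of _ i] by (simp add: fun_eq_iff)
    then have "bnorm (\<lambda>\<phi>. F (r i) \<phi> - f \<phi>) \<le> K * e i"
      using bspace_diff(2)[OF F fb, of "r i"] Hb(2)[of i] by simp
    moreover have "bnorm (\<lambda>\<phi>. F k \<phi> - F (r i) \<phi>) \<le> e i"
      using m[of i k "r i"] r(1)[of i] that by simp
    ultimately have "Q * (bnorm (\<lambda>\<phi>. F k \<phi> - F (r i) \<phi>) + bnorm (\<lambda>\<phi>. F (r i) \<phi> - f \<phi>)) \<le> Q * (e i + K * e i)"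
      using Q(1) by (intro mult_left_mono) simp_all
    then have "bnorm (\<lambda>\<phi>. (F k \<phi> - F (r i) \<phi>) + (F (r i) \<phi> - f \<phi>)) \<le> Q * (e i + K * e i)"
      using Q(2)[OF bspace_diff(1)[OF F F, of k "r i"] bspace_diff(1)[OF F fb, of "r i"]] by linarith
    then show ?thesis unfolding E by (simp add: algebra_simps)
  qed
  have "(\<lambda>k. bnorm (\<lambda>\<phi>. F k \<phi> - f \<phi>)) \<longlonglongrightarrow> 0"
  proof (rule LIMSEQ_I)
    fix \<epsilon> :: real assume \<epsilon>: "0 < \<epsilon>"
    have "(\<lambda>i. Q * (1 + K) * e i) \<longlonglongrightarrow> Q * (1 + K) * 0"
      by (rule tendsto_mult_left[OF summable_LIMSEQ_zero[OF se]])
    then have "(\<lambda>i. Q * (1 + K) * e i) \<longlonglongrightarrow> 0" by (simp only: mult_zero_right)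
    from eventually_happens[OF order_tendstoD(2)[OF this \<epsilon>]] obtain i where "Q * (1 + K) * e i < \<epsilon>" by auto
    then have "bnorm (\<lambda>\<phi>. F k \<phi> - f \<phi>) < \<epsilon>" if "r i \<le> k" for k using le[OF that] by simp
    then show "\<exists>no. \<forall>k\<ge>no. norm (bnorm (\<lambda>\<phi>. F k \<phi> - f \<phi>) - 0) < \<epsilon>"
      by (intro exI[of _ "r i"]) (simp add: bnorm_nonneg)
  qed
  then show ?thesis using fb by blast
qed

lemma bspace_quasi_banach: "quasi_banach_space bspace bnorm"
  unfolding quasi_banach_space_def
proof (intro conjI allI impI bspace_quasi_normed)
  fix F :: "nat \<Rightarrow> 'n distr"
  assume F: "\<forall>k. F k \<in> bspace" "\<forall>\<epsilon>>0. \<exists>M. \<forall>k\<ge>M. \<forall>l\<ge>M. bnorm (\<lambda>\<phi>. F k \<phi> - F l \<phi>) < \<epsilon>"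
  show "\<exists>f\<in>bspace. (\<lambda>k. bnorm (\<lambda>\<phi>. F k \<phi> - f \<phi>)) \<longlonglongrightarrow> 0"
    by (rule bspace_complete) (use F in blast)+
qed

lemma schwartz_bspace_continuous:
  "continuous_map schwartz_topology (quasi_norm_topology bspace bnorm) distr_of_schwartz"
proof -
  obtain C N where C: "C > 0" "\<And>\<psi>. \<psi> \<in> schwartz \<Longrightarrow> besov_le \<psi> (C * schwartz_sup N \<psi>)"
    using besov_le_schwartz by blast
  have b: "distr_of \<psi> \<in> bspace" "bnorm (distr_of \<psi>) \<le> C * schwartz_sup N \<psi>" if "\<psi> \<in> schwartz" for \<psi>
    using bspaceI[OF schwartz_poly_bounded[OF that] _ C(2)[OF that]] C(1) schwartz_sup_nonneg[OF that] by simp_all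
  show ?thesis
    unfolding continuous_map topspace_schwartz_topology topspace_quasi_norm_topology
  proof (intro conjI allI impI)
    show "distr_of_schwartz ` schwartz \<subseteq> bspace" using b(1) by (auto simp: distr_of_schwartz_eq)
    fix U assume "openin (quasi_norm_topology bspace bnorm) U"
    then have U: "\<And>f. f \<in> U \<Longrightarrow> \<exists>\<epsilon>>0. {g \<in> bspace. bnorm (\<lambda>\<phi>. g \<phi> - f \<phi>) < \<epsilon>} \<subseteq> U"
      by (simp add: openin_quasi_norm_topology quasi_norm_open_def)
    show "openin schwartz_topology {x \<in> schwartz. distr_of_schwartz x \<in> U}"
    proof (rule openin_schwartzI)
      fix \<phi> assume "\<phi> \<in> {x \<in> schwartz. distr_of_schwartz x \<in> U}"
      then have \<phi>: "\<phi> \<in> schwartz" "distr_of \<phi> \<in> U" by (auto simp: distr_of_schwartz_eq)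
      then obtain \<epsilon> where \<epsilon>: "\<epsilon> > 0" "{g \<in> bspace. bnorm (\<lambda>\<eta>. g \<eta> - distr_of \<phi> \<eta>) < \<epsilon>} \<subseteq> U" using U by blast
      have "distr_of \<psi> \<in> U" if \<psi>: "\<psi> \<in> schwartz" and small: "schwartz_sup N (\<lambda>x. \<psi> x - \<phi> x) < \<epsilon> / C" for \<psi>
      proof -
        note d = schwartz_diff[OF \<psi> \<phi>(1)]
        have "distr_of (\<lambda>x. (\<psi> x - \<phi> x) + \<phi> x) = (\<lambda>\<eta>. distr_of (\<lambda>x. \<psi> x - \<phi> x) \<eta> + distr_of \<phi> \<eta>)"
          by (rule distr_of_add[OF schwartz_poly_bounded[OF d] schwartz_poly_bounded[OF \<phi>(1)]])
        then have "(\<lambda>\<eta>. distr_of \<psi> \<eta> - distr_of \<phi> \<eta>) = distr_of (\<lambda>x. \<psi> x - \<phi> x)" by (simp add: fun_eq_iff)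
        moreover have "bnorm (distr_of (\<lambda>x. \<psi> x - \<phi> x)) < \<epsilon>"
        proof (rule le_less_trans[OF b(2)[OF d]])
          show "C * schwartz_sup N (\<lambda>x. \<psi> x - \<phi> x) < \<epsilon>" using small C(1) by (simp add: pos_less_divide_eq mult.commute)
        qed
        ultimately show ?thesis using \<epsilon>(2) b(1)[OF \<psi>] by auto
      qed
      moreover have "\<epsilon> / C > 0" using \<epsilon>(1) C(1) by simp
      ultimately show "\<exists>N \<epsilon>. \<epsilon> > 0 \<and> (\<forall>\<psi>\<in>schwartz. schwartz_sup N (\<lambda>x. \<psi> x - \<phi> x) < \<epsilon> \<longrightarrow> \<psi> \<in> {x \<in> schwartz. distr_of_schwartz x \<in> U})"
        by (intro exI[of _ N] exI[of _ "\<epsilon> / C"]) (simp add: distr_of_schwartz_eq)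
    qed auto
  qed
qed

text \<open>An element of the space is integration against a function bounded by \<open>C\<close>
  times its quasi-norm, so its value at \<open>\<phi>\<close> is controlled by one norm
  \<open>schwartz_sup\<close>. That norm is bounded on bounded sets, which gives continuity into the
  strong topology.\<close>

lemma bspace_tempered_continuous:
  "continuous_map (quasi_norm_topology bspace bnorm) tempered_topology (\<lambda>f. f)"
  unfolding continuous_map topspace_tempered_topology topspace_quasi_norm_topology
proof (intro conjI allI impI)
  show "(\<lambda>f. f) ` bspace \<subseteq> tempered" by (auto intro: bspace_tempered)
  fix U :: "'n distr set" assume "openin tempered_topology U"
  then have U: "\<And>T. T \<in> U \<Longrightarrow> \<exists>K. schwartz_bounded K \<and> (\<exists>\<epsilon>>0. tempered_nbhd K \<epsilon> T \<subseteq> U)"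
    by (simp add: openin_tempered_topology tempered_open_def)
  obtain C where C: "C > 0" "\<And>f. f \<in> bspace \<Longrightarrow> \<exists>G. poly_bounded (C * bnorm f) 0 G \<and> f = distr_of G \<and> besov_le G (bnorm f)"
    using bspaceE by blast
  let ?m = "decay_mass TYPE('n)" and ?N = "CARD('n) + 1"
  have ev: "norm (f \<phi>) \<le> C * bnorm f * (?m * schwartz_sup ?N \<phi>)" if f: "f \<in> bspace" and \<phi>: "\<phi> \<in> schwartz" for f \<phi>
  proof -
    obtain G where G: "poly_bounded (C * bnorm f) 0 G" "f = distr_of G" using C(2)[OF f] by blast
    show ?thesis using distr_of_norm_le[OF G(1) _ \<phi>] C(1) G(2) by (simp add: bnorm_nonneg)
  qed
  show "openin (quasi_norm_topology bspace bnorm) {f \<in> bspace. f \<in> U}"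
    unfolding openin_quasi_norm_topology quasi_norm_open_def
  proof (intro conjI ballI)
    fix f assume "f \<in> {f \<in> bspace. f \<in> U}"
    then have f: "f \<in> bspace" "f \<in> U" by auto
    obtain K \<epsilon> where K: "schwartz_bounded K" and \<epsilon>: "\<epsilon> > 0" "tempered_nbhd K \<epsilon> f \<subseteq> U" using U[OF f(2)] by blast
    obtain R where R: "\<And>\<phi>. \<phi> \<in> K \<Longrightarrow> schwartz_sup ?N \<phi> \<le> R" using schwartz_bounded_sup[OF K] by blast
    let ?L = "C * (?m * \<bar>R\<bar>) + 1"
    have L: "?L > 0" using C(1) decay_mass_nonneg[where 'n='n] by (simp add: add_nonneg_pos)
    have "g \<in> U" if g: "g \<in> bspace" "bnorm (\<lambda>\<phi>. g \<phi> - f \<phi>) < \<epsilon> / ?L" for g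
    proof -
      have "norm (g \<phi> - f \<phi>) < \<epsilon>" if \<phi>: "\<phi> \<in> K" for \<phi>
      proof -
        have s: "\<phi> \<in> schwartz" using K \<phi> by (auto simp: schwartz_bounded_def)
        let ?b = "bnorm (\<lambda>\<phi>. g \<phi> - f \<phi>)"
        have "norm (g \<phi> - f \<phi>) \<le> C * ?b * (?m * schwartz_sup ?N \<phi>)" by (rule ev[OF bspace_diff(1)[OF g(1) f(1)] s])
        also have "\<dots> \<le> C * ?b * (?m * \<bar>R\<bar>)"
          using R[OF \<phi>] C(1) decay_mass_nonneg[where 'n='n] by (intro mult_left_mono) (auto simp: bnorm_nonneg)
        also have "\<dots> \<le> ?b * ?L" by (simp add: algebra_simps bnorm_nonneg)
        also have "\<dots> < \<epsilon>" using g(2) L by (simp add: pos_less_divide_eq)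
        finally show ?thesis .
      qed
      then have "g \<in> tempered_nbhd K \<epsilon> f" using bspace_tempered[OF g(1)] by (simp add: tempered_nbhd_def)
      then show ?thesis using \<epsilon>(2) by blast
    qed
    moreover have "\<epsilon> / ?L > 0" using \<epsilon>(1) L by simp
    ultimately show "\<exists>\<epsilon>>0. {g \<in> bspace. bnorm (\<lambda>\<phi>. g \<phi> - f \<phi>) < \<epsilon>} \<subseteq> {f \<in> bspace. f \<in> U}" by blast
  qed auto
qed

lemma bspace_multiplication_algebra: "multiplication_algebra bspace bnorm"
  unfolding multiplication_algebra_def
  by (intro conjI ballI bspace_quasi_banach schwartz_bspace_continuous bspace_tempered_continuous bspace_regular bspace_mult)

end

theorem theorem3p6:
  fixes \<phi>0 :: "real ^ 'n::finite \<Rightarrow> complex" and p q :: ereal and s :: real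
  assumes "\<phi>0 \<in> schwartz"
    and "\<And>x. norm x \<le> 1 \<Longrightarrow> \<phi>0 x = 1"
    and "\<And>x. norm x \<ge> 3 / 2 \<Longrightarrow> \<phi>0 x = 0"
    and "0 < p" and "0 < q"
    and "ereal (real CARD('n)) / p < ereal s"
  shows "multiplication_algebra (besov_space \<phi>0 s p q)
           (\<lambda>f. enn2real (besov_norm \<phi>0 s p q f))"
proof -
  interpret besov_setting \<phi>0 s p q by unfold_locales (use assms in auto)
  show ?thesis using bspace_multiplication_algebra unfolding bnorm_def[abs_def] .
qed

end
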